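(* The category of finite-dimensional vector spaces over a field of characteristic zero is a Nakayama category.
   Context: Monoidal category means symmetric monoidal category (tensor $\otimes$, unit $1$); monoidal functor means strong symmetric monoidal functor. $\mathcal{C}$ has duals if every object $A$ has a dual $A^d$, with maps $1\to A^d\otimes A$ and $A\otimes A^d\to 1$ satisfying the triangle identities. Pre-Nakayama map. Let $f^*\colon\mathcal{A}\to\mathcal{B}$ be a monoidal functor between monoidal categories with duals, with left adjoint $f_!$ and right adjoint $f_*$; write $\eta_!\colon \mathrm{id}\to f^*f_!$, $\epsilon_!\colon f_!f^*\to\mathrm{id}$, $\eta_*\colon\mathrm{id}\to f_*f^*$, $\epsilon_*\colon f^*f_*\to\mathrm{id}$ for units and counits. The projection maps are $\lambda\colon f_!(A\otimes f^*B)\xrightarrow{f_!(\eta_!\otimes \mathrm{id})}f_!(f^*f_!A\otimes f^*B)\cong f_!f^*(f_!A\otimes B)\xrightarrow{\epsilon_!}f_!A\otimes B$ and $\rho\colon A\otimes f_*B\xrightarrow{\eta_*}f_*f^*(A\otimes f_*B)\cong f_*(f^*A\otimes f^*f_*B)\xrightarrow{f_*(\mathrm{id}\otimes\epsilon_* )}f_*(f^*A\otimes B)$; both are isomorphisms. The pre-Nakayama map $\gamma_f\colon f_*\to f_!$ is, at $A$, $f_*A\cong f_*(A\otimes 1)\xrightarrow{f_*(\eta_!\otimes \mathrm{id})}f_*(f^*f_!A\otimes 1)\xrightarrow{\rho^{-1}}f_!A\otimes f_*1\xrightarrow{\lambda^{-1}}f_!(A\otimes f^*f_*1)\xrightarrow{f_!(\mathrm{id}\otimes\epsilon_*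 )}f_!(A\otimes 1)\cong f_!A$. Groupoids and Kan extensions. A groupoid is essentially finite if it has finitely many isomorphism classes of objects and all its hom-sets are finite. For a groupoid $X$, $\mathcal{C}^X$ is the category of functors $X\to\mathcal{C}$ with pointwise tensor product. For $f\colon X\to Y$, $f^*\colon\mathcal{C}^Y\to\mathcal{C}^X$ is restriction, and $f_!$, $f_*$ are left and right Kan extension. If $p\colon P_y\to X$ is the homotopy fibre of $f$ at $y$, then $f_!V(y)=\operatorname{colim}_{P_y}p^*V$ and $f_*V(y)=\lim_{P_y}p^*V$. If $\mathcal{C}$ has duals and essentially finite colimits (colimits indexed by essentially finite groupoids), both exist for maps of essentially finite groupoids. Nakayama map. On each connected component $\hat P$ of $P_y$, the essentially unique map $\iota\colon\{*\}\to\hat P$ gives an endomorphism $1\xrightarrow{\eta_*}\iota_*\iota^*1\xrightarrow{\gamma_\iota}\iota_!\iota^*1\xrightarrow{\epsilon_!}1$ of the unit of $\mathcal{C}^{\hat P}$. Together these give $\delta_f\colon 1\to 1$ in $\mathcal{C}^{P_y}$ and, by tensoring, a natural endomorphism $\delta_f$ of $p^*V$. When $\delta_f$ is invertible (for all $y$), the Nakayama map is $\nu_f\colon f_*V\xrightarrow{\gamma_f}f_!V\xrightarrow{f_!\delta_f^{-1}}f_!V$, where $f_!\delta_f^{-1}$ is at $y$ the map induced on $\operatorname{colim}_{P_y}p^*V$ by $\delta_f^{-1}$. Nakayama category. A category $\mathcal{C}$ is a Nakayama category if (i) it has essentially finite colimits; (ii) it is symmetric monoidal; (iii) it has duals; (iv)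 $\delta_f$ is invertible for every map $f$ of essentially finite groupoids; (v) for all composable $X\xrightarrow{f}Y\xrightarrow{g}Z$ of essentially finite groupoids, up to the canonical identifications $(gf)_*\cong g_*f_*$ and $(gf)_!\cong g_!f_!$, one has $\nu_{gf}=(g_!\nu_f)\circ\nu_g=\nu_g\circ(g_*\nu_f)$ as maps $g_*f_*\to g_!f_!$. The category of finite-dimensional vector spaces carries its usual tensor product. *)

theory Defs
  imports "Jordan_Normal_Form.Missing_VectorSpace"
begin

section \<open>Categories, functors, adjunctions, colimits\<close>

record ('o, 'm) category =
  Obj :: "'o set"
  Arr :: "'m set"
  Dom :: "'m \<Rightarrow> 'o"
  Cod :: "'m \<Rightarrow> 'o"
  Idn :: "'o \<Rightarrow> 'm"
  Cmp :: "'m \<Rightarrow> 'm \<Rightarrow> 'm"  (infixr \<open>\<bullet>\<index>\<close> 70)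

definition Hom :: "('o, 'm, 'r) category_scheme \<Rightarrow> 'o \<Rightarrow> 'o \<Rightarrow> 'm set" where
  "Hom C a b = {f \<in> Arr C. Dom C f = a \<and> Cod C f = b}"

locale category =
  fixes C :: "('o, 'm, 'r) category_scheme" (structure)
  assumes Dom_closed: "f \<in> Arr C \<Longrightarrow> Dom C f \<in> Obj C"
    and Cod_closed: "f \<in> Arr C \<Longrightarrow> Cod C f \<in> Obj C"
    and Idn_closed: "a \<in> Obj C \<Longrightarrow> Idn C a \<in> Hom C a a"
    and Cmp_closed: "\<lbrakk>f \<in> Hom C a b; g \<in> Hom C b c\<rbrakk> \<Longrightarrow> g \<bullet> f \<in> Hom C a c"
    and Idn_left: "f \<in> Hom C a b \<Longrightarrow> Idn C b \<bullet> f = f"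
    and Idn_right: "f \<in> Hom C a b \<Longrightarrow> f \<bullet> Idn C a = f"
    and Cmp_assoc: "\<lbrakk>f \<in> Hom C a b; g \<in> Hom C b c; h \<in> Hom C c d\<rbrakk>
      \<Longrightarrow> (h \<bullet> g) \<bullet> f = h \<bullet> (g \<bullet> f)"

definition inverse_arrows :: "('o, 'm, 'r) category_scheme \<Rightarrow> 'm \<Rightarrow> 'm \<Rightarrow> bool" where
  "inverse_arrows C f g \<longleftrightarrow> f \<in> Arr C \<and> g \<in> Hom C (Cod C f) (Dom C f) \<and>
     g \<bullet>\<^bsub>C\<^esub> f = Idn C (Dom C f) \<and> f \<bullet>\<^bsub>C\<^esub> g = Idn C (Cod C f)"

definition is_iso_arr :: "('o, 'm, 'r) category_scheme \<Rightarrow> 'm \<Rightarrow> bool" where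
  "is_iso_arr C f \<longleftrightarrow> (\<exists>g. inverse_arrows C f g)"

definition inv_arr :: "('o, 'm, 'r) category_scheme \<Rightarrow> 'm \<Rightarrow> 'm" where
  "inv_arr C f = (THE g. inverse_arrows C f g)"

definition isomorphic_rel :: "('o, 'm, 'r) category_scheme \<Rightarrow> ('o \<times> 'o) set" where
  "isomorphic_rel C = {(a, b). a \<in> Obj C \<and> b \<in> Obj C \<and> (\<exists>f \<in> Hom C a b. is_iso_arr C f)}"

definition groupoid :: "('o, 'm, 'r) category_scheme \<Rightarrow> bool" where
  "groupoid X \<longleftrightarrow> category X \<and> (\<forall>f \<in> Arr X. is_iso_arr X f)"

definition ess_finite_groupoid :: "('o, 'm, 'r) category_scheme \<Rightarrow> bool" where
  "ess_finite_groupoid X \<longleftrightarrow> groupoid X \<and> finite (Obj X // isomorphic_rel X) \<and>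
     (\<forall>a \<in> Obj X. \<forall>b \<in> Obj X. finite (Hom X a b))"

record ('o, 'm, 'p, 'n) cfunctor =
  FObj :: "'o \<Rightarrow> 'p"
  FArr :: "'m \<Rightarrow> 'n"

definition is_functor ::
    "('o, 'm, 'r) category_scheme \<Rightarrow> ('p, 'n, 's) category_scheme \<Rightarrow> ('o, 'm, 'p, 'n) cfunctor \<Rightarrow> bool"
  where
  "is_functor C D F \<longleftrightarrow> category C \<and> category D \<and>
     (\<forall>a \<in> Obj C. FObj F a \<in> Obj D) \<and>
     (\<forall>f \<in> Arr C. FArr F f \<in> Hom D (FObj F (Dom C f)) (FObj F (Cod C f))) \<and>
     (\<forall>a \<in> Obj C. FArr F (Idn C a) = Idn D (FObj F a)) \<and>
     (\<forall>a b c. \<forall>f \<in> Hom C a b. \<forall>g \<in> Hom C b c. FArr F (g \<bullet>\<^bsub>C\<^esub> f) = FArr F g \<bullet>\<^bsub>D\<^esub> FArr F f)"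

definition comp_functor ::
    "('p, 'n, 'q, 'l) cfunctor \<Rightarrow> ('o, 'm, 'p, 'n) cfunctor \<Rightarrow> ('o, 'm, 'q, 'l) cfunctor" where
  "comp_functor G F = \<lparr>FObj = FObj G \<circ> FObj F, FArr = FArr G \<circ> FArr F\<rparr>"

text \<open>\<open>L\<close> is left adjoint to \<open>R\<close>, with unit \<open>\<eta>\<close> and counit \<open>\<epsilon>\<close>.\<close>

definition adjunction ::
    "('o, 'm, 'r) category_scheme \<Rightarrow> ('p, 'n, 's) category_scheme \<Rightarrow>
     ('o, 'm, 'p, 'n) cfunctor \<Rightarrow> ('p, 'n, 'o, 'm) cfunctor \<Rightarrow> ('o \<Rightarrow> 'm) \<Rightarrow> ('p \<Rightarrow> 'n) \<Rightarrow> bool" where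
  "adjunction C D L R \<eta> \<epsilon> \<longleftrightarrow> is_functor C D L \<and> is_functor D C R \<and>
     (\<forall>a \<in> Obj C. \<eta> a \<in> Hom C a (FObj R (FObj L a))) \<and>
     (\<forall>b \<in> Obj D. \<epsilon> b \<in> Hom D (FObj L (FObj R b)) b) \<and>
     (\<forall>f \<in> Arr C. \<eta> (Cod C f) \<bullet>\<^bsub>C\<^esub> f = FArr R (FArr L f) \<bullet>\<^bsub>C\<^esub> \<eta> (Dom C f)) \<and>
     (\<forall>g \<in> Arr D. \<epsilon> (Cod D g) \<bullet>\<^bsub>D\<^esub> FArr L (FArr R g) = g \<bullet>\<^bsub>D\<^esub> \<epsilon> (Dom D g)) \<and>
     (\<forall>a \<in> Obj C. \<epsilon> (FObj L a) \<bullet>\<^bsub>D\<^esub> FArr L (\<eta> a) = Idn D (FObj L a)) \<and>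
     (\<forall>b \<in> Obj D. FArr R (\<epsilon> b) \<bullet>\<^bsub>C\<^esub> \<eta> (FObj R b) = Idn C (FObj R b))"

definition is_cocone ::
    "('x, 'y, 'r) category_scheme \<Rightarrow> ('o, 'm, 's) category_scheme \<Rightarrow> ('x, 'y, 'o, 'm) cfunctor \<Rightarrow>
     'o \<Rightarrow> ('x \<Rightarrow> 'm) \<Rightarrow> bool" where
  "is_cocone P C D c t \<longleftrightarrow> c \<in> Obj C \<and> (\<forall>p \<in> Obj P. t p \<in> Hom C (FObj D p) c) \<and>
     (\<forall>k \<in> Arr P. t (Cod P k) \<bullet>\<^bsub>C\<^esub> FArr D k = t (Dom P k))"

definition is_colimit ::
    "('x, 'y, 'r) category_scheme \<Rightarrow> ('o, 'm, 's) category_scheme \<Rightarrow> ('x, 'y, 'o, 'm) cfunctor \<Rightarrow>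
     'o \<Rightarrow> ('x \<Rightarrow> 'm) \<Rightarrow> bool" where
  "is_colimit P C D c t \<longleftrightarrow> is_cocone P C D c t \<and>
     (\<forall>c' t'. is_cocone P C D c' t' \<longrightarrow>
        (\<exists>!u. u \<in> Hom C c c' \<and> (\<forall>p \<in> Obj P. u \<bullet>\<^bsub>C\<^esub> t p = t' p)))"

text \<open>The type \<open>'u\<close> is the universe from which the objects and arrows of the indexing groupoids are
  taken. Every essentially finite groupoid is equivalent to one in \<open>'u\<close> as soon as \<open>'u\<close> is infinite.\<close>

definition has_ess_finite_colimits :: "'u itself \<Rightarrow> ('o, 'm, 's) category_scheme \<Rightarrow> bool" where
  "has_ess_finite_colimits U C \<longleftrightarrow>
     (\<forall>(P :: ('u, 'u) category) D. ess_finite_groupoid P \<and> is_functor P C D \<longrightarrow>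
        (\<exists>c t. is_colimit P C D c t))"


section \<open>Symmetric monoidal categories and duals\<close>

record ('o, 'm) smcat = "('o, 'm) category" +
  TensO :: "'o \<Rightarrow> 'o \<Rightarrow> 'o"  (infixr \<open>\<boxtimes>\<index>\<close> 75)
  TensA :: "'m \<Rightarrow> 'm \<Rightarrow> 'm"  (infixr \<open>\<star>\<index>\<close> 75)
  Unit :: "'o"
  Assoc :: "'o \<Rightarrow> 'o \<Rightarrow> 'o \<Rightarrow> 'm"
  LUn :: "'o \<Rightarrow> 'm"
  RUn :: "'o \<Rightarrow> 'm"
  Braid :: "'o \<Rightarrow> 'o \<Rightarrow> 'm"

locale symmetric_monoidal_category = category C
  for C :: "('o, 'm, 'r) smcat_scheme" (structure) +
  assumes Unit_closed: "Unit C \<in> Obj C"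
    and TensO_closed: "\<lbrakk>a \<in> Obj C; b \<in> Obj C\<rbrakk> \<Longrightarrow> a \<boxtimes> b \<in> Obj C"
    and TensA_closed: "\<lbrakk>f \<in> Hom C a b; g \<in> Hom C c d\<rbrakk> \<Longrightarrow> f \<star> g \<in> Hom C (a \<boxtimes> c) (b \<boxtimes> d)"
    and TensA_Idn: "\<lbrakk>a \<in> Obj C; b \<in> Obj C\<rbrakk> \<Longrightarrow> Idn C a \<star> Idn C b = Idn C (a \<boxtimes> b)"
    and TensA_Cmp: "\<lbrakk>f \<in> Hom C a b; f' \<in> Hom C b c; g \<in> Hom C a' b'; g' \<in> Hom C b' c'\<rbrakk>
      \<Longrightarrow> (f' \<bullet> f) \<star> (g' \<bullet> g) = (f' \<star> g') \<bullet> (f \<star> g)"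
    and Assoc_closed: "\<lbrakk>a \<in> Obj C; b \<in> Obj C; c \<in> Obj C\<rbrakk>
      \<Longrightarrow> Assoc C a b c \<in> Hom C ((a \<boxtimes> b) \<boxtimes> c) (a \<boxtimes> (b \<boxtimes> c)) \<and> is_iso_arr C (Assoc C a b c)"
    and LUn_closed: "a \<in> Obj C \<Longrightarrow> LUn C a \<in> Hom C (Unit C \<boxtimes> a) a \<and> is_iso_arr C (LUn C a)"
    and RUn_closed: "a \<in> Obj C \<Longrightarrow> RUn C a \<in> Hom C (a \<boxtimes> Unit C) a \<and> is_iso_arr C (RUn C a)"
    and Braid_closed: "\<lbrakk>a \<in> Obj C; b \<in> Obj C\<rbrakk> \<Longrightarrow> Braid C a b \<in> Hom C (a \<boxtimes> b) (b \<boxtimes> a)"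
    and Assoc_natural: "\<lbrakk>f \<in> Hom C a a'; g \<in> Hom C b b'; h \<in> Hom C c c'\<rbrakk>
      \<Longrightarrow> Assoc C a' b' c' \<bullet> ((f \<star> g) \<star> h) = (f \<star> (g \<star> h)) \<bullet> Assoc C a b c"
    and LUn_natural: "f \<in> Hom C a b \<Longrightarrow> LUn C b \<bullet> (Idn C (Unit C) \<star> f) = f \<bullet> LUn C a"
    and RUn_natural: "f \<in> Hom C a b \<Longrightarrow> RUn C b \<bullet> (f \<star> Idn C (Unit C)) = f \<bullet> RUn C a"
    and Braid_natural: "\<lbrakk>f \<in> Hom C a a'; g \<in> Hom C b b'\<rbrakk>
      \<Longrightarrow> Braid C a' b' \<bullet> (f \<star> g) = (g \<star> f) \<bullet> Braid C a b"
    and pentagon: "\<lbrakk>a \<in> Obj C; b \<in> Obj C; c \<in> Obj C; d \<in> Obj C\<rbrakk>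
      \<Longrightarrow> (Idn C a \<star> Assoc C b c d) \<bullet> Assoc C a (b \<boxtimes> c) d \<bullet> (Assoc C a b c \<star> Idn C d)
          = Assoc C a b (c \<boxtimes> d) \<bullet> Assoc C (a \<boxtimes> b) c d"
    and triangle: "\<lbrakk>a \<in> Obj C; b \<in> Obj C\<rbrakk>
      \<Longrightarrow> (Idn C a \<star> LUn C b) \<bullet> Assoc C a (Unit C) b = RUn C a \<star> Idn C b"
    and hexagon: "\<lbrakk>a \<in> Obj C; b \<in> Obj C; c \<in> Obj C\<rbrakk>
      \<Longrightarrow> Assoc C b c a \<bullet> Braid C a (b \<boxtimes> c) \<bullet> Assoc C a b c
          = (Idn C b \<star> Braid C a c) \<bullet> Assoc C b a c \<bullet> (Braid C a b \<star> Idn C c)"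
    and symmetry: "\<lbrakk>a \<in> Obj C; b \<in> Obj C\<rbrakk> \<Longrightarrow> Braid C b a \<bullet> Braid C a b = Idn C (a \<boxtimes> b)"

definition is_dual :: "('o, 'm, 'r) smcat_scheme \<Rightarrow> 'o \<Rightarrow> 'o \<Rightarrow> 'm \<Rightarrow> 'm \<Rightarrow> bool" where
  "is_dual C a d coev ev \<longleftrightarrow> a \<in> Obj C \<and> d \<in> Obj C \<and>
     coev \<in> Hom C (Unit C) (d \<boxtimes>\<^bsub>C\<^esub> a) \<and> ev \<in> Hom C (a \<boxtimes>\<^bsub>C\<^esub> d) (Unit C) \<and>
     LUn C a \<bullet>\<^bsub>C\<^esub> (ev \<star>\<^bsub>C\<^esub> Idn C a) \<bullet>\<^bsub>C\<^esub> inv_arr C (Assoc C a d a) \<bullet>\<^bsub>C\<^esub>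
       (Idn C a \<star>\<^bsub>C\<^esub> coev) \<bullet>\<^bsub>C\<^esub> inv_arr C (RUn C a) = Idn C a \<and>
     RUn C d \<bullet>\<^bsub>C\<^esub> (Idn C d \<star>\<^bsub>C\<^esub> ev) \<bullet>\<^bsub>C\<^esub> Assoc C d a d \<bullet>\<^bsub>C\<^esub>
       (coev \<star>\<^bsub>C\<^esub> Idn C d) \<bullet>\<^bsub>C\<^esub> inv_arr C (LUn C d) = Idn C d"

definition has_duals :: "('o, 'm, 'r) smcat_scheme \<Rightarrow> bool" where
  "has_duals C \<longleftrightarrow> (\<forall>a \<in> Obj C. \<exists>d coev ev. is_dual C a d coev ev)"


section \<open>The pre-Nakayama map\<close>

text \<open>The data of a strong monoidal functor \<open>f\<^sup>*: A \<rightarrow> B\<close> with both adjoints.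
  \<open>pull_mult a a'\<close> is the coherence isomorphism from \<open>f\<^sup>*a \<boxtimes> f\<^sup>*a'\<close> to \<open>f\<^sup>*(a \<boxtimes> a')\<close>.\<close>

record ('a, 'am, 'b, 'bm) adjoint_triple =
  pull :: "('a, 'am, 'b, 'bm) cfunctor"
  pull_mult :: "'a \<Rightarrow> 'a \<Rightarrow> 'bm"
  lower_shriek :: "('b, 'bm, 'a, 'am) cfunctor"
  shriek_unit :: "'b \<Rightarrow> 'bm"
  shriek_counit :: "'a \<Rightarrow> 'am"
  lower_star :: "('b, 'bm, 'a, 'am) cfunctor"
  star_unit :: "'a \<Rightarrow> 'am"
  star_counit :: "'b \<Rightarrow> 'bm"

definition proj_shriek ::
    "('a, 'am, 'r) smcat_scheme \<Rightarrow> ('b, 'bm, 's) smcat_scheme \<Rightarrow>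
     ('a, 'am, 'b, 'bm) adjoint_triple \<Rightarrow> 'b \<Rightarrow> 'a \<Rightarrow> 'am" where
  "proj_shriek A B T b a =
     shriek_counit T (FObj (lower_shriek T) b \<boxtimes>\<^bsub>A\<^esub> a) \<bullet>\<^bsub>A\<^esub>
     FArr (lower_shriek T) (pull_mult T (FObj (lower_shriek T) b) a) \<bullet>\<^bsub>A\<^esub>
     FArr (lower_shriek T) (shriek_unit T b \<star>\<^bsub>B\<^esub> Idn B (FObj (pull T) a))"

definition proj_star ::
    "('a, 'am, 'r) smcat_scheme \<Rightarrow> ('b, 'bm, 's) smcat_scheme \<Rightarrow>
     ('a, 'am, 'b, 'bm) adjoint_triple \<Rightarrow> 'a \<Rightarrow> 'b \<Rightarrow> 'am" where
  "proj_star A B T a b =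
     FArr (lower_star T) (Idn B (FObj (pull T) a) \<star>\<^bsub>B\<^esub> star_counit T b) \<bullet>\<^bsub>A\<^esub>
     FArr (lower_star T) (inv_arr B (pull_mult T a (FObj (lower_star T) b))) \<bullet>\<^bsub>A\<^esub>
     star_unit T (a \<boxtimes>\<^bsub>A\<^esub> FObj (lower_star T) b)"

definition pre_nakayama ::
    "('a, 'am, 'r) smcat_scheme \<Rightarrow> ('b, 'bm, 's) smcat_scheme \<Rightarrow>
     ('a, 'am, 'b, 'bm) adjoint_triple \<Rightarrow> 'b \<Rightarrow> 'am" where
  "pre_nakayama A B T b =
     FArr (lower_shriek T) (RUn B b) \<bullet>\<^bsub>A\<^esub>
     FArr (lower_shriek T) (Idn B b \<star>\<^bsub>B\<^esub> star_counit T (Unit B)) \<bullet>\<^bsub>A\<^esub>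
     inv_arr A (proj_shriek A B T b (FObj (lower_star T) (Unit B))) \<bullet>\<^bsub>A\<^esub>
     inv_arr A (proj_star A B T (FObj (lower_shriek T) b) (Unit B)) \<bullet>\<^bsub>A\<^esub>
     FArr (lower_star T) (shriek_unit T b \<star>\<^bsub>B\<^esub> Idn B (Unit B)) \<bullet>\<^bsub>A\<^esub>
     FArr (lower_star T) (inv_arr B (RUn B b))"


section \<open>Functor categories, restriction and Kan extensions\<close>

text \<open>Objects and arrows of the functor category are taken extensional (\<open>undefined\<close> outside the
  objects and arrows of \<open>X\<close>), so that equality of functors and of transformations is pointwise. A
  natural transformation is stored as a triple of source, target and family of components.\<close>

type_synonym ('x, 'y, 'o, 'm) nat_trans =
  "('x, 'y, 'o, 'm) cfunctor \<times> ('x, 'y, 'o, 'm) cfunctor \<times> ('x \<Rightarrow> 'm)"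

abbreviation component_at :: "('x, 'y, 'o, 'm) nat_trans \<Rightarrow> 'x \<Rightarrow> 'm" where
  "component_at t x \<equiv> snd (snd t) x"

definition ext_functor ::
    "('x, 'y, 'r) category_scheme \<Rightarrow> ('x \<Rightarrow> 'o) \<Rightarrow> ('y \<Rightarrow> 'm) \<Rightarrow> ('x, 'y, 'o, 'm) cfunctor" where
  "ext_functor X F0 F1 = \<lparr>FObj = restrict F0 (Obj X), FArr = restrict F1 (Arr X)\<rparr>"

definition functors ::
    "('x, 'y, 'r) category_scheme \<Rightarrow> ('o, 'm, 's) category_scheme \<Rightarrow> ('x, 'y, 'o, 'm) cfunctor set"
  where
  "functors X C = {F. is_functor X C F \<and> FObj F \<in> extensional (Obj X) \<and> FArr F \<in> extensional (Arr X)}"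

definition nat_transformations ::
    "('x, 'y, 'r) category_scheme \<Rightarrow> ('o, 'm, 's) category_scheme \<Rightarrow> ('x, 'y, 'o, 'm) nat_trans set"
  where
  "nat_transformations X C = {(F, G, t). F \<in> functors X C \<and> G \<in> functors X C \<and>
     t \<in> extensional (Obj X) \<and> (\<forall>x \<in> Obj X. t x \<in> Hom C (FObj F x) (FObj G x)) \<and>
     (\<forall>k \<in> Arr X. t (Cod X k) \<bullet>\<^bsub>C\<^esub> FArr F k = FArr G k \<bullet>\<^bsub>C\<^esub> t (Dom X k))}"

definition tensor_functor ::
    "('x, 'y, 'r) category_scheme \<Rightarrow> ('o, 'm, 's) smcat_scheme \<Rightarrow>
     ('x, 'y, 'o, 'm) cfunctor \<Rightarrow> ('x, 'y, 'o, 'm) cfunctor \<Rightarrow> ('x, 'y, 'o, 'm) cfunctor" where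
  "tensor_functor X C F G =
     ext_functor X (\<lambda>x. FObj F x \<boxtimes>\<^bsub>C\<^esub> FObj G x) (\<lambda>k. FArr F k \<star>\<^bsub>C\<^esub> FArr G k)"

definition unit_functor ::
    "('x, 'y, 'r) category_scheme \<Rightarrow> ('o, 'm, 's) smcat_scheme \<Rightarrow> ('x, 'y, 'o, 'm) cfunctor" where
  "unit_functor X C = ext_functor X (\<lambda>x. Unit C) (\<lambda>k. Idn C (Unit C))"

definition functor_cat ::
    "('x, 'y, 'r) category_scheme \<Rightarrow> ('o, 'm, 's) smcat_scheme \<Rightarrow>
     (('x, 'y, 'o, 'm) cfunctor, ('x, 'y, 'o, 'm) nat_trans) smcat" where
  "functor_cat X C =
     \<lparr>Obj = functors X C,
      Arr = nat_transformations X C,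
      Dom = (\<lambda>(F, G, t). F),
      Cod = (\<lambda>(F, G, t). G),
      Idn = (\<lambda>F. (F, F, \<lambda>x \<in> Obj X. Idn C (FObj F x))),
      Cmp = (\<lambda>(G', H, s) (F, G, t). (F, H, \<lambda>x \<in> Obj X. s x \<bullet>\<^bsub>C\<^esub> t x)),
      TensO = tensor_functor X C,
      TensA = (\<lambda>(F, F', s) (G, G', t).
        (tensor_functor X C F G, tensor_functor X C F' G', \<lambda>x \<in> Obj X. s x \<star>\<^bsub>C\<^esub> t x)),
      Unit = unit_functor X C,
      Assoc = (\<lambda>F G H.
        (tensor_functor X C (tensor_functor X C F G) H,
         tensor_functor X C F (tensor_functor X C G H),
         \<lambda>x \<in> Obj X. Assoc C (FObj F x) (FObj G x) (FObj H x))),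
      LUn = (\<lambda>F. (tensor_functor X C (unit_functor X C) F, F, \<lambda>x \<in> Obj X. LUn C (FObj F x))),
      RUn = (\<lambda>F. (tensor_functor X C F (unit_functor X C), F, \<lambda>x \<in> Obj X. RUn C (FObj F x))),
      Braid = (\<lambda>F G. (tensor_functor X C F G, tensor_functor X C G F,
        \<lambda>x \<in> Obj X. Braid C (FObj F x) (FObj G x)))\<rparr>"

definition pull_functor ::
    "('x, 'y, 'r) category_scheme \<Rightarrow> ('x, 'y, 'z, 'w) cfunctor \<Rightarrow> ('z, 'w, 'o, 'm) cfunctor \<Rightarrow>
     ('x, 'y, 'o, 'm) cfunctor" where
  "pull_functor X f V = ext_functor X (\<lambda>x. FObj V (FObj f x)) (\<lambda>k. FArr V (FArr f k))"

definition restriction ::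
    "('x, 'y, 'r) category_scheme \<Rightarrow> ('x, 'y, 'z, 'w) cfunctor \<Rightarrow>
     (('z, 'w, 'o, 'm) cfunctor, ('z, 'w, 'o, 'm) nat_trans,
      ('x, 'y, 'o, 'm) cfunctor, ('x, 'y, 'o, 'm) nat_trans) cfunctor" where
  "restriction X f =
     \<lparr>FObj = pull_functor X f,
      FArr = (\<lambda>(V, W, t). (pull_functor X f V, pull_functor X f W, \<lambda>x \<in> Obj X. t (FObj f x)))\<rparr>"

text \<open>Restriction preserves the pointwise tensor product strictly, so its coherence isomorphism is
  the identity. The Kan extensions are an arbitrary but fixed choice of adjoints of restriction.\<close>

definition kan ::
    "('x, 'y, 'r) category_scheme \<Rightarrow> ('z, 'w, 's) category_scheme \<Rightarrow> ('o, 'm, 't) smcat_scheme \<Rightarrow>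
     ('x, 'y, 'z, 'w) cfunctor \<Rightarrow>
     (('z, 'w, 'o, 'm) cfunctor, ('z, 'w, 'o, 'm) nat_trans,
      ('x, 'y, 'o, 'm) cfunctor, ('x, 'y, 'o, 'm) nat_trans) adjoint_triple" where
  "kan X Y C f =
     (let (L, \<eta>L, \<epsilon>L) = (SOME (L, \<eta>, \<epsilon>).
            adjunction (functor_cat X C) (functor_cat Y C) L (restriction X f) \<eta> \<epsilon>);
          (R, \<eta>R, \<epsilon>R) = (SOME (R, \<eta>, \<epsilon>).
            adjunction (functor_cat Y C) (functor_cat X C) (restriction X f) R \<eta> \<epsilon>)
      in \<lparr>pull = restriction X f,
          pull_mult = (\<lambda>V W. Idn (functor_cat X C) (pull_functor X f (V \<boxtimes>\<^bsub>functor_cat Y C\<^esub> W))),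
          lower_shriek = L, shriek_unit = \<eta>L, shriek_counit = \<epsilon>L,
          lower_star = R, star_unit = \<eta>R, star_counit = \<epsilon>R\<rparr>)"


section \<open>The Nakayama map\<close>

text \<open>The homotopy fibre of \<open>f: X \<rightarrow> Y\<close> at \<open>y\<close>: an object is a pair \<open>(x, h)\<close> with \<open>h: f x \<rightarrow> y\<close>,
  an arrow is a triple of source, target and an arrow of \<open>X\<close> over \<open>y\<close>.\<close>

definition hfibre ::
    "('x, 'y, 'r) category_scheme \<Rightarrow> ('z, 'w, 's) category_scheme \<Rightarrow> ('x, 'y, 'z, 'w) cfunctor \<Rightarrow> 'z \<Rightarrow>
     ('x \<times> 'w, ('x \<times> 'w) \<times> ('x \<times> 'w) \<times> 'y) category" where
  "hfibre X Y f y =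
     \<lparr>Obj = {(x, h). x \<in> Obj X \<and> h \<in> Hom Y (FObj f x) y},
      Arr = {((x, h), (x', h'), k). x \<in> Obj X \<and> h \<in> Hom Y (FObj f x) y \<and>
               x' \<in> Obj X \<and> h' \<in> Hom Y (FObj f x') y \<and> k \<in> Hom X x x' \<and> h' \<bullet>\<^bsub>Y\<^esub> FArr f k = h},
      Dom = (\<lambda>(p, q, k). p),
      Cod = (\<lambda>(p, q, k). q),
      Idn = (\<lambda>p. (p, p, Idn X (fst p))),
      Cmp = (\<lambda>(q', r, l) (p, q, k). (p, r, l \<bullet>\<^bsub>X\<^esub> k))\<rparr>"

definition hfibre_proj :: "('x \<times> 'w, ('x \<times> 'w) \<times> ('x \<times> 'w) \<times> 'y, 'x, 'y) cfunctor" where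
  "hfibre_proj = \<lparr>FObj = fst, FArr = (\<lambda>(p, q, k). k)\<rparr>"

definition conn_component :: "('o, 'm) category \<Rightarrow> 'o \<Rightarrow> ('o, 'm) category" where
  "conn_component P p =
     P\<lparr>Obj := {q \<in> Obj P. Hom P p q \<noteq> {}},
       Arr := {k \<in> Arr P. Hom P p (Dom P k) \<noteq> {} \<and> Hom P p (Cod P k) \<noteq> {}}\<rparr>"

definition point_cat :: "(unit, unit) category" where
  "point_cat = \<lparr>Obj = UNIV, Arr = UNIV, Dom = (\<lambda>_. ()), Cod = (\<lambda>_. ()), Idn = (\<lambda>_. ()), Cmp = (\<lambda>_ _. ())\<rparr>"

definition point_map :: "('o, 'm, 'r) category_scheme \<Rightarrow> 'o \<Rightarrow> (unit, unit, 'o, 'm) cfunctor" where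
  "point_map P b = \<lparr>FObj = (\<lambda>_. b), FArr = (\<lambda>_. Idn P b)\<rparr>"

text \<open>For a connected groupoid \<open>P\<close> and \<open>\<iota>: * \<rightarrow> P\<close> the essentially unique map, the endomorphism
  \<open>1 \<rightarrow> \<iota>\<^sub>* \<iota>\<^sup>* 1 \<rightarrow> \<iota>\<^sub>! \<iota>\<^sup>* 1 \<rightarrow> 1\<close> of the unit of the category of functors on \<open>P\<close>.\<close>

definition component_endo ::
    "('o, 'm) category \<Rightarrow> ('c, 'd, 't) smcat_scheme \<Rightarrow> ('o, 'm, 'c, 'd) nat_trans" where
  "component_endo P C =
     (let CP = functor_cat P C;
          T = kan point_cat P C (point_map P (SOME b. b \<in> Obj P))
      in shriek_counit T (Unit CP) \<bullet>\<^bsub>CP\<^esub>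
         pre_nakayama CP (functor_cat point_cat C) T (FObj (pull T) (Unit CP)) \<bullet>\<^bsub>CP\<^esub>
         star_unit T (Unit CP))"

definition delta ::
    "('x, 'y, 'r) category_scheme \<Rightarrow> ('z, 'w, 's) category_scheme \<Rightarrow> ('o, 'm, 't) smcat_scheme \<Rightarrow>
     ('x, 'y, 'z, 'w) cfunctor \<Rightarrow> 'z \<Rightarrow>
     ('x \<times> 'w, ('x \<times> 'w) \<times> ('x \<times> 'w) \<times> 'y, 'o, 'm) nat_trans" where
  "delta X Y C f y =
     (let P = hfibre X Y f y in
      (unit_functor P C, unit_functor P C,
       \<lambda>p \<in> Obj P. component_at (component_endo (conn_component P p) C) p))"

text \<open>An endomorphism \<open>e\<close> of the unit acts on every object \<open>a\<close> by tensoring.\<close>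

definition unit_endo_action :: "('o, 'm, 'r) smcat_scheme \<Rightarrow> 'm \<Rightarrow> 'o \<Rightarrow> 'm" where
  "unit_endo_action C e a = LUn C a \<bullet>\<^bsub>C\<^esub> (e \<star>\<^bsub>C\<^esub> Idn C a) \<bullet>\<^bsub>C\<^esub> inv_arr C (LUn C a)"

text \<open>The leg at \<open>(x, h)\<close> of the canonical cocone exhibiting \<open>f\<^sub>! V (y)\<close> as the colimit of \<open>p\<^sup>* V\<close>
  over the homotopy fibre at \<open>y\<close>, namely \<open>V x \<rightarrow> f\<^sub>! V (f x) \<rightarrow> f\<^sub>! V (y)\<close>.\<close>

definition shriek_leg ::
    "('x, 'y, 'r) category_scheme \<Rightarrow> ('z, 'w, 's) category_scheme \<Rightarrow> ('o, 'm, 't) smcat_scheme \<Rightarrow>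
     ('x, 'y, 'z, 'w) cfunctor \<Rightarrow> ('x, 'y, 'o, 'm) cfunctor \<Rightarrow> 'x \<times> 'w \<Rightarrow> 'm" where
  "shriek_leg X Y C f V = (\<lambda>(x, h).
     FArr (FObj (lower_shriek (kan X Y C f)) V) h \<bullet>\<^bsub>C\<^esub>
     component_at (shriek_unit (kan X Y C f) V) x)"

definition shriek_delta_inv ::
    "('x, 'y, 'r) category_scheme \<Rightarrow> ('z, 'w, 's) category_scheme \<Rightarrow> ('o, 'm, 't) smcat_scheme \<Rightarrow>
     ('x, 'y, 'z, 'w) cfunctor \<Rightarrow> ('x, 'y, 'o, 'm) cfunctor \<Rightarrow> ('z, 'w, 'o, 'm) nat_trans" where
  "shriek_delta_inv X Y C f V =
     (let fV = FObj (lower_shriek (kan X Y C f)) V in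
      (fV, fV, \<lambda>y \<in> Obj Y.
        let P = hfibre X Y f y;
            e = unit_endo_action (functor_cat P C) (inv_arr (functor_cat P C) (delta X Y C f y))
                  (pull_functor P hfibre_proj V)
        in THE u. u \<in> Hom C (FObj fV y) (FObj fV y) \<and>
             (\<forall>q \<in> Obj P. u \<bullet>\<^bsub>C\<^esub> shriek_leg X Y C f V q = shriek_leg X Y C f V q \<bullet>\<^bsub>C\<^esub> component_at e q)))"

definition nakayama ::
    "('x, 'y, 'r) category_scheme \<Rightarrow> ('z, 'w, 's) category_scheme \<Rightarrow> ('o, 'm, 't) smcat_scheme \<Rightarrow>
     ('x, 'y, 'z, 'w) cfunctor \<Rightarrow> ('x, 'y, 'o, 'm) cfunctor \<Rightarrow> ('z, 'w, 'o, 'm) nat_trans" where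
  "nakayama X Y C f V =
     shriek_delta_inv X Y C f V \<bullet>\<^bsub>functor_cat Y C\<^esub>
     pre_nakayama (functor_cat Y C) (functor_cat X C) (kan X Y C f) V"

text \<open>The canonical comparisons \<open>(g f)\<^sub>* \<rightarrow> g\<^sub>* f\<^sub>*\<close> and \<open>(g f)\<^sub>! \<rightarrow> g\<^sub>! f\<^sub>!\<close>, given by uniqueness of
  adjoints of \<open>(g f)\<^sup>* = f\<^sup>* g\<^sup>*\<close>.\<close>

definition star_comparison ::
    "('x, 'y, 'r) category_scheme \<Rightarrow> ('z, 'w, 's) category_scheme \<Rightarrow> ('i, 'j, 'k) category_scheme \<Rightarrow>
     ('o, 'm, 't) smcat_scheme \<Rightarrow> ('x, 'y, 'z, 'w) cfunctor \<Rightarrow> ('z, 'w, 'i, 'j) cfunctor \<Rightarrow>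
     ('x, 'y, 'o, 'm) cfunctor \<Rightarrow> ('i, 'j, 'o, 'm) nat_trans" where
  "star_comparison X Y Z C f g V =
     (let Tf = kan X Y C f; Tg = kan Y Z C g; Th = kan X Z C (comp_functor g f);
          CZ = functor_cat Z C; hV = FObj (lower_star Th) V
      in FArr (lower_star Tg) (FArr (lower_star Tf) (star_counit Th V)) \<bullet>\<^bsub>CZ\<^esub>
         FArr (lower_star Tg) (star_unit Tf (FObj (pull Tg) hV)) \<bullet>\<^bsub>CZ\<^esub>
         star_unit Tg hV)"

definition shriek_comparison ::
    "('x, 'y, 'r) category_scheme \<Rightarrow> ('z, 'w, 's) category_scheme \<Rightarrow> ('i, 'j, 'k) category_scheme \<Rightarrow>
     ('o, 'm, 't) smcat_scheme \<Rightarrow> ('x, 'y, 'z, 'w) cfunctor \<Rightarrow> ('z, 'w, 'i, 'j) cfunctor \<Rightarrow>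
     ('x, 'y, 'o, 'm) cfunctor \<Rightarrow> ('i, 'j, 'o, 'm) nat_trans" where
  "shriek_comparison X Y Z C f g V =
     (let Tf = kan X Y C f; Tg = kan Y Z C g; Th = kan X Z C (comp_functor g f);
          CZ = functor_cat Z C; fV = FObj (lower_shriek Tf) V
      in shriek_counit Th (FObj (lower_shriek Tg) fV) \<bullet>\<^bsub>CZ\<^esub>
         FArr (lower_shriek Th) (FArr (pull Tf) (shriek_unit Tg fV)) \<bullet>\<^bsub>CZ\<^esub>
         FArr (lower_shriek Th) (shriek_unit Tf V))"

definition nakayama_functorial ::
    "('x, 'y, 'r) category_scheme \<Rightarrow> ('z, 'w, 's) category_scheme \<Rightarrow> ('i, 'j, 'k) category_scheme \<Rightarrow>
     ('o, 'm, 't) smcat_scheme \<Rightarrow> ('x, 'y, 'z, 'w) cfunctor \<Rightarrow> ('z, 'w, 'i, 'j) cfunctor \<Rightarrow> bool" where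
  "nakayama_functorial X Y Z C f g \<longleftrightarrow>
     (\<forall>V \<in> Obj (functor_cat X C).
       let Tf = kan X Y C f; Tg = kan Y Z C g; CZ = functor_cat Z C;
           shriek_first = FArr (lower_shriek Tg) (nakayama X Y C f V) \<bullet>\<^bsub>CZ\<^esub>
             nakayama Y Z C g (FObj (lower_star Tf) V);
           star_first = nakayama Y Z C g (FObj (lower_shriek Tf) V) \<bullet>\<^bsub>CZ\<^esub>
             FArr (lower_star Tg) (nakayama X Y C f V)
       in shriek_comparison X Y Z C f g V \<bullet>\<^bsub>CZ\<^esub> nakayama X Z C (comp_functor g f) V
            = shriek_first \<bullet>\<^bsub>CZ\<^esub> star_comparison X Y Z C f g V \<and>
          shriek_first = star_first)"

definition nakayama_category :: "'u itself \<Rightarrow> ('o, 'm, 't) smcat_scheme \<Rightarrow> bool" where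
  "nakayama_category U C \<longleftrightarrow>
     has_ess_finite_colimits U C \<and>
     symmetric_monoidal_category C \<and>
     has_duals C \<and>
     (\<forall>(X :: ('u, 'u) category) (Y :: ('u, 'u) category) f.
        ess_finite_groupoid X \<and> ess_finite_groupoid Y \<and> is_functor X Y f \<longrightarrow>
        (\<forall>y \<in> Obj Y. is_iso_arr (functor_cat (hfibre X Y f y) C) (delta X Y C f y))) \<and>
     (\<forall>(X :: ('u, 'u) category) (Y :: ('u, 'u) category) (Z :: ('u, 'u) category) f g.
        ess_finite_groupoid X \<and> ess_finite_groupoid Y \<and> ess_finite_groupoid Z \<and>
        is_functor X Y f \<and> is_functor Y Z g \<longrightarrow>
        nakayama_functorial X Y Z C f g)"


section \<open>Finite-dimensional vector spaces\<close>

text \<open>Objects are the finite-dimensional \<open>K\<close>-vector spaces whose carrier is a subset of \<open>'v\<close>.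
  Linear maps are stored with source and target, extensionally on the source.\<close>

type_synonym ('k, 'v) lin_arr = "('k, 'v) module \<times> ('k, 'v) module \<times> ('v \<Rightarrow> 'v)"

definition fd_spaces :: "('k, 'r) ring_scheme \<Rightarrow> ('k, 'v) module set" where
  "fd_spaces K = {V. vectorspace K V \<and> vectorspace.fin_dim K V}"

definition lin_maps ::
    "('k, 'r) ring_scheme \<Rightarrow> ('k, 'v) module \<Rightarrow> ('k, 'v) module \<Rightarrow> ('v \<Rightarrow> 'v) set" where
  "lin_maps K V W = module_hom K V W \<inter> extensional (carrier V)"

definition bilinear_map ::
    "('k, 'r) ring_scheme \<Rightarrow> ('k, 'v) module \<Rightarrow> ('k, 'v) module \<Rightarrow> ('k, 'v) module \<Rightarrow>
     ('v \<Rightarrow> 'v \<Rightarrow> 'v) \<Rightarrow> bool" where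
  "bilinear_map K V W U b \<longleftrightarrow>
     (\<forall>v \<in> carrier V. (\<lambda>w. b v w) \<in> module_hom K W U) \<and>
     (\<forall>w \<in> carrier W. (\<lambda>v. b v w) \<in> module_hom K V U)"

text \<open>The tensor product, specified by its universal property; \<open>'v\<close> has room for one as soon as
  \<open>K\<close> embeds into it and is infinite.\<close>

definition is_tensor_product ::
    "('k, 'r) ring_scheme \<Rightarrow> ('k, 'v) module \<Rightarrow> ('k, 'v) module \<Rightarrow> ('k, 'v) module \<Rightarrow>
     ('v \<Rightarrow> 'v \<Rightarrow> 'v) \<Rightarrow> bool" where
  "is_tensor_product K V W T t \<longleftrightarrow> T \<in> fd_spaces K \<and> bilinear_map K V W T t \<and>
     (\<forall>U \<in> fd_spaces K. \<forall>b. bilinear_map K V W U b \<longrightarrow>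
        (\<exists>!\<phi>. \<phi> \<in> lin_maps K T U \<and> (\<forall>v \<in> carrier V. \<forall>w \<in> carrier W. \<phi> (t v w) = b v w)))"

definition tensor_choice ::
    "('k, 'r) ring_scheme \<Rightarrow> ('k, 'v) module \<Rightarrow> ('k, 'v) module \<Rightarrow> ('k, 'v) module \<times> ('v \<Rightarrow> 'v \<Rightarrow> 'v)"
  where
  "tensor_choice K V W = (SOME (T, t). is_tensor_product K V W T t)"

definition vs_tensor ::
    "('k, 'r) ring_scheme \<Rightarrow> ('k, 'v) module \<Rightarrow> ('k, 'v) module \<Rightarrow> ('k, 'v) module" where
  "vs_tensor K V W = fst (tensor_choice K V W)"

definition pure_tensor ::
    "('k, 'r) ring_scheme \<Rightarrow> ('k, 'v) module \<Rightarrow> ('k, 'v) module \<Rightarrow> 'v \<Rightarrow> 'v \<Rightarrow> 'v" where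
  "pure_tensor K V W = snd (tensor_choice K V W)"

text \<open>A copy inside \<open>'v\<close> of the one-dimensional space \<open>K\<close>, with the isomorphism \<open>K \<rightarrow> U\<close>.\<close>

definition unit_choice :: "('k, 'r) ring_scheme \<Rightarrow> ('k, 'v) module \<times> ('k \<Rightarrow> 'v)" where
  "unit_choice K = (SOME (U, i). U \<in> fd_spaces K \<and> bij_betw i (carrier K) (carrier U) \<and>
     (\<forall>c \<in> carrier K. \<forall>d \<in> carrier K. i (c \<oplus>\<^bsub>K\<^esub> d) = i c \<oplus>\<^bsub>U\<^esub> i d \<and> i (c \<otimes>\<^bsub>K\<^esub> d) = c \<odot>\<^bsub>U\<^esub> i d))"

definition vs_unit :: "('k, 'r) ring_scheme \<Rightarrow> ('k, 'v) module" where
  "vs_unit K = fst (unit_choice K)"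

definition vs_unit_vec :: "('k, 'r) ring_scheme \<Rightarrow> 'v" where
  "vs_unit_vec K = snd (unit_choice K :: ('k, 'v) module \<times> ('k \<Rightarrow> 'v)) \<one>\<^bsub>K\<^esub>"

definition the_lin ::
    "('k, 'r) ring_scheme \<Rightarrow> ('k, 'v) module \<Rightarrow> ('k, 'v) module \<Rightarrow> (('v \<Rightarrow> 'v) \<Rightarrow> bool) \<Rightarrow> ('k, 'v) lin_arr"
  where
  "the_lin K V W \<Phi> = (V, W, THE \<phi>. \<phi> \<in> lin_maps K V W \<and> \<Phi> \<phi>)"

definition FdVect ::
    "('k, 'r) ring_scheme \<Rightarrow> (('k, 'v) module, ('k, 'v) lin_arr) smcat" where
  "FdVect K =
     \<lparr>Obj = fd_spaces K,
      Arr = {(V, W, f). V \<in> fd_spaces K \<and> W \<in> fd_spaces K \<and> f \<in> lin_maps K V W},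
      Dom = (\<lambda>(V, W, f). V),
      Cod = (\<lambda>(V, W, f). W),
      Idn = (\<lambda>V. (V, V, \<lambda>v \<in> carrier V. v)),
      Cmp = (\<lambda>(W', U, g) (V, W, f). (V, U, compose (carrier V) g f)),
      TensO = vs_tensor K,
      TensA = (\<lambda>(V, V', f) (W, W', g).
        the_lin K (vs_tensor K V W) (vs_tensor K V' W')
          (\<lambda>\<phi>. \<forall>v \<in> carrier V. \<forall>w \<in> carrier W.
             \<phi> (pure_tensor K V W v w) = pure_tensor K V' W' (f v) (g w))),
      Unit = vs_unit K,
      Assoc = (\<lambda>U V W.
        the_lin K (vs_tensor K (vs_tensor K U V) W) (vs_tensor K U (vs_tensor K V W))
          (\<lambda>\<phi>. \<forall>u \<in> carrier U. \<forall>v \<in> carrier V. \<forall>w \<in> carrier W.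
             \<phi> (pure_tensor K (vs_tensor K U V) W (pure_tensor K U V u v) w)
               = pure_tensor K U (vs_tensor K V W) u (pure_tensor K V W v w))),
      LUn = (\<lambda>V. the_lin K (vs_tensor K (vs_unit K) V) V
        (\<lambda>\<phi>. \<forall>v \<in> carrier V. \<phi> (pure_tensor K (vs_unit K) V (vs_unit_vec K) v) = v)),
      RUn = (\<lambda>V. the_lin K (vs_tensor K V (vs_unit K)) V
        (\<lambda>\<phi>. \<forall>v \<in> carrier V. \<phi> (pure_tensor K V (vs_unit K) v (vs_unit_vec K)) = v)),
      Braid = (\<lambda>V W. the_lin K (vs_tensor K V W) (vs_tensor K W V)
        (\<lambda>\<phi>. \<forall>v \<in> carrier V. \<forall>w \<in> carrier W.
           \<phi> (pure_tensor K V W v w) = pure_tensor K W V w v))\<rparr>"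

end

theory Submission
  imports Defs "HOL-Library.Equipollence" "HOL.Rat"
begin

text \<open>
  Call a symmetric monoidal category rational if its hom sets are \<open>\<rat>\<close>-vector spaces, composition
  and tensor product are bilinear, and the images of any finite family of idempotents have a direct sum.
  A rational monoidal category with duals is a Nakayama category (\<open>nakayama_categoryI\<close>), and
  finite-dimensional vector spaces over a field of characteristic zero form one
  (\<open>rational_monoidal_FD\<close>, \<open>has_duals_FD\<close>).

  The first part rests on integration over an essentially finite groupoid \<open>P\<close>: the integral \<open>\<integral> F\<close> of
  an isomorphism invariant family of arrows is the sum of \<open>F c / card (Aut c)\<close> over representatives
  \<open>c\<close> of the isomorphism classes. A diagram \<open>D\<close> on \<open>P\<close> has a bilimit, an object \<open>E\<close> with a cocone
  \<open>l\<close> and a cone \<open>m\<close> such that \<open>m q \<circ> l p\<close> is the sum of the \<open>D k\<close> over all \<open>k: p \<rightarrow> q\<close> and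
  \<open>\<integral> l \<circ> m = id\<close>; for a group it is the space of (co)invariants, split off by averaging
  (\<open>bilimit_exists\<close>). A bilimit is a colimit and a limit, and comparison arrows can be written as
  integrals. The bilimits over the homotopy fibres of \<open>f: X \<rightarrow> Y\<close> form a functor that is left and
  right adjoint to \<open>f\<^sup>*\<close> (\<open>adjoints_exist\<close>), so adjoints exist, and whichever adjoints are chosen are
  again such bilimits, with the canonical cocone \<open>l\<close> on \<open>f\<^sub>!\<close> (\<open>left_cone\<close>) and the canonical cone
  \<open>\<pi>\<close> on \<open>f\<^sub>*\<close> (\<open>right_cone\<close>). In these terms everything can be computed:

  \<^item> the projection maps are invertible, because tensoring preserves bilimits;
  \<^item> \<open>\<gamma>\<close> is the sum of \<open>l c \<circ> \<pi> c\<close> over representatives \<open>c\<close> of the fibre (\<open>pre_nakayama_component\<close>);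
  \<^item> \<open>\<delta>\<close> is multiplication by \<open>card (Aut c)\<close> (\<open>component_endo_at\<close>), which is invertible as the
    hom sets are rational;
  \<^item> hence \<open>\<nu>\<close> is the integral \<open>\<integral> l \<circ> \<pi>\<close> over the fibre (\<open>nakayama_component\<close>).

  Naturality of \<open>l\<close> and \<open>\<pi>\<close> gives \<open>(g\<^sub>! \<nu>\<^sub>f) \<circ> \<nu>\<^sub>g = \<nu>\<^sub>g \<circ> (g\<^sub>* \<nu>\<^sub>f)\<close>. That both are \<open>\<nu>\<close> of the
  composite is Fubini's theorem (\<open>integ_fubini\<close>): the fibre of \<open>g f\<close> over \<open>z\<close> is itself fibred over
  the fibre of \<open>g\<close> at \<open>z\<close>, with fibre at \<open>(y, h)\<close> the fibre of \<open>f\<close> at \<open>y\<close>.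

  For vector spaces, the work is to realise tensor products and direct sums inside the given type:
  as \<open>K\<close> is infinite, a finite-dimensional space is no larger than \<open>K\<close> (\<open>fd_copy\<close>). The coherence
  axioms are then checked on pure tensors.
\<close>

notation component_at (infixl "at" 100)

section \<open>Arrows, inverses and groupoids\<close>

lemma HomD: "f \<in> Hom C a b \<Longrightarrow> f \<in> Arr C" "f \<in> Hom C a b \<Longrightarrow> Dom C f = a" "f \<in> Hom C a b \<Longrightarrow> Cod C f = b"
  by (simp_all add: Hom_def)

context category
begin

lemma Hom_obj: "f \<in> Hom C a b \<Longrightarrow> a \<in> Obj C" "f \<in> Hom C a b \<Longrightarrow> b \<in> Obj C"
  using Dom_closed Cod_closed by (auto simp: Hom_def)

lemma inverse_arrows_unique:
  assumes "inverse_arrows C f g" "inverse_arrows C f g'"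
  shows "g = g'"
proof -
  let ?a = "Dom C f" and ?b = "Cod C f"
  have f: "f \<in> Hom C ?a ?b" and g: "g \<in> Hom C ?b ?a" and g': "g' \<in> Hom C ?b ?a"
    using assms by (auto simp: inverse_arrows_def Hom_def)
  have "g = g \<bullet> (f \<bullet> g')"
    using assms Idn_right[OF g] by (simp add: inverse_arrows_def)
  also have "\<dots> = (g \<bullet> f) \<bullet> g'"
    using Cmp_assoc[OF g' f g] by simp
  also have "\<dots> = g'"
    using assms Idn_left[OF g'] by (simp add: inverse_arrows_def)
  finally show ?thesis .
qed

lemma inv_arr_eqI: "inverse_arrows C f g \<Longrightarrow> inv_arr C f = g"
  unfolding inv_arr_def by (rule the_equality) (auto intro: inverse_arrows_unique)

lemma inverse_arrowsI:
  "f \<in> Hom C a b \<Longrightarrow> g \<in> Hom C b a \<Longrightarrow> g \<bullet> f = Idn C a \<Longrightarrow> f \<bullet> g = Idn C b \<Longrightarrow> inverse_arrows C f g"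
  by (auto simp: inverse_arrows_def Hom_def)

lemma is_iso_inv_arr:
  assumes "is_iso_arr C f" "f \<in> Hom C a b"
  shows "inv_arr C f \<in> Hom C b a" "inv_arr C f \<bullet> f = Idn C a" "f \<bullet> inv_arr C f = Idn C b"
proof -
  obtain g where g: "inverse_arrows C f g" using assms by (auto simp: is_iso_arr_def)
  have "inv_arr C f = g" using g by (rule inv_arr_eqI)
  with g assms(2) show "inv_arr C f \<in> Hom C b a" "inv_arr C f \<bullet> f = Idn C a"
      "f \<bullet> inv_arr C f = Idn C b"
    by (auto simp: inverse_arrows_def Hom_def)
qed

lemma inv_arr_Idn: "a \<in> Obj C \<Longrightarrow> inv_arr C (Idn C a) = Idn C a"
  by (rule inv_arr_eqI, rule inverse_arrowsI) (auto intro: Idn_closed Idn_left)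

lemma Cmp_cancel:
  assumes "g \<bullet> f = k" "f \<in> Hom C a b" "g \<in> Hom C b c" "r \<in> Hom C d a"
  shows "g \<bullet> (f \<bullet> r) = k \<bullet> r"
  using Cmp_assoc[OF assms(4,2,3)] assms(1) by simp

lemma paste_squares:
  assumes "v \<bullet> f = f' \<bullet> u" "w \<bullet> g = g' \<bullet> v"
    and f: "f \<in> Hom C a b" and g: "g \<in> Hom C b c" and f': "f' \<in> Hom C a' b'" and g': "g' \<in> Hom C b' c'"
    and u: "u \<in> Hom C a a'" and v: "v \<in> Hom C b b'" and w: "w \<in> Hom C c c'"
  shows "w \<bullet> (g \<bullet> f) = (g' \<bullet> f') \<bullet> u"
proof -
  have "w \<bullet> (g \<bullet> f) = g' \<bullet> (v \<bullet> f)"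
    using Cmp_assoc[OF f g w] Cmp_assoc[OF f v g'] assms(2) by simp
  also have "\<dots> = (g' \<bullet> f') \<bullet> u"
    using Cmp_assoc[OF u f' g'] assms(1) by simp
  finally show ?thesis .
qed

end

lemma groupoid_category: "groupoid X \<Longrightarrow> category X"
  by (simp add: groupoid_def)

lemma groupoid_inv:
  assumes "groupoid X" "k \<in> Hom X a b"
  shows "inv_arr X k \<in> Hom X b a" "inv_arr X k \<bullet>\<^bsub>X\<^esub> k = Idn X a" "k \<bullet>\<^bsub>X\<^esub> inv_arr X k = Idn X b"
  using category.is_iso_inv_arr[of X k a b] assms by (auto simp: groupoid_def Hom_def)

lemma groupoid_inv_inv:
  assumes X: "groupoid X" and k: "k \<in> Hom X a b"
  shows "inv_arr X (inv_arr X k) = k"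
proof -
  interpret category X using X by (rule groupoid_category)
  show ?thesis
    by (rule inv_arr_eqI, rule inverse_arrowsI[OF groupoid_inv(1)[OF X k] k])
      (simp_all add: groupoid_inv(2,3)[OF X k])
qed

lemma groupoid_cancel_left:
  assumes "groupoid X" "k \<in> Hom X b c" "u \<in> Hom X a b"
  shows "inv_arr X k \<bullet>\<^bsub>X\<^esub> (k \<bullet>\<^bsub>X\<^esub> u) = u"
  using groupoid_inv(2)[OF assms(1,2)]
    category.Cmp_assoc[OF groupoid_category[OF assms(1)] assms(3,2) groupoid_inv(1)[OF assms(1,2)]]
    category.Idn_left[OF groupoid_category[OF assms(1)] assms(3)] by simp

lemma groupoid_cancel_left':
  assumes "groupoid X" "k \<in> Hom X b c" "u \<in> Hom X a c"
  shows "k \<bullet>\<^bsub>X\<^esub> (inv_arr X k \<bullet>\<^bsub>X\<^esub> u) = u"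
  using groupoid_inv(3)[OF assms(1,2)]
    category.Cmp_assoc[OF groupoid_category[OF assms(1)] assms(3) groupoid_inv(1)[OF assms(1,2)] assms(2)]
    category.Idn_left[OF groupoid_category[OF assms(1)] assms(3)] by simp

lemma groupoid_post_bij:
  assumes X: "groupoid X" and k: "k \<in> Hom X b c"
  shows "bij_betw (\<lambda>u. k \<bullet>\<^bsub>X\<^esub> u) (Hom X a b) (Hom X a c)"
proof (rule bij_betw_byWitness[where f' = "\<lambda>u. inv_arr X k \<bullet>\<^bsub>X\<^esub> u"])
  interpret category X using X by (rule groupoid_category)
  note i = groupoid_inv[OF X k]
  show "\<forall>u\<in>Hom X a b. inv_arr X k \<bullet>\<^bsub>X\<^esub> (k \<bullet>\<^bsub>X\<^esub> u) = u"
    using groupoid_cancel_left[OF X k] by blast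
  show "\<forall>u\<in>Hom X a c. k \<bullet>\<^bsub>X\<^esub> (inv_arr X k \<bullet>\<^bsub>X\<^esub> u) = u"
    using groupoid_cancel_left'[OF X k] by blast
  show "(\<lambda>u. k \<bullet>\<^bsub>X\<^esub> u) ` Hom X a b \<subseteq> Hom X a c" using Cmp_closed[OF _ k] by blast
  show "(\<lambda>u. inv_arr X k \<bullet>\<^bsub>X\<^esub> u) ` Hom X a c \<subseteq> Hom X a b" using Cmp_closed[OF _ i(1)] by blast
qed

lemma groupoid_pre_bij:
  assumes X: "groupoid X" and k: "k \<in> Hom X a b"
  shows "bij_betw (\<lambda>u. u \<bullet>\<^bsub>X\<^esub> k) (Hom X b c) (Hom X a c)"
proof (rule bij_betw_byWitness[where f' = "\<lambda>u. u \<bullet>\<^bsub>X\<^esub> inv_arr X k"])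
  interpret category X using X by (rule groupoid_category)
  note i = groupoid_inv[OF X k]
  show "\<forall>u\<in>Hom X b c. (u \<bullet>\<^bsub>X\<^esub> k) \<bullet>\<^bsub>X\<^esub> inv_arr X k = u"
    using Cmp_assoc[OF i(1) k] Idn_right i by auto
  show "\<forall>u\<in>Hom X a c. (u \<bullet>\<^bsub>X\<^esub> inv_arr X k) \<bullet>\<^bsub>X\<^esub> k = u"
    using Cmp_assoc[OF k i(1)] Idn_right i by auto
  show "(\<lambda>u. u \<bullet>\<^bsub>X\<^esub> k) ` Hom X b c \<subseteq> Hom X a c" using Cmp_closed[OF k] by blast
  show "(\<lambda>u. u \<bullet>\<^bsub>X\<^esub> inv_arr X k) ` Hom X a c \<subseteq> Hom X b c" using Cmp_closed[OF i(1)] by blast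
qed

lemma groupoid_inv_cmp:
  assumes X: "groupoid X" and k: "k \<in> Hom X a b" and u: "u \<in> Hom X b c"
  shows "inv_arr X (u \<bullet>\<^bsub>X\<^esub> k) = inv_arr X k \<bullet>\<^bsub>X\<^esub> inv_arr X u"
proof -
  interpret category X using X by (rule groupoid_category)
  note ik = groupoid_inv[OF X k] and iu = groupoid_inv[OF X u]
  show ?thesis
  proof (rule inv_arr_eqI, rule inverse_arrowsI)
    show uk: "u \<bullet>\<^bsub>X\<^esub> k \<in> Hom X a c" by (rule Cmp_closed[OF k u])
    show "inv_arr X k \<bullet>\<^bsub>X\<^esub> inv_arr X u \<in> Hom X c a" by (rule Cmp_closed[OF iu(1) ik(1)])
    show "(inv_arr X k \<bullet>\<^bsub>X\<^esub> inv_arr X u) \<bullet>\<^bsub>X\<^esub> u \<bullet>\<^bsub>X\<^esub> k = Idn X a"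
      using Cmp_assoc[OF uk iu(1) ik(1)] groupoid_cancel_left[OF X u k] ik(2) by simp
    show "(u \<bullet>\<^bsub>X\<^esub> k) \<bullet>\<^bsub>X\<^esub> inv_arr X k \<bullet>\<^bsub>X\<^esub> inv_arr X u = Idn X c"
      using Cmp_assoc[OF Cmp_closed[OF iu(1) ik(1)] k u] groupoid_cancel_left'[OF X k iu(1)] iu(3) by simp
  qed
qed

lemma is_functorD:
  assumes "is_functor C D F"
  shows "category C" "category D"
    "a \<in> Obj C \<Longrightarrow> FObj F a \<in> Obj D"
    "f \<in> Hom C a b \<Longrightarrow> FArr F f \<in> Hom D (FObj F a) (FObj F b)"
    "a \<in> Obj C \<Longrightarrow> FArr F (Idn C a) = Idn D (FObj F a)"
    "f \<in> Hom C a b \<Longrightarrow> g \<in> Hom C b c \<Longrightarrow> FArr F (g \<bullet>\<^bsub>C\<^esub> f) = FArr F g \<bullet>\<^bsub>D\<^esub> FArr F f"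
  using assms by (auto simp: is_functor_def Hom_def)

lemma functor_inv:
  assumes F: "is_functor X D F" and X: "groupoid X" and k: "k \<in> Hom X a b"
  shows "inverse_arrows D (FArr F k) (FArr F (inv_arr X k))"
proof -
  interpret category D using is_functorD[OF F] by simp
  note ik = groupoid_inv[OF X k]
  have ab: "a \<in> Obj X" "b \<in> Obj X"
    using category.Hom_obj[OF groupoid_category[OF X] k] by auto
  note Fd = is_functorD[OF F]
  show ?thesis
  proof (rule inverse_arrowsI[OF Fd(4)[OF k] Fd(4)[OF ik(1)]])
    show "FArr F (inv_arr X k) \<bullet>\<^bsub>D\<^esub> FArr F k = Idn D (FObj F a)"
      using Fd(6)[OF k ik(1)] Fd(5)[OF ab(1)] ik(2) by simp
    show "FArr F k \<bullet>\<^bsub>D\<^esub> FArr F (inv_arr X k) = Idn D (FObj F b)"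
      using Fd(6)[OF ik(1) k] Fd(5)[OF ab(2)] ik(3) by simp
  qed
qed

section \<open>Representatives of isomorphism classes\<close>

definition iso_reps :: "('o, 'm, 'r) category_scheme \<Rightarrow> 'o set" where
  "iso_reps P = (\<lambda>A. SOME a. a \<in> A) ` (Obj P // isomorphic_rel P)"

lemma isomorphic_rel_groupoid:
  "groupoid P \<Longrightarrow> isomorphic_rel P = {(a, b). a \<in> Obj P \<and> b \<in> Obj P \<and> Hom P a b \<noteq> {}}"
  by (auto simp: isomorphic_rel_def groupoid_def Hom_def)

lemma isomorphic_rel_equiv:
  assumes "groupoid P" shows "equiv (Obj P) (isomorphic_rel P)"
proof -
  interpret category P using assms by (rule groupoid_category)
  show ?thesis unfolding isomorphic_rel_groupoid[OF assms]
  proof (rule equivI)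
    show "refl_on (Obj P) {(a, b). a \<in> Obj P \<and> b \<in> Obj P \<and> Hom P a b \<noteq> {}}"
      using Idn_closed by (auto simp: refl_on_def)
    show "sym {(a, b). a \<in> Obj P \<and> b \<in> Obj P \<and> Hom P a b \<noteq> {}}"
      using groupoid_inv(1)[OF assms] by (auto simp: sym_def)
    show "trans {(a, b). a \<in> Obj P \<and> b \<in> Obj P \<and> Hom P a b \<noteq> {}}"
      using Cmp_closed by (fastforce simp: trans_def)
  qed auto
qed

locale ess_finite =
  fixes P :: "('o, 'm, 'r) category_scheme"
  assumes ess_finite: "ess_finite_groupoid P"
begin

lemma groupoid: "groupoid P"
  using ess_finite by (simp add: ess_finite_groupoid_def)

sublocale category P
  by (rule groupoid_category[OF groupoid])

lemma finite_Hom: "finite (Hom P a b)"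
proof (cases "a \<in> Obj P \<and> b \<in> Obj P")
  case False
  then have "Hom P a b = {}" using Hom_obj by blast
  then show ?thesis by simp
qed (use ess_finite in \<open>auto simp: ess_finite_groupoid_def\<close>)

lemma reps_finite: "finite (iso_reps P)"
  using ess_finite by (simp add: iso_reps_def ess_finite_groupoid_def)

lemma rep_in_class: "A \<in> Obj P // isomorphic_rel P \<Longrightarrow> (SOME a. a \<in> A) \<in> A"
  by (metis some_in_eq in_quotient_imp_non_empty isomorphic_rel_equiv[OF groupoid])

lemma reps_obj: "c \<in> iso_reps P \<Longrightarrow> c \<in> Obj P"
  using rep_in_class in_quotient_imp_subset[OF isomorphic_rel_equiv[OF groupoid]]
  by (fastforce simp: iso_reps_def)

lemma reps_ex: assumes "p \<in> Obj P" obtains c where "c \<in> iso_reps P" "Hom P p c \<noteq> {}"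
proof -
  let ?A = "isomorphic_rel P `` {p}"
  have "?A \<in> Obj P // isomorphic_rel P" using assms by (rule quotientI)
  from rep_in_class[OF this] imageI[OF this, of "\<lambda>A. SOME a. a \<in> A"] show ?thesis
    by (intro that[of "SOME a. a \<in> ?A"]) (auto simp: iso_reps_def isomorphic_rel_groupoid[OF groupoid])
qed

lemma reps_unique:
  assumes "c \<in> iso_reps P" "c' \<in> iso_reps P" "Hom P p c \<noteq> {}" "Hom P p c' \<noteq> {}"
  shows "c = c'"
proof -
  obtain A A' where A: "A \<in> Obj P // isomorphic_rel P" "c = (SOME a. a \<in> A)"
    and A': "A' \<in> Obj P // isomorphic_rel P" "c' = (SOME a. a \<in> A')"
    using assms by (auto simp: iso_reps_def)
  obtain u v where "u \<in> Hom P p c" "v \<in> Hom P p c'" using assms by auto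
  then have "v \<bullet>\<^bsub>P\<^esub> inv_arr P u \<in> Hom P c c'"
    using groupoid_inv(1)[OF groupoid] Cmp_closed by blast
  then have "(c, c') \<in> isomorphic_rel P"
    using assms reps_obj by (auto simp: isomorphic_rel_groupoid[OF groupoid])
  then have "A = A'"
    using quotient_eq_iff[OF isomorphic_rel_equiv[OF groupoid] A(1) A'(1)]
      rep_in_class[OF A(1)] rep_in_class[OF A'(1)] A(2) A'(2) by simp
  then show ?thesis using A A' by simp
qed

lemma card_Hom_rep:
  assumes "Hom P p c \<noteq> {}" shows "card (Hom P p c) = card (Hom P c c)"
proof -
  obtain k where "k \<in> Hom P p c" using assms by auto
  from bij_betw_same_card[OF groupoid_pre_bij[OF groupoid this, of c]] show ?thesis by simp
qed

lemma card_Aut_pos: "p \<in> Obj P \<Longrightarrow> card (Hom P p p) > 0"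
  using finite_Hom[of p p] Idn_closed[of p] by (auto simp: card_gt_0_iff)

text \<open>The constant function \<open>1\<close> has integral \<open>1\<close> against the density \<open>card (Hom p \<dots>)\<close>: only the
  representative of \<open>p\<close> contributes, and \<open>Hom p c\<close> is a torsor under \<open>Aut c\<close>.\<close>

lemma reps_weight_sum:
  assumes "p \<in> Obj P"
  shows "(\<Sum>c\<in>iso_reps P. 1 / rat_of_nat (card (Hom P c c)) * rat_of_nat (card (Hom P p c))) = 1"
proof -
  obtain c0 where c0: "c0 \<in> iso_reps P" "Hom P p c0 \<noteq> {}" using reps_ex[OF assms] .
  have "(\<Sum>c\<in>iso_reps P. 1 / rat_of_nat (card (Hom P c c)) * rat_of_nat (card (Hom P p c)))
      = (\<Sum>c\<in>iso_reps P. if c = c0 then 1 else 0)"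
  proof (rule sum.cong)
    fix c assume c: "c \<in> iso_reps P"
    show "1 / rat_of_nat (card (Hom P c c)) * rat_of_nat (card (Hom P p c)) = (if c = c0 then 1 else 0)"
    proof (cases "c = c0")
      case True
      have "rat_of_nat (card (Hom P c c)) > 0"
        using card_Aut_pos[OF reps_obj[OF c]] by (simp only: of_nat_0_less_iff)
      then show ?thesis using card_Hom_rep[OF c0(2)] True by simp
    next
      case False
      then have "Hom P p c = {}" using reps_unique[OF c c0(1)] c0(2) by blast
      then show ?thesis using False by simp
    qed
  qed simp
  then show ?thesis using c0 reps_finite by simp
qed

end

section \<open>Categories of functors on a groupoid\<close>

lemma component_Cmp:
  "x \<in> Obj X \<Longrightarrow> (\<beta> \<bullet>\<^bsub>functor_cat X C\<^esub> \<alpha>) at x = \<beta> at x \<bullet>\<^bsub>C\<^esub> \<alpha> at x"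
  by (simp add: functor_cat_def split: prod.split)

lemma component_Idn:
  "x \<in> Obj X \<Longrightarrow> Idn (functor_cat X C) F at x = Idn C (FObj F x)"
  by (simp add: functor_cat_def)

lemma component_TensA:
  "x \<in> Obj X \<Longrightarrow> (\<alpha> \<star>\<^bsub>functor_cat X C\<^esub> \<beta>) at x = \<alpha> at x \<star>\<^bsub>C\<^esub> \<beta> at x"
  by (simp add: functor_cat_def split: prod.split)

lemma component_RUn:
  "x \<in> Obj X \<Longrightarrow> RUn (functor_cat X C) F at x = RUn C (FObj F x)"
  by (simp add: functor_cat_def)

lemma component_LUn:
  "x \<in> Obj X \<Longrightarrow> LUn (functor_cat X C) F at x = LUn C (FObj F x)"
  by (simp add: functor_cat_def)

lemma component_restriction:
  "x \<in> Obj X \<Longrightarrow> FArr (restriction X f) \<alpha> at x = \<alpha> at (FObj f x)"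
  by (simp add: restriction_def split: prod.split)

lemmas component_simps = component_Cmp component_Idn component_TensA component_RUn component_LUn
  component_restriction

lemma FObj_restriction: "FObj (restriction X f) V = pull_functor X f V"
  by (simp add: restriction_def)

lemma FObj_pull: "x \<in> Obj X \<Longrightarrow> FObj (pull_functor X f V) x = FObj V (FObj f x)"
  and FArr_pull: "k \<in> Arr X \<Longrightarrow> FArr (pull_functor X f V) k = FArr V (FArr f k)"
  by (simp_all add: pull_functor_def ext_functor_def)

lemma FObj_tensor: "x \<in> Obj X \<Longrightarrow> FObj (F \<boxtimes>\<^bsub>functor_cat X C\<^esub> G) x = FObj F x \<boxtimes>\<^bsub>C\<^esub> FObj G x"
  and FArr_tensor: "k \<in> Arr X \<Longrightarrow> FArr (F \<boxtimes>\<^bsub>functor_cat X C\<^esub> G) k = FArr F k \<star>\<^bsub>C\<^esub> FArr G k"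
  by (simp_all add: functor_cat_def tensor_functor_def ext_functor_def)

lemma FObj_Unit: "x \<in> Obj X \<Longrightarrow> FObj (Unit (functor_cat X C)) x = Unit C"
  and FArr_Unit: "k \<in> Arr X \<Longrightarrow> FArr (Unit (functor_cat X C)) k = Idn C (Unit C)"
  by (simp_all add: functor_cat_def unit_functor_def ext_functor_def)

lemmas functor_simps = FObj_restriction FObj_pull FArr_pull FObj_tensor FArr_tensor FObj_Unit FArr_Unit

lemma Obj_functor_cat: "Obj (functor_cat X C) = functors X C"
  by (simp add: functor_cat_def)

lemma functorsD: "F \<in> functors X C \<Longrightarrow> is_functor X C F"
  by (simp add: functors_def)

lemma functor_cat_HomD:
  assumes "\<alpha> \<in> Hom (functor_cat X C) F G"
  shows "F \<in> functors X C" "G \<in> functors X C" "\<alpha> = (F, G, snd (snd \<alpha>))"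
    "x \<in> Obj X \<Longrightarrow> \<alpha> at x \<in> Hom C (FObj F x) (FObj G x)"
    "k \<in> Hom X x y \<Longrightarrow> \<alpha> at y \<bullet>\<^bsub>C\<^esub> FArr F k = FArr G k \<bullet>\<^bsub>C\<^esub> \<alpha> at x"
  using assms by (auto simp: functor_cat_def Hom_def nat_transformations_def)

lemma functor_cat_HomI:
  assumes "F \<in> functors X C" "G \<in> functors X C"
    "\<And>x. x \<in> Obj X \<Longrightarrow> t x \<in> Hom C (FObj F x) (FObj G x)"
    "\<And>k x y. k \<in> Hom X x y \<Longrightarrow> t y \<bullet>\<^bsub>C\<^esub> FArr F k = FArr G k \<bullet>\<^bsub>C\<^esub> t x"
  shows "(F, G, restrict t (Obj X)) \<in> Hom (functor_cat X C) F G"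
proof -
  interpret category X using functorsD[OF assms(1)] by (simp add: is_functor_def)
  have "\<forall>k\<in>Arr X. restrict t (Obj X) (Cod X k) \<bullet>\<^bsub>C\<^esub> FArr F k = FArr G k \<bullet>\<^bsub>C\<^esub> restrict t (Obj X) (Dom X k)"
    using assms(4) Dom_closed Cod_closed by (simp add: Hom_def)
  then show ?thesis
    using assms by (simp add: functor_cat_def Hom_def nat_transformations_def)
qed

lemma functor_cat_ext:
  assumes "\<alpha> \<in> Hom (functor_cat X C) F G" "\<beta> \<in> Hom (functor_cat X C) F G"
    "\<And>x. x \<in> Obj X \<Longrightarrow> \<alpha> at x = \<beta> at x"
  shows "\<alpha> = \<beta>"
proof -
  have "snd (snd \<alpha>) \<in> extensional (Obj X)" "snd (snd \<beta>) \<in> extensional (Obj X)"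
    using assms(1,2) by (auto simp: functor_cat_def Hom_def nat_transformations_def)
  then have "snd (snd \<alpha>) = snd (snd \<beta>)" using assms(3) by (rule extensionalityI)
  then show ?thesis using functor_cat_HomD(3)[OF assms(1)] functor_cat_HomD(3)[OF assms(2)] by metis
qed

lemma ext_functor_in_functors:
  assumes "category X" "category C"
    "\<And>x. x \<in> Obj X \<Longrightarrow> F0 x \<in> Obj C"
    "\<And>k x y. k \<in> Hom X x y \<Longrightarrow> F1 k \<in> Hom C (F0 x) (F0 y)"
    "\<And>x. x \<in> Obj X \<Longrightarrow> F1 (Idn X x) = Idn C (F0 x)"
    "\<And>k l x y z. k \<in> Hom X x y \<Longrightarrow> l \<in> Hom X y z \<Longrightarrow> F1 (l \<bullet>\<^bsub>X\<^esub> k) = F1 l \<bullet>\<^bsub>C\<^esub> F1 k"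
  shows "ext_functor X F0 F1 \<in> functors X C"
proof -
  interpret X: category X by fact
  let ?F = "ext_functor X F0 F1"
  have o: "FObj ?F x = F0 x" if "x \<in> Obj X" for x using that by (simp add: ext_functor_def)
  have r: "FArr ?F k = F1 k" if "k \<in> Hom X x y" for k x y
    using HomD(1)[OF that] by (simp add: ext_functor_def)
  have "is_functor X C ?F"
    unfolding is_functor_def
  proof (intro conjI ballI allI)
    fix k assume "k \<in> Arr X"
    then have k: "k \<in> Hom X (Dom X k) (Cod X k)" by (simp add: Hom_def)
    show "FArr ?F k \<in> Hom C (FObj ?F (Dom X k)) (FObj ?F (Cod X k))"
      using assms(4)[OF k] by (simp add: r[OF k] o X.Hom_obj[OF k])
  next
    fix x assume x: "x \<in> Obj X"
    show "FArr ?F (Idn X x) = Idn C (FObj ?F x)"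
      using assms(5)[OF x] by (simp add: r[OF X.Idn_closed[OF x]] o x)
  next
    fix x y z k l assume k: "k \<in> Hom X x y" and l: "l \<in> Hom X y z"
    show "FArr ?F (l \<bullet>\<^bsub>X\<^esub> k) = FArr ?F l \<bullet>\<^bsub>C\<^esub> FArr ?F k"
      using assms(6)[OF k l] by (simp add: r[OF X.Cmp_closed[OF k l]] r[OF k] r[OF l])
  qed (use assms o in simp_all)
  then show ?thesis by (simp add: functors_def) (simp add: ext_functor_def)
qed

lemma category_functor_cat:
  fixes C :: "('o, 'm, 'r) smcat_scheme"
  assumes X: "category X" and C: "category C"
  shows "category (functor_cat X C)"
proof -
  interpret X: category X by fact
  interpret C: category C by fact
  let ?F = "functor_cat X C"
  have idn: "Idn ?F F \<in> Hom ?F F F" if "F \<in> Obj ?F" for F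
  proof -
    have F: "F \<in> functors X C" using that by (simp add: Obj_functor_cat)
    note Fd = is_functorD[OF functorsD[OF F]]
    have "(F, F, \<lambda>x\<in>Obj X. Idn C (FObj F x)) \<in> Hom ?F F F"
      using C.Idn_closed[OF Fd(3)] C.Idn_left[OF Fd(4)] C.Idn_right[OF Fd(4)]
      by (intro functor_cat_HomI[OF F F]) auto
    then show ?thesis by (simp add: functor_cat_def)
  qed
  have cmp: "\<beta> \<bullet>\<^bsub>?F\<^esub> \<alpha> \<in> Hom ?F F H" if a: "\<alpha> \<in> Hom ?F F G" and b: "\<beta> \<in> Hom ?F G H" for \<alpha> \<beta> F G H
  proof -
    note F = functor_cat_HomD[OF a] and G = functor_cat_HomD[OF b]
    have "(F, H, \<lambda>x\<in>Obj X. \<beta> at x \<bullet>\<^bsub>C\<^esub> \<alpha> at x) \<in> Hom ?F F H"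
    proof (rule functor_cat_HomI[OF F(1) G(2)])
      fix x assume "x \<in> Obj X"
      then show "\<beta> at x \<bullet>\<^bsub>C\<^esub> \<alpha> at x \<in> Hom C (FObj F x) (FObj H x)"
        using C.Cmp_closed[OF F(4) G(4)] by simp
    next
      fix k x y assume k: "k \<in> Hom X x y"
      note xy = X.Hom_obj[OF k]
      note hs = is_functorD(4)[OF functorsD[OF F(1)] k] is_functorD(4)[OF functorsD[OF G(1)] k]
        is_functorD(4)[OF functorsD[OF G(2)] k]
      show "(\<beta> at y \<bullet>\<^bsub>C\<^esub> \<alpha> at y) \<bullet>\<^bsub>C\<^esub> FArr F k
          = FArr H k \<bullet>\<^bsub>C\<^esub> \<beta> at x \<bullet>\<^bsub>C\<^esub> \<alpha> at x"
        using C.paste_squares[OF F(5)[OF k, symmetric] G(5)[OF k, symmetric]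
          F(4)[OF xy(1)] G(4)[OF xy(1)] F(4)[OF xy(2)] G(4)[OF xy(2)] hs] by simp
    qed
    moreover have "\<beta> \<bullet>\<^bsub>?F\<^esub> \<alpha> = (F, H, \<lambda>x\<in>Obj X. \<beta> at x \<bullet>\<^bsub>C\<^esub> \<alpha> at x)"
      by (subst F(3), subst G(3)) (simp add: functor_cat_def)
    ultimately show ?thesis by simp
  qed
  show ?thesis
  proof
    fix f assume "f \<in> Arr ?F"
    then have f: "f \<in> Hom ?F (Dom ?F f) (Cod ?F f)" by (simp add: Hom_def)
    show "Dom ?F f \<in> Obj ?F" "Cod ?F f \<in> Obj ?F"
      using functor_cat_HomD(1,2)[OF f] by (simp_all add: Obj_functor_cat)
  next
    fix f F G assume f: "f \<in> Hom ?F F G"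
    then have F: "F \<in> Obj ?F" "G \<in> Obj ?F"
      using functor_cat_HomD(1,2)[OF f] by (simp_all add: Obj_functor_cat)
    show "Idn ?F G \<bullet>\<^bsub>?F\<^esub> f = f"
      using C.Idn_left[OF functor_cat_HomD(4)[OF f]]
      by (intro functor_cat_ext[OF cmp[OF f idn[OF F(2)]] f]) (simp add: component_simps)
    show "f \<bullet>\<^bsub>?F\<^esub> Idn ?F F = f"
      using C.Idn_right[OF functor_cat_HomD(4)[OF f]]
      by (intro functor_cat_ext[OF cmp[OF idn[OF F(1)] f] f]) (simp add: component_simps)
  next
    fix f g h a b c d
    assume f: "f \<in> Hom ?F a b" and g: "g \<in> Hom ?F b c" and h: "h \<in> Hom ?F c d"
    show "(h \<bullet>\<^bsub>?F\<^esub> g) \<bullet>\<^bsub>?F\<^esub> f = h \<bullet>\<^bsub>?F\<^esub> g \<bullet>\<^bsub>?F\<^esub> f"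
      using C.Cmp_assoc[OF functor_cat_HomD(4)[OF f] functor_cat_HomD(4)[OF g] functor_cat_HomD(4)[OF h]]
      by (intro functor_cat_ext[OF cmp[OF f cmp[OF g h]] cmp[OF cmp[OF f g] h]])
        (simp add: component_simps)
  qed (use idn cmp in auto)
qed

text \<open>The pointwise inverse of a natural transformation is automatically natural.\<close>

lemma functor_cat_inverse:
  fixes C :: "('o, 'm, 'r) smcat_scheme"
  assumes X: "category X" and C: "category C" and a: "\<alpha> \<in> Hom (functor_cat X C) F G"
    and inv: "\<And>x. x \<in> Obj X \<Longrightarrow> inverse_arrows C (\<alpha> at x) (t x)"
  shows "is_iso_arr (functor_cat X C) \<alpha>" "inv_arr (functor_cat X C) \<alpha> \<in> Hom (functor_cat X C) G F"
    "x \<in> Obj X \<Longrightarrow> inv_arr (functor_cat X C) \<alpha> at x = t x"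
proof -
  interpret X: category X by fact
  interpret C: category C by fact
  let ?F = "functor_cat X C"
  interpret F: category ?F by (rule category_functor_cat[OF X C])
  note F = functor_cat_HomD[OF a]
  have t: "t x \<in> Hom C (FObj G x) (FObj F x)" "t x \<bullet>\<^bsub>C\<^esub> \<alpha> at x = Idn C (FObj F x)"
    "\<alpha> at x \<bullet>\<^bsub>C\<^esub> t x = Idn C (FObj G x)" if "x \<in> Obj X" for x
    using inv[OF that] F(4)[OF that] by (auto simp: inverse_arrows_def Hom_def)
  let ?b = "(G, F, restrict t (Obj X))"
  have b: "?b \<in> Hom ?F G F"
  proof (rule functor_cat_HomI[OF F(2,1)])
    fix k x y assume k: "k \<in> Hom X x y"
    note xy = X.Hom_obj[OF k]
    have Gk: "FArr G k \<in> Hom C (FObj G x) (FObj G y)" and Fk: "FArr F k \<in> Hom C (FObj F x) (FObj F y)"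
      using is_functorD(4)[OF functorsD[OF F(2)] k] is_functorD(4)[OF functorsD[OF F(1)] k] by simp_all
    have "t y \<bullet>\<^bsub>C\<^esub> FArr G k = t y \<bullet>\<^bsub>C\<^esub> FArr G k \<bullet>\<^bsub>C\<^esub> \<alpha> at x \<bullet>\<^bsub>C\<^esub> t x"
      using t[OF xy(1)] C.Idn_right[OF Gk] by simp
    also have "\<dots> = t y \<bullet>\<^bsub>C\<^esub> (FArr G k \<bullet>\<^bsub>C\<^esub> \<alpha> at x) \<bullet>\<^bsub>C\<^esub> t x"
      by (simp add: C.Cmp_assoc[OF t(1)[OF xy(1)] F(4)[OF xy(1)] Gk])
    also have "\<dots> = t y \<bullet>\<^bsub>C\<^esub> \<alpha> at y \<bullet>\<^bsub>C\<^esub> FArr F k \<bullet>\<^bsub>C\<^esub> t x"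
      by (simp add: F(5)[OF k, symmetric] C.Cmp_assoc[OF t(1)[OF xy(1)] Fk F(4)[OF xy(2)]])
    also have "\<dots> = FArr F k \<bullet>\<^bsub>C\<^esub> t x"
      using C.Cmp_cancel[OF t(2)[OF xy(2)] F(4)[OF xy(2)] t(1)[OF xy(2)] C.Cmp_closed[OF t(1)[OF xy(1)] Fk]]
        C.Idn_left[OF C.Cmp_closed[OF t(1)[OF xy(1)] Fk]] by simp
    finally show "t y \<bullet>\<^bsub>C\<^esub> FArr G k = FArr F k \<bullet>\<^bsub>C\<^esub> t x" .
  qed (rule t(1))
  have "inverse_arrows ?F \<alpha> ?b"
  proof (rule F.inverse_arrowsI[OF a b])
    have "F \<in> Obj ?F" "G \<in> Obj ?F" using F by (simp_all add: Obj_functor_cat)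
    note FG = this
    show "?b \<bullet>\<^bsub>?F\<^esub> \<alpha> = Idn ?F F"
      using t(2) by (intro functor_cat_ext[OF F.Cmp_closed[OF a b] F.Idn_closed[OF FG(1)]])
        (simp add: component_simps)
    show "\<alpha> \<bullet>\<^bsub>?F\<^esub> ?b = Idn ?F G"
      using t(3) by (intro functor_cat_ext[OF F.Cmp_closed[OF b a] F.Idn_closed[OF FG(2)]])
        (simp add: component_simps)
  qed
  then have *: "is_iso_arr ?F \<alpha>" "inv_arr ?F \<alpha> = ?b"
    by (auto simp: is_iso_arr_def intro: F.inv_arr_eqI)
  from * b show "is_iso_arr ?F \<alpha>" "inv_arr ?F \<alpha> \<in> Hom ?F G F" by simp_all
  show "x \<in> Obj X \<Longrightarrow> inv_arr ?F \<alpha> at x = t x" using * by simp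
qed

lemma pull_functor_closed:
  fixes C :: "('o, 'm, 'r) smcat_scheme"
  assumes f: "is_functor X Y f" and V: "V \<in> functors Y C"
  shows "pull_functor X f V \<in> functors X C"
  unfolding pull_functor_def
  supply fd = is_functorD[OF f] and Vd = is_functorD[OF functorsD[OF V]]
  using fd(1,3,5,6) Vd(2,3,5) Vd(4)[OF fd(4)] Vd(6)[OF fd(4) fd(4)]
  by (intro ext_functor_in_functors) auto

lemma is_functor_restriction:
  fixes C :: "('o, 'm, 'r) smcat_scheme"
  assumes f: "is_functor X Y f" and C: "category C"
  shows "is_functor (functor_cat Y C) (functor_cat X C) (restriction X f)"
proof -
  let ?X = "functor_cat X C" and ?Y = "functor_cat Y C"
  interpret CX: category ?X using is_functorD(1)[OF f] C by (rule category_functor_cat)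
  interpret CY: category ?Y using is_functorD(2)[OF f] C by (rule category_functor_cat)
  note fd = is_functorD[OF f]
  have arr: "FArr (restriction X f) \<alpha> \<in> Hom ?X (pull_functor X f F) (pull_functor X f G)"
    if a: "\<alpha> \<in> Hom ?Y F G" for \<alpha> F G
  proof -
    note F = functor_cat_HomD[OF a]
    have "(pull_functor X f F, pull_functor X f G, \<lambda>x\<in>Obj X. \<alpha> at (FObj f x))
        \<in> Hom ?X (pull_functor X f F) (pull_functor X f G)"
      using F(4)[OF fd(3)] F(5)[OF fd(4)]
      by (intro functor_cat_HomI pull_functor_closed[OF f] F)
        (auto simp: functor_simps HomD(1) dest: category.Hom_obj[OF fd(1)])
    then show ?thesis by (subst F(3)) (simp add: restriction_def)
  qed
  have obj: "\<And>F. F \<in> Obj ?Y \<Longrightarrow> pull_functor X f F \<in> Obj ?X"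
    using pull_functor_closed[OF f] by (simp add: Obj_functor_cat)
  show ?thesis
    unfolding is_functor_def FObj_restriction
  proof (intro conjI ballI allI)
    fix F assume F: "F \<in> Obj ?Y"
    show "FArr (restriction X f) (Idn ?Y F) = Idn ?X (pull_functor X f F)"
      using fd by (intro functor_cat_ext[OF arr[OF CY.Idn_closed[OF F]] CX.Idn_closed[OF obj[OF F]]])
        (simp add: component_simps functor_simps)
  next
    fix F G H \<alpha> \<beta> assume a: "\<alpha> \<in> Hom ?Y F G" and b: "\<beta> \<in> Hom ?Y G H"
    show "FArr (restriction X f) (\<beta> \<bullet>\<^bsub>?Y\<^esub> \<alpha>)
        = FArr (restriction X f) \<beta> \<bullet>\<^bsub>?X\<^esub> FArr (restriction X f) \<alpha>"
      using fd by (intro functor_cat_ext[OF arr[OF CY.Cmp_closed[OF a b]] CX.Cmp_closed[OF arr[OF a] arr[OF b]]])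
        (simp add: component_simps functor_simps)
  qed (use obj arr CX.category_axioms CY.category_axioms in \<open>auto simp: Hom_def\<close>)
qed

context symmetric_monoidal_category
begin

lemma tensor_closed:
  assumes F: "F \<in> functors X C" and G: "G \<in> functors X C"
  shows "F \<boxtimes>\<^bsub>functor_cat X C\<^esub> G \<in> functors X C"
proof -
  note Fd = is_functorD[OF functorsD[OF F]] and Gd = is_functorD[OF functorsD[OF G]]
  have "tensor_functor X C F G \<in> functors X C"
    unfolding tensor_functor_def
    using Fd(1,2,3,5,6) Gd(3,5,6) TensO_closed TensA_closed[OF Fd(4) Gd(4)]
      TensA_Cmp[OF Fd(4) Fd(4) Gd(4) Gd(4)]
    by (intro ext_functor_in_functors) (auto simp: TensA_Idn)
  then show ?thesis by (simp add: functor_cat_def)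
qed

lemma Unit_functor_closed:
  assumes "category X" shows "Unit (functor_cat X C) \<in> functors X C"
proof -
  have "unit_functor X C \<in> functors X C"
    unfolding unit_functor_def
    using assms category_axioms Unit_closed Idn_closed Idn_left[OF Idn_closed[OF Unit_closed]]
    by (intro ext_functor_in_functors) auto
  then show ?thesis by (simp add: functor_cat_def)
qed

lemma TensA_functor_closed:
  assumes a: "\<alpha> \<in> Hom (functor_cat X C) F F'" and b: "\<beta> \<in> Hom (functor_cat X C) G G'"
  shows "\<alpha> \<star>\<^bsub>functor_cat X C\<^esub> \<beta> \<in> Hom (functor_cat X C) (F \<boxtimes>\<^bsub>functor_cat X C\<^esub> G) (F' \<boxtimes>\<^bsub>functor_cat X C\<^esub> G')"
proof -
  note F = functor_cat_HomD[OF a] and G = functor_cat_HomD[OF b]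
  have X: "category X" using is_functorD(1)[OF functorsD[OF F(1)]] .
  have "(F \<boxtimes>\<^bsub>functor_cat X C\<^esub> G, F' \<boxtimes>\<^bsub>functor_cat X C\<^esub> G', \<lambda>x\<in>Obj X. \<alpha> at x \<star> \<beta> at x)
      \<in> Hom (functor_cat X C) (F \<boxtimes>\<^bsub>functor_cat X C\<^esub> G) (F' \<boxtimes>\<^bsub>functor_cat X C\<^esub> G')"
  proof (rule functor_cat_HomI[OF tensor_closed[OF F(1) G(1)] tensor_closed[OF F(2) G(2)]])
    fix k x y assume k: "k \<in> Hom X x y"
    note xy = category.Hom_obj[OF X k]
    show "(\<alpha> at y \<star> \<beta> at y) \<bullet> FArr (F \<boxtimes>\<^bsub>functor_cat X C\<^esub> G) k
        = FArr (F' \<boxtimes>\<^bsub>functor_cat X C\<^esub> G') k \<bullet> (\<alpha> at x \<star> \<beta> at x)"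
      using TensA_Cmp[OF is_functorD(4)[OF functorsD[OF F(1)] k] F(4)[OF xy(2)]
          is_functorD(4)[OF functorsD[OF G(1)] k] G(4)[OF xy(2)]]
        TensA_Cmp[OF F(4)[OF xy(1)] is_functorD(4)[OF functorsD[OF F(2)] k]
          G(4)[OF xy(1)] is_functorD(4)[OF functorsD[OF G(2)] k]] F(5)[OF k] G(5)[OF k]
      by (simp add: FArr_tensor HomD(1)[OF k])
  qed (use F(4) G(4) TensA_closed in \<open>simp add: functor_simps\<close>)
  moreover have "\<alpha> \<star>\<^bsub>functor_cat X C\<^esub> \<beta>
      = (F \<boxtimes>\<^bsub>functor_cat X C\<^esub> G, F' \<boxtimes>\<^bsub>functor_cat X C\<^esub> G', \<lambda>x\<in>Obj X. \<alpha> at x \<star> \<beta> at x)"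
    by (subst F(3), subst G(3)) (simp add: functor_cat_def)
  ultimately show ?thesis by simp
qed

lemma RUn_functor:
  assumes F: "F \<in> functors X C"
  shows "RUn (functor_cat X C) F \<in> Hom (functor_cat X C) (F \<boxtimes>\<^bsub>functor_cat X C\<^esub> Unit (functor_cat X C)) F"
    "inv_arr (functor_cat X C) (RUn (functor_cat X C) F)
      \<in> Hom (functor_cat X C) F (F \<boxtimes>\<^bsub>functor_cat X C\<^esub> Unit (functor_cat X C))"
    "x \<in> Obj X \<Longrightarrow> inv_arr (functor_cat X C) (RUn (functor_cat X C) F) at x = inv_arr C (RUn C (FObj F x))"
proof -
  note Fd = is_functorD[OF functorsD[OF F]]
  let ?G = "F \<boxtimes>\<^bsub>functor_cat X C\<^esub> Unit (functor_cat X C)"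
  have "(?G, F, \<lambda>x\<in>Obj X. RUn C (FObj F x)) \<in> Hom (functor_cat X C) ?G F"
    using RUn_closed[OF Fd(3)] RUn_natural[OF Fd(4)]
    by (intro functor_cat_HomI tensor_closed Unit_functor_closed Fd(1) F) (auto simp: functor_simps HomD(1))
  moreover have "RUn (functor_cat X C) F = (?G, F, \<lambda>x\<in>Obj X. RUn C (FObj F x))"
    by (simp add: functor_cat_def)
  ultimately show *: "RUn (functor_cat X C) F \<in> Hom (functor_cat X C) ?G F" by simp
  have "inverse_arrows C (RUn (functor_cat X C) F at x) (inv_arr C (RUn C (FObj F x)))"
    if "x \<in> Obj X" for x
    using that is_iso_inv_arr[of "RUn C (FObj F x)"] RUn_closed[OF Fd(3)[OF that]]
    by (auto intro!: inverse_arrowsI simp: component_simps)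
  from functor_cat_inverse[OF Fd(1) category_axioms * this]
  show "inv_arr (functor_cat X C) (RUn (functor_cat X C) F) \<in> Hom (functor_cat X C) F ?G"
    "x \<in> Obj X \<Longrightarrow> inv_arr (functor_cat X C) (RUn (functor_cat X C) F) at x = inv_arr C (RUn C (FObj F x))"
    by auto
qed

text \<open>Endomorphisms of the unit act by conjugation with the left unitor, whose inverse is therefore
  needed in functor categories.\<close>

lemma LUn_functor_inv:
  assumes F: "F \<in> functors X C" and x: "x \<in> Obj X"
  shows "inv_arr (functor_cat X C) (LUn (functor_cat X C) F) at x = inv_arr C (LUn C (FObj F x))"
proof -
  note Fd = is_functorD[OF functorsD[OF F]]
  let ?G = "Unit (functor_cat X C) \<boxtimes>\<^bsub>functor_cat X C\<^esub> F"
  have "(?G, F, \<lambda>x\<in>Obj X. LUn C (FObj F x)) \<in> Hom (functor_cat X C) ?G F"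
    using LUn_closed[OF Fd(3)] LUn_natural[OF Fd(4)]
    by (intro functor_cat_HomI tensor_closed Unit_functor_closed Fd(1) F) (auto simp: functor_simps HomD(1))
  moreover have "LUn (functor_cat X C) F = (?G, F, \<lambda>x\<in>Obj X. LUn C (FObj F x))"
    by (simp add: functor_cat_def)
  ultimately have *: "LUn (functor_cat X C) F \<in> Hom (functor_cat X C) ?G F" by simp
  have "inverse_arrows C (LUn (functor_cat X C) F at x) (inv_arr C (LUn C (FObj F x)))"
    if "x \<in> Obj X" for x
    using that is_iso_inv_arr[of "LUn C (FObj F x)"] LUn_closed[OF Fd(3)[OF that]]
    by (auto intro!: inverse_arrowsI simp: component_simps)
  from functor_cat_inverse(3)[OF Fd(1) category_axioms * this x] show ?thesis by simp
qed

end

section \<open>Rational monoidal categories\<close>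

text \<open>The properties of finite-dimensional vector spaces in characteristic zero that the proof uses.
  The last axiom combines direct sums with splitting of idempotents: \<open>E\<close> is the sum of the images of
  the \<open>e i\<close>, with inclusions and projections \<open>l\<close> and \<open>m\<close> extended to the \<open>A i\<close>; joint injectivity of
  the \<open>m i\<close> says that \<open>E\<close> is no larger than that. The index set is a set of naturals because an axiom
  cannot quantify over types.\<close>

locale rational_monoidal_category = symmetric_monoidal_category C
  for C :: "('o, 'm, 'r) smcat_scheme" (structure) +
  fixes add :: "'m \<Rightarrow> 'm \<Rightarrow> 'm" and zer :: "'o \<Rightarrow> 'o \<Rightarrow> 'm" and scl :: "rat \<Rightarrow> 'm \<Rightarrow> 'm"
  assumes add_closed: "\<lbrakk>f \<in> Hom C a b; g \<in> Hom C a b\<rbrakk> \<Longrightarrow> add f g \<in> Hom C a b"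
    and zer_closed: "\<lbrakk>a \<in> Obj C; b \<in> Obj C\<rbrakk> \<Longrightarrow> zer a b \<in> Hom C a b"
    and scl_closed: "f \<in> Hom C a b \<Longrightarrow> scl q f \<in> Hom C a b"
    and add_assoc: "\<lbrakk>f \<in> Hom C a b; g \<in> Hom C a b; h \<in> Hom C a b\<rbrakk> \<Longrightarrow> add (add f g) h = add f (add g h)"
    and add_commute: "\<lbrakk>f \<in> Hom C a b; g \<in> Hom C a b\<rbrakk> \<Longrightarrow> add f g = add g f"
    and add_zer: "f \<in> Hom C a b \<Longrightarrow> add (zer a b) f = f"
    and scl_add_right: "\<lbrakk>f \<in> Hom C a b; g \<in> Hom C a b\<rbrakk> \<Longrightarrow> scl q (add f g) = add (scl q f) (scl q g)"
    and scl_add_left: "f \<in> Hom C a b \<Longrightarrow> scl (q + q') f = add (scl q f) (scl q' f)"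
    and scl_scl: "f \<in> Hom C a b \<Longrightarrow> scl q (scl q' f) = scl (q * q') f"
    and scl_one: "f \<in> Hom C a b \<Longrightarrow> scl 1 f = f"
    and scl_zero: "f \<in> Hom C a b \<Longrightarrow> scl 0 f = zer a b"
    and Cmp_add_left: "\<lbrakk>f \<in> Hom C a b; g \<in> Hom C b c; g' \<in> Hom C b c\<rbrakk> \<Longrightarrow> add g g' \<bullet> f = add (g \<bullet> f) (g' \<bullet> f)"
    and Cmp_add_right: "\<lbrakk>f \<in> Hom C a b; f' \<in> Hom C a b; g \<in> Hom C b c\<rbrakk> \<Longrightarrow> g \<bullet> add f f' = add (g \<bullet> f) (g \<bullet> f')"
    and Cmp_scl_left: "\<lbrakk>f \<in> Hom C a b; g \<in> Hom C b c\<rbrakk> \<Longrightarrow> scl q g \<bullet> f = scl q (g \<bullet> f)"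
    and Cmp_scl_right: "\<lbrakk>f \<in> Hom C a b; g \<in> Hom C b c\<rbrakk> \<Longrightarrow> g \<bullet> scl q f = scl q (g \<bullet> f)"
    and TensA_add_left: "\<lbrakk>f \<in> Hom C a b; f' \<in> Hom C a b; g \<in> Hom C c d\<rbrakk> \<Longrightarrow> add f f' \<star> g = add (f \<star> g) (f' \<star> g)"
    and TensA_add_right: "\<lbrakk>f \<in> Hom C a b; g \<in> Hom C c d; g' \<in> Hom C c d\<rbrakk> \<Longrightarrow> f \<star> add g g' = add (f \<star> g) (f \<star> g')"
    and TensA_scl_left: "\<lbrakk>f \<in> Hom C a b; g \<in> Hom C c d\<rbrakk> \<Longrightarrow> scl q f \<star> g = scl q (f \<star> g)"
    and TensA_scl_right: "\<lbrakk>f \<in> Hom C a b; g \<in> Hom C c d\<rbrakk> \<Longrightarrow> f \<star> scl q g = scl q (f \<star> g)"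
    and retract_sums: "\<lbrakk>finite (I :: nat set); \<And>i. i \<in> I \<Longrightarrow> A i \<in> Obj C;
        \<And>i. i \<in> I \<Longrightarrow> e i \<in> Hom C (A i) (A i); \<And>i. i \<in> I \<Longrightarrow> e i \<bullet> e i = e i\<rbrakk> \<Longrightarrow>
      \<exists>E l m. E \<in> Obj C \<and> (\<forall>i\<in>I. l i \<in> Hom C (A i) E \<and> m i \<in> Hom C E (A i) \<and>
        m i \<bullet> l i = e i \<and> e i \<bullet> m i = m i \<and> (\<forall>j\<in>I. j \<noteq> i \<longrightarrow> m j \<bullet> l i = zer (A i) (A j))) \<and>
        (\<forall>c u v. u \<in> Hom C c E \<longrightarrow> v \<in> Hom C c E \<longrightarrow> (\<forall>i\<in>I. m i \<bullet> u = m i \<bullet> v) \<longrightarrow> u = v)"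
begin

subsection \<open>Weighted sums of arrows\<close>

definition hom_monoid :: "'o \<Rightarrow> 'o \<Rightarrow> 'm monoid" where
  "hom_monoid a b = \<lparr>carrier = Hom C a b, mult = add, one = zer a b\<rparr>"

definition wsum :: "'o \<Rightarrow> 'o \<Rightarrow> 'i set \<Rightarrow> ('i \<Rightarrow> rat) \<Rightarrow> ('i \<Rightarrow> 'm) \<Rightarrow> 'm" where
  "wsum a b I w F = finprod (hom_monoid a b) (\<lambda>i. scl (w i) (F i)) I"

lemma comm_monoid_hom:
  assumes "a \<in> Obj C" "b \<in> Obj C" shows "comm_monoid (hom_monoid a b)"
proof (rule comm_monoidI)
  fix x y z
  assume "x \<in> carrier (hom_monoid a b)" "y \<in> carrier (hom_monoid a b)" "z \<in> carrier (hom_monoid a b)"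
  then show "x \<otimes>\<^bsub>hom_monoid a b\<^esub> y \<otimes>\<^bsub>hom_monoid a b\<^esub> z = x \<otimes>\<^bsub>hom_monoid a b\<^esub> (y \<otimes>\<^bsub>hom_monoid a b\<^esub> z)"
    by (simp add: hom_monoid_def add_assoc)
next
  fix x y
  assume "x \<in> carrier (hom_monoid a b)" "y \<in> carrier (hom_monoid a b)"
  then show "x \<otimes>\<^bsub>hom_monoid a b\<^esub> y = y \<otimes>\<^bsub>hom_monoid a b\<^esub> x"
    by (simp add: hom_monoid_def add_commute)
qed (use assms zer_closed add_closed add_zer in \<open>simp_all add: hom_monoid_def\<close>)

lemma wsum_empty:
  assumes "a \<in> Obj C" "b \<in> Obj C" shows "wsum a b {} w F = zer a b"
proof -
  interpret M: comm_monoid "hom_monoid a b" using assms by (rule comm_monoid_hom)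
  show ?thesis by (simp add: wsum_def) (simp add: hom_monoid_def)
qed

context
  fixes a b
  assumes ab: "a \<in> Obj C" "b \<in> Obj C"
begin

lemma wsum_insert:
  assumes "finite I" "i \<notin> I" "F \<in> insert i I \<rightarrow> Hom C a b"
  shows "wsum a b (insert i I) w F = add (scl (w i) (F i)) (wsum a b I w F)"
proof -
  interpret M: comm_monoid "hom_monoid a b" using ab by (rule comm_monoid_hom)
  have "(\<lambda>i. scl (w i) (F i)) \<in> insert i I \<rightarrow> carrier (hom_monoid a b)"
    using assms(3) by (auto simp: hom_monoid_def Pi_iff intro!: scl_closed)
  then show ?thesis
    using M.finprod_insert[of I i "\<lambda>i. scl (w i) (F i)"] assms by (simp add: wsum_def hom_monoid_def)
qed

lemma wsum_closed:
  assumes "F \<in> I \<rightarrow> Hom C a b"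
  shows "wsum a b I w F \<in> Hom C a b"
proof -
  interpret M: comm_monoid "hom_monoid a b" using ab by (rule comm_monoid_hom)
  have "(\<lambda>i. scl (w i) (F i)) \<in> I \<rightarrow> carrier (hom_monoid a b)"
    using assms by (auto simp: hom_monoid_def Pi_iff intro!: scl_closed)
  from M.finprod_closed[OF this] show ?thesis by (simp add: wsum_def hom_monoid_def)
qed

lemma wsum_cong:
  assumes "F \<in> I \<rightarrow> Hom C a b" "F' \<in> I \<rightarrow> Hom C a b" "\<And>i. i \<in> I \<Longrightarrow> w i = w' i"
    "\<And>i. i \<in> I \<Longrightarrow> w i \<noteq> 0 \<Longrightarrow> F i = F' i"
  shows "wsum a b I w F = wsum a b I w' F'"
proof -
  interpret M: comm_monoid "hom_monoid a b" using ab by (rule comm_monoid_hom)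
  have "scl (w i) (F i) = scl (w' i) (F' i)" if "i \<in> I" for i
    using assms(3,4)[OF that] scl_zero[of "F i" a b] scl_zero[of "F' i" a b] assms(1,2) that
    by (cases "w i = 0") (auto simp: Pi_iff)
  moreover have "(\<lambda>i. scl (w' i) (F' i)) \<in> I \<rightarrow> carrier (hom_monoid a b)"
    using assms by (auto simp: hom_monoid_def Pi_iff intro!: scl_closed)
  ultimately show ?thesis
    unfolding wsum_def by (intro M.finprod_cong') auto
qed

text \<open>Composition and tensoring with a fixed arrow are linear, hence commute with weighted sums.\<close>

lemma wsum_linear:
  assumes \<phi>: "\<And>f. f \<in> Hom C a b \<Longrightarrow> \<phi> f \<in> Hom C c d"
    "\<And>f g. f \<in> Hom C a b \<Longrightarrow> g \<in> Hom C a b \<Longrightarrow> \<phi> (add f g) = add (\<phi> f) (\<phi> g)"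
    "\<And>q f. f \<in> Hom C a b \<Longrightarrow> \<phi> (scl q f) = scl q (\<phi> f)"
    and I: "finite I" and F: "F \<in> I \<rightarrow> Hom C a b"
  shows "\<phi> (wsum a b I w F) = wsum c d I w (\<lambda>i. \<phi> (F i))"
proof -
  have z: "zer a b \<in> Hom C a b" using zer_closed ab by simp
  note cd = Hom_obj[OF \<phi>(1)[OF z]]
  show ?thesis using I F
  proof (induction I)
    case empty
    have "\<phi> (zer a b) = zer c d" using \<phi>(3)[OF z, of 0] scl_zero[OF z] scl_zero[OF \<phi>(1)[OF z]] by simp
    then show ?case by (simp add: wsum_empty ab cd)
  next
    case (insert i I)
    have Fi: "F i \<in> Hom C a b" and FI: "F \<in> I \<rightarrow> Hom C a b" using insert.prems by auto
    have \<phi>F: "(\<lambda>i. \<phi> (F i)) \<in> insert i I \<rightarrow> Hom C c d" using insert.prems \<phi>(1) by auto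
    show ?case
      using wsum_insert[OF insert.hyps insert.prems] \<phi>(2)[OF scl_closed[OF Fi] wsum_closed[OF FI]] \<phi>(3)[OF Fi]
        insert.IH[OF FI] rational_monoidal_category.wsum_insert[OF rational_monoidal_category_axioms cd insert.hyps \<phi>F]
      by simp
  qed
qed

lemma wsum_post:
  assumes "finite I" "F \<in> I \<rightarrow> Hom C a b" "g \<in> Hom C b c"
  shows "g \<bullet> wsum a b I w F = wsum a c I w (\<lambda>i. g \<bullet> F i)"
  using Cmp_closed[OF _ assms(3)] Cmp_add_right[OF _ _ assms(3)] Cmp_scl_right[OF _ assms(3)]
  by (rule wsum_linear[where \<phi> = "\<lambda>f. g \<bullet> f"]) (use assms(1,2) in auto)

lemma wsum_pre:
  assumes "finite I" "F \<in> I \<rightarrow> Hom C a b" "f \<in> Hom C c a"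
  shows "wsum a b I w F \<bullet> f = wsum c b I w (\<lambda>i. F i \<bullet> f)"
  using Cmp_closed[OF assms(3)] Cmp_add_left[OF assms(3)] Cmp_scl_left[OF assms(3)]
  by (rule wsum_linear[where \<phi> = "\<lambda>g. g \<bullet> f"]) (use assms(1,2) in auto)

lemma wsum_tensor_right:
  assumes "finite I" "F \<in> I \<rightarrow> Hom C a b" "g \<in> Hom C c d"
  shows "wsum a b I w F \<star> g = wsum (a \<boxtimes> c) (b \<boxtimes> d) I w (\<lambda>i. F i \<star> g)"
  using TensA_closed[OF _ assms(3)] TensA_add_left[OF _ _ assms(3)] TensA_scl_left[OF _ assms(3)]
  by (rule wsum_linear[where \<phi> = "\<lambda>f. f \<star> g"]) (use assms(1,2) in auto)

lemma wsum_tensor_left: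
  assumes "finite I" "F \<in> I \<rightarrow> Hom C a b" "g \<in> Hom C c d"
  shows "g \<star> wsum a b I w F = wsum (c \<boxtimes> a) (d \<boxtimes> b) I w (\<lambda>i. g \<star> F i)"
  using TensA_closed[OF assms(3)] TensA_add_right[OF assms(3)] TensA_scl_right[OF assms(3)]
  by (rule wsum_linear[where \<phi> = "\<lambda>f. g \<star> f"]) (use assms(1,2) in auto)

lemma wsum_const:
  assumes "finite I" "t \<in> Hom C a b"
  shows "wsum a b I w (\<lambda>_. t) = scl (sum w I) t"
  using assms(1)
proof (induction I)
  case empty
  then show ?case using scl_zero[OF assms(2)] by (simp add: wsum_empty ab)
next
  case (insert i I)
  then show ?case using wsum_insert[of I i "\<lambda>_. t"] scl_add_left[OF assms(2)] assms(2) by simp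
qed

lemma wsum_scl_in:
  assumes "F \<in> I \<rightarrow> Hom C a b"
  shows "wsum a b I w (\<lambda>i. scl (q i) (F i)) = wsum a b I (\<lambda>i. w i * q i) F"
proof -
  interpret M: comm_monoid "hom_monoid a b" using ab by (rule comm_monoid_hom)
  have "(\<lambda>i. scl (w i * q i) (F i)) \<in> I \<rightarrow> carrier (hom_monoid a b)"
    using assms by (auto simp: hom_monoid_def Pi_iff intro!: scl_closed)
  moreover have "scl (w i) (scl (q i) (F i)) = scl (w i * q i) (F i)" if "i \<in> I" for i
    using scl_scl[of "F i" a b] assms that by (auto simp: Pi_iff)
  ultimately show ?thesis unfolding wsum_def by (intro M.finprod_cong') auto
qed

lemma wsum_scl:
  assumes "finite I" "F \<in> I \<rightarrow> Hom C a b"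
  shows "scl q (wsum a b I w F) = wsum a b I (\<lambda>i. q * w i) F"
proof -
  have "scl q (wsum a b I w F) = wsum a b I w (\<lambda>i. scl q (F i))"
    using scl_closed scl_add_right scl_scl assms by (intro wsum_linear[where \<phi> = "scl q"]) (auto simp: mult.commute)
  then show ?thesis using wsum_scl_in[OF assms(2), of w "\<lambda>_. q"] by (simp add: mult.commute)
qed

lemma wsum_add_weights:
  assumes "finite I" "F \<in> I \<rightarrow> Hom C a b"
  shows "wsum a b I (\<lambda>i. v i + w i) F = add (wsum a b I v F) (wsum a b I w F)"
proof -
  interpret M: comm_monoid "hom_monoid a b" using ab by (rule comm_monoid_hom)
  have c: "(\<lambda>i. scl (v i) (F i)) \<in> I \<rightarrow> carrier (hom_monoid a b)"
    "(\<lambda>i. scl (w i) (F i)) \<in> I \<rightarrow> carrier (hom_monoid a b)" for w v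
    using assms by (auto simp: hom_monoid_def Pi_iff intro!: scl_closed)
  have "finprod (hom_monoid a b) (\<lambda>i. scl (v i + w i) (F i)) I
      = finprod (hom_monoid a b) (\<lambda>i. scl (v i) (F i) \<otimes>\<^bsub>hom_monoid a b\<^esub> scl (w i) (F i)) I"
    using assms scl_add_left
    by (intro M.finprod_cong') (auto simp: hom_monoid_def Pi_iff intro!: add_closed scl_closed)
  also have "\<dots> = add (wsum a b I v F) (wsum a b I w F)"
    using M.finprod_multf[OF c] by (simp add: wsum_def) (simp add: hom_monoid_def)
  finally show ?thesis by (simp add: wsum_def)
qed

lemma wsum_nested:
  assumes "finite I" "finite J" "G \<in> J \<rightarrow> Hom C a b"
  shows "wsum a b I w (\<lambda>i. wsum a b J (v i) G) = wsum a b J (\<lambda>j. \<Sum>i\<in>I. w i * v i j) G"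
  using assms(1)
proof (induction I)
  case empty
  have "wsum a b J (\<lambda>_. 0) G = wsum a b J (\<lambda>_. 0) (\<lambda>_. zer a b)"
    using assms zer_closed ab by (intro wsum_cong) auto
  also have "\<dots> = zer a b"
    using wsum_const[OF assms(2) zer_closed[OF ab], of "\<lambda>_. 0"] scl_zero[OF zer_closed[OF ab]] by simp
  finally show ?case by (simp add: wsum_empty ab)
next
  case (insert i I)
  have "(\<lambda>i. wsum a b J (v i) G) \<in> insert i I \<rightarrow> Hom C a b"
    using wsum_closed[OF assms(3)] by auto
  from wsum_insert[OF insert.hyps this, of w] show ?case
    using insert wsum_scl[OF assms(2,3)] wsum_add_weights[OF assms(2,3)] by simp
qed

lemma wsum_reindex:
  assumes "bij_betw h I J" "F \<in> J \<rightarrow> Hom C a b"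
  shows "wsum a b I (\<lambda>i. w (h i)) (\<lambda>i. F (h i)) = wsum a b J w F"
proof -
  interpret M: comm_monoid "hom_monoid a b" using ab by (rule comm_monoid_hom)
  have "(\<lambda>i. scl (w i) (F i)) \<in> h ` I \<rightarrow> carrier (hom_monoid a b)"
    using assms scl_closed by (auto simp: hom_monoid_def bij_betw_def Pi_iff)
  from M.finprod_reindex[OF this] show ?thesis
    using assms by (simp add: wsum_def bij_betw_def)
qed

lemma wsum_single:
  assumes "finite I" "F \<in> I \<rightarrow> Hom C a b" "j \<in> I" "\<And>i. i \<in> I \<Longrightarrow> i \<noteq> j \<Longrightarrow> F i = zer a b"
  shows "wsum a b I w F = scl (w j) (F j)"
proof -
  have Fj: "F j \<in> Hom C a b" using assms by auto
  have z: "zer a b \<in> Hom C a b" using zer_closed ab by simp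
  have "wsum a b I w F = wsum a b I (\<lambda>i. w i * (if i = j then 1 else 0)) F"
  proof -
    have "wsum a b I w F = wsum a b I w (\<lambda>i. scl (if i = j then 1 else 0) (F i))"
      using assms(2,4) scl_closed scl_one scl_zero[OF z]
      by (intro wsum_cong) (auto simp: Pi_iff)
    then show ?thesis using wsum_scl_in[OF assms(2)] by simp
  qed
  also have "\<dots> = wsum a b I (\<lambda>i. w i * (if i = j then 1 else 0)) (\<lambda>_. F j)"
    using assms(2) Fj by (intro wsum_cong) (auto split: if_splits)
  also have "\<dots> = scl (w j) (F j)"
    using assms(1,3) wsum_const[OF assms(1) Fj] by (simp add: if_distrib sum.delta cong: if_cong)
  finally show ?thesis .
qed

end

subsection \<open>Integration over a groupoid\<close>

text \<open>The weight \<open>1 / card (Aut c)\<close>, that of groupoid cardinality, makes Fubini's theorem hold.\<close>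

definition integ :: "'o \<Rightarrow> 'o \<Rightarrow> ('p, 'q, 'z) category_scheme \<Rightarrow> ('p \<Rightarrow> 'm) \<Rightarrow> 'm" where
  "integ a b P F = wsum a b (iso_reps P) (\<lambda>c. 1 / of_nat (card (Hom P c c))) F"

text \<open>Summing over all arrows out of \<open>p\<close> and dividing by automorphisms counts the value once.\<close>

lemma integ_homsum:
  assumes P: "ess_finite P" and p: "p \<in> Obj P" and t: "t \<in> Hom C a b"
    and G: "\<And>c k. k \<in> Hom P p c \<Longrightarrow> G c k = t"
  shows "integ a b P (\<lambda>c. wsum a b (Hom P p c) (\<lambda>_. 1) (G c)) = t"
proof -
  interpret P: ess_finite P by fact
  note ab = Hom_obj[OF t]
  have "wsum a b (Hom P p c) (\<lambda>_. 1) (G c) = scl (of_nat (card (Hom P p c))) t" for c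
  proof -
    have "wsum a b (Hom P p c) (\<lambda>_. 1) (G c) = wsum a b (Hom P p c) (\<lambda>_. 1) (\<lambda>_. t)"
      using G t by (intro wsum_cong ab) auto
    then show ?thesis using wsum_const[OF ab P.finite_Hom t, of _ _ "\<lambda>_. 1"] by simp
  qed
  then show ?thesis
    unfolding integ_def
    using wsum_scl_in[OF ab, of "\<lambda>_. t" "iso_reps P"] wsum_const[OF ab P.reps_finite t]
      P.reps_weight_sum[OF p] t scl_one[OF t] by simp
qed

lemma integ_eqI:
  assumes P: "ess_finite P" and "a \<in> Obj C" "b \<in> Obj C"
    "\<And>c. c \<in> Obj P \<Longrightarrow> F c \<in> Hom C a b" "\<And>c. c \<in> Obj P \<Longrightarrow> F c = F' c"
  shows "integ a b P F = integ a b P F'"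
  unfolding integ_def using assms ess_finite.reps_obj[OF P] by (intro wsum_cong) fastforce+

lemma integ_post:
  assumes P: "ess_finite P" and "a \<in> Obj C" "b \<in> Obj C"
    "\<And>c. c \<in> Obj P \<Longrightarrow> F c \<in> Hom C a b" "g \<in> Hom C b d"
  shows "g \<bullet> integ a b P F = integ a d P (\<lambda>p. g \<bullet> F p)"
  unfolding integ_def using assms ess_finite.reps_obj[OF P] ess_finite.reps_finite[OF P]
  by (intro wsum_post) auto

lemma integ_pre:
  assumes P: "ess_finite P" and "a \<in> Obj C" "b \<in> Obj C"
    "\<And>c. c \<in> Obj P \<Longrightarrow> F c \<in> Hom C a b" "f \<in> Hom C d a"
  shows "integ a b P F \<bullet> f = integ d b P (\<lambda>p. F p \<bullet> f)"
  unfolding integ_def using assms ess_finite.reps_obj[OF P] ess_finite.reps_finite[OF P]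
  by (intro wsum_pre) auto

lemma integ_closed:
  assumes P: "ess_finite P" and "a \<in> Obj C" "b \<in> Obj C"
    "\<And>c. c \<in> Obj P \<Longrightarrow> F c \<in> Hom C a b"
  shows "integ a b P F \<in> Hom C a b"
  unfolding integ_def using assms ess_finite.reps_obj[OF P] by (intro wsum_closed) auto

text \<open>The family \<open>card (Hom p q) / card (Aut p)\<close> is the indicator function of the class of \<open>q\<close>, so an
  invariant family is a combination of its values at representatives.\<close>

lemma integ_density:
  assumes P: "ess_finite P" and q: "q \<in> Obj P" and ab: "a \<in> Obj C" "b \<in> Obj C"
    and G: "\<And>p. p \<in> Obj P \<Longrightarrow> G p \<in> Hom C a b" and inv: "\<And>p p' k. k \<in> Hom P p p' \<Longrightarrow> G p = G p'"
  shows "wsum a b (iso_reps P) (\<lambda>p. 1 / of_nat (card (Hom P p p)) * of_nat (card (Hom P p q))) G = G q"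
proof -
  interpret P: ess_finite P by fact
  have bij: "bij_betw (inv_arr P) (Hom P p q) (Hom P q p)" for p
    using groupoid_inv(1)[OF P.groupoid] groupoid_inv_inv[OF P.groupoid]
    by (intro bij_betw_byWitness[where f' = "inv_arr P"]) auto
  have "wsum a b (iso_reps P) (\<lambda>p. 1 / of_nat (card (Hom P p p)) * of_nat (card (Hom P p q))) G
      = wsum a b (iso_reps P) (\<lambda>p. 1 / of_nat (card (Hom P p p)) * of_nat (card (Hom P q p))) (\<lambda>_. G q)"
  proof (rule wsum_cong[OF ab])
    fix p assume "p \<in> iso_reps P"
    show "1 / rat_of_nat (card (Hom P p p)) * of_nat (card (Hom P p q))
        = 1 / of_nat (card (Hom P p p)) * of_nat (card (Hom P q p))"
      using bij_betw_same_card[OF bij] by simp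
    assume "1 / rat_of_nat (card (Hom P p p)) * of_nat (card (Hom P p q)) \<noteq> 0"
    then have "Hom P p q \<noteq> {}" by auto
    then show "G p = G q" using inv by blast
  qed (use G q P.reps_obj in auto)
  also have "\<dots> = G q"
    using wsum_const[OF ab P.reps_finite G[OF q]] P.reps_weight_sum[OF q] scl_one[OF G[OF q]] by simp
  finally show ?thesis .
qed

text \<open>Fubini. Writing the integrand as a combination of the values at the representatives \<open>p\<close> of
  \<open>P\<close> (\<open>integ_density\<close>) reduces the claim to one about cardinalities: the iterated integral of
  \<open>card (Hom p (\<Phi> d c))\<close> is \<open>1\<close>, which follows by applying \<open>reps_weight_sum\<close> twice.\<close>

lemma integ_fubini:
  assumes P: "ess_finite P" and Q: "ess_finite Q" and R: "\<And>d. d \<in> Obj Q \<Longrightarrow> ess_finite (R d)"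
    and \<Phi>: "\<And>d c. d \<in> Obj Q \<Longrightarrow> c \<in> Obj (R d) \<Longrightarrow> \<Phi> d c \<in> Obj P"
    and \<pi>: "\<And>p. p \<in> Obj P \<Longrightarrow> \<pi> p \<in> Obj Q"
    and \<sigma>: "\<And>p d u. p \<in> Obj P \<Longrightarrow> u \<in> Hom Q (\<pi> p) d \<Longrightarrow> \<sigma> p u \<in> Obj (R d)"
    and count: "\<And>p d c. p \<in> Obj P \<Longrightarrow> d \<in> Obj Q \<Longrightarrow> c \<in> Obj (R d) \<Longrightarrow>
      card (Hom P p (\<Phi> d c)) = (\<Sum>u\<in>Hom Q (\<pi> p) d. card (Hom (R d) (\<sigma> p u) c))"
    and ab: "a \<in> Obj C" "b \<in> Obj C"
    and G: "\<And>p. p \<in> Obj P \<Longrightarrow> G p \<in> Hom C a b" and inv: "\<And>p p' k. k \<in> Hom P p p' \<Longrightarrow> G p = G p'"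
  shows "integ a b Q (\<lambda>d. integ a b (R d) (\<lambda>c. G (\<Phi> d c))) = integ a b P G"
proof -
  interpret P: ess_finite P by fact
  interpret Q: ess_finite Q by fact
  let ?w = "\<lambda>p. 1 / rat_of_nat (card (Hom P p p))"
  have GP: "G \<in> iso_reps P \<rightarrow> Hom C a b" using G P.reps_obj by auto
  have inner: "integ a b (R d) (\<lambda>c. G (\<Phi> d c))
      = wsum a b (iso_reps P) (\<lambda>p. ?w p * of_nat (card (Hom Q (\<pi> p) d))) G" if d: "d \<in> Obj Q" for d
  proof -
    interpret R: ess_finite "R d" by (rule R[OF d])
    let ?v = "\<lambda>c. 1 / rat_of_nat (card (Hom (R d) c c))"
    have "integ a b (R d) (\<lambda>c. G (\<Phi> d c))
        = integ a b (R d) (\<lambda>c. wsum a b (iso_reps P) (\<lambda>p. ?w p * of_nat (card (Hom P p (\<Phi> d c)))) G)"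
      using G \<Phi> d integ_density[OF P \<Phi>[OF d] ab G inv]
      by (intro integ_eqI[OF R[OF d] ab]) auto
    also have "\<dots> = wsum a b (iso_reps P)
        (\<lambda>p. \<Sum>c\<in>iso_reps (R d). ?v c * (?w p * of_nat (card (Hom P p (\<Phi> d c))))) G"
      unfolding integ_def by (rule wsum_nested[OF ab R.reps_finite P.reps_finite GP])
    also have "\<dots> = wsum a b (iso_reps P) (\<lambda>p. ?w p * of_nat (card (Hom Q (\<pi> p) d))) G"
    proof (rule wsum_cong[OF ab GP GP])
      fix p assume "p \<in> iso_reps P"
      then have p: "p \<in> Obj P" by (rule P.reps_obj)
      have "(\<Sum>c\<in>iso_reps (R d). ?v c * (?w p * of_nat (card (Hom P p (\<Phi> d c)))))
          = (\<Sum>c\<in>iso_reps (R d). \<Sum>u\<in>Hom Q (\<pi> p) d. ?w p * (?v c * of_nat (card (Hom (R d) (\<sigma> p u) c))))"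
        using count[OF p d R.reps_obj] by (intro sum.cong) (simp_all add: sum_distrib_left mult_ac)
      also have "\<dots> = (\<Sum>u\<in>Hom Q (\<pi> p) d. ?w p * (\<Sum>c\<in>iso_reps (R d). ?v c * of_nat (card (Hom (R d) (\<sigma> p u) c))))"
        by (subst sum.swap) (simp add: sum_distrib_left)
      also have "\<dots> = (\<Sum>u\<in>Hom Q (\<pi> p) d. ?w p)"
        using R.reps_weight_sum[OF \<sigma>[OF p]] by (intro sum.cong) auto
      finally show "(\<Sum>c\<in>iso_reps (R d). ?v c * (?w p * of_nat (card (Hom P p (\<Phi> d c)))))
          = ?w p * of_nat (card (Hom Q (\<pi> p) d))" by simp
    qed simp
    finally show ?thesis .
  qed
  have "integ a b Q (\<lambda>d. integ a b (R d) (\<lambda>c. G (\<Phi> d c)))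
      = integ a b Q (\<lambda>d. wsum a b (iso_reps P) (\<lambda>p. ?w p * of_nat (card (Hom Q (\<pi> p) d))) G)"
  proof (rule integ_eqI[OF Q ab])
    fix d assume d: "d \<in> Obj Q"
    show "integ a b (R d) (\<lambda>c. G (\<Phi> d c)) = wsum a b (iso_reps P) (\<lambda>p. ?w p * of_nat (card (Hom Q (\<pi> p) d))) G"
      using inner[OF d] .
    then show "integ a b (R d) (\<lambda>c. G (\<Phi> d c)) \<in> Hom C a b" using wsum_closed[OF ab GP] by simp
  qed
  also have "\<dots> = wsum a b (iso_reps P)
      (\<lambda>p. \<Sum>d\<in>iso_reps Q. 1 / of_nat (card (Hom Q d d)) * (?w p * of_nat (card (Hom Q (\<pi> p) d)))) G"
    unfolding integ_def by (rule wsum_nested[OF ab Q.reps_finite P.reps_finite GP])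
  also have "\<dots> = integ a b P G"
    unfolding integ_def
  proof (rule wsum_cong[OF ab GP GP])
    fix p assume "p \<in> iso_reps P"
    then have p: "p \<in> Obj P" by (rule P.reps_obj)
    have "(\<Sum>d\<in>iso_reps Q. 1 / rat_of_nat (card (Hom Q d d)) * (?w p * of_nat (card (Hom Q (\<pi> p) d))))
        = ?w p * (\<Sum>d\<in>iso_reps Q. 1 / rat_of_nat (card (Hom Q d d)) * of_nat (card (Hom Q (\<pi> p) d)))"
      by (simp add: sum_distrib_left mult_ac)
    then show "(\<Sum>d\<in>iso_reps Q. 1 / rat_of_nat (card (Hom Q d d)) * (?w p * of_nat (card (Hom Q (\<pi> p) d)))) = ?w p"
      using Q.reps_weight_sum[OF \<pi>[OF p]] by simp
  qed simp
  finally show ?thesis .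
qed

subsection \<open>Bilimits\<close>

text \<open>For a finite group acting on a vector space, \<open>E\<close> is the space of coinvariants, \<open>l\<close> the quotient
  map and \<open>m\<close> the norm map, whose composite with \<open>l\<close> is the sum over the group.\<close>

definition bilimit ::
  "('p, 'q, 'z) category_scheme \<Rightarrow> ('p, 'q, 'o, 'm) cfunctor \<Rightarrow> 'o \<Rightarrow> ('p \<Rightarrow> 'm) \<Rightarrow> ('p \<Rightarrow> 'm) \<Rightarrow> bool" where
  "bilimit P D E l m \<longleftrightarrow> E \<in> Obj C \<and>
     (\<forall>p\<in>Obj P. l p \<in> Hom C (FObj D p) E \<and> m p \<in> Hom C E (FObj D p)) \<and>
     (\<forall>p q. \<forall>k\<in>Hom P p q. l q \<bullet> FArr D k = l p \<and> FArr D k \<bullet> m p = m q) \<and>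
     (\<forall>p\<in>Obj P. \<forall>q\<in>Obj P. m q \<bullet> l p = wsum (FObj D p) (FObj D q) (Hom P p q) (\<lambda>_. 1) (FArr D)) \<and>
     integ E E P (\<lambda>c. l c \<bullet> m c) = Idn C E"

lemma bilimitD:
  assumes "bilimit P D E l m"
  shows "E \<in> Obj C" "p \<in> Obj P \<Longrightarrow> l p \<in> Hom C (FObj D p) E" "p \<in> Obj P \<Longrightarrow> m p \<in> Hom C E (FObj D p)"
    "k \<in> Hom P p q \<Longrightarrow> l q \<bullet> FArr D k = l p" "k \<in> Hom P p q \<Longrightarrow> FArr D k \<bullet> m p = m q"
    "p \<in> Obj P \<Longrightarrow> q \<in> Obj P \<Longrightarrow> m q \<bullet> l p = wsum (FObj D p) (FObj D q) (Hom P p q) (\<lambda>_. 1) (FArr D)"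
    "integ E E P (\<lambda>c. l c \<bullet> m c) = Idn C E"
  using assms unfolding bilimit_def by blast+

text \<open>Composition with the identity \<open>\<integral> l \<circ> m\<close> expands every arrow out of or into a bilimit, so that
  it is determined by its composites with the legs, or with the projections.\<close>

lemma bilimit_expand_left:
  assumes P: "ess_finite P" and B: "bilimit P D E l m" and u: "u \<in> Hom C E c"
  shows "u = integ E c P (\<lambda>p. (u \<bullet> l p) \<bullet> m p)"
proof -
  note b = bilimitD[OF B] and lm = Cmp_closed[OF b(3) b(2)]
  have "u = u \<bullet> integ E E P (\<lambda>c. l c \<bullet> m c)" using b(7) Idn_right[OF u] by simp
  also have "\<dots> = integ E c P (\<lambda>p. u \<bullet> (l p \<bullet> m p))" by (rule integ_post[OF P b(1) b(1) lm u])
  also have "\<dots> = integ E c P (\<lambda>p. (u \<bullet> l p) \<bullet> m p)"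
    using Cmp_assoc[OF b(3) b(2) u] Cmp_closed[OF lm u] by (intro integ_eqI[OF P b(1) Hom_obj(2)[OF u]]) simp_all
  finally show ?thesis .
qed

lemma bilimit_expand_right:
  assumes P: "ess_finite P" and B: "bilimit P D E l m" and u: "u \<in> Hom C c E"
  shows "u = integ c E P (\<lambda>p. l p \<bullet> (m p \<bullet> u))"
proof -
  note b = bilimitD[OF B] and lm = Cmp_closed[OF b(3) b(2)]
  have "u = integ E E P (\<lambda>c. l c \<bullet> m c) \<bullet> u" using b(7) Idn_left[OF u] by simp
  also have "\<dots> = integ c E P (\<lambda>p. (l p \<bullet> m p) \<bullet> u)" by (rule integ_pre[OF P b(1) b(1) lm u])
  also have "\<dots> = integ c E P (\<lambda>p. l p \<bullet> (m p \<bullet> u))"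
    using Cmp_assoc[OF u b(3) b(2)] Cmp_closed[OF u lm] by (intro integ_eqI[OF P Hom_obj(1)[OF u] b(1)]) simp_all
  finally show ?thesis .
qed

lemma bilimit_ext_left:
  assumes P: "ess_finite P" and B: "bilimit P D E l m" and u: "u \<in> Hom C E c" and v: "v \<in> Hom C E c"
    and eq: "\<And>p. p \<in> Obj P \<Longrightarrow> u \<bullet> l p = v \<bullet> l p"
  shows "u = v"
proof -
  note b = bilimitD[OF B] and c = Hom_obj(2)[OF u]
  show ?thesis
    using Cmp_closed[OF b(3) Cmp_closed[OF b(2) u]] eq
    by (subst bilimit_expand_left[OF P B u], subst bilimit_expand_left[OF P B v])
      (intro integ_eqI[OF P b(1) c]; simp)
qed

lemma bilimit_ext_right:
  assumes P: "ess_finite P" and B: "bilimit P D E l m" and u: "u \<in> Hom C c E" and v: "v \<in> Hom C c E"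
    and eq: "\<And>p. p \<in> Obj P \<Longrightarrow> m p \<bullet> u = m p \<bullet> v"
  shows "u = v"
proof -
  note b = bilimitD[OF B] and c = Hom_obj(1)[OF u]
  show ?thesis
    using Cmp_closed[OF Cmp_closed[OF u b(3)] b(2)] eq
    by (subst bilimit_expand_right[OF P B u], subst bilimit_expand_right[OF P B v])
      (intro integ_eqI[OF P c b(1)]; simp)
qed

text \<open>A bilimit is a colimit: a cocone \<open>t\<close> factors through \<open>\<integral> t \<circ> m\<close>, since composing with \<open>l p\<close>
  gives the integral over \<open>q\<close> of the sum of \<open>t q \<circ> D k = t p\<close> over \<open>k: p \<rightarrow> q\<close>. Dually it is a limit.\<close>

lemma bilimit_cocone:
  assumes P: "ess_finite P" and B: "bilimit P D E l m" and D: "is_functor P C D" and c: "c \<in> Obj C"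
    and t: "\<And>p. p \<in> Obj P \<Longrightarrow> t p \<in> Hom C (FObj D p) c"
    and nat: "\<And>p q k. k \<in> Hom P p q \<Longrightarrow> t q \<bullet> FArr D k = t p"
  shows "integ E c P (\<lambda>p. t p \<bullet> m p) \<in> Hom C E c"
    "p \<in> Obj P \<Longrightarrow> integ E c P (\<lambda>p. t p \<bullet> m p) \<bullet> l p = t p"
proof -
  interpret P: ess_finite P by fact
  note b = bilimitD[OF B] and Dd = is_functorD[OF D]
  have tm: "t q \<bullet> m q \<in> Hom C E c" if "q \<in> Obj P" for q using Cmp_closed[OF b(3) t] that by simp
  show "integ E c P (\<lambda>p. t p \<bullet> m p) \<in> Hom C E c" using integ_closed[OF P b(1) c] tm by simp
  assume p: "p \<in> Obj P"
  have "integ E c P (\<lambda>p. t p \<bullet> m p) \<bullet> l p = integ (FObj D p) c P (\<lambda>q. (t q \<bullet> m q) \<bullet> l p)"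
    by (rule integ_pre[OF P b(1) c tm b(2)[OF p]])
  also have "\<dots> = integ (FObj D p) c P (\<lambda>q. wsum (FObj D p) c (Hom P p q) (\<lambda>_. 1) (\<lambda>k. t q \<bullet> FArr D k))"
  proof (rule integ_eqI[OF P Dd(3)[OF p] c])
    fix q assume q: "q \<in> Obj P"
    show "(t q \<bullet> m q) \<bullet> l p \<in> Hom C (FObj D p) c" using Cmp_closed[OF b(2)[OF p] tm[OF q]] .
    have "(t q \<bullet> m q) \<bullet> l p = t q \<bullet> wsum (FObj D p) (FObj D q) (Hom P p q) (\<lambda>_. 1) (FArr D)"
      using Cmp_assoc[OF b(2)[OF p] b(3)[OF q] t[OF q]] b(6)[OF p q] by simp
    then show "(t q \<bullet> m q) \<bullet> l p = wsum (FObj D p) c (Hom P p q) (\<lambda>_. 1) (\<lambda>k. t q \<bullet> FArr D k)"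
      using wsum_post[OF Dd(3)[OF p] Dd(3)[OF q] P.finite_Hom _ t[OF q]] Dd(4) by simp
  qed
  also have "\<dots> = t p" using nat by (intro integ_homsum[OF P p t[OF p]])
  finally show "integ E c P (\<lambda>p. t p \<bullet> m p) \<bullet> l p = t p" .
qed

lemma bilimit_cone:
  assumes P: "ess_finite P" and B: "bilimit P D E l m" and D: "is_functor P C D" and c: "c \<in> Obj C"
    and t: "\<And>p. p \<in> Obj P \<Longrightarrow> t p \<in> Hom C c (FObj D p)"
    and nat: "\<And>p q k. k \<in> Hom P p q \<Longrightarrow> FArr D k \<bullet> t p = t q"
  shows "integ c E P (\<lambda>p. l p \<bullet> t p) \<in> Hom C c E"
    "p \<in> Obj P \<Longrightarrow> m p \<bullet> integ c E P (\<lambda>p. l p \<bullet> t p) = t p"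
proof -
  interpret P: ess_finite P by fact
  note b = bilimitD[OF B] and Dd = is_functorD[OF D]
  have tm: "l q \<bullet> t q \<in> Hom C c E" if "q \<in> Obj P" for q using Cmp_closed[OF t b(2)] that by simp
  show "integ c E P (\<lambda>p. l p \<bullet> t p) \<in> Hom C c E" using integ_closed[OF P c b(1)] tm by simp
  assume p: "p \<in> Obj P"
  have "m p \<bullet> integ c E P (\<lambda>p. l p \<bullet> t p) = integ c (FObj D p) P (\<lambda>q. m p \<bullet> (l q \<bullet> t q))"
    by (rule integ_post[OF P c b(1) tm b(3)[OF p]])
  also have "\<dots> = integ c (FObj D p) P (\<lambda>q. wsum c (FObj D p) (Hom P p q) (\<lambda>_. 1) (\<lambda>k. FArr D (inv_arr P k) \<bullet> t q))"
  proof (rule integ_eqI[OF P c Dd(3)[OF p]])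
    fix q assume q: "q \<in> Obj P"
    show "m p \<bullet> (l q \<bullet> t q) \<in> Hom C c (FObj D p)" using Cmp_closed[OF tm[OF q] b(3)[OF p]] .
    have bij: "bij_betw (inv_arr P) (Hom P p q) (Hom P q p)"
      using groupoid_inv(1)[OF P.groupoid] groupoid_inv_inv[OF P.groupoid]
      by (intro bij_betw_byWitness[where f' = "inv_arr P"]) auto
    have "m p \<bullet> (l q \<bullet> t q) = wsum (FObj D q) (FObj D p) (Hom P q p) (\<lambda>_. 1) (FArr D) \<bullet> t q"
      using Cmp_assoc[OF t[OF q] b(2)[OF q] b(3)[OF p]] b(6)[OF q p] by simp
    also have "\<dots> = wsum c (FObj D p) (Hom P q p) (\<lambda>_. 1) (\<lambda>k. FArr D k \<bullet> t q)"
      using wsum_pre[OF Dd(3)[OF q] Dd(3)[OF p] P.finite_Hom _ t[OF q]] Dd(4) by simp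
    also have "\<dots> = wsum c (FObj D p) (Hom P p q) (\<lambda>_. 1) (\<lambda>k. FArr D (inv_arr P k) \<bullet> t q)"
      using Cmp_closed[OF t[OF q] Dd(4)]
        wsum_reindex[OF c Dd(3)[OF p] bij, where w = "\<lambda>_. 1" and F = "\<lambda>k. FArr D k \<bullet> t q"] by simp
    finally show "m p \<bullet> (l q \<bullet> t q) = wsum c (FObj D p) (Hom P p q) (\<lambda>_. 1) (\<lambda>k. FArr D (inv_arr P k) \<bullet> t q)" .
  qed
  also have "\<dots> = t p"
    using nat[OF groupoid_inv(1)[OF P.groupoid]] by (intro integ_homsum[OF P p t[OF p]])
  finally show "m p \<bullet> integ c E P (\<lambda>p. l p \<bullet> t p) = t p" .
qed

text \<open>Of the two composites of such an arrow with the integral, one is \<open>\<integral> l \<circ> m = id\<close> and the other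
  fixes the legs, or the projections.\<close>

lemma bilimit_comparison:
  assumes P: "ess_finite P" and D: "is_functor P C D" and B: "bilimit P D E l m" and B': "bilimit P D F l' m'"
  shows "u \<in> Hom C F E \<Longrightarrow> (\<And>p. p \<in> Obj P \<Longrightarrow> u \<bullet> l' p = l p) \<Longrightarrow>
      inverse_arrows C u (integ E F P (\<lambda>p. l' p \<bullet> m p))"
    "u \<in> Hom C E F \<Longrightarrow> (\<And>p. p \<in> Obj P \<Longrightarrow> m' p \<bullet> u = m p) \<Longrightarrow>
      inverse_arrows C u (integ F E P (\<lambda>p. l p \<bullet> m' p))"
proof -
  note b = bilimitD[OF B] and b' = bilimitD[OF B']
  note lm = Cmp_closed[OF b(3) b(2)]
  show "inverse_arrows C u (integ E F P (\<lambda>p. l' p \<bullet> m p))"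
    if u: "u \<in> Hom C F E" and ul: "\<And>p. p \<in> Obj P \<Longrightarrow> u \<bullet> l' p = l p"
  proof -
    let ?v = "integ E F P (\<lambda>p. l' p \<bullet> m p)"
    have v: "?v \<in> Hom C E F" "\<And>p. p \<in> Obj P \<Longrightarrow> ?v \<bullet> l p = l' p"
      by (rule bilimit_cocone[OF P B D b'(1,2,4)]; assumption)+
    have "u \<bullet> ?v = integ E E P (\<lambda>p. u \<bullet> (l' p \<bullet> m p))" by (rule integ_post[OF P b(1) b'(1) Cmp_closed[OF b(3) b'(2)] u])
    also have "\<dots> = integ E E P (\<lambda>p. l p \<bullet> m p)"
      using Cmp_assoc[OF b(3) b'(2) u] ul Cmp_closed[OF Cmp_closed[OF b(3) b'(2)] u] by (intro integ_eqI[OF P b(1) b(1)]) simp_all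
    finally have 1: "u \<bullet> ?v = Idn C E" using b(7) by simp
    have "?v \<bullet> u = Idn C F"
      using Cmp_assoc[OF b'(2) u v(1)] ul v(2) Idn_left[OF b'(2)]
      by (intro bilimit_ext_left[OF P B' Cmp_closed[OF u v(1)] Idn_closed[OF b'(1)]]) simp
    with 1 show ?thesis by (intro inverse_arrowsI[OF u v(1)])
  qed
  show "inverse_arrows C u (integ F E P (\<lambda>p. l p \<bullet> m' p))"
    if u: "u \<in> Hom C E F" and mu: "\<And>p. p \<in> Obj P \<Longrightarrow> m' p \<bullet> u = m p"
  proof -
    let ?v = "integ F E P (\<lambda>p. l p \<bullet> m' p)"
    have v: "?v \<in> Hom C F E" "\<And>p. p \<in> Obj P \<Longrightarrow> m p \<bullet> ?v = m' p"
      by (rule bilimit_cone[OF P B D b'(1,3,5)]; assumption)+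
    have "?v \<bullet> u = integ E E P (\<lambda>p. (l p \<bullet> m' p) \<bullet> u)" by (rule integ_pre[OF P b'(1) b(1) Cmp_closed[OF b'(3) b(2)] u])
    also have "\<dots> = integ E E P (\<lambda>p. l p \<bullet> m p)"
      using Cmp_assoc[OF u b'(3) b(2)] mu Cmp_closed[OF u Cmp_closed[OF b'(3) b(2)]] by (intro integ_eqI[OF P b(1) b(1)]) simp_all
    finally have 1: "?v \<bullet> u = Idn C E" using b(7) by simp
    have "u \<bullet> ?v = Idn C F"
      using Cmp_assoc[OF v(1) u b'(3)] mu v(2) Idn_right[OF b'(3)]
      by (intro bilimit_ext_right[OF P B' Cmp_closed[OF v(1) u] Idn_closed[OF b'(1)]]) simp
    with 1 show ?thesis by (intro inverse_arrowsI[OF u v(1)])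
  qed
qed

lemma bilimit_iso:
  assumes P: "ess_finite P" and B: "bilimit P D E l m" and D: "is_functor P C D"
    and th: "\<theta> \<in> Hom C E E'" and th': "\<theta>' \<in> Hom C E' E"
    and inv: "\<theta>' \<bullet> \<theta> = Idn C E" "\<theta> \<bullet> \<theta>' = Idn C E'"
  shows "bilimit P D E' (\<lambda>p. \<theta> \<bullet> l p) (\<lambda>p. m p \<bullet> \<theta>')"
proof -
  interpret P: ess_finite P by fact
  note b = bilimitD[OF B] and Dd = is_functorD[OF D] and E' = Hom_obj(2)[OF th]
  have "integ E' E' P (\<lambda>c. (\<theta> \<bullet> l c) \<bullet> (m c \<bullet> \<theta>')) = Idn C E'"
  proof -
    have "integ E' E' P (\<lambda>c. (\<theta> \<bullet> l c) \<bullet> (m c \<bullet> \<theta>')) = integ E' E' P (\<lambda>c. \<theta> \<bullet> ((l c \<bullet> m c) \<bullet> \<theta>'))"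
    proof (rule integ_eqI[OF P E' E'])
      fix c assume c: "c \<in> Obj P"
      show "(\<theta> \<bullet> l c) \<bullet> (m c \<bullet> \<theta>') \<in> Hom C E' E'"
        using Cmp_closed[OF Cmp_closed[OF th' b(3)[OF c]] Cmp_closed[OF b(2)[OF c] th]] .
      show "(\<theta> \<bullet> l c) \<bullet> (m c \<bullet> \<theta>') = \<theta> \<bullet> ((l c \<bullet> m c) \<bullet> \<theta>')"
        using Cmp_assoc[OF Cmp_closed[OF th' b(3)[OF c]] b(2)[OF c] th]
          Cmp_assoc[OF th' b(3)[OF c] b(2)[OF c]] by simp
    qed
    also have "\<dots> = \<theta> \<bullet> (integ E E P (\<lambda>c. l c \<bullet> m c) \<bullet> \<theta>')"
      using integ_pre[OF P b(1) b(1) Cmp_closed[OF b(3) b(2)] th']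
        integ_post[OF P E' b(1) Cmp_closed[OF th' Cmp_closed[OF b(3) b(2)]] th] by simp
    finally show ?thesis using b(7) Idn_left[OF th'] inv by simp
  qed
  moreover have "(m q \<bullet> \<theta>') \<bullet> (\<theta> \<bullet> l p) = m q \<bullet> l p" if "p \<in> Obj P" "q \<in> Obj P" for p q
    using Cmp_assoc[OF Cmp_closed[OF b(2)[OF that(1)] th] th' b(3)[OF that(2)]]
      Cmp_cancel[OF inv(1) th th' b(2)[OF that(1)]] Idn_left[OF b(2)[OF that(1)]] by simp
  moreover have "(\<theta> \<bullet> l q) \<bullet> FArr D k = \<theta> \<bullet> l p" "FArr D k \<bullet> (m p \<bullet> \<theta>') = m q \<bullet> \<theta>'" if k: "k \<in> Hom P p q" for p q k
    using P.Hom_obj[OF k] b(4,5)[OF k] Cmp_assoc[OF Dd(4)[OF k] b(2) th] Cmp_assoc[OF th' b(3) Dd(4)[OF k]]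
    by simp_all
  ultimately show ?thesis
    unfolding bilimit_def
    using E' b Cmp_closed[OF b(2) th] Cmp_closed[OF th' b(3)] by auto
qed

text \<open>Averaging over \<open>Aut c\<close> is an idempotent of \<open>D c\<close>. The bilimit is the sum, over representatives
  \<open>c\<close>, of the retracts that split these idempotents.\<close>

lemma bilimit_exists:
  assumes P: "ess_finite P" and D: "is_functor P C D"
  shows "\<exists>E l m. bilimit P D E l m"
proof -
  interpret P: ess_finite P by fact
  note Dd = is_functorD[OF D]
  let ?R = "iso_reps P"
  define av where "av c = wsum (FObj D c) (FObj D c) (Hom P c c) (\<lambda>_. 1 / of_nat (card (Hom P c c))) (FArr D)" for c
  have hom: "FArr D \<in> Hom P p q \<rightarrow> Hom C (FObj D p) (FObj D q)" for p q using Dd(4) by auto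
  have av_closed: "av c \<in> Hom C (FObj D c) (FObj D c)" if "c \<in> Obj P" for c
    unfolding av_def using wsum_closed[OF Dd(3)[OF that] Dd(3)[OF that] hom] .
  have weights: "(\<Sum>_\<in>Hom P c c. 1 / rat_of_nat (card (Hom P c c))) = 1" if "c \<in> Obj P" for c
  proof -
    have "rat_of_nat (card (Hom P c c)) > 0" using P.card_Aut_pos[OF that] by (simp only: of_nat_0_less_iff)
    then show ?thesis by simp
  qed
  have av_right: "av c \<bullet> FArr D k = av c" and av_left: "FArr D k \<bullet> av c = av c" if k: "k \<in> Hom P c c" for c k
  proof -
    have c: "c \<in> Obj P" using P.Hom_obj[OF k] by simp
    note Dc = Dd(3)[OF c]
    let ?w = "\<lambda>_. 1 / rat_of_nat (card (Hom P c c))"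
    have "av c \<bullet> FArr D k = wsum (FObj D c) (FObj D c) (Hom P c c) ?w (\<lambda>u. FArr D u \<bullet> FArr D k)"
      unfolding av_def by (rule wsum_pre[OF Dc Dc P.finite_Hom hom Dd(4)[OF k]])
    also have "\<dots> = wsum (FObj D c) (FObj D c) (Hom P c c) ?w (\<lambda>u. FArr D (u \<bullet>\<^bsub>P\<^esub> k))"
      using Dd(6)[OF k] Cmp_closed[OF Dd(4)[OF k] Dd(4)] Dd(4)[OF P.Cmp_closed[OF k]]
      by (intro wsum_cong Dc) auto
    also have "\<dots> = av c"
      unfolding av_def
      using wsum_reindex[OF Dc Dc groupoid_pre_bij[OF P.groupoid k] hom, where w = ?w] by simp
    finally show "av c \<bullet> FArr D k = av c" .
    have "FArr D k \<bullet> av c = wsum (FObj D c) (FObj D c) (Hom P c c) ?w (\<lambda>u. FArr D k \<bullet> FArr D u)"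
      unfolding av_def by (rule wsum_post[OF Dc Dc P.finite_Hom hom Dd(4)[OF k]])
    also have "\<dots> = wsum (FObj D c) (FObj D c) (Hom P c c) ?w (\<lambda>u. FArr D (k \<bullet>\<^bsub>P\<^esub> u))"
      using Dd(6)[OF _ k] Cmp_closed[OF Dd(4) Dd(4)[OF k]] Dd(4)[OF P.Cmp_closed[OF _ k]]
      by (intro wsum_cong Dc) auto
    also have "\<dots> = av c"
      unfolding av_def
      using wsum_reindex[OF Dc Dc groupoid_post_bij[OF P.groupoid k] hom, where w = ?w] by simp
    finally show "FArr D k \<bullet> av c = av c" .
  qed
  have av_idem: "av c \<bullet> av c = av c" if c: "c \<in> Obj P" for c
  proof -
    note Dc = Dd(3)[OF c]
    have "av c \<bullet> av c = wsum (FObj D c) (FObj D c) (Hom P c c) (\<lambda>_. 1 / of_nat (card (Hom P c c))) (\<lambda>u. av c \<bullet> FArr D u)"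
      by (rule trans[OF arg_cong[OF av_def, of "\<lambda>x. av c \<bullet> x"] wsum_post[OF Dc Dc P.finite_Hom hom av_closed[OF c]]])
    also have "\<dots> = wsum (FObj D c) (FObj D c) (Hom P c c) (\<lambda>_. 1 / of_nat (card (Hom P c c))) (\<lambda>_. av c)"
      using av_right av_closed[OF c] by (intro wsum_cong Dc) auto
    also have "\<dots> = av c"
      using wsum_const[OF Dc Dc P.finite_Hom av_closed[OF c]] weights[OF c] scl_one[OF av_closed[OF c]] by simp
    finally show ?thesis .
  qed
  obtain h where h: "bij_betw h {0..<card ?R} ?R" using ex_bij_betw_nat_finite[OF P.reps_finite] by blast
  define J where "J = {0..<card ?R}"
  have hJ: "h i \<in> ?R" if "i \<in> J" for i using h that by (auto simp: bij_betw_def J_def)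
  have ho: "h i \<in> Obj P" if "i \<in> J" for i using P.reps_obj[OF hJ[OF that]] .
  have "\<exists>E l m. E \<in> Obj C \<and> (\<forall>i\<in>J. l i \<in> Hom C (FObj D (h i)) E \<and> m i \<in> Hom C E (FObj D (h i)) \<and>
        m i \<bullet> l i = av (h i) \<and> av (h i) \<bullet> m i = m i \<and> (\<forall>j\<in>J. j \<noteq> i \<longrightarrow> m j \<bullet> l i = zer (FObj D (h i)) (FObj D (h j)))) \<and>
        (\<forall>c u v. u \<in> Hom C c E \<longrightarrow> v \<in> Hom C c E \<longrightarrow> (\<forall>i\<in>J. m i \<bullet> u = m i \<bullet> v) \<longrightarrow> u = v)"
  proof (rule retract_sums)
    show "finite J" by (simp add: J_def)
  qed (fact Dd(3)[OF ho] av_closed[OF ho] av_idem[OF ho])+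
  then obtain E L M where E: "E \<in> Obj C" and
    LM: "\<forall>i\<in>J. L i \<in> Hom C (FObj D (h i)) E \<and> M i \<in> Hom C E (FObj D (h i)) \<and>
        M i \<bullet> L i = av (h i) \<and> av (h i) \<bullet> M i = M i \<and> (\<forall>j\<in>J. j \<noteq> i \<longrightarrow> M j \<bullet> L i = zer (FObj D (h i)) (FObj D (h j)))"
    and mono: "\<forall>c u v. u \<in> Hom C c E \<longrightarrow> v \<in> Hom C c E \<longrightarrow> (\<forall>i\<in>J. M i \<bullet> u = M i \<bullet> v) \<longrightarrow> u = v"
    by (elim exE conjE) (rule that)
  have L: "L i \<in> Hom C (FObj D (h i)) E" and M: "M i \<in> Hom C E (FObj D (h i))"
    and ret: "M i \<bullet> L i = av (h i)" and aM: "av (h i) \<bullet> M i = M i" if "i \<in> J" for i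
    using bspec[OF LM that] by blast+
  have ret0: "M j \<bullet> L i = zer (FObj D (h i)) (FObj D (h j))" if "i \<in> J" "j \<in> J" "j \<noteq> i" for i j
    using bspec[OF LM that(1)] that by blast
  have monic: "u = v" if "u \<in> Hom C c E" "v \<in> Hom C c E" "\<And>i. i \<in> J \<Longrightarrow> M i \<bullet> u = M i \<bullet> v" for c u v
    using mono that by blast
  have zer_cmp: "zer a b \<bullet> f = zer c b" and cmp_zer: "g \<bullet> zer a b = zer a d"
    if "a \<in> Obj C" "b \<in> Obj C" "f \<in> Hom C c a" "g \<in> Hom C b d" for a b c d f g
  proof -
    have z: "zer a b \<in> Hom C a b" using zer_closed that by simp
    show "zer a b \<bullet> f = zer c b"
      using Cmp_scl_left[OF that(3) z, of 0] scl_zero[OF z] scl_zero[OF Cmp_closed[OF that(3) z]] by simp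
    show "g \<bullet> zer a b = zer a d"
      using Cmp_scl_right[OF z that(4), of 0] scl_zero[OF z] scl_zero[OF Cmp_closed[OF z that(4)]] by simp
  qed
  have La: "L i \<bullet> av (h i) = L i" if i: "i \<in> J" for i
  proof (rule monic)
    note avi = av_closed[OF ho[OF i]]
    show "L i \<bullet> av (h i) \<in> Hom C (FObj D (h i)) E" by (rule Cmp_closed[OF avi L[OF i]])
    fix j assume j: "j \<in> J"
    have "M j \<bullet> (L i \<bullet> av (h i)) = (M j \<bullet> L i) \<bullet> av (h i)" using Cmp_assoc[OF avi L[OF i] M[OF j]] by simp
    also have "\<dots> = M j \<bullet> L i"
      using ret[OF i] ret0[OF i j] av_idem[OF ho[OF i]] zer_cmp[OF Dd(3)[OF ho[OF i]] Dd(3)[OF ho[OF j]] avi M[OF j, THEN Hom_obj(2), THEN Idn_closed]]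
      by (cases "j = i") auto
    finally show "M j \<bullet> (L i \<bullet> av (h i)) = M j \<bullet> L i" .
  qed (use L i in auto)
  have Linv: "L i \<bullet> FArr D k = L i" and Minv: "FArr D k \<bullet> M i = M i" if i: "i \<in> J" and k: "k \<in> Hom P (h i) (h i)" for i k
    using Cmp_assoc[OF Dd(4)[OF k] av_closed[OF ho[OF i]] L[OF i]] La[OF i] av_right[OF k]
      Cmp_assoc[OF M[OF i] av_closed[OF ho[OF i]] Dd(4)[OF k]] aM[OF i] av_left[OF k] by simp_all
  have "\<exists>i k. i \<in> J \<and> k \<in> Hom P p (h i)" if "p \<in> Obj P" for p
  proof -
    obtain c where "c \<in> ?R" "Hom P p c \<noteq> {}" using P.reps_ex[OF \<open>p \<in> Obj P\<close>] .
    moreover from this(1) obtain i where "i \<in> J" "c = h i"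
      using h unfolding bij_betw_def J_def by (metis imageE)
    ultimately show ?thesis by blast
  qed
  then obtain ix \<kappa> where ix: "\<And>p. p \<in> Obj P \<Longrightarrow> ix p \<in> J" and \<kappa>: "\<And>p. p \<in> Obj P \<Longrightarrow> \<kappa> p \<in> Hom P p (h (ix p))"
    by metis
  note i\<kappa> = groupoid_inv(1)[OF P.groupoid \<kappa>]
  have ix_eq: "i = ix p" if "p \<in> Obj P" "i \<in> J" "k \<in> Hom P p (h i)" for p i k
  proof -
    have "h i = h (ix p)"
      using P.reps_unique[OF hJ[OF that(2)] hJ[OF ix[OF that(1)]]] that(3) \<kappa>[OF that(1)] by blast
    then show ?thesis using h that(2) ix[OF that(1)] by (auto simp: bij_betw_def inj_on_def J_def)
  qed
  define n where "n c = rat_of_nat (card (Hom P c c))" for c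
  have n: "n c \<noteq> 0" if "c \<in> Obj P" for c
  proof -
    have "n c > 0" unfolding n_def using P.card_Aut_pos[OF that] by (simp only: of_nat_0_less_iff)
    then show ?thesis by simp
  qed
  define l where "l p = L (ix p) \<bullet> FArr D (\<kappa> p)" for p
  \<comment> \<open>\<open>M i \<circ> L i\<close> is the average over \<open>Aut (h i)\<close>; the factor \<open>n\<close> makes \<open>m \<circ> l\<close> the sum\<close>
  define m where "m p = scl (n (h (ix p))) (FArr D (inv_arr P (\<kappa> p)) \<bullet> M (ix p))" for p
  have l: "l p \<in> Hom C (FObj D p) E" if "p \<in> Obj P" for p
    unfolding l_def using Cmp_closed[OF Dd(4)[OF \<kappa>[OF that]] L[OF ix[OF that]]] .
  have m0: "FArr D (inv_arr P (\<kappa> p)) \<bullet> M (ix p) \<in> Hom C E (FObj D p)" if "p \<in> Obj P" for p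
    using Cmp_closed[OF M[OF ix[OF that]] Dd(4)[OF i\<kappa>[OF that]]] .
  have m: "m p \<in> Hom C E (FObj D p)" if "p \<in> Obj P" for p
    unfolding m_def using scl_closed[OF m0[OF that]] .
  have L_any: "L (ix p) \<bullet> FArr D k = l p" and M_any: "FArr D (inv_arr P k) \<bullet> M (ix p) = FArr D (inv_arr P (\<kappa> p)) \<bullet> M (ix p)"
    if p: "p \<in> Obj P" and k: "k \<in> Hom P p (h (ix p))" for p k
  proof -
    let ?g = "k \<bullet>\<^bsub>P\<^esub> inv_arr P (\<kappa> p)"
    note ik = groupoid_inv[OF P.groupoid k] and ik' = groupoid_inv[OF P.groupoid \<kappa>[OF p]]
    have g: "?g \<in> Hom P (h (ix p)) (h (ix p))" using P.Cmp_closed[OF ik'(1) k] .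
    have gk: "?g \<bullet>\<^bsub>P\<^esub> \<kappa> p = k"
      using P.Cmp_assoc[OF \<kappa>[OF p] ik'(1) k] ik'(2) P.Idn_right[OF k] by simp
    have "L (ix p) \<bullet> FArr D k = L (ix p) \<bullet> (FArr D ?g \<bullet> FArr D (\<kappa> p))"
      using Dd(6)[OF \<kappa>[OF p] g] gk by simp
    then show "L (ix p) \<bullet> FArr D k = l p"
      using Cmp_assoc[OF Dd(4)[OF \<kappa>[OF p]] Dd(4)[OF g] L[OF ix[OF p]]] Linv[OF ix[OF p] g] by (simp add: l_def)
    have "inv_arr P k \<bullet>\<^bsub>P\<^esub> ?g = inv_arr P (\<kappa> p)"
      using groupoid_cancel_left[OF P.groupoid k ik'(1)] .
    then have "FArr D (inv_arr P (\<kappa> p)) = FArr D (inv_arr P k) \<bullet> FArr D ?g"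
      using Dd(6)[OF g ik(1)] by simp
    then show "FArr D (inv_arr P k) \<bullet> M (ix p) = FArr D (inv_arr P (\<kappa> p)) \<bullet> M (ix p)"
      using Cmp_assoc[OF M[OF ix[OF p]] Dd(4)[OF g] Dd(4)[OF ik(1)]] Minv[OF ix[OF p] g] by simp
  qed
  have nat: "l q \<bullet> FArr D k = l p \<and> FArr D k \<bullet> m p = m q" if k: "k \<in> Hom P p q" for p q k
  proof -
    have p: "p \<in> Obj P" and q: "q \<in> Obj P" using P.Hom_obj[OF k] by auto
    note qk = P.Cmp_closed[OF k \<kappa>[OF q]]
    have e: "ix q = ix p" using ix_eq[OF p ix[OF q] qk] .
    have "l q \<bullet> FArr D k = L (ix q) \<bullet> FArr D (\<kappa> q \<bullet>\<^bsub>P\<^esub> k)"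
      unfolding l_def using Cmp_assoc[OF Dd(4)[OF k] Dd(4)[OF \<kappa>[OF q]] L[OF ix[OF q]]] Dd(6)[OF k \<kappa>[OF q]] by simp
    then have 1: "l q \<bullet> FArr D k = l p" using L_any[OF p] qk e by simp
    have kp: "k \<bullet>\<^bsub>P\<^esub> inv_arr P (\<kappa> p) = inv_arr P (\<kappa> p \<bullet>\<^bsub>P\<^esub> inv_arr P k)"
      using groupoid_inv_cmp[OF P.groupoid groupoid_inv(1)[OF P.groupoid k] \<kappa>[OF p]] groupoid_inv_inv[OF P.groupoid k] by simp
    have kk: "\<kappa> p \<bullet>\<^bsub>P\<^esub> inv_arr P k \<in> Hom P q (h (ix q))"
      using P.Cmp_closed[OF groupoid_inv(1)[OF P.groupoid k] \<kappa>[OF p]] e by simp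
    have "FArr D k \<bullet> (FArr D (inv_arr P (\<kappa> p)) \<bullet> M (ix p)) = FArr D (inv_arr P (\<kappa> p \<bullet>\<^bsub>P\<^esub> inv_arr P k)) \<bullet> M (ix q)"
      using Cmp_assoc[OF M[OF ix[OF p]] Dd(4)[OF i\<kappa>[OF p]] Dd(4)[OF k]] Dd(6)[OF i\<kappa>[OF p] k] e kp by simp
    also have "\<dots> = FArr D (inv_arr P (\<kappa> q)) \<bullet> M (ix q)" using M_any[OF q kk] .
    finally have "FArr D k \<bullet> m p = m q"
      unfolding m_def using Cmp_scl_right[OF m0[OF p] Dd(4)[OF k]] e by simp
    with 1 show ?thesis by simp
  qed
  have ml: "m q \<bullet> l p = wsum (FObj D p) (FObj D q) (Hom P p q) (\<lambda>_. 1) (FArr D)"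
    if p: "p \<in> Obj P" and q: "q \<in> Obj P" for p q
  proof -
    let ?i = "ix p" and ?j = "ix q"
    note Dp = Dd(3)[OF p] and Dq = Dd(3)[OF q]
    let ?u = "FArr D (inv_arr P (\<kappa> q))"
    note u = Dd(4)[OF i\<kappa>[OF q]] and lp = l[OF p] and k = Dd(4)[OF \<kappa>[OF p]]
    have "m q \<bullet> l p = scl (n (h ?j)) ((?u \<bullet> M ?j) \<bullet> l p)"
      unfolding m_def using Cmp_scl_left[OF lp m0[OF q]] .
    also have "(?u \<bullet> M ?j) \<bullet> l p = ?u \<bullet> ((M ?j \<bullet> L ?i) \<bullet> FArr D (\<kappa> p))"
      unfolding l_def
      using Cmp_assoc[OF Cmp_closed[OF k L[OF ix[OF p]]] M[OF ix[OF q]] u] Cmp_assoc[OF k L[OF ix[OF p]] M[OF ix[OF q]]] by simp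
    finally have 1: "m q \<bullet> l p = scl (n (h ?j)) (?u \<bullet> ((M ?j \<bullet> L ?i) \<bullet> FArr D (\<kappa> p)))" .
    show ?thesis
    proof (cases "?i = ?j")
      case False
      have "Hom P p q = {}"
      proof (rule ccontr)
        assume "Hom P p q \<noteq> {}"
        then obtain x where x: "x \<in> Hom P p q" by auto
        show False using ix_eq[OF p ix[OF q] P.Cmp_closed[OF x \<kappa>[OF q]]] False by simp
      qed
      then have "wsum (FObj D p) (FObj D q) (Hom P p q) (\<lambda>_. 1) (FArr D) = zer (FObj D p) (FObj D q)"
        using wsum_empty[OF Dp Dq] by simp
      moreover have "m q \<bullet> l p = zer (FObj D p) (FObj D q)"
      proof -
        have z: "zer (FObj D p) (FObj D q) \<in> Hom C (FObj D p) (FObj D q)" using zer_closed[OF Dp Dq] .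
        have "?u \<bullet> ((M ?j \<bullet> L ?i) \<bullet> FArr D (\<kappa> p)) = zer (FObj D p) (FObj D q)"
          using ret0[OF ix[OF p] ix[OF q]] False
            zer_cmp[OF Dd(3)[OF ho[OF ix[OF p]]] Dd(3)[OF ho[OF ix[OF q]]] k u]
            cmp_zer[OF Dp Dd(3)[OF ho[OF ix[OF q]]] Idn_closed[OF Dp] u] by simp
        then show ?thesis using 1 scl_zero[OF z] scl_scl[OF z, of "n (h ?j)" 0] by simp
      qed
      ultimately show ?thesis by simp
    next
      case True
      let ?c = "h ?i"
      have c: "?c \<in> Obj P" using ho[OF ix[OF p]] .
      note Dc = Dd(3)[OF c]
      have kc: "FArr D (\<kappa> p) \<in> Hom C (FObj D p) (FObj D ?c)" and uc: "?u \<in> Hom C (FObj D ?c) (FObj D q)"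
        and \<kappa>p: "\<kappa> p \<in> Hom P p ?c" and i\<kappa>q: "inv_arr P (\<kappa> q) \<in> Hom P ?c q" and \<kappa>q: "\<kappa> q \<in> Hom P q ?c"
        using k u True \<kappa>[OF p] i\<kappa>[OF q] \<kappa>[OF q] by simp_all
      let ?w = "\<lambda>_. 1 / n ?c"
      have "?u \<bullet> ((M ?j \<bullet> L ?i) \<bullet> FArr D (\<kappa> p)) = ?u \<bullet> (av ?c \<bullet> FArr D (\<kappa> p))"
        using ret[OF ix[OF p]] True by simp
      also have "\<dots> = ?u \<bullet> wsum (FObj D p) (FObj D ?c) (Hom P ?c ?c) ?w (\<lambda>a. FArr D a \<bullet> FArr D (\<kappa> p))"
        unfolding av_def n_def using wsum_pre[OF Dc Dc P.finite_Hom hom kc] by simp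
      also have "\<dots> = wsum (FObj D p) (FObj D q) (Hom P ?c ?c) ?w (\<lambda>a. ?u \<bullet> (FArr D a \<bullet> FArr D (\<kappa> p)))"
        using Cmp_closed[OF kc Dd(4)] by (intro wsum_post[OF Dp Dc P.finite_Hom _ uc]) auto
      also have "\<dots> = wsum (FObj D p) (FObj D q) (Hom P ?c ?c) ?w (\<lambda>a. FArr D (inv_arr P (\<kappa> q) \<bullet>\<^bsub>P\<^esub> (a \<bullet>\<^bsub>P\<^esub> \<kappa> p)))"
        using Cmp_closed[OF Cmp_closed[OF kc Dd(4)] uc] Dd(4)[OF P.Cmp_closed[OF P.Cmp_closed[OF \<kappa>p] i\<kappa>q]]
          Dd(6)[OF \<kappa>p] Dd(6)[OF P.Cmp_closed[OF \<kappa>p] i\<kappa>q]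
        by (intro wsum_cong[OF Dp Dq]) auto
      also have "\<dots> = wsum (FObj D p) (FObj D q) (Hom P p q) ?w (FArr D)"
        using wsum_reindex[OF Dp Dq
            bij_betw_trans[OF groupoid_pre_bij[OF P.groupoid \<kappa>p] groupoid_post_bij[OF P.groupoid i\<kappa>q]] hom, where w = ?w]
        by (simp add: comp_def)
      finally show ?thesis
        using 1 wsum_scl[OF Dp Dq P.finite_Hom hom, where q = "n ?c" and w = ?w] n[OF c] True by simp
    qed
  qed
  have "integ E E P (\<lambda>c. l c \<bullet> m c) = Idn C E"
  proof -
    let ?LM = "\<lambda>i. L i \<bullet> M i"
    have LM: "?LM i \<in> Hom C E E" if "i \<in> J" for i using Cmp_closed[OF M L] that by blast
    have "integ E E P (\<lambda>c. l c \<bullet> m c) = wsum E E J (\<lambda>i. 1 / n (h i)) (\<lambda>i. l (h i) \<bullet> m (h i))"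
      unfolding integ_def n_def J_def
      using wsum_reindex[OF E E h, of "\<lambda>c. l c \<bullet> m c" "\<lambda>c. 1 / of_nat (card (Hom P c c))"]
        Cmp_closed[OF m l] P.reps_obj by (simp add: Pi_iff)
    also have "\<dots> = wsum E E J (\<lambda>i. 1 / n (h i)) (\<lambda>i. scl (n (h i)) (?LM i))"
    proof (rule wsum_cong[OF E E])
      fix i assume i: "i \<in> J"
      note hi = ho[OF i]
      have e: "ix (h i) = i" using ix_eq[OF hi i P.Idn_closed[OF hi]] by simp
      have k: "\<kappa> (h i) \<in> Hom P (h i) (h i)" and ik: "inv_arr P (\<kappa> (h i)) \<in> Hom P (h i) (h i)"
        using \<kappa>[OF hi] i\<kappa>[OF hi] e by simp_all
      show "l (h i) \<bullet> m (h i) = scl (n (h i)) (?LM i)"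
        unfolding l_def m_def e using Linv[OF i k] Minv[OF i ik] Cmp_scl_right[OF M[OF i] L[OF i]] by simp
    qed (use Cmp_closed[OF m l] ho LM scl_closed in \<open>auto simp: Pi_iff\<close>)
    also have "\<dots> = wsum E E J (\<lambda>_. 1) ?LM"
    proof -
      have LM': "?LM \<in> J \<rightarrow> Hom C E E" using LM by auto
      show ?thesis
        using n[OF ho] by (subst wsum_scl_in[OF E E LM']) (intro wsum_cong[OF E E LM' LM'], auto)
    qed
    also have "\<dots> = Idn C E"
    proof (rule monic)
      have fin: "finite J" by (simp add: J_def)
      show "wsum E E J (\<lambda>_. 1) ?LM \<in> Hom C E E" using LM by (intro wsum_closed[OF E E]) auto
      fix j assume j: "j \<in> J"
      have "M j \<bullet> wsum E E J (\<lambda>_. 1) ?LM = wsum E (FObj D (h j)) J (\<lambda>_. 1) (\<lambda>i. M j \<bullet> (L i \<bullet> M i))"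
        using LM by (intro wsum_post[OF E E fin _ M[OF j]]) auto
      also have "\<dots> = scl 1 (M j \<bullet> (L j \<bullet> M j))"
      proof (rule wsum_single[OF E Dd(3)[OF ho[OF j]] fin _ j])
        show "(\<lambda>i. M j \<bullet> (L i \<bullet> M i)) \<in> J \<rightarrow> Hom C E (FObj D (h j))" using Cmp_closed[OF LM M[OF j]] by auto
        fix i assume i: "i \<in> J" "i \<noteq> j"
        show "M j \<bullet> (L i \<bullet> M i) = zer E (FObj D (h j))"
          using Cmp_assoc[OF M[OF i(1)] L[OF i(1)] M[OF j]] ret0[OF i(1) j] i(2)
            zer_cmp[OF Dd(3)[OF ho[OF i(1)]] Dd(3)[OF ho[OF j]] M[OF i(1)] Idn_closed[OF Dd(3)[OF ho[OF j]]]] by simp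
      qed
      also have "\<dots> = M j \<bullet> Idn C E"
        using Cmp_assoc[OF M[OF j] L[OF j] M[OF j]] ret[OF j] aM[OF j] scl_one[OF M[OF j]] Idn_right[OF M[OF j]] by simp
      finally show "M j \<bullet> wsum E E J (\<lambda>_. 1) ?LM = M j \<bullet> Idn C E" .
    qed (use Idn_closed[OF E] in simp)
    finally show ?thesis .
  qed
  then have "bilimit P D E l m"
    unfolding bilimit_def using E l m nat ml by blast
  then show ?thesis by blast
qed

end

section \<open>Homotopy fibres\<close>

lemma ess_finiteI:
  assumes P: "groupoid P" and S: "finite S" "\<And>p. p \<in> Obj P \<Longrightarrow> \<exists>s\<in>S. Hom P p s \<noteq> {}"
    and fin: "\<And>a b. a \<in> Obj P \<Longrightarrow> b \<in> Obj P \<Longrightarrow> finite (Hom P a b)"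
  shows "ess_finite P"
proof -
  interpret category P by (rule groupoid_category[OF P])
  have "Obj P // isomorphic_rel P \<subseteq> (\<lambda>s. isomorphic_rel P `` {s}) ` S"
  proof
    fix A assume "A \<in> Obj P // isomorphic_rel P"
    then obtain p where p: "p \<in> Obj P" "A = isomorphic_rel P `` {p}" by (auto elim: quotientE)
    obtain s where s: "s \<in> S" "Hom P p s \<noteq> {}" using S(2)[OF p(1)] by blast
    then have "s \<in> Obj P" using Hom_obj by blast
    then have "(p, s) \<in> isomorphic_rel P" using p s by (simp add: isomorphic_rel_groupoid[OF P])
    then show "A \<in> (\<lambda>s. isomorphic_rel P `` {s}) ` S"
      using s p equiv_class_eq[OF isomorphic_rel_equiv[OF P]] by blast
  qed
  then have "finite (Obj P // isomorphic_rel P)" using S(1) finite_surj by blast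
  then show ?thesis using P fin by unfold_locales (simp add: ess_finite_groupoid_def)
qed

text \<open>Essential finiteness passes from \<open>X\<close> and \<open>Y\<close> to the homotopy fibres of \<open>f\<close>. Transport along \<open>k\<close>
  in \<open>Y\<close> is \<open>push k\<close>, which is an isomorphism between fibres.\<close>

locale groupoid_map = X: ess_finite X + Y: ess_finite Y
  for X :: "('x, 'y) category" and Y :: "('z, 'w) category" +
  fixes f :: "('x, 'y, 'z, 'w) cfunctor"
  assumes f: "is_functor X Y f"
begin

abbreviation "hf \<equiv> hfibre X Y f"

abbreviation push :: "'w \<Rightarrow> 'x \<times> 'w \<Rightarrow> 'x \<times> 'w" where
  "push k p \<equiv> (fst p, k \<bullet>\<^bsub>Y\<^esub> snd p)"

lemmas fd = is_functorD[OF f]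

lemma hf_Obj: "p \<in> Obj (hf y) \<longleftrightarrow> fst p \<in> Obj X \<and> snd p \<in> Hom Y (FObj f (fst p)) y"
  by (auto simp: hfibre_def)

lemma hf_Hom: "\<kappa> \<in> Hom (hf y) p q \<longleftrightarrow> p \<in> Obj (hf y) \<and> q \<in> Obj (hf y) \<and> fst \<kappa> = p \<and> fst (snd \<kappa>) = q \<and>
    snd (snd \<kappa>) \<in> Hom X (fst p) (fst q) \<and> snd q \<bullet>\<^bsub>Y\<^esub> FArr f (snd (snd \<kappa>)) = snd p"
  unfolding Hom_def[of "hf y"]
  by (cases p; cases q; cases \<kappa>) (auto simp: hfibre_def)

lemma hf_sel: "Idn (hf y) p = (p, p, Idn X (fst p))"
  "fst (\<mu> \<bullet>\<^bsub>hf y\<^esub> \<kappa>) = fst \<kappa>" "fst (snd (\<mu> \<bullet>\<^bsub>hf y\<^esub> \<kappa>)) = fst (snd \<mu>)"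
  "snd (snd (\<mu> \<bullet>\<^bsub>hf y\<^esub> \<kappa>)) = snd (snd \<mu>) \<bullet>\<^bsub>X\<^esub> snd (snd \<kappa>)"
  by (simp_all add: hfibre_def split: prod.split)

lemma hf_category: "category (hf y)"
proof
  fix \<kappa> assume "\<kappa> \<in> Arr (hf y)"
  then show "Dom (hf y) \<kappa> \<in> Obj (hf y)" "Cod (hf y) \<kappa> \<in> Obj (hf y)"
    using hf_Hom[of \<kappa> y "Dom (hf y) \<kappa>" "Cod (hf y) \<kappa>"] by (simp_all add: Hom_def[of "hf y"])
next
  fix p assume "p \<in> Obj (hf y)"
  then show "Idn (hf y) p \<in> Hom (hf y) p p"
    using X.Idn_closed[of "fst p"] fd(5)[of "fst p"] Y.Idn_right[of "snd p" "FObj f (fst p)" y]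
    by (simp add: hf_Hom hf_sel) (simp add: hf_Obj)
next
  fix p q r \<kappa> \<mu> assume a: "\<kappa> \<in> Hom (hf y) p q" "\<mu> \<in> Hom (hf y) q r"
  then have k: "snd (snd \<kappa>) \<in> Hom X (fst p) (fst q)" and l: "snd (snd \<mu>) \<in> Hom X (fst q) (fst r)"
    and r: "snd r \<in> Hom Y (FObj f (fst r)) y"
    and e: "snd q \<bullet>\<^bsub>Y\<^esub> FArr f (snd (snd \<kappa>)) = snd p" "snd r \<bullet>\<^bsub>Y\<^esub> FArr f (snd (snd \<mu>)) = snd q"
    by (simp_all add: hf_Hom hf_Obj)
  show "\<mu> \<bullet>\<^bsub>hf y\<^esub> \<kappa> \<in> Hom (hf y) p r"
    using a X.Cmp_closed[OF k l] fd(6)[OF k l] Y.Cmp_assoc[OF fd(4)[OF k] fd(4)[OF l] r] e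
    by (simp add: hf_Hom hf_sel)
next
  fix p q \<kappa> assume "\<kappa> \<in> Hom (hf y) p q"
  then show "Idn (hf y) q \<bullet>\<^bsub>hf y\<^esub> \<kappa> = \<kappa>" "\<kappa> \<bullet>\<^bsub>hf y\<^esub> Idn (hf y) p = \<kappa>"
    by (auto simp: hf_Hom hf_sel prod_eq_iff X.Idn_left X.Idn_right)
next
  fix p q r s \<kappa> \<mu> \<nu>
  assume "\<kappa> \<in> Hom (hf y) p q" "\<mu> \<in> Hom (hf y) q r" "\<nu> \<in> Hom (hf y) r s"
  then show "(\<nu> \<bullet>\<^bsub>hf y\<^esub> \<mu>) \<bullet>\<^bsub>hf y\<^esub> \<kappa> = \<nu> \<bullet>\<^bsub>hf y\<^esub> \<mu> \<bullet>\<^bsub>hf y\<^esub> \<kappa>"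
    by (auto simp: hf_Hom hf_sel prod_eq_iff intro: X.Cmp_assoc)
qed

lemma hf_groupoid: "groupoid (hf y)"
  unfolding groupoid_def
proof (intro conjI ballI hf_category)
  interpret P: category "hf y" by (rule hf_category)
  fix \<kappa> assume "\<kappa> \<in> Arr (hf y)"
  define p q k where "p = fst \<kappa>" and "q = fst (snd \<kappa>)" and "k = snd (snd \<kappa>)"
  have \<kappa>: "\<kappa> \<in> Hom (hf y) p q"
    using \<open>\<kappa> \<in> Arr (hf y)\<close> by (auto simp: Hom_def hfibre_def p_def q_def split: prod.split)
  then have k: "k \<in> Hom X (fst p) (fst q)" and e: "snd q \<bullet>\<^bsub>Y\<^esub> FArr f k = snd p"
    and po: "p \<in> Obj (hf y)" and qo: "q \<in> Obj (hf y)"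
    by (simp_all add: hf_Hom k_def)
  have q: "snd q \<in> Hom Y (FObj f (fst q)) y" using qo by (simp add: hf_Obj)
  note ik = groupoid_inv[OF X.groupoid k]
  have "snd p \<bullet>\<^bsub>Y\<^esub> FArr f (inv_arr X k) = snd q"
    using Y.Cmp_assoc[OF fd(4)[OF ik(1)] fd(4)[OF k] q] fd(6)[OF ik(1) k] ik(3) e
      fd(5)[of "fst q"] X.Hom_obj[OF k] Y.Idn_right[OF q] by simp
  then have \<mu>: "(q, p, inv_arr X k) \<in> Hom (hf y) q p"
    using ik po qo by (simp add: hf_Hom)
  have "inverse_arrows (hf y) \<kappa> (q, p, inv_arr X k)"
    using ik \<kappa> by (intro P.inverse_arrowsI[OF \<kappa> \<mu>]) (simp_all add: prod_eq_iff hf_sel hf_Hom flip: k_def)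
  then show "is_iso_arr (hf y) \<kappa>" unfolding is_iso_arr_def by (rule exI)
qed

lemma hf_ess_finite: "ess_finite (hf y)"
proof (rule ess_finiteI[OF hf_groupoid])
  let ?S = "\<Union>c\<in>iso_reps X. {c} \<times> Hom Y (FObj f c) y"
  show "finite ?S" using X.reps_finite Y.finite_Hom by blast
  fix p assume p: "p \<in> Obj (hf y)"
  then have "fst p \<in> Obj X" by (simp add: hf_Obj)
  then obtain c where c: "c \<in> iso_reps X" and "Hom X (fst p) c \<noteq> {}" by (rule X.reps_ex)
  then obtain k where k: "k \<in> Hom X (fst p) c" by blast
  have h: "snd p \<in> Hom Y (FObj f (fst p)) y" using p by (simp add: hf_Obj)
  note ik = groupoid_inv[OF X.groupoid k]
  let ?s = "(c, snd p \<bullet>\<^bsub>Y\<^esub> FArr f (inv_arr X k))"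
  have s: "snd ?s \<in> Hom Y (FObj f c) y" using Y.Cmp_closed[OF fd(4)[OF ik(1)] h] by simp
  have "snd ?s \<bullet>\<^bsub>Y\<^esub> FArr f k = snd p"
    using Y.Cmp_assoc[OF fd(4)[OF k] fd(4)[OF ik(1)] h] fd(6)[OF k ik(1)] ik(2)
      fd(5)[of "fst p"] X.Hom_obj[OF k] Y.Idn_right[OF h] by simp
  then have "(p, ?s, k) \<in> Hom (hf y) p ?s"
    using p s k X.reps_obj[OF c] by (simp add: hf_Hom) (simp add: hf_Obj)
  then show "\<exists>s\<in>?S. Hom (hf y) p s \<noteq> {}" using c s by (intro bexI[of _ ?s]) auto
next
  fix p q
  have "Hom (hf y) p q \<subseteq> (\<lambda>k. (p, q, k)) ` Hom X (fst p) (fst q)"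
    by (auto simp: hf_Hom image_iff prod_eq_iff)
  then show "finite (Hom (hf y) p q)" using X.finite_Hom finite_surj by blast
qed

lemma hf_proj: "is_functor (hf y) X hfibre_proj"
  unfolding is_functor_def
proof (intro conjI ballI allI)
  fix \<kappa> assume "\<kappa> \<in> Arr (hf y)"
  then have "\<kappa> \<in> Hom (hf y) (Dom (hf y) \<kappa>) (Cod (hf y) \<kappa>)" by (simp add: Hom_def)
  then show "FArr hfibre_proj \<kappa> \<in> Hom X (FObj hfibre_proj (Dom (hf y) \<kappa>)) (FObj hfibre_proj (Cod (hf y) \<kappa>))"
    by (simp add: hf_Hom hfibre_proj_def case_prod_beta)
qed (simp_all add: hf_category X.category_axioms hf_sel hfibre_proj_def hf_Obj case_prod_beta)

lemma push_closed: "k \<in> Hom Y y y' \<Longrightarrow> p \<in> Obj (hf y) \<Longrightarrow> push k p \<in> Obj (hf y')"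
  using Y.Cmp_closed by (auto simp: hf_Obj)

lemma push_Hom_bij:
  assumes k: "k \<in> Hom Y y y'" and p: "p \<in> Obj (hf y)" and q: "q \<in> Obj (hf y)"
  shows "bij_betw (\<lambda>\<kappa>. (push k p, push k q, snd (snd \<kappa>))) (Hom (hf y) p q) (Hom (hf y') (push k p) (push k q))"
proof (rule bij_betw_byWitness[where f' = "\<lambda>\<kappa>. (p, q, snd (snd \<kappa>))"])
  have h: "snd p \<in> Hom Y (FObj f (fst p)) y" "snd q \<in> Hom Y (FObj f (fst q)) y"
    using p q by (simp_all add: hf_Obj)
  have *: "(k \<bullet>\<^bsub>Y\<^esub> snd q) \<bullet>\<^bsub>Y\<^esub> FArr f u = k \<bullet>\<^bsub>Y\<^esub> snd p \<longleftrightarrow> snd q \<bullet>\<^bsub>Y\<^esub> FArr f u = snd p"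
    if u: "u \<in> Hom X (fst p) (fst q)" for u
    using Y.Cmp_assoc[OF fd(4)[OF u] h(2) k] groupoid_cancel_left[OF Y.groupoid k h(1)]
      groupoid_cancel_left[OF Y.groupoid k Y.Cmp_closed[OF fd(4)[OF u] h(2)]] by metis
  show "(\<lambda>\<kappa>. (push k p, push k q, snd (snd \<kappa>))) ` Hom (hf y) p q \<subseteq> Hom (hf y') (push k p) (push k q)"
    using push_closed[OF k] * by (auto simp: hf_Hom)
  show "(\<lambda>\<kappa>. (p, q, snd (snd \<kappa>))) ` Hom (hf y') (push k p) (push k q) \<subseteq> Hom (hf y) p q"
    using p q * by (auto simp: hf_Hom)
qed (auto simp: hf_Hom prod_eq_iff)

lemma base_point: "x \<in> Obj X \<Longrightarrow> (x, Idn Y (FObj f x)) \<in> Obj (hf (FObj f x))"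
  using fd(3) Y.Idn_closed by (simp add: hf_Obj)

lemma push_base: "p \<in> Obj (hf y) \<Longrightarrow> push (snd p) (fst p, Idn Y (FObj f (fst p))) = p"
  using Y.Idn_right by (auto simp: hf_Obj prod_eq_iff)

lemma push_inv: "p \<in> Obj (hf y) \<Longrightarrow> push (inv_arr Y (snd p)) p = (fst p, Idn Y (FObj f (fst p)))"
  using groupoid_inv(2)[OF Y.groupoid] by (auto simp: hf_Obj)

end

section \<open>Two-sided Kan extensions\<close>

locale kan_setting = rational_monoidal_category C add zer scl + groupoid_map X Y f
  for C :: "('o, 'm, 'r) smcat_scheme" (structure) and add zer scl
    and X :: "('x, 'y) category" and Y :: "('z, 'w) category" and f
begin

abbreviation "CX \<equiv> functor_cat X C"
abbreviation "CY \<equiv> functor_cat Y C"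

sublocale CX: category CX
  using category_functor_cat X.category_axioms category_axioms by blast

sublocale CY: category CY
  using category_functor_cat Y.category_axioms category_axioms by blast

abbreviation fib :: "('x, 'y, 'o, 'm) cfunctor \<Rightarrow> 'z \<Rightarrow> ('x \<times> 'w, ('x \<times> 'w) \<times> ('x \<times> 'w) \<times> 'y, 'o, 'm) cfunctor" where
  "fib V y \<equiv> pull_functor (hf y) hfibre_proj V"

lemma fib_functor: "V \<in> functors X C \<Longrightarrow> is_functor (hf y) C (fib V y)"
  by (rule functorsD[OF pull_functor_closed[OF hf_proj]])

lemma fib_Obj: "p \<in> Obj (hf y) \<Longrightarrow> FObj (fib V y) p = FObj V (fst p)"
  by (simp add: functor_simps hfibre_proj_def)

lemma fib_Arr: "\<kappa> \<in> Hom (hf y) p q \<Longrightarrow> FArr (fib V y) \<kappa> = FArr V (snd (snd \<kappa>))"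
  by (simp add: functor_simps HomD(1) hfibre_proj_def split: prod.split)

text \<open>\<open>F\<close> is at each \<open>y\<close> the bilimit of \<open>V\<close> over the homotopy fibre, hence both a left and a right
  Kan extension of \<open>V\<close>. The object \<open>y\<close> is the codomain of \<open>snd p\<close>, so the legs are one family.\<close>

definition kan_cone ::
  "('x, 'y, 'o, 'm) cfunctor \<Rightarrow> ('z, 'w, 'o, 'm) cfunctor \<Rightarrow> ('x \<times> 'w \<Rightarrow> 'm) \<Rightarrow> ('x \<times> 'w \<Rightarrow> 'm) \<Rightarrow> bool" where
  "kan_cone V F l m \<longleftrightarrow> V \<in> functors X C \<and> F \<in> functors Y C \<and>
     (\<forall>y\<in>Obj Y. bilimit (hf y) (fib V y) (FObj F y) l m) \<and>
     (\<forall>y y'. \<forall>k\<in>Hom Y y y'. \<forall>p\<in>Obj (hf y).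
        FArr F k \<bullet> l p = l (push k p) \<and> m (push k p) \<bullet> FArr F k = m p)"

lemma kan_coneD:
  assumes K: "kan_cone V F l m"
  shows "V \<in> functors X C" "F \<in> functors Y C" "y \<in> Obj Y \<Longrightarrow> bilimit (hf y) (fib V y) (FObj F y) l m"
    "k \<in> Hom Y y y' \<Longrightarrow> p \<in> Obj (hf y) \<Longrightarrow> FArr F k \<bullet> l p = l (push k p)"
    "k \<in> Hom Y y y' \<Longrightarrow> p \<in> Obj (hf y) \<Longrightarrow> m (push k p) \<bullet> FArr F k = m p"
    "y \<in> Obj Y \<Longrightarrow> p \<in> Obj (hf y) \<Longrightarrow> l p \<in> Hom C (FObj V (fst p)) (FObj F y)"
    "y \<in> Obj Y \<Longrightarrow> p \<in> Obj (hf y) \<Longrightarrow> m p \<in> Hom C (FObj F y) (FObj V (fst p))"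
    "y \<in> Obj Y \<Longrightarrow> p \<in> Obj (hf y) \<Longrightarrow> q \<in> Obj (hf y) \<Longrightarrow> m q \<bullet> l p
       = wsum (FObj V (fst p)) (FObj V (fst q)) (Hom (hf y) p q) (\<lambda>_. 1) (\<lambda>\<kappa>. FArr V (snd (snd \<kappa>)))"
    "y \<in> Obj Y \<Longrightarrow> \<kappa> \<in> Hom (hf y) p q \<Longrightarrow> l q \<bullet> FArr V (snd (snd \<kappa>)) = l p"
    "y \<in> Obj Y \<Longrightarrow> \<kappa> \<in> Hom (hf y) p q \<Longrightarrow> FArr V (snd (snd \<kappa>)) \<bullet> m p = m q"
proof -
  show V: "V \<in> functors X C" and "F \<in> functors Y C"
    and B: "y \<in> Obj Y \<Longrightarrow> bilimit (hf y) (fib V y) (FObj F y) l m" for y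
    using K by (simp_all add: kan_cone_def)
  show "k \<in> Hom Y y y' \<Longrightarrow> p \<in> Obj (hf y) \<Longrightarrow> FArr F k \<bullet> l p = l (push k p)"
    "k \<in> Hom Y y y' \<Longrightarrow> p \<in> Obj (hf y) \<Longrightarrow> m (push k p) \<bullet> FArr F k = m p"
    using K unfolding kan_cone_def by blast+
  show "y \<in> Obj Y \<Longrightarrow> p \<in> Obj (hf y) \<Longrightarrow> l p \<in> Hom C (FObj V (fst p)) (FObj F y)"
    "y \<in> Obj Y \<Longrightarrow> p \<in> Obj (hf y) \<Longrightarrow> m p \<in> Hom C (FObj F y) (FObj V (fst p))"
    using bilimitD(2,3)[OF B] by (simp_all add: fib_Obj)
  show "y \<in> Obj Y \<Longrightarrow> \<kappa> \<in> Hom (hf y) p q \<Longrightarrow> l q \<bullet> FArr V (snd (snd \<kappa>)) = l p"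
    "y \<in> Obj Y \<Longrightarrow> \<kappa> \<in> Hom (hf y) p q \<Longrightarrow> FArr V (snd (snd \<kappa>)) \<bullet> m p = m q"
    using bilimitD(4,5)[OF B] by (simp_all add: fib_Arr)
  assume y: "y \<in> Obj Y" and p: "p \<in> Obj (hf y)" and q: "q \<in> Obj (hf y)"
  note Vd = is_functorD[OF functorsD[OF V]]
  have "FArr V (snd (snd \<kappa>)) \<in> Hom C (FObj V (fst p)) (FObj V (fst q))" if "\<kappa> \<in> Hom (hf y) p q" for \<kappa>
    using that Vd(4) by (simp add: hf_Hom)
  then show "m q \<bullet> l p = wsum (FObj V (fst p)) (FObj V (fst q)) (Hom (hf y) p q) (\<lambda>_. 1) (\<lambda>\<kappa>. FArr V (snd (snd \<kappa>)))"
    using bilimitD(6)[OF B[OF y] p q] Vd(3) p q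
    by (simp add: fib_Obj) (intro wsum_cong; simp add: hf_Obj fib_Arr)
qed

lemma bilimit_cong:
  assumes P: "ess_finite P" and B: "bilimit P D E l m"
    and eq: "\<And>p. p \<in> Obj P \<Longrightarrow> l' p = l p" "\<And>p. p \<in> Obj P \<Longrightarrow> m' p = m p"
  shows "bilimit P D E l' m'"
proof -
  interpret P: ess_finite P by fact
  note b = bilimitD[OF B]
  have "integ E E P (\<lambda>c. l' c \<bullet> m' c) = integ E E P (\<lambda>c. l c \<bullet> m c)"
    using eq Cmp_closed[OF b(3) b(2)] by (intro integ_eqI[OF P b(1) b(1)]) auto
  then show ?thesis unfolding bilimit_def using b eq P.Hom_obj by auto
qed

lemma kan_cone_ext_left:
  assumes K: "kan_cone V F l m" and a: "\<alpha> \<in> Hom CY F G" and b: "\<beta> \<in> Hom CY F G"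
    and eq: "\<And>y p. y \<in> Obj Y \<Longrightarrow> p \<in> Obj (hf y) \<Longrightarrow> \<alpha> at y \<bullet> l p = \<beta> at y \<bullet> l p"
  shows "\<alpha> = \<beta>"
  using bilimit_ext_left[OF hf_ess_finite kan_coneD(3)[OF K]] functor_cat_HomD(4)[OF a]
    functor_cat_HomD(4)[OF b] eq by (intro functor_cat_ext[OF a b]) blast

lemma kan_cone_ext_right:
  assumes K: "kan_cone V F l m" and a: "\<alpha> \<in> Hom CY G F" and b: "\<beta> \<in> Hom CY G F"
    and eq: "\<And>y p. y \<in> Obj Y \<Longrightarrow> p \<in> Obj (hf y) \<Longrightarrow> m p \<bullet> \<alpha> at y = m p \<bullet> \<beta> at y"
  shows "\<alpha> = \<beta>"
  using bilimit_ext_right[OF hf_ess_finite kan_coneD(3)[OF K]] functor_cat_HomD(4)[OF a]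
    functor_cat_HomD(4)[OF b] eq by (intro functor_cat_ext[OF a b]) blast

text \<open>The pointwise universal properties assemble to natural transformations, as naturality in \<open>y\<close>
  can be tested on the legs, or on the projections.\<close>

lemma kan_cone_out:
  assumes K: "kan_cone V F l m" and G: "G \<in> functors Y C"
    and s: "\<And>y p. y \<in> Obj Y \<Longrightarrow> p \<in> Obj (hf y) \<Longrightarrow> s p \<in> Hom C (FObj V (fst p)) (FObj G y)"
    and cocone: "\<And>y p q \<kappa>. y \<in> Obj Y \<Longrightarrow> \<kappa> \<in> Hom (hf y) p q \<Longrightarrow> s q \<bullet> FArr V (snd (snd \<kappa>)) = s p"
    and nat: "\<And>y y' k p. k \<in> Hom Y y y' \<Longrightarrow> p \<in> Obj (hf y) \<Longrightarrow> FArr G k \<bullet> s p = s (push k p)"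
  shows "\<exists>\<alpha>\<in>Hom CY F G. \<forall>y\<in>Obj Y. \<forall>p\<in>Obj (hf y). \<alpha> at y \<bullet> l p = s p"
proof -
  note k = kan_coneD[OF K]
  note Fd = is_functorD[OF functorsD[OF k(2)]] and Gd = is_functorD[OF functorsD[OF G]]
  define u where "u y = integ (FObj F y) (FObj G y) (hf y) (\<lambda>p. s p \<bullet> m p)" for y
  have u: "u y \<in> Hom C (FObj F y) (FObj G y)" and ul: "p \<in> Obj (hf y) \<Longrightarrow> u y \<bullet> l p = s p"
    if y: "y \<in> Obj Y" for y p
    unfolding u_def
    using s[OF y] cocone[OF y] fib_Arr
    by (intro bilimit_cocone[OF hf_ess_finite k(3)[OF y] fib_functor[OF k(1)] Gd(3)[OF y]]; simp add: fib_Obj)+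
  have "(F, G, restrict u (Obj Y)) \<in> Hom CY F G"
  proof (rule functor_cat_HomI[OF k(2) G u])
    fix j y y' assume j: "j \<in> Hom Y y y'"
    note y = Y.Hom_obj[OF j]
    show "u y' \<bullet> FArr F j = FArr G j \<bullet> u y"
    proof (rule bilimit_ext_left[OF hf_ess_finite k(3)[OF y(1)]])
      fix p assume p: "p \<in> Obj (hf y)"
      have "(u y' \<bullet> FArr F j) \<bullet> l p = s (push j p)"
        using Cmp_assoc[OF k(6)[OF y(1) p] Fd(4)[OF j] u[OF y(2)]] k(4)[OF j p] ul[OF y(2) push_closed[OF j p]] by simp
      then show "(u y' \<bullet> FArr F j) \<bullet> l p = (FArr G j \<bullet> u y) \<bullet> l p"
        using Cmp_assoc[OF k(6)[OF y(1) p] u[OF y(1)] Gd(4)[OF j]] ul[OF y(1) p] nat[OF j p] by simp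
    qed (use Cmp_closed[OF Fd(4)[OF j] u[OF y(2)]] Cmp_closed[OF u[OF y(1)] Gd(4)[OF j]] in simp_all)
  qed
  then show ?thesis using ul by (intro bexI[of _ "(F, G, restrict u (Obj Y))"]) auto
qed

lemma kan_cone_in:
  assumes K: "kan_cone V F l m" and G: "G \<in> functors Y C"
    and s: "\<And>y p. y \<in> Obj Y \<Longrightarrow> p \<in> Obj (hf y) \<Longrightarrow> s p \<in> Hom C (FObj G y) (FObj V (fst p))"
    and cone: "\<And>y p q \<kappa>. y \<in> Obj Y \<Longrightarrow> \<kappa> \<in> Hom (hf y) p q \<Longrightarrow> FArr V (snd (snd \<kappa>)) \<bullet> s p = s q"
    and nat: "\<And>y y' k p. k \<in> Hom Y y y' \<Longrightarrow> p \<in> Obj (hf y) \<Longrightarrow> s (push k p) \<bullet> FArr G k = s p"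
  shows "\<exists>\<alpha>\<in>Hom CY G F. \<forall>y\<in>Obj Y. \<forall>p\<in>Obj (hf y). m p \<bullet> \<alpha> at y = s p"
proof -
  note k = kan_coneD[OF K]
  note Fd = is_functorD[OF functorsD[OF k(2)]] and Gd = is_functorD[OF functorsD[OF G]]
  define u where "u y = integ (FObj G y) (FObj F y) (hf y) (\<lambda>p. l p \<bullet> s p)" for y
  have u: "u y \<in> Hom C (FObj G y) (FObj F y)" and ul: "p \<in> Obj (hf y) \<Longrightarrow> m p \<bullet> u y = s p"
    if y: "y \<in> Obj Y" for y p
    unfolding u_def
    using s[OF y] cone[OF y] fib_Arr
    by (intro bilimit_cone[OF hf_ess_finite k(3)[OF y] fib_functor[OF k(1)] Gd(3)[OF y]]; simp add: fib_Obj)+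
  have "(G, F, restrict u (Obj Y)) \<in> Hom CY G F"
  proof (rule functor_cat_HomI[OF G k(2) u])
    fix j y y' assume j: "j \<in> Hom Y y y'"
    note y = Y.Hom_obj[OF j]
    note ij = groupoid_inv[OF Y.groupoid j]
    show "u y' \<bullet> FArr G j = FArr F j \<bullet> u y"
    proof (rule bilimit_ext_right[OF hf_ess_finite k(3)[OF y(2)]])
      fix q assume q: "q \<in> Obj (hf y')"
      let ?p = "push (inv_arr Y j) q"
      have p: "?p \<in> Obj (hf y)" using push_closed[OF ij(1) q] .
      have qp: "push j ?p = q"
        using groupoid_cancel_left'[OF Y.groupoid j, of "snd q"] q by (auto simp: hf_Obj prod_eq_iff)
      have "m q \<bullet> (u y' \<bullet> FArr G j) = s ?p"
        using Cmp_assoc[OF Gd(4)[OF j] u[OF y(2)] k(7)[OF y(2) q]] ul[OF y(2) q] nat[OF j p] qp by simp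
      moreover have "m q \<bullet> (FArr F j \<bullet> u y) = s ?p"
        using Cmp_assoc[OF u[OF y(1)] Fd(4)[OF j] k(7)[OF y(2) q]] k(5)[OF j p] qp ul[OF y(1) p] by simp
      ultimately show "m q \<bullet> (u y' \<bullet> FArr G j) = m q \<bullet> (FArr F j \<bullet> u y)" by simp
    qed (use Cmp_closed[OF Gd(4)[OF j] u[OF y(2)]] Cmp_closed[OF u[OF y(1)] Fd(4)[OF j]] in simp_all)
  qed
  then show ?thesis using ul by (intro bexI[of _ "(G, F, restrict u (Obj Y))"]) auto
qed

text \<open>The colimit property determines the action of \<open>F\<close> on arrows from the legs alone. It is
  compatible with the projections as well, because \<open>m q \<circ> l p\<close> only depends on the arrows
  from \<open>p\<close> to \<open>q\<close>, which \<open>push k\<close> preserves.\<close>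

lemma kan_cone_exists:
  assumes V: "V \<in> functors X C"
  shows "\<exists>F l m. kan_cone V F l m"
proof -
  note Vd = is_functorD[OF functorsD[OF V]]
  have "\<forall>y. \<exists>E l m. bilimit (hf y) (fib V y) E l m"
    using bilimit_exists[OF hf_ess_finite fib_functor[OF V]] by blast
  then obtain E l' m' where B': "bilimit (hf y) (fib V y) (E y) (l' y) (m' y)" for y by metis
  define l where "l p = l' (Cod Y (snd p)) p" for p
  define m where "m p = m' (Cod Y (snd p)) p" for p
  have cod: "Cod Y (snd p) = y" if "p \<in> Obj (hf y)" for p y using that by (simp add: hf_Obj Hom_def)
  have B: "bilimit (hf y) (fib V y) (E y) l m" for y
    by (rule bilimit_cong[OF hf_ess_finite B']) (simp_all add: l_def m_def cod)
  note b = bilimitD[OF B]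
  have l: "l p \<in> Hom C (FObj V (fst p)) (E y)" and m: "m p \<in> Hom C (E y) (FObj V (fst p))"
    if "p \<in> Obj (hf y)" for p y
    using b(2,3)[OF that] that by (simp_all add: fib_Obj)
  have ml: "m q \<bullet> l p = wsum (FObj V (fst p)) (FObj V (fst q)) (Hom (hf y) p q) (\<lambda>_. 1) (FArr (fib V y))"
    if "p \<in> Obj (hf y)" "q \<in> Obj (hf y)" for p q y
    using b(6)[OF that] that by (simp add: fib_Obj)
  define F1 where "F1 k = integ (E (Dom Y k)) (E (Cod Y k)) (hf (Dom Y k)) (\<lambda>p. l (push k p) \<bullet> m p)" for k
  have F1: "F1 k \<in> Hom C (E y) (E y')" and Fl: "p \<in> Obj (hf y) \<Longrightarrow> F1 k \<bullet> l p = l (push k p)"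
    if k: "k \<in> Hom Y y y'" for k y y' p
  proof -
    have *: "l (push k q) \<bullet> FArr (fib V y) \<kappa> = l (push k p)" if \<kappa>: "\<kappa> \<in> Hom (hf y) p q" for p q \<kappa>
    proof -
      interpret P: category "hf y" by (rule hf_category)
      note pq = P.Hom_obj[OF \<kappa>]
      have "(push k p, push k q, snd (snd \<kappa>)) \<in> Hom (hf y') (push k p) (push k q)"
        using push_Hom_bij[OF k pq] \<kappa> by (auto simp: bij_betw_def)
      from b(4)[OF this] fib_Arr[OF this] show ?thesis using fib_Arr[OF \<kappa>] by simp
    qed
    have e: "F1 k = integ (E y) (E y') (hf y) (\<lambda>p. l (push k p) \<bullet> m p)"
      using k by (simp add: F1_def Hom_def)
    show "F1 k \<in> Hom C (E y) (E y')" "p \<in> Obj (hf y) \<Longrightarrow> F1 k \<bullet> l p = l (push k p)"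
      unfolding e using l[OF push_closed[OF k]] *
      by (intro bilimit_cocone[OF hf_ess_finite B fib_functor[OF V] b(1)]; simp add: fib_Obj)+
  qed
  let ?F = "ext_functor Y E F1"
  have F: "?F \<in> functors Y C"
  proof (rule ext_functor_in_functors[OF Y.category_axioms category_axioms])
    fix y assume y: "y \<in> Obj Y"
    note i = Y.Idn_closed[OF y]
    show "F1 (Idn Y y) = Idn C (E y)"
    proof (rule bilimit_ext_left[OF hf_ess_finite B F1[OF i] Idn_closed[OF b(1)]])
      fix p assume p: "p \<in> Obj (hf y)"
      then have "push (Idn Y y) p = p" using Y.Idn_left by (auto simp: hf_Obj prod_eq_iff)
      then show "F1 (Idn Y y) \<bullet> l p = Idn C (E y) \<bullet> l p" using Fl[OF i p] Idn_left[OF l[OF p]] by simp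
    qed
  next
    fix j k y y' z assume j: "j \<in> Hom Y y y'" and k: "k \<in> Hom Y y' z"
    note kj = Y.Cmp_closed[OF j k]
    show "F1 (k \<bullet>\<^bsub>Y\<^esub> j) = F1 k \<bullet> F1 j"
    proof (rule bilimit_ext_left[OF hf_ess_finite B F1[OF kj] Cmp_closed[OF F1[OF j] F1[OF k]]])
      fix p assume p: "p \<in> Obj (hf y)"
      have "push (k \<bullet>\<^bsub>Y\<^esub> j) p = push k (push j p)"
        using p Y.Cmp_assoc[of "snd p" "FObj f (fst p)" y j y' k z] j k by (simp add: hf_Obj)
      then show "F1 (k \<bullet>\<^bsub>Y\<^esub> j) \<bullet> l p = (F1 k \<bullet> F1 j) \<bullet> l p"
        using Fl[OF kj p] Cmp_assoc[OF l[OF p] F1[OF j] F1[OF k]] Fl[OF j p] Fl[OF k push_closed[OF j p]] by simp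
    qed
  qed (use b(1) F1 in auto)
  have FO: "FObj ?F y = E y" if "y \<in> Obj Y" for y using that by (simp add: ext_functor_def)
  have FA: "FArr ?F k = F1 k" if "k \<in> Hom Y y y'" for k y y' using HomD(1)[OF that] by (simp add: ext_functor_def)
  have mF: "m (push k q) \<bullet> F1 k = m q" if k: "k \<in> Hom Y y y'" and q: "q \<in> Obj (hf y)" for k y y' q
  proof (rule bilimit_ext_left[OF hf_ess_finite B])
    note q' = push_closed[OF k q]
    show "m (push k q) \<bullet> F1 k \<in> Hom C (E y) (FObj V (fst q))" "m q \<in> Hom C (E y) (FObj V (fst q))"
      using Cmp_closed[OF F1[OF k] m[OF q']] m[OF q] by simp_all
    fix p assume p: "p \<in> Obj (hf y)"
    note p' = push_closed[OF k p]
    have Vo: "FObj V (fst p) \<in> Obj C" "FObj V (fst q) \<in> Obj C" using Vd(3) p q by (simp_all add: hf_Obj)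
    have hom: "FArr V (snd (snd \<kappa>)) \<in> Hom C (FObj V (fst p)) (FObj V (fst q))" if "\<kappa> \<in> Hom (hf y) p q" for \<kappa>
      using that Vd(4) by (simp add: hf_Hom)
    have hom': "FArr V (snd (snd \<kappa>)) \<in> Hom C (FObj V (fst p)) (FObj V (fst q))" if "\<kappa> \<in> Hom (hf y') (push k p) (push k q)" for \<kappa>
      using that Vd(4) by (simp add: hf_Hom)
    have "(m (push k q) \<bullet> F1 k) \<bullet> l p = m (push k q) \<bullet> l (push k p)"
      using Cmp_assoc[OF l[OF p] F1[OF k] m[OF q']] Fl[OF k p] by simp
    also have "\<dots> = wsum (FObj V (fst p)) (FObj V (fst q)) (Hom (hf y') (push k p) (push k q)) (\<lambda>_. 1) (\<lambda>\<kappa>. FArr V (snd (snd \<kappa>)))"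
      using ml[OF p' q'] hom' Vo by (simp) (intro wsum_cong; simp add: fib_Arr)
    also have "\<dots> = wsum (FObj V (fst p)) (FObj V (fst q)) (Hom (hf y) p q) (\<lambda>_. 1) (\<lambda>\<kappa>. FArr V (snd (snd \<kappa>)))"
      using wsum_reindex[OF Vo push_Hom_bij[OF k p q], of "\<lambda>\<kappa>. FArr V (snd (snd \<kappa>))" "\<lambda>_. 1"] hom' by auto
    also have "\<dots> = m q \<bullet> l p"
      using ml[OF p q] hom Vo by (simp) (intro wsum_cong; simp add: fib_Arr)
    finally show "(m (push k q) \<bullet> F1 k) \<bullet> l p = m q \<bullet> l p" .
  qed
  have "kan_cone V ?F l m"
    unfolding kan_cone_def using V F B FO FA Fl mF by auto
  then show ?thesis by blast
qed

end

section \<open>Adjoints of restriction\<close>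

lemma adjunctionD:
  assumes "adjunction C D L R \<eta> \<epsilon>"
  shows "is_functor C D L" "is_functor D C R"
    "a \<in> Obj C \<Longrightarrow> \<eta> a \<in> Hom C a (FObj R (FObj L a))"
    "b \<in> Obj D \<Longrightarrow> \<epsilon> b \<in> Hom D (FObj L (FObj R b)) b"
    "g \<in> Hom C a a' \<Longrightarrow> \<eta> a' \<bullet>\<^bsub>C\<^esub> g = FArr R (FArr L g) \<bullet>\<^bsub>C\<^esub> \<eta> a"
    "k \<in> Hom D b b' \<Longrightarrow> \<epsilon> b' \<bullet>\<^bsub>D\<^esub> FArr L (FArr R k) = k \<bullet>\<^bsub>D\<^esub> \<epsilon> b"
    "a \<in> Obj C \<Longrightarrow> \<epsilon> (FObj L a) \<bullet>\<^bsub>D\<^esub> FArr L (\<eta> a) = Idn D (FObj L a)"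
    "b \<in> Obj D \<Longrightarrow> FArr R (\<epsilon> b) \<bullet>\<^bsub>C\<^esub> \<eta> (FObj R b) = Idn C (FObj R b)"
  using assms by (auto simp: adjunction_def Hom_def)

text \<open>Transposition along an adjunction, and its uniqueness, on either side.\<close>

lemma adjunction_left_mate:
  assumes A: "adjunction C D L R \<eta> \<epsilon>" and a: "a \<in> Obj C" and b: "b \<in> Obj D" and g: "g \<in> Hom C a (FObj R b)"
  shows "\<epsilon> b \<bullet>\<^bsub>D\<^esub> FArr L g \<in> Hom D (FObj L a) b"
    "FArr R (\<epsilon> b \<bullet>\<^bsub>D\<^esub> FArr L g) \<bullet>\<^bsub>C\<^esub> \<eta> a = g"
proof -
  note A = adjunctionD[OF A]
  note L = is_functorD[OF A(1)] and R = is_functorD[OF A(2)]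
  interpret C: category C by (rule L(1))
  interpret D: category D by (rule L(2))
  note Lg = L(4)[OF g]
  show "\<epsilon> b \<bullet>\<^bsub>D\<^esub> FArr L g \<in> Hom D (FObj L a) b" by (rule D.Cmp_closed[OF Lg A(4)[OF b]])
  have "FArr R (\<epsilon> b \<bullet>\<^bsub>D\<^esub> FArr L g) \<bullet>\<^bsub>C\<^esub> \<eta> a = FArr R (\<epsilon> b) \<bullet>\<^bsub>C\<^esub> (FArr R (FArr L g) \<bullet>\<^bsub>C\<^esub> \<eta> a)"
    using R(6)[OF Lg A(4)[OF b]] C.Cmp_assoc[OF A(3)[OF a] R(4)[OF Lg] R(4)[OF A(4)[OF b]]] by simp
  also have "\<dots> = (FArr R (\<epsilon> b) \<bullet>\<^bsub>C\<^esub> \<eta> (FObj R b)) \<bullet>\<^bsub>C\<^esub> g"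
    using A(5)[OF g] C.Cmp_assoc[OF g A(3)[OF R(3)[OF b]] R(4)[OF A(4)[OF b]]] by simp
  also have "\<dots> = g" using A(8)[OF b] C.Idn_left[OF g] by simp
  finally show "FArr R (\<epsilon> b \<bullet>\<^bsub>D\<^esub> FArr L g) \<bullet>\<^bsub>C\<^esub> \<eta> a = g" .
qed

lemma adjunction_left_unique:
  assumes A: "adjunction C D L R \<eta> \<epsilon>" and a: "a \<in> Obj C"
    and u: "u \<in> Hom D (FObj L a) b" and v: "v \<in> Hom D (FObj L a) b"
    and eq: "FArr R u \<bullet>\<^bsub>C\<^esub> \<eta> a = FArr R v \<bullet>\<^bsub>C\<^esub> \<eta> a"
  shows "u = v"
proof -
  note A = adjunctionD[OF A]
  note L = is_functorD[OF A(1)] and R = is_functorD[OF A(2)]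
  interpret C: category C by (rule L(1))
  interpret D: category D by (rule L(2))
  have b: "b \<in> Obj D" using D.Hom_obj[OF u] by simp
  have "w = \<epsilon> b \<bullet>\<^bsub>D\<^esub> FArr L (FArr R w \<bullet>\<^bsub>C\<^esub> \<eta> a)" if w: "w \<in> Hom D (FObj L a) b" for w
  proof -
    note Rw = R(4)[OF w] and e = A(4)[OF L(3)[OF a]] and La = L(4)[OF A(3)[OF a]]
    have "\<epsilon> b \<bullet>\<^bsub>D\<^esub> FArr L (FArr R w \<bullet>\<^bsub>C\<^esub> \<eta> a) = (\<epsilon> b \<bullet>\<^bsub>D\<^esub> FArr L (FArr R w)) \<bullet>\<^bsub>D\<^esub> FArr L (\<eta> a)"
      using L(6)[OF A(3)[OF a] Rw] D.Cmp_assoc[OF La L(4)[OF Rw] A(4)[OF b]] by simp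
    also have "\<dots> = w" using A(6)[OF w] D.Cmp_assoc[OF La e w] A(7)[OF a] D.Idn_right[OF w] by simp
    finally show ?thesis by simp
  qed
  then show ?thesis using u v eq by metis
qed

lemma adjunction_right_mate:
  assumes A: "adjunction C D L R \<eta> \<epsilon>" and a: "a \<in> Obj C" and b: "b \<in> Obj D" and g: "g \<in> Hom D (FObj L a) b"
  shows "FArr R g \<bullet>\<^bsub>C\<^esub> \<eta> a \<in> Hom C a (FObj R b)"
    "\<epsilon> b \<bullet>\<^bsub>D\<^esub> FArr L (FArr R g \<bullet>\<^bsub>C\<^esub> \<eta> a) = g"
proof -
  note A = adjunctionD[OF A]
  note L = is_functorD[OF A(1)] and R = is_functorD[OF A(2)]
  interpret C: category C by (rule L(1))
  interpret D: category D by (rule L(2))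
  note Rg = R(4)[OF g] and e = A(4)[OF L(3)[OF a]] and La = L(4)[OF A(3)[OF a]]
  show "FArr R g \<bullet>\<^bsub>C\<^esub> \<eta> a \<in> Hom C a (FObj R b)" by (rule C.Cmp_closed[OF A(3)[OF a] Rg])
  have "\<epsilon> b \<bullet>\<^bsub>D\<^esub> FArr L (FArr R g \<bullet>\<^bsub>C\<^esub> \<eta> a) = (\<epsilon> b \<bullet>\<^bsub>D\<^esub> FArr L (FArr R g)) \<bullet>\<^bsub>D\<^esub> FArr L (\<eta> a)"
    using L(6)[OF A(3)[OF a] Rg] D.Cmp_assoc[OF La L(4)[OF Rg] A(4)[OF b]] by simp
  also have "\<dots> = g" using A(6)[OF g] D.Cmp_assoc[OF La e g] A(7)[OF a] D.Idn_right[OF g] by simp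
  finally show "\<epsilon> b \<bullet>\<^bsub>D\<^esub> FArr L (FArr R g \<bullet>\<^bsub>C\<^esub> \<eta> a) = g" .
qed

lemma adjunction_right_unique:
  assumes A: "adjunction C D L R \<eta> \<epsilon>" and b: "b \<in> Obj D"
    and u: "u \<in> Hom C a (FObj R b)" and v: "v \<in> Hom C a (FObj R b)"
    and eq: "\<epsilon> b \<bullet>\<^bsub>D\<^esub> FArr L u = \<epsilon> b \<bullet>\<^bsub>D\<^esub> FArr L v"
  shows "u = v"
proof -
  interpret C: category C using is_functorD(1)[OF adjunctionD(1)[OF A]] .
  have a: "a \<in> Obj C" using C.Hom_obj[OF u] by simp
  show ?thesis
    by (rule trans[OF adjunction_left_mate(2)[OF A a b u, symmetric, unfolded eq] adjunction_left_mate(2)[OF A a b v]])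
qed

context kan_setting
begin

abbreviation "re W \<equiv> pull_functor X f W"
abbreviation "rs \<equiv> restriction X f :: (('z, 'w, 'o, 'm) cfunctor, ('z, 'w, 'o, 'm) nat_trans,
      ('x, 'y, 'o, 'm) cfunctor, ('x, 'y, 'o, 'm) nat_trans) cfunctor"

lemma rs_functor: "is_functor CY CX rs"
  by (rule is_functor_restriction[OF f category_axioms])

lemmas rs_Hom = is_functorD(4)[OF rs_functor, unfolded FObj_restriction]

lemma rs_closed: "W \<in> functors Y C \<Longrightarrow> re W \<in> functors X C"
  by (rule pull_functor_closed[OF f])

lemma rs_Obj: "x \<in> Obj X \<Longrightarrow> FObj (re W) x = FObj W (FObj f x)"
  and rs_Arr: "k \<in> Hom X x x' \<Longrightarrow> FArr (re W) k = FArr W (FArr f k)"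
  by (simp_all add: functor_simps HomD(1))

text \<open>An arrow \<open>k\<close> of \<open>X\<close> lies in the fibre over its target, from \<open>(x, f k)\<close> to the base point.\<close>

lemma hf_base_arrow:
  assumes k: "k \<in> Hom X x x'"
  shows "((x, FArr f k), (x', Idn Y (FObj f x')), k) \<in> Hom (hf (FObj f x')) (x, FArr f k) (x', Idn Y (FObj f x'))"
  using k X.Hom_obj[OF k] fd(4)[OF k] fd(3) Y.Idn_closed Y.Idn_left[OF fd(4)[OF k]]
  by (simp add: hf_Hom hf_Obj)

text \<open>The legs and projections at the base points \<open>(x, id)\<close> are the future unit and counit. They
  determine all others by functoriality.\<close>

lemma kan_cone_unit:
  assumes K: "kan_cone V F l m"
  shows "(V, re F, \<lambda>x\<in>Obj X. l (x, Idn Y (FObj f x))) \<in> Hom CX V (re F)"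
    "(re F, V, \<lambda>x\<in>Obj X. m (x, Idn Y (FObj f x))) \<in> Hom CX (re F) V"
proof -
  note k = kan_coneD[OF K]
  note Vd = is_functorD[OF functorsD[OF k(1)]] and Fd = is_functorD[OF functorsD[OF k(2)]]
  let ?b = "\<lambda>x. (x, Idn Y (FObj f x))"
  show "(V, re F, \<lambda>x\<in>Obj X. l (?b x)) \<in> Hom CX V (re F)"
  proof (rule functor_cat_HomI[OF k(1) rs_closed[OF k(2)]])
    fix u x x' assume u: "u \<in> Hom X x x'"
    note x = X.Hom_obj[OF u]
    have "push (FArr f u) (?b x) = (x, FArr f u)" using Y.Idn_right[OF fd(4)[OF u]] by simp
    then show "l (?b x') \<bullet> FArr V u = FArr (re F) u \<bullet> l (?b x)"
      using k(9)[OF fd(3)[OF x(2)] hf_base_arrow[OF u]] k(4)[OF fd(4)[OF u] base_point[OF x(1)]]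
      by (simp add: rs_Arr[OF u])
  qed (use k(6)[OF fd(3) base_point] in \<open>simp add: rs_Obj\<close>)
  show "(re F, V, \<lambda>x\<in>Obj X. m (?b x)) \<in> Hom CX (re F) V"
  proof (rule functor_cat_HomI[OF rs_closed[OF k(2)] k(1)])
    fix u x x' assume u: "u \<in> Hom X x x'"
    note x = X.Hom_obj[OF u]
    note fu = fd(4)[OF u]
    have p: "push (FArr f u) (?b x) = (x, FArr f u)" using Y.Idn_right[OF fu] by simp
    have po: "(x, FArr f u) \<in> Obj (hf (FObj f x'))" using push_closed[OF fu base_point[OF x(1)]] p by simp
    have "FArr V u \<bullet> m (?b x) = FArr V u \<bullet> (m (x, FArr f u) \<bullet> FArr F (FArr f u))"
      using k(5)[OF fu base_point[OF x(1)]] p by simp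
    also have "\<dots> = m (?b x') \<bullet> FArr F (FArr f u)"
      using Cmp_assoc[OF Fd(4)[OF fu] k(7)[OF fd(3)[OF x(2)] po], of "FArr V u" "FObj V x'"] Vd(4)[OF u]
        k(10)[OF fd(3)[OF x(2)] hf_base_arrow[OF u]] by simp
    finally show "m (?b x') \<bullet> FArr (re F) u = FArr V u \<bullet> m (?b x)"
      by (simp add: rs_Arr[OF u])
  qed (use k(7)[OF fd(3) base_point] in \<open>simp add: rs_Obj\<close>)
qed

lemma kan_cone_legs_base:
  assumes K: "kan_cone V F l m" and y: "y \<in> Obj Y" and p: "p \<in> Obj (hf y)"
  shows "FArr F (snd p) \<bullet> l (fst p, Idn Y (FObj f (fst p))) = l p"
    "m (fst p, Idn Y (FObj f (fst p))) \<bullet> FArr F (inv_arr Y (snd p)) = m p"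
proof -
  note k = kan_coneD[OF K]
  have h: "snd p \<in> Hom Y (FObj f (fst p)) y" and x: "fst p \<in> Obj X" using p by (simp_all add: hf_Obj)
  show "FArr F (snd p) \<bullet> l (fst p, Idn Y (FObj f (fst p))) = l p"
    using k(4)[OF h base_point[OF x]] push_base[OF p] by simp
  show "m (fst p, Idn Y (FObj f (fst p))) \<bullet> FArr F (inv_arr Y (snd p)) = m p"
    using k(5)[OF groupoid_inv(1)[OF Y.groupoid h] p] push_inv[OF p] by simp
qed

text \<open>A functor \<open>W\<close> on \<open>Y\<close> carries the canonical cocone \<open>W h\<close> and cone \<open>W h\<inverse>\<close> on its restriction.\<close>

lemma restriction_cocone:
  assumes W: "W \<in> functors Y C"
  shows "y \<in> Obj Y \<Longrightarrow> p \<in> Obj (hf y) \<Longrightarrow> FArr W (snd p) \<in> Hom C (FObj (re W) (fst p)) (FObj W y)"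
    "y \<in> Obj Y \<Longrightarrow> \<kappa> \<in> Hom (hf y) p q \<Longrightarrow> FArr W (snd q) \<bullet> FArr (re W) (snd (snd \<kappa>)) = FArr W (snd p)"
    "k \<in> Hom Y y y' \<Longrightarrow> p \<in> Obj (hf y) \<Longrightarrow> FArr W k \<bullet> FArr W (snd p) = FArr W (snd (push k p))"
proof -
  note Wd = is_functorD[OF functorsD[OF W]]
  show "y \<in> Obj Y \<Longrightarrow> p \<in> Obj (hf y) \<Longrightarrow> FArr W (snd p) \<in> Hom C (FObj (re W) (fst p)) (FObj W y)"
    using Wd(4) by (simp add: hf_Obj rs_Obj)
  show "FArr W (snd q) \<bullet> FArr (re W) (snd (snd \<kappa>)) = FArr W (snd p)" if \<kappa>: "\<kappa> \<in> Hom (hf y) p q"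
  proof -
    have u: "snd (snd \<kappa>) \<in> Hom X (fst p) (fst q)" and q: "snd q \<in> Hom Y (FObj f (fst q)) y"
      and e: "snd q \<bullet>\<^bsub>Y\<^esub> FArr f (snd (snd \<kappa>)) = snd p"
      using \<kappa> by (simp_all add: hf_Hom hf_Obj)
    show ?thesis using Wd(6)[OF fd(4)[OF u] q] e by (simp add: rs_Arr[OF u])
  qed
  show "k \<in> Hom Y y y' \<Longrightarrow> p \<in> Obj (hf y) \<Longrightarrow> FArr W k \<bullet> FArr W (snd p) = FArr W (snd (push k p))"
    using Wd(6)[of "snd p" "FObj f (fst p)" y k y'] by (simp add: hf_Obj)
qed

lemma restriction_cone:
  assumes W: "W \<in> functors Y C"
  shows "y \<in> Obj Y \<Longrightarrow> p \<in> Obj (hf y) \<Longrightarrow> FArr W (inv_arr Y (snd p)) \<in> Hom C (FObj W y) (FObj (re W) (fst p))"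
    "y \<in> Obj Y \<Longrightarrow> \<kappa> \<in> Hom (hf y) p q \<Longrightarrow>
      FArr (re W) (snd (snd \<kappa>)) \<bullet> FArr W (inv_arr Y (snd p)) = FArr W (inv_arr Y (snd q))"
    "k \<in> Hom Y y y' \<Longrightarrow> p \<in> Obj (hf y) \<Longrightarrow> FArr W (inv_arr Y (snd (push k p))) \<bullet> FArr W k = FArr W (inv_arr Y (snd p))"
proof -
  note Wd = is_functorD[OF functorsD[OF W]]
  show "y \<in> Obj Y \<Longrightarrow> p \<in> Obj (hf y) \<Longrightarrow> FArr W (inv_arr Y (snd p)) \<in> Hom C (FObj W y) (FObj (re W) (fst p))"
    using Wd(4)[OF groupoid_inv(1)[OF Y.groupoid]] by (simp add: hf_Obj rs_Obj)
  show "FArr (re W) (snd (snd \<kappa>)) \<bullet> FArr W (inv_arr Y (snd p)) = FArr W (inv_arr Y (snd q))"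
    if \<kappa>: "\<kappa> \<in> Hom (hf y) p q"
  proof -
    have u: "snd (snd \<kappa>) \<in> Hom X (fst p) (fst q)" and q: "snd q \<in> Hom Y (FObj f (fst q)) y"
      and p: "snd p \<in> Hom Y (FObj f (fst p)) y"
      and e: "snd q \<bullet>\<^bsub>Y\<^esub> FArr f (snd (snd \<kappa>)) = snd p"
      using \<kappa> by (simp_all add: hf_Hom hf_Obj)
    note iq = groupoid_inv(1)[OF Y.groupoid q] and fu = fd(4)[OF u]
    have "inv_arr Y (snd p) = inv_arr Y (FArr f (snd (snd \<kappa>))) \<bullet>\<^bsub>Y\<^esub> inv_arr Y (snd q)"
      using groupoid_inv_cmp[OF Y.groupoid fu q] e by simp
    then have "FArr f (snd (snd \<kappa>)) \<bullet>\<^bsub>Y\<^esub> inv_arr Y (snd p) = inv_arr Y (snd q)"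
      using groupoid_cancel_left'[OF Y.groupoid fu iq] by simp
    then show ?thesis using Wd(6)[OF groupoid_inv(1)[OF Y.groupoid p] fu] by (simp add: rs_Arr[OF u])
  qed
  show "FArr W (inv_arr Y (snd (push k p))) \<bullet> FArr W k = FArr W (inv_arr Y (snd p))"
    if k: "k \<in> Hom Y y y'" and p: "p \<in> Obj (hf y)"
  proof -
    have h: "snd p \<in> Hom Y (FObj f (fst p)) y" using p by (simp add: hf_Obj)
    note ih = groupoid_inv(1)[OF Y.groupoid h] and ik = groupoid_inv[OF Y.groupoid k]
    have "inv_arr Y (k \<bullet>\<^bsub>Y\<^esub> snd p) \<bullet>\<^bsub>Y\<^esub> k = inv_arr Y (snd p)"
      using groupoid_inv_cmp[OF Y.groupoid h k] Y.Cmp_assoc[OF k ik(1) ih] ik(2) Y.Idn_right[OF ih] by simp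
    then show ?thesis
      using Wd(6)[OF k groupoid_inv(1)[OF Y.groupoid Y.Cmp_closed[OF h k]]] by simp
  qed
qed

text \<open>The map induced on colimits is also the one induced on limits: on a leg, the composites with
  \<open>m'\<close> are sums over the same arrows by naturality of \<open>t\<close>.\<close>

lemma kan_cone_map:
  assumes K: "kan_cone V F l m" and K': "kan_cone W G l' m'" and t: "t \<in> Hom CX V W"
  shows "\<exists>\<alpha>\<in>Hom CY F G. \<forall>y\<in>Obj Y. \<forall>p\<in>Obj (hf y).
    \<alpha> at y \<bullet> l p = l' p \<bullet> t at (fst p) \<and>
    m' p \<bullet> \<alpha> at y = t at (fst p) \<bullet> m p"
proof -
  note k = kan_coneD[OF K] and k' = kan_coneD[OF K'] and t = functor_cat_HomD[OF t]
  note Vd = is_functorD[OF functorsD[OF k(1)]] and Wd = is_functorD[OF functorsD[OF k'(1)]]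
  note Gd = is_functorD[OF functorsD[OF k'(2)]]
  have tp: "t at (fst p) \<in> Hom C (FObj V (fst p)) (FObj W (fst p))" if "p \<in> Obj (hf y)" for p y
    using t(4) that by (simp add: hf_Obj)
  have "\<exists>\<alpha>\<in>Hom CY F G. \<forall>y\<in>Obj Y. \<forall>p\<in>Obj (hf y). \<alpha> at y \<bullet> l p = l' p \<bullet> t at (fst p)"
  proof (rule kan_cone_out[OF K k'(2)])
    fix y p assume y: "y \<in> Obj Y" and p: "p \<in> Obj (hf y)"
    show "l' p \<bullet> t at (fst p) \<in> Hom C (FObj V (fst p)) (FObj G y)"
      by (rule Cmp_closed[OF tp[OF p] k'(6)[OF y p]])
  next
    fix y p q \<kappa> assume y: "y \<in> Obj Y" and \<kappa>: "\<kappa> \<in> Hom (hf y) p q"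
    then have p: "p \<in> Obj (hf y)" and q: "q \<in> Obj (hf y)" and u: "snd (snd \<kappa>) \<in> Hom X (fst p) (fst q)"
      by (simp_all add: hf_Hom)
    show "(l' q \<bullet> t at (fst q)) \<bullet> FArr V (snd (snd \<kappa>)) = l' p \<bullet> t at (fst p)"
      using Cmp_assoc[OF Vd(4)[OF u] tp[OF q] k'(6)[OF y q]] t(5)[OF u]
        Cmp_assoc[OF tp[OF p] Wd(4)[OF u] k'(6)[OF y q]] k'(9)[OF y \<kappa>] by simp
  next
    fix y y' j p assume j: "j \<in> Hom Y y y'" and p: "p \<in> Obj (hf y)"
    note y = Y.Hom_obj[OF j]
    show "FArr G j \<bullet> l' p \<bullet> t at (fst p) = l' (push j p) \<bullet> t at (fst (push j p))"
      using Cmp_assoc[OF tp[OF p] k'(6)[OF y(1) p] Gd(4)[OF j]] k'(4)[OF j p] by simp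
  qed
  then obtain \<alpha> where \<alpha>: "\<alpha> \<in> Hom CY F G"
    and al: "\<And>y p. y \<in> Obj Y \<Longrightarrow> p \<in> Obj (hf y) \<Longrightarrow> \<alpha> at y \<bullet> l p = l' p \<bullet> t at (fst p)" by blast
  note \<alpha>y = functor_cat_HomD(4)[OF \<alpha>]
  have "m' q \<bullet> \<alpha> at y = t at (fst q) \<bullet> m q" if y: "y \<in> Obj Y" and q: "q \<in> Obj (hf y)" for y q
  proof (rule bilimit_ext_left[OF hf_ess_finite k(3)[OF y]])
    fix p assume p: "p \<in> Obj (hf y)"
    have o: "FObj V (fst p) \<in> Obj C" "FObj W (fst p) \<in> Obj C" "FObj V (fst q) \<in> Obj C" "FObj W (fst q) \<in> Obj C"
      using Vd(3) Wd(3) p q by (simp_all add: hf_Obj)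
    have u: "snd (snd \<kappa>) \<in> Hom X (fst p) (fst q)" if "\<kappa> \<in> Hom (hf y) p q" for \<kappa> using that by (simp add: hf_Hom)
    interpret P: ess_finite "hf y" by (rule hf_ess_finite)
    have "(m' q \<bullet> \<alpha> at y) \<bullet> l p = (m' q \<bullet> l' p) \<bullet> t at (fst p)"
      using Cmp_assoc[OF k(6)[OF y p] \<alpha>y[OF y] k'(7)[OF y q]] al[OF y p]
        Cmp_assoc[OF tp[OF p] k'(6)[OF y p] k'(7)[OF y q]] by simp
    also have "\<dots> = wsum (FObj V (fst p)) (FObj W (fst q)) (Hom (hf y) p q) (\<lambda>_. 1)
        (\<lambda>\<kappa>. FArr W (snd (snd \<kappa>)) \<bullet> t at (fst p))"
      using k'(8)[OF y p q] wsum_pre[OF o(2,4) P.finite_Hom _ tp[OF p]] Wd(4)[OF u] by simp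
    also have "\<dots> = wsum (FObj V (fst p)) (FObj W (fst q)) (Hom (hf y) p q) (\<lambda>_. 1)
        (\<lambda>\<kappa>. t at (fst q) \<bullet> FArr V (snd (snd \<kappa>)))"
      using t(5)[OF u] Cmp_closed[OF tp[OF p] Wd(4)[OF u]] Cmp_closed[OF Vd(4)[OF u] tp[OF q]]
      by (intro wsum_cong o) auto
    also have "\<dots> = t at (fst q) \<bullet> (m q \<bullet> l p)"
      using k(8)[OF y p q] wsum_post[OF o(1,3) P.finite_Hom _ tp[OF q]] Vd(4)[OF u] by simp
    also have "\<dots> = (t at (fst q) \<bullet> m q) \<bullet> l p"
      using Cmp_assoc[OF k(6)[OF y p] k(7)[OF y q] tp[OF q]] by simp
    finally show "(m' q \<bullet> \<alpha> at y) \<bullet> l p = (t at (fst q) \<bullet> m q) \<bullet> l p" .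
  qed (use Cmp_closed[OF \<alpha>y[OF y] k'(7)[OF y q]] Cmp_closed[OF k(7)[OF y q] tp[OF q]] in simp_all)
  then show ?thesis using \<alpha> al by blast
qed

text \<open>Sending \<open>V\<close> to its two-sided Kan extension is left and right adjoint to restriction at once.\<close>

lemma adjoints_exist:
  "\<exists>L \<eta> \<epsilon>. adjunction CX CY L rs \<eta> \<epsilon>" "\<exists>R \<eta> \<epsilon>. adjunction CY CX rs R \<eta> \<epsilon>"
proof -
  have "\<forall>V. \<exists>F l m. V \<in> functors X C \<longrightarrow> kan_cone V F l m" using kan_cone_exists by blast
  then obtain F l m where K: "\<And>V. V \<in> functors X C \<Longrightarrow> kan_cone V (F V) (l V) (m V)" by metis
  note k = kan_coneD[OF K]
  have "\<exists>\<alpha>. \<alpha> \<in> Hom CY (F (Dom CX t)) (F (Cod CX t)) \<and> (\<forall>y\<in>Obj Y. \<forall>p\<in>Obj (hf y).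
    \<alpha> at y \<bullet> l (Dom CX t) p = l (Cod CX t) p \<bullet> t at (fst p) \<and> m (Cod CX t) p \<bullet> \<alpha> at y = t at (fst p) \<bullet> m (Dom CX t) p)"
    if "t \<in> Arr CX" for t
  proof -
    have t: "t \<in> Hom CX (Dom CX t) (Cod CX t)" using that by (simp add: Hom_def)
    from kan_cone_map[OF K[OF functor_cat_HomD(1)[OF t]] K[OF functor_cat_HomD(2)[OF t]] t] show ?thesis by blast
  qed
  then obtain A where A0: "\<And>t. t \<in> Arr CX \<Longrightarrow> A t \<in> Hom CY (F (Dom CX t)) (F (Cod CX t)) \<and> (\<forall>y\<in>Obj Y. \<forall>p\<in>Obj (hf y).
    A t at y \<bullet> l (Dom CX t) p = l (Cod CX t) p \<bullet> t at (fst p) \<and>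
    m (Cod CX t) p \<bullet> A t at y = t at (fst p) \<bullet> m (Dom CX t) p)" by metis
  have A: "A t \<in> Hom CY (F V) (F W)"
    and Al: "\<And>y p. y \<in> Obj Y \<Longrightarrow> p \<in> Obj (hf y) \<Longrightarrow> A t at y \<bullet> l V p = l W p \<bullet> t at (fst p)"
    and mA: "\<And>y p. y \<in> Obj Y \<Longrightarrow> p \<in> Obj (hf y) \<Longrightarrow> m W p \<bullet> A t at y = t at (fst p) \<bullet> m V p"
    if "t \<in> Hom CX V W" for t V W
    using A0[of t] HomD[OF that] by auto
  have tp: "t at (fst p) \<in> Hom C (FObj V (fst p)) (FObj W (fst p))"
    if "t \<in> Hom CX V W" "p \<in> Obj (hf y)" for t V W p y
    using functor_cat_HomD(4)[OF that(1)] that(2) by (simp add: hf_Obj)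
  define K where "K = \<lparr>FObj = F, FArr = A\<rparr>"
  have K_functor: "is_functor CX CY K"
    unfolding is_functor_def
  proof (intro conjI ballI allI)
    fix V assume "V \<in> Obj CX"
    then have V: "V \<in> functors X C" by (simp add: Obj_functor_cat)
    show FV: "FObj K V \<in> Obj CY" using k(2)[OF V] by (simp add: K_def Obj_functor_cat)
    note i = CX.Idn_closed[OF \<open>V \<in> Obj CX\<close>]
    have "A (Idn CX V) = Idn CY (F V)"
    proof (rule kan_cone_ext_left[OF K[OF V] A[OF i]])
      show "Idn CY (F V) \<in> Hom CY (F V) (F V)" using CY.Idn_closed FV by (simp add: K_def)
      fix y p assume y: "y \<in> Obj Y" and p: "p \<in> Obj (hf y)"
      have "fst p \<in> Obj X" using p by (simp add: hf_Obj)
      then show "A (Idn CX V) at y \<bullet> l V p = Idn CY (F V) at y \<bullet> l V p"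
        using Al[OF i y p] Idn_left[OF k(6)[OF V y p]] Idn_right[OF k(6)[OF V y p]] y by (simp add: component_simps)
    qed
    then show "FArr K (Idn CX V) = Idn CY (FObj K V)" by (simp add: K_def)
  next
    fix t assume "t \<in> Arr CX"
    then have "t \<in> Hom CX (Dom CX t) (Cod CX t)" by (simp add: Hom_def)
    then show "FArr K t \<in> Hom CY (FObj K (Dom CX t)) (FObj K (Cod CX t))" using A by (simp add: K_def)
  next
    fix U V W s t assume s: "s \<in> Hom CX U V" and t: "t \<in> Hom CX V W"
    note U = functor_cat_HomD(1)[OF s] and V = functor_cat_HomD(1)[OF t] and W = functor_cat_HomD(2)[OF t]
    note ts = CX.Cmp_closed[OF s t]
    have "A (t \<bullet>\<^bsub>CX\<^esub> s) = A t \<bullet>\<^bsub>CY\<^esub> A s"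
    proof (rule kan_cone_ext_left[OF K[OF U] A[OF ts] CY.Cmp_closed[OF A[OF s] A[OF t]]])
      fix y p assume y: "y \<in> Obj Y" and p: "p \<in> Obj (hf y)"
      have x: "fst p \<in> Obj X" using p by (simp add: hf_Obj)
      note As = functor_cat_HomD(4)[OF A[OF s] y] and At = functor_cat_HomD(4)[OF A[OF t] y]
      have "(A (t \<bullet>\<^bsub>CX\<^esub> s)) at y \<bullet> l U p = l W p \<bullet> (t at (fst p) \<bullet> s at (fst p))"
        using Al[OF ts y p] by (simp add: component_simps x)
      also have "\<dots> = A t at y \<bullet> (l V p \<bullet> s at (fst p))"
        using Cmp_assoc[OF tp[OF s p] tp[OF t p] k(6)[OF W y p]] Al[OF t y p]
          Cmp_assoc[OF tp[OF s p] k(6)[OF V y p] At] by simp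
      also have "\<dots> = (A t \<bullet>\<^bsub>CY\<^esub> A s) at y \<bullet> l U p"
        using Cmp_assoc[OF k(6)[OF U y p] As At] Al[OF s y p] by (simp add: component_simps y)
      finally show "(A (t \<bullet>\<^bsub>CX\<^esub> s)) at y \<bullet> l U p = (A t \<bullet>\<^bsub>CY\<^esub> A s) at y \<bullet> l U p" .
    qed
    then show "FArr K (t \<bullet>\<^bsub>CX\<^esub> s) = FArr K t \<bullet>\<^bsub>CY\<^esub> FArr K s" by (simp add: K_def)
  qed (fact CX.category_axioms CY.category_axioms)+
  have KO: "FObj K = F" "FArr K = A" by (simp_all add: K_def)
  let ?b = "\<lambda>x. (x, Idn Y (FObj f x))"
  define \<eta> where "\<eta> V = (V, re (F V), \<lambda>x\<in>Obj X. l V (?b x))" for V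
  define \<epsilon>' where "\<epsilon>' V = (re (F V), V, \<lambda>x\<in>Obj X. m V (?b x))" for V
  have \<eta>: "\<eta> V \<in> Hom CX V (re (F V))" and \<epsilon>': "\<epsilon>' V \<in> Hom CX (re (F V)) V"
    if "V \<in> functors X C" for V
    using kan_cone_unit[OF K[OF that]] by (simp_all add: \<eta>_def \<epsilon>'_def)
  have \<eta>c: "\<eta> V at x = l V (?b x)" and \<epsilon>'c: "\<epsilon>' V at x = m V (?b x)" if "x \<in> Obj X" for V x
    using that by (simp_all add: \<eta>_def \<epsilon>'_def)
  let ?r = "pull_functor X f"
  have "\<exists>\<alpha> \<beta>.
    (\<alpha> \<in> Hom CY (F (?r W)) W \<and> (\<forall>y\<in>Obj Y. \<forall>p\<in>Obj (hf y). \<alpha> at y \<bullet> l (?r W) p = FArr W (snd p))) \<and>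
    (\<beta> \<in> Hom CY W (F (?r W)) \<and> (\<forall>y\<in>Obj Y. \<forall>p\<in>Obj (hf y). m (?r W) p \<bullet> \<beta> at y = FArr W (inv_arr Y (snd p))))"
    if W: "W \<in> functors Y C" for W
  proof -
    have "\<exists>\<alpha>\<in>Hom CY (F (?r W)) W. \<forall>y\<in>Obj Y. \<forall>p\<in>Obj (hf y). \<alpha> at y \<bullet> l (?r W) p = FArr W (snd p)"
      by (rule kan_cone_out[OF K[OF rs_closed[OF W]] W]) (fact restriction_cocone[OF W])+
    moreover have "\<exists>\<beta>\<in>Hom CY W (F (?r W)). \<forall>y\<in>Obj Y. \<forall>p\<in>Obj (hf y). m (?r W) p \<bullet> \<beta> at y = FArr W (inv_arr Y (snd p))"
      by (rule kan_cone_in[OF K[OF rs_closed[OF W]] W]) (fact restriction_cone[OF W])+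
    ultimately show ?thesis by blast
  qed
  then obtain \<epsilon> \<eta>' where e0: "\<And>W. W \<in> functors Y C \<Longrightarrow>
    (\<epsilon> W \<in> Hom CY (F (?r W)) W \<and> (\<forall>y\<in>Obj Y. \<forall>p\<in>Obj (hf y). \<epsilon> W at y \<bullet> l (?r W) p = FArr W (snd p))) \<and>
    (\<eta>' W \<in> Hom CY W (F (?r W)) \<and> (\<forall>y\<in>Obj Y. \<forall>p\<in>Obj (hf y). m (?r W) p \<bullet> \<eta>' W at y = FArr W (inv_arr Y (snd p))))"
    by metis
  have \<epsilon>: "\<epsilon> W \<in> Hom CY (F (?r W)) W" and \<eta>': "\<eta>' W \<in> Hom CY W (F (?r W))"
    and \<epsilon>l: "\<And>y p. y \<in> Obj Y \<Longrightarrow> p \<in> Obj (hf y) \<Longrightarrow> \<epsilon> W at y \<bullet> l (?r W) p = FArr W (snd p)"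
    and m\<eta>: "\<And>y p. y \<in> Obj Y \<Longrightarrow> p \<in> Obj (hf y) \<Longrightarrow> m (?r W) p \<bullet> \<eta>' W at y = FArr W (inv_arr Y (snd p))"
    if "W \<in> functors Y C" for W
    using e0[OF that] by auto
  have left: "adjunction CX CY K rs \<eta> \<epsilon>"
    unfolding adjunction_def FObj_restriction KO
  proof (intro conjI ballI)
    show "\<eta> V \<in> Hom CX V (?r (F V))" if "V \<in> Obj CX" for V using \<eta> that by (simp add: Obj_functor_cat)
    show "\<epsilon> W \<in> Hom CY (F (?r W)) W" if "W \<in> Obj CY" for W using \<epsilon> that by (simp add: Obj_functor_cat)
  next
    fix t assume "t \<in> Arr CX"
    define V W where "V = Dom CX t" and "W = Cod CX t"
    have t: "t \<in> Hom CX V W" using \<open>t \<in> Arr CX\<close> by (simp add: Hom_def V_def W_def)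
    note V = functor_cat_HomD(1)[OF t] and W = functor_cat_HomD(2)[OF t]
    have "\<eta> W \<bullet>\<^bsub>CX\<^esub> t = FArr rs (A t) \<bullet>\<^bsub>CX\<^esub> \<eta> V"
    proof (rule functor_cat_ext[OF CX.Cmp_closed[OF t \<eta>[OF W]] CX.Cmp_closed[OF \<eta>[OF V] rs_Hom[OF A[OF t]]]])
      fix x assume x: "x \<in> Obj X"
      show "(\<eta> W \<bullet>\<^bsub>CX\<^esub> t) at x = (FArr rs (A t) \<bullet>\<^bsub>CX\<^esub> \<eta> V) at x"
        using Al[OF t fd(3)[OF x] base_point[OF x]] x by (simp add: component_simps \<eta>c)
    qed
    then show "\<eta> (Cod CX t) \<bullet>\<^bsub>CX\<^esub> t = FArr rs (A t) \<bullet>\<^bsub>CX\<^esub> \<eta> (Dom CX t)" by (simp add: V_def W_def)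
  next
    fix t assume "t \<in> Arr CY"
    define V W where "V = Dom CY t" and "W = Cod CY t"
    have t: "t \<in> Hom CY V W" using \<open>t \<in> Arr CY\<close> by (simp add: Hom_def V_def W_def)
    note V = functor_cat_HomD(1)[OF t] and W = functor_cat_HomD(2)[OF t]
    note rt = rs_Hom[OF t] and rV = rs_closed[OF V] and rW = rs_closed[OF W]
    have "\<epsilon> W \<bullet>\<^bsub>CY\<^esub> A (FArr rs t) = t \<bullet>\<^bsub>CY\<^esub> \<epsilon> V"
    proof (rule kan_cone_ext_left[OF K[OF rV] CY.Cmp_closed[OF A[OF rt] \<epsilon>[OF W]] CY.Cmp_closed[OF \<epsilon>[OF V] t]])
      fix y p assume y: "y \<in> Obj Y" and p: "p \<in> Obj (hf y)"
      have x: "fst p \<in> Obj X" and h: "snd p \<in> Hom Y (FObj f (fst p)) y" using p by (simp_all add: hf_Obj)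
      note eW = functor_cat_HomD(4)[OF \<epsilon>[OF W] y] and eV = functor_cat_HomD(4)[OF \<epsilon>[OF V] y]
      note Ay = functor_cat_HomD(4)[OF A[OF rt] y] and ty = functor_cat_HomD(4)[OF t y]
      show "(\<epsilon> W \<bullet>\<^bsub>CY\<^esub> A (FArr rs t)) at y \<bullet> l (?r V) p = (t \<bullet>\<^bsub>CY\<^esub> \<epsilon> V) at y \<bullet> l (?r V) p"
        using Cmp_assoc[OF k(6)[OF rV y p] Ay eW] Al[OF rt y p] Cmp_assoc[OF tp[OF rt p] k(6)[OF rW y p] eW]
          \<epsilon>l[OF W y p] Cmp_assoc[OF k(6)[OF rV y p] eV ty] \<epsilon>l[OF V y p] functor_cat_HomD(5)[OF t h]
        by (simp add: component_simps x y)
    qed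
    then show "\<epsilon> (Cod CY t) \<bullet>\<^bsub>CY\<^esub> A (FArr rs t) = t \<bullet>\<^bsub>CY\<^esub> \<epsilon> (Dom CY t)" by (simp add: V_def W_def)
  next
    fix V assume "V \<in> Obj CX"
    then have V: "V \<in> functors X C" by (simp add: Obj_functor_cat)
    note FV = k(2)[OF V] and rFV = rs_closed[OF k(2)[OF V]]
    show "\<epsilon> (F V) \<bullet>\<^bsub>CY\<^esub> A (\<eta> V) = Idn CY (F V)"
    proof (rule kan_cone_ext_left[OF K[OF V] CY.Cmp_closed[OF A[OF \<eta>[OF V]] \<epsilon>[OF FV]]])
      show "Idn CY (F V) \<in> Hom CY (F V) (F V)" using CY.Idn_closed FV by (simp add: Obj_functor_cat)
      fix y p assume y: "y \<in> Obj Y" and p: "p \<in> Obj (hf y)"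
      have x: "fst p \<in> Obj X" using p by (simp_all add: hf_Obj)
      note e = functor_cat_HomD(4)[OF \<epsilon>[OF FV] y] and a = functor_cat_HomD(4)[OF A[OF \<eta>[OF V]] y]
      show "(\<epsilon> (F V) \<bullet>\<^bsub>CY\<^esub> A (\<eta> V)) at y \<bullet> l V p = Idn CY (F V) at y \<bullet> l V p"
        using Cmp_assoc[OF k(6)[OF V y p] a e] Al[OF \<eta>[OF V] y p] Cmp_assoc[OF tp[OF \<eta>[OF V] p] k(6)[OF rFV y p] e]
          \<epsilon>l[OF FV y p] kan_cone_legs_base(1)[OF K[OF V] y p] Idn_left[OF k(6)[OF V y p]]
        by (simp add: component_simps x y \<eta>c)
    qed
  next
    fix W assume "W \<in> Obj CY"
    then have W: "W \<in> functors Y C" by (simp add: Obj_functor_cat)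
    note rW = rs_closed[OF W]
    show "FArr rs (\<epsilon> W) \<bullet>\<^bsub>CX\<^esub> \<eta> (?r W) = Idn CX (?r W)"
    proof (rule functor_cat_ext[OF CX.Cmp_closed[OF \<eta>[OF rW] rs_Hom[OF \<epsilon>[OF W]]]])
      show "Idn CX (?r W) \<in> Hom CX (?r W) (?r W)" using CX.Idn_closed rW by (simp add: Obj_functor_cat)
      fix x assume x: "x \<in> Obj X"
      show "(FArr rs (\<epsilon> W) \<bullet>\<^bsub>CX\<^esub> \<eta> (?r W)) at x = Idn CX (?r W) at x"
        using \<epsilon>l[OF W fd(3)[OF x] base_point[OF x]] is_functorD(5)[OF functorsD[OF W] fd(3)[OF x]] x
        by (simp add: component_simps \<eta>c rs_Obj)
    qed
  qed (fact K_functor rs_functor)+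
  have right: "adjunction CY CX rs K \<eta>' \<epsilon>'"
    unfolding adjunction_def FObj_restriction KO
  proof (intro conjI ballI)
    show "\<epsilon>' V \<in> Hom CX (?r (F V)) V" if "V \<in> Obj CX" for V using \<epsilon>' that by (simp add: Obj_functor_cat)
    show "\<eta>' W \<in> Hom CY W (F (?r W))" if "W \<in> Obj CY" for W using \<eta>' that by (simp add: Obj_functor_cat)
  next
    fix t assume "t \<in> Arr CX"
    define V W where "V = Dom CX t" and "W = Cod CX t"
    have t: "t \<in> Hom CX V W" using \<open>t \<in> Arr CX\<close> by (simp add: Hom_def V_def W_def)
    note V = functor_cat_HomD(1)[OF t] and W = functor_cat_HomD(2)[OF t]
    have "\<epsilon>' W \<bullet>\<^bsub>CX\<^esub> FArr rs (A t) = t \<bullet>\<^bsub>CX\<^esub> \<epsilon>' V"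
    proof (rule functor_cat_ext[OF CX.Cmp_closed[OF rs_Hom[OF A[OF t]] \<epsilon>'[OF W]] CX.Cmp_closed[OF \<epsilon>'[OF V] t]])
      fix x assume x: "x \<in> Obj X"
      show "(\<epsilon>' W \<bullet>\<^bsub>CX\<^esub> FArr rs (A t)) at x = (t \<bullet>\<^bsub>CX\<^esub> \<epsilon>' V) at x"
        using mA[OF t fd(3)[OF x] base_point[OF x]] x by (simp add: component_simps \<epsilon>'c)
    qed
    then show "\<epsilon>' (Cod CX t) \<bullet>\<^bsub>CX\<^esub> FArr rs (A t) = t \<bullet>\<^bsub>CX\<^esub> \<epsilon>' (Dom CX t)" by (simp add: V_def W_def)
  next
    fix t assume "t \<in> Arr CY"
    define V W where "V = Dom CY t" and "W = Cod CY t"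
    have t: "t \<in> Hom CY V W" using \<open>t \<in> Arr CY\<close> by (simp add: Hom_def V_def W_def)
    note V = functor_cat_HomD(1)[OF t] and W = functor_cat_HomD(2)[OF t]
    note rt = rs_Hom[OF t] and rV = rs_closed[OF V] and rW = rs_closed[OF W]
    have "\<eta>' W \<bullet>\<^bsub>CY\<^esub> t = A (FArr rs t) \<bullet>\<^bsub>CY\<^esub> \<eta>' V"
    proof (rule kan_cone_ext_right[OF K[OF rW] CY.Cmp_closed[OF t \<eta>'[OF W]] CY.Cmp_closed[OF \<eta>'[OF V] A[OF rt]]])
      fix y p assume y: "y \<in> Obj Y" and p: "p \<in> Obj (hf y)"
      have x: "fst p \<in> Obj X" and h: "snd p \<in> Hom Y (FObj f (fst p)) y" using p by (simp_all add: hf_Obj)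
      note eW = functor_cat_HomD(4)[OF \<eta>'[OF W] y] and eV = functor_cat_HomD(4)[OF \<eta>'[OF V] y]
      note Ay = functor_cat_HomD(4)[OF A[OF rt] y] and ty = functor_cat_HomD(4)[OF t y]
      show "m (?r W) p \<bullet> (\<eta>' W \<bullet>\<^bsub>CY\<^esub> t) at y = m (?r W) p \<bullet> (A (FArr rs t) \<bullet>\<^bsub>CY\<^esub> \<eta>' V) at y"
        using Cmp_assoc[OF ty eW k(7)[OF rW y p]] m\<eta>[OF W y p] Cmp_assoc[OF eV Ay k(7)[OF rW y p]] mA[OF rt y p]
          Cmp_assoc[OF eV k(7)[OF rV y p] tp[OF rt p]] m\<eta>[OF V y p]
          functor_cat_HomD(5)[OF t groupoid_inv(1)[OF Y.groupoid h]]
        by (simp add: component_simps x y)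
    qed
    then show "\<eta>' (Cod CY t) \<bullet>\<^bsub>CY\<^esub> t = A (FArr rs t) \<bullet>\<^bsub>CY\<^esub> \<eta>' (Dom CY t)" by (simp add: V_def W_def)
  next
    fix V assume "V \<in> Obj CX"
    then have V: "V \<in> functors X C" by (simp add: Obj_functor_cat)
    note FV = k(2)[OF V] and rFV = rs_closed[OF k(2)[OF V]]
    show "A (\<epsilon>' V) \<bullet>\<^bsub>CY\<^esub> \<eta>' (F V) = Idn CY (F V)"
    proof (rule kan_cone_ext_right[OF K[OF V] CY.Cmp_closed[OF \<eta>'[OF FV] A[OF \<epsilon>'[OF V]]]])
      show "Idn CY (F V) \<in> Hom CY (F V) (F V)" using CY.Idn_closed FV by (simp add: Obj_functor_cat)
      fix y p assume y: "y \<in> Obj Y" and p: "p \<in> Obj (hf y)"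
      have x: "fst p \<in> Obj X" using p by (simp_all add: hf_Obj)
      note e = functor_cat_HomD(4)[OF \<eta>'[OF FV] y] and a = functor_cat_HomD(4)[OF A[OF \<epsilon>'[OF V]] y]
      show "m V p \<bullet> (A (\<epsilon>' V) \<bullet>\<^bsub>CY\<^esub> \<eta>' (F V)) at y = m V p \<bullet> Idn CY (F V) at y"
        using Cmp_assoc[OF e a k(7)[OF V y p]] mA[OF \<epsilon>'[OF V] y p] Cmp_assoc[OF e k(7)[OF rFV y p] tp[OF \<epsilon>'[OF V] p]]
          m\<eta>[OF FV y p] kan_cone_legs_base(2)[OF K[OF V] y p] Idn_right[OF k(7)[OF V y p]]
        by (simp add: component_simps x y \<epsilon>'c)
    qed
  next
    fix W assume "W \<in> Obj CY"
    then have W: "W \<in> functors Y C" by (simp add: Obj_functor_cat)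
    note rW = rs_closed[OF W]
    show "\<epsilon>' (?r W) \<bullet>\<^bsub>CX\<^esub> FArr rs (\<eta>' W) = Idn CX (?r W)"
    proof (rule functor_cat_ext[OF CX.Cmp_closed[OF rs_Hom[OF \<eta>'[OF W]] \<epsilon>'[OF rW]]])
      show "Idn CX (?r W) \<in> Hom CX (?r W) (?r W)" using CX.Idn_closed rW by (simp add: Obj_functor_cat)
      fix x assume x: "x \<in> Obj X"
      show "(\<epsilon>' (?r W) \<bullet>\<^bsub>CX\<^esub> FArr rs (\<eta>' W)) at x = Idn CX (?r W) at x"
        using m\<eta>[OF W fd(3)[OF x] base_point[OF x]] is_functorD(5)[OF functorsD[OF W] fd(3)[OF x]] x
          Y.inv_arr_Idn[OF fd(3)[OF x]]
        by (simp add: component_simps \<epsilon>'c rs_Obj)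
    qed
  qed (fact K_functor rs_functor)+
  show "\<exists>L \<eta> \<epsilon>. adjunction CX CY L rs \<eta> \<epsilon>" using left by blast
  show "\<exists>R \<eta> \<epsilon>. adjunction CY CX rs R \<eta> \<epsilon>" using right by blast
qed

abbreviation "T \<equiv> kan X Y C f"

lemma kan_adjunctions:
  "adjunction CX CY (lower_shriek T) rs (shriek_unit T) (shriek_counit T)"
  "adjunction CY CX rs (lower_star T) (star_unit T) (star_counit T)"
proof -
  let ?P = "\<lambda>(L, \<eta>, \<epsilon>). adjunction CX CY L rs \<eta> \<epsilon>" and ?Q = "\<lambda>(R, \<eta>, \<epsilon>). adjunction CY CX rs R \<eta> \<epsilon>"
  have P: "?P (Eps ?P)" by (rule someI_ex) (use adjoints_exist(1) in auto)
  have Q: "?Q (Eps ?Q)" by (rule someI_ex) (use adjoints_exist(2) in auto)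
  obtain L \<eta> \<epsilon> where 1: "Eps ?P = (L, \<eta>, \<epsilon>)" by (cases "Eps ?P")
  obtain R \<eta>' \<epsilon>' where 2: "Eps ?Q = (R, \<eta>', \<epsilon>')" by (cases "Eps ?Q")
  show "adjunction CX CY (lower_shriek T) rs (shriek_unit T) (shriek_counit T)"
    "adjunction CY CX rs (lower_star T) (star_unit T) (star_counit T)"
    using P Q unfolding kan_def 1 2 by simp_all
qed

lemma kan_sel: "pull T = rs" "pull_mult T V W = Idn CX (re (V \<boxtimes>\<^bsub>CY\<^esub> W))"
  by (simp_all add: kan_def case_prod_beta Let_def)

subsection \<open>Arbitrary adjoints are two-sided Kan extensions\<close>

abbreviation "Lo V \<equiv> FObj (lower_shriek T) V"
abbreviation "La t \<equiv> FArr (lower_shriek T) t"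
abbreviation "Ro V \<equiv> FObj (lower_star T) V"
abbreviation "Ra t \<equiv> FArr (lower_star T) t"
abbreviation "lg V \<equiv> shriek_leg X Y C f V"

text \<open>The projection \<open>f\<^sub>* V (y) \<rightarrow> f\<^sub>* V (f x) \<rightarrow> V x\<close> at \<open>p = (x, h)\<close>, dual to the leg of \<open>f\<^sub>! V\<close>.\<close>

definition pr :: "('x, 'y, 'o, 'm) cfunctor \<Rightarrow> 'x \<times> 'w \<Rightarrow> 'm" where
  "pr V p = star_counit T V at (fst p) \<bullet> FArr (Ro V) (inv_arr Y (snd p))"

lemma lg_eq: "lg V p = FArr (Lo V) (snd p) \<bullet> shriek_unit T V at (fst p)"
  by (simp add: shriek_leg_def case_prod_beta)

lemmas Lad = adjunctionD[OF kan_adjunctions(1), unfolded FObj_restriction Obj_functor_cat]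
lemmas Rad = adjunctionD[OF kan_adjunctions(2), unfolded FObj_restriction Obj_functor_cat]
lemmas Lfun = is_functorD[OF Lad(1), unfolded Obj_functor_cat]
lemmas Rfun = is_functorD[OF Rad(2), unfolded Obj_functor_cat]

text \<open>The cocone \<open>lg\<close> and any two-sided Kan extension \<open>F\<close> are both universal, the former by the
  adjunction, so \<open>f\<^sub>! V\<close> is isomorphic to \<open>F\<close> and the projections of \<open>F\<close> can be transported.\<close>

lemma left_cone:
  assumes V: "V \<in> functors X C"
  shows "\<exists>m. kan_cone V (Lo V) (lg V) m"
proof -
  obtain F l m where K: "kan_cone V F l m" using kan_cone_exists[OF V] by blast
  note k = kan_coneD[OF K] and unit = kan_cone_unit(1)[OF K]
  note LV = Lfun(3)[OF V]
  note Fd = is_functorD[OF functorsD[OF k(2)]] and Ld = is_functorD[OF functorsD[OF LV]]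
  note Vd = is_functorD[OF functorsD[OF V]]
  note \<eta> = functor_cat_HomD[OF Lad(3)[OF V]]
  have e: "shriek_unit T V at x \<in> Hom C (FObj V x) (FObj (Lo V) (FObj f x))" if "x \<in> Obj X" for x
    using \<eta>(4)[OF that] by (simp add: rs_Obj that)
  have h: "snd p \<in> Hom Y (FObj f (fst p)) y" and x: "fst p \<in> Obj X" if "p \<in> Obj (hf y)" for p y
    using that by (simp_all add: hf_Obj)
  let ?b = "\<lambda>x. (x, Idn Y (FObj f x))"
  let ?\<theta> = "shriek_counit T F \<bullet>\<^bsub>CY\<^esub> La (V, re F, \<lambda>x\<in>Obj X. l (?b x))"
  have \<theta>: "?\<theta> \<in> Hom CY (Lo V) F"
    and \<theta>\<eta>: "FArr rs ?\<theta> \<bullet>\<^bsub>CX\<^esub> shriek_unit T V = (V, re F, \<lambda>x\<in>Obj X. l (?b x))"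
    using adjunction_left_mate[OF kan_adjunctions(1), of V F, unfolded FObj_restriction Obj_functor_cat, OF V k(2) unit]
    by auto
  note \<theta>c = functor_cat_HomD(4)[OF \<theta>]
  have lg: "lg V p \<in> Hom C (FObj V (fst p)) (FObj (Lo V) y)" if p: "p \<in> Obj (hf y)" for p y
    unfolding lg_eq by (rule Cmp_closed[OF e[OF x[OF p]] Ld(4)[OF h[OF p]]])
  have lg_push: "FArr (Lo V) j \<bullet> lg V p = lg V (push j p)" if j: "j \<in> Hom Y y y'" and p: "p \<in> Obj (hf y)" for j y y' p
    using Cmp_assoc[OF e[OF x[OF p]] Ld(4)[OF h[OF p]] Ld(4)[OF j]] Ld(6)[OF h[OF p] j] by (simp add: lg_eq)
  have lg_fib: "lg V q \<bullet> FArr V (snd (snd \<kappa>)) = lg V p" if y: "y \<in> Obj Y" and \<kappa>: "\<kappa> \<in> Hom (hf y) p q" for y p q \<kappa>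
  proof -
    have p: "p \<in> Obj (hf y)" and q: "q \<in> Obj (hf y)" and u: "snd (snd \<kappa>) \<in> Hom X (fst p) (fst q)"
      and e': "snd q \<bullet>\<^bsub>Y\<^esub> FArr f (snd (snd \<kappa>)) = snd p"
      using \<kappa> by (simp_all add: hf_Hom)
    note fu = fd(4)[OF u]
    have "lg V q \<bullet> FArr V (snd (snd \<kappa>)) = FArr (Lo V) (snd q) \<bullet> (FArr (Lo V) (FArr f (snd (snd \<kappa>))) \<bullet> shriek_unit T V at (fst p))"
      using Cmp_assoc[OF Vd(4)[OF u] e[OF x[OF q]] Ld(4)[OF h[OF q]]] \<eta>(5)[OF u] by (simp add: lg_eq rs_Arr[OF u])
    also have "\<dots> = lg V p"
      using Cmp_assoc[OF e[OF x[OF p]] Ld(4)[OF fu] Ld(4)[OF h[OF q]]] Ld(6)[OF fu h[OF q]] e' by (simp add: lg_eq)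
    finally show ?thesis .
  qed
  have \<theta>\<eta>x: "?\<theta> at (FObj f x) \<bullet> shriek_unit T V at x = l (?b x)" if x: "x \<in> Obj X" for x
    using arg_cong[OF \<theta>\<eta>, of "\<lambda>t. t at x"] x component_Cmp[OF x, of C "FArr rs ?\<theta>" "shriek_unit T V"]
      component_restriction[OF x, of f ?\<theta>] by simp
  have \<theta>l: "?\<theta> at y \<bullet> lg V p = l p" if y: "y \<in> Obj Y" and p: "p \<in> Obj (hf y)" for y p
  proof -
    note fx = fd(3)[OF x[OF p]] and e = e[OF x[OF p]] and h = h[OF p]
    have "?\<theta> at y \<bullet> lg V p = FArr F (snd p) \<bullet> (?\<theta> at (FObj f (fst p)) \<bullet> shriek_unit T V at (fst p))"
      using Cmp_assoc[OF e Ld(4)[OF h] \<theta>c[OF y]] functor_cat_HomD(5)[OF \<theta> h] Cmp_assoc[OF e \<theta>c[OF fx] Fd(4)[OF h]]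
      by (simp add: lg_eq)
    also have "\<dots> = l p" unfolding \<theta>\<eta>x[OF x[OF p]] by (rule kan_cone_legs_base(1)[OF K y p])
    finally show ?thesis .
  qed
  \<comment> \<open>\<open>\<theta>\<close> comes from the adjunction, its inverse \<open>\<theta>'\<close> from the colimit property of \<open>F\<close>\<close>
  obtain \<theta>' where \<theta>': "\<theta>' \<in> Hom CY F (Lo V)"
    and \<theta>'l: "\<And>y p. y \<in> Obj Y \<Longrightarrow> p \<in> Obj (hf y) \<Longrightarrow> \<theta>' at y \<bullet> l p = lg V p"
    using kan_cone_out[OF K LV, of "lg V"] lg lg_fib lg_push by blast
  note \<theta>'c = functor_cat_HomD(4)[OF \<theta>']
  have idF: "Idn CY F \<in> Hom CY F F" and idL: "Idn CY (Lo V) \<in> Hom CY (Lo V) (Lo V)"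
    using CY.Idn_closed k(2) LV by (simp_all add: Obj_functor_cat)
  have inv1: "?\<theta> \<bullet>\<^bsub>CY\<^esub> \<theta>' = Idn CY F"
  proof (rule kan_cone_ext_left[OF K CY.Cmp_closed[OF \<theta>' \<theta>] idF])
    fix y p assume y: "y \<in> Obj Y" and p: "p \<in> Obj (hf y)"
    show "(?\<theta> \<bullet>\<^bsub>CY\<^esub> \<theta>') at y \<bullet> l p = Idn CY F at y \<bullet> l p"
      using Cmp_assoc[OF k(6)[OF y p] \<theta>'c[OF y] \<theta>c[OF y]] \<theta>'l[OF y p] \<theta>l[OF y p] Idn_left[OF k(6)[OF y p]] y
        component_Cmp[OF y, of C ?\<theta> \<theta>'] component_Idn[OF y, of C F] by simp
  qed
  have inv2: "\<theta>' \<bullet>\<^bsub>CY\<^esub> ?\<theta> = Idn CY (Lo V)"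
  proof (rule adjunction_left_unique[OF kan_adjunctions(1), of V, unfolded Obj_functor_cat, OF V CY.Cmp_closed[OF \<theta> \<theta>'] idL])
    show "FArr rs (\<theta>' \<bullet>\<^bsub>CY\<^esub> ?\<theta>) \<bullet>\<^bsub>CX\<^esub> shriek_unit T V = FArr rs (Idn CY (Lo V)) \<bullet>\<^bsub>CX\<^esub> shriek_unit T V"
    proof (rule functor_cat_ext[OF CX.Cmp_closed[OF Lad(3)[OF V] rs_Hom[OF CY.Cmp_closed[OF \<theta> \<theta>']]]
            CX.Cmp_closed[OF Lad(3)[OF V] rs_Hom[OF idL]]])
      fix x assume x: "x \<in> Obj X"
      note fx = fd(3)[OF x] and e = e[OF x]
      have "(\<theta>' \<bullet>\<^bsub>CY\<^esub> ?\<theta>) at (FObj f x) \<bullet> shriek_unit T V at x = \<theta>' at (FObj f x) \<bullet> l (?b x)"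
        using Cmp_assoc[OF e \<theta>c[OF fx] \<theta>'c[OF fx]] \<theta>\<eta>x[OF x] component_Cmp[OF fx, of C \<theta>' ?\<theta>] by simp
      also have "\<dots> = shriek_unit T V at x"
        using \<theta>'l[OF fx base_point[OF x]] Ld(5)[OF fx] Idn_left[OF e] by (simp add: lg_eq)
      finally show "(FArr rs (\<theta>' \<bullet>\<^bsub>CY\<^esub> ?\<theta>) \<bullet>\<^bsub>CX\<^esub> shriek_unit T V) at x
          = (FArr rs (Idn CY (Lo V)) \<bullet>\<^bsub>CX\<^esub> shriek_unit T V) at x"
        using Idn_left[OF e] component_Cmp[OF x, of C "FArr rs (\<theta>' \<bullet>\<^bsub>CY\<^esub> ?\<theta>)" "shriek_unit T V"]
          component_Cmp[OF x, of C "FArr rs (Idn CY (Lo V))" "shriek_unit T V"]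
          component_restriction[OF x, of f "\<theta>' \<bullet>\<^bsub>CY\<^esub> ?\<theta>"] component_restriction[OF x, of f "Idn CY (Lo V)"]
          component_Idn[OF fx, of C "Lo V"] by simp
    qed
  qed
  define m' where "m' p = m p \<bullet> ?\<theta> at (Cod Y (snd p))" for p
  have m': "m' p = m p \<bullet> ?\<theta> at y" if "p \<in> Obj (hf y)" for p y
    using that by (simp add: m'_def hf_Obj Hom_def)
  have "kan_cone V (Lo V) (lg V) m'"
    unfolding kan_cone_def
  proof (intro conjI ballI allI V LV)
    fix y assume y: "y \<in> Obj Y"
    have "\<theta>' at y \<bullet> ?\<theta> at y = Idn C (FObj (Lo V) y)"
      "?\<theta> at y \<bullet> \<theta>' at y = Idn C (FObj F y)"
      using arg_cong[OF inv1, of "\<lambda>t. t at y"] arg_cong[OF inv2, of "\<lambda>t. t at y"]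
        component_Cmp[OF y, of C ?\<theta> \<theta>'] component_Cmp[OF y, of C \<theta>' ?\<theta>]
        component_Idn[OF y, of C F] component_Idn[OF y, of C "Lo V"] by simp_all
    from bilimit_iso[OF hf_ess_finite k(3)[OF y] fib_functor[OF V] \<theta>'c[OF y] \<theta>c[OF y] this(2,1)]
    show "bilimit (hf y) (fib V y) (FObj (Lo V) y) (lg V) m'"
      by (rule bilimit_cong[OF hf_ess_finite]) (simp_all add: \<theta>'l[OF y] m')
  next
    fix y y' j p assume j: "j \<in> Hom Y y y'" and p: "p \<in> Obj (hf y)"
    note y = Y.Hom_obj[OF j] and p' = push_closed[OF j p]
    show "FArr (Lo V) j \<bullet> lg V p = lg V (push j p)" by (rule lg_push[OF j p])
    show "m' (push j p) \<bullet> FArr (Lo V) j = m' p"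
      unfolding m'[OF p'] m'[OF p]
      using Cmp_assoc[OF Ld(4)[OF j] \<theta>c[OF y(2)] k(7)[OF y(2) p']] functor_cat_HomD(5)[OF \<theta> j]
        Cmp_assoc[OF \<theta>c[OF y(1)] Fd(4)[OF j] k(7)[OF y(2) p']] k(5)[OF j p] by simp
  qed
  then show ?thesis by blast
qed

lemma right_cone:
  assumes V: "V \<in> functors X C"
  shows "\<exists>n. kan_cone V (Ro V) n (pr V)"
proof -
  obtain F l m where K: "kan_cone V F l m" using kan_cone_exists[OF V] by blast
  note k = kan_coneD[OF K] and unit = kan_cone_unit(2)[OF K]
  note RV = Rfun(3)[OF V]
  note Fd = is_functorD[OF functorsD[OF k(2)]] and Rd = is_functorD[OF functorsD[OF RV]]
  note Vd = is_functorD[OF functorsD[OF V]]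
  note \<epsilon> = functor_cat_HomD[OF Rad(4)[OF V]]
  let ?b = "\<lambda>x. (x, Idn Y (FObj f x))"
  let ?\<theta> = "Ra (re F, V, \<lambda>x\<in>Obj X. m (?b x)) \<bullet>\<^bsub>CY\<^esub> star_unit T F"
  have \<theta>: "?\<theta> \<in> Hom CY F (Ro V)"
    and \<epsilon>\<theta>: "star_counit T V \<bullet>\<^bsub>CX\<^esub> FArr rs ?\<theta> = (re F, V, \<lambda>x\<in>Obj X. m (?b x))"
    using adjunction_right_mate[OF kan_adjunctions(2), of F V, unfolded FObj_restriction Obj_functor_cat, OF k(2) V unit]
    by auto
  note \<theta>c = functor_cat_HomD(4)[OF \<theta>]
  have e: "star_counit T V at x \<in> Hom C (FObj (Ro V) (FObj f x)) (FObj V x)" if "x \<in> Obj X" for x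
    using \<epsilon>(4)[OF that] by (simp add: rs_Obj that)
  have h: "snd p \<in> Hom Y (FObj f (fst p)) y" and x: "fst p \<in> Obj X" if "p \<in> Obj (hf y)" for p y
    using that by (simp_all add: hf_Obj)
  note ih = groupoid_inv(1)[OF Y.groupoid h]
  have pr: "pr V p \<in> Hom C (FObj (Ro V) y) (FObj V (fst p))" if p: "p \<in> Obj (hf y)" for p y
    unfolding pr_def by (rule Cmp_closed[OF Rd(4)[OF ih[OF p]] e[OF x[OF p]]])
  have pr_push: "pr V (push j p) \<bullet> FArr (Ro V) j = pr V p" if j: "j \<in> Hom Y y y'" and p: "p \<in> Obj (hf y)" for j y y' p
  proof -
    note i = groupoid_inv(1)[OF Y.groupoid Y.Cmp_closed[OF h[OF p] j]] and ij = groupoid_inv[OF Y.groupoid j]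
    have "inv_arr Y (j \<bullet>\<^bsub>Y\<^esub> snd p) \<bullet>\<^bsub>Y\<^esub> j = inv_arr Y (snd p)"
      using groupoid_inv_cmp[OF Y.groupoid h[OF p] j] Y.Cmp_assoc[OF j ij(1) ih[OF p]] ij(2) Y.Idn_right[OF ih[OF p]] by simp
    then show ?thesis
      using Cmp_assoc[OF Rd(4)[OF j] Rd(4)[OF i] e[OF x[OF p]]] Rd(6)[OF j i] by (simp add: pr_def)
  qed
  have pr_fib: "FArr V (snd (snd \<kappa>)) \<bullet> pr V p = pr V q" if y: "y \<in> Obj Y" and \<kappa>: "\<kappa> \<in> Hom (hf y) p q" for y p q \<kappa>
  proof -
    have p: "p \<in> Obj (hf y)" and q: "q \<in> Obj (hf y)" and u: "snd (snd \<kappa>) \<in> Hom X (fst p) (fst q)"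
      and e': "snd q \<bullet>\<^bsub>Y\<^esub> FArr f (snd (snd \<kappa>)) = snd p"
      using \<kappa> by (simp_all add: hf_Hom)
    note fu = fd(4)[OF u]
    have "inv_arr Y (snd p) = inv_arr Y (FArr f (snd (snd \<kappa>))) \<bullet>\<^bsub>Y\<^esub> inv_arr Y (snd q)"
      using groupoid_inv_cmp[OF Y.groupoid fu h[OF q]] e' by simp
    then have i: "FArr f (snd (snd \<kappa>)) \<bullet>\<^bsub>Y\<^esub> inv_arr Y (snd p) = inv_arr Y (snd q)"
      using groupoid_cancel_left'[OF Y.groupoid fu ih[OF q]] by simp
    have "FArr V (snd (snd \<kappa>)) \<bullet> pr V p
        = (star_counit T V at (fst q) \<bullet> FArr (Ro V) (FArr f (snd (snd \<kappa>)))) \<bullet> FArr (Ro V) (inv_arr Y (snd p))"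
      using Cmp_assoc[OF Rd(4)[OF ih[OF p]] e[OF x[OF p]] Vd(4)[OF u]] \<epsilon>(5)[OF u] by (simp add: pr_def rs_Arr[OF u])
    also have "\<dots> = pr V q"
      using Cmp_assoc[OF Rd(4)[OF ih[OF p]] Rd(4)[OF fu] e[OF x[OF q]]] Rd(6)[OF ih[OF p] fu] i by (simp add: pr_def)
    finally show ?thesis .
  qed
  have \<epsilon>\<theta>x: "star_counit T V at x \<bullet> ?\<theta> at (FObj f x) = m (?b x)" if x: "x \<in> Obj X" for x
    using arg_cong[OF \<epsilon>\<theta>, of "\<lambda>t. t at x"] x component_Cmp[OF x, of C "star_counit T V" "FArr rs ?\<theta>"]
      component_restriction[OF x, of f ?\<theta>] by simp
  have pr\<theta>: "pr V p \<bullet> ?\<theta> at y = m p" if y: "y \<in> Obj Y" and p: "p \<in> Obj (hf y)" for y p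
  proof -
    note fx = fd(3)[OF x[OF p]] and i = ih[OF p]
    have "pr V p \<bullet> ?\<theta> at y = (star_counit T V at (fst p) \<bullet> ?\<theta> at (FObj f (fst p))) \<bullet> FArr F (inv_arr Y (snd p))"
      using Cmp_assoc[OF \<theta>c[OF y] Rd(4)[OF i] e[OF x[OF p]]] functor_cat_HomD(5)[OF \<theta> i]
        Cmp_assoc[OF Fd(4)[OF i] \<theta>c[OF fx] e[OF x[OF p]]] by (simp add: pr_def)
    also have "\<dots> = m p" unfolding \<epsilon>\<theta>x[OF x[OF p]] by (rule kan_cone_legs_base(2)[OF K y p])
    finally show ?thesis .
  qed
  obtain \<theta>' where \<theta>': "\<theta>' \<in> Hom CY (Ro V) F"
    and m\<theta>': "\<And>y p. y \<in> Obj Y \<Longrightarrow> p \<in> Obj (hf y) \<Longrightarrow> m p \<bullet> \<theta>' at y = pr V p"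
    using kan_cone_in[OF K RV, of "pr V"] pr pr_fib pr_push by blast
  note \<theta>'c = functor_cat_HomD(4)[OF \<theta>']
  have idF: "Idn CY F \<in> Hom CY F F" and idR: "Idn CY (Ro V) \<in> Hom CY (Ro V) (Ro V)"
    using CY.Idn_closed k(2) RV by (simp_all add: Obj_functor_cat)
  have inv1: "\<theta>' \<bullet>\<^bsub>CY\<^esub> ?\<theta> = Idn CY F"
  proof (rule kan_cone_ext_right[OF K CY.Cmp_closed[OF \<theta> \<theta>'] idF])
    fix y p assume y: "y \<in> Obj Y" and p: "p \<in> Obj (hf y)"
    show "m p \<bullet> (\<theta>' \<bullet>\<^bsub>CY\<^esub> ?\<theta>) at y = m p \<bullet> Idn CY F at y"
      using Cmp_assoc[OF \<theta>c[OF y] \<theta>'c[OF y] k(7)[OF y p]] m\<theta>'[OF y p] pr\<theta>[OF y p] Idn_right[OF k(7)[OF y p]]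
        component_Cmp[OF y, of C \<theta>' ?\<theta>] component_Idn[OF y, of C F] by simp
  qed
  have inv2: "?\<theta> \<bullet>\<^bsub>CY\<^esub> \<theta>' = Idn CY (Ro V)"
  proof (rule adjunction_right_unique[OF kan_adjunctions(2), of V, unfolded Obj_functor_cat, OF V CY.Cmp_closed[OF \<theta>' \<theta>] idR])
    show "star_counit T V \<bullet>\<^bsub>CX\<^esub> FArr rs (?\<theta> \<bullet>\<^bsub>CY\<^esub> \<theta>') = star_counit T V \<bullet>\<^bsub>CX\<^esub> FArr rs (Idn CY (Ro V))"
    proof (rule functor_cat_ext[OF CX.Cmp_closed[OF rs_Hom[OF CY.Cmp_closed[OF \<theta>' \<theta>]] Rad(4)[OF V]]
            CX.Cmp_closed[OF rs_Hom[OF idR] Rad(4)[OF V]]])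
      fix x assume x: "x \<in> Obj X"
      note fx = fd(3)[OF x]
      have "star_counit T V at x \<bullet> (?\<theta> \<bullet>\<^bsub>CY\<^esub> \<theta>') at (FObj f x) = m (?b x) \<bullet> \<theta>' at (FObj f x)"
        using Cmp_assoc[OF \<theta>'c[OF fx] \<theta>c[OF fx] e[OF x]] \<epsilon>\<theta>x[OF x] component_Cmp[OF fx, of C ?\<theta> \<theta>'] by simp
      also have "\<dots> = star_counit T V at x"
        using m\<theta>'[OF fx base_point[OF x]] Rd(5)[OF fx] Idn_right[OF e[OF x]] Y.inv_arr_Idn[OF fx] by (simp add: pr_def)
      finally show "(star_counit T V \<bullet>\<^bsub>CX\<^esub> FArr rs (?\<theta> \<bullet>\<^bsub>CY\<^esub> \<theta>')) at x
          = (star_counit T V \<bullet>\<^bsub>CX\<^esub> FArr rs (Idn CY (Ro V))) at x"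
        using Idn_right[OF e[OF x]] component_Cmp[OF x, of C "star_counit T V" "FArr rs (?\<theta> \<bullet>\<^bsub>CY\<^esub> \<theta>')"]
          component_Cmp[OF x, of C "star_counit T V" "FArr rs (Idn CY (Ro V))"]
          component_restriction[OF x, of f "?\<theta> \<bullet>\<^bsub>CY\<^esub> \<theta>'"] component_restriction[OF x, of f "Idn CY (Ro V)"]
          component_Idn[OF fx, of C "Ro V"] by simp
    qed
  qed
  define n where "n p = ?\<theta> at (Cod Y (snd p)) \<bullet> l p" for p
  have n: "n p = ?\<theta> at y \<bullet> l p" if "p \<in> Obj (hf y)" for p y
    using that by (simp add: n_def hf_Obj Hom_def)
  have "kan_cone V (Ro V) n (pr V)"
    unfolding kan_cone_def
  proof (intro conjI ballI allI V RV)
    fix y assume y: "y \<in> Obj Y"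
    have "\<theta>' at y \<bullet> ?\<theta> at y = Idn C (FObj F y)"
      "?\<theta> at y \<bullet> \<theta>' at y = Idn C (FObj (Ro V) y)"
      using arg_cong[OF inv1, of "\<lambda>t. t at y"] arg_cong[OF inv2, of "\<lambda>t. t at y"]
        component_Cmp[OF y, of C ?\<theta> \<theta>'] component_Cmp[OF y, of C \<theta>' ?\<theta>]
        component_Idn[OF y, of C F] component_Idn[OF y, of C "Ro V"] by simp_all
    from bilimit_iso[OF hf_ess_finite k(3)[OF y] fib_functor[OF V] \<theta>c[OF y] \<theta>'c[OF y] this]
    show "bilimit (hf y) (fib V y) (FObj (Ro V) y) n (pr V)"
      by (rule bilimit_cong[OF hf_ess_finite]) (simp_all add: m\<theta>'[OF y] n)
  next
    fix y y' j p assume j: "j \<in> Hom Y y y'" and p: "p \<in> Obj (hf y)"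
    note y = Y.Hom_obj[OF j] and p' = push_closed[OF j p]
    show "pr V (push j p) \<bullet> FArr (Ro V) j = pr V p" by (rule pr_push[OF j p])
    show "FArr (Ro V) j \<bullet> n p = n (push j p)"
      unfolding n[OF p'] n[OF p]
      using Cmp_assoc[OF k(6)[OF y(1) p] \<theta>c[OF y(1)] Rd(4)[OF j]] functor_cat_HomD(5)[OF \<theta> j]
        Cmp_assoc[OF k(6)[OF y(1) p] Fd(4)[OF j] \<theta>c[OF y(2)]] k(4)[OF j p] by simp
  qed
  then show ?thesis by blast
qed

lemma lg_closed: "V \<in> functors X C \<Longrightarrow> y \<in> Obj Y \<Longrightarrow> p \<in> Obj (hf y) \<Longrightarrow> lg V p \<in> Hom C (FObj V (fst p)) (FObj (Lo V) y)"
  using left_cone kan_coneD(6) by blast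

lemma pr_closed: "V \<in> functors X C \<Longrightarrow> y \<in> Obj Y \<Longrightarrow> p \<in> Obj (hf y) \<Longrightarrow> pr V p \<in> Hom C (FObj (Ro V) y) (FObj V (fst p))"
  using right_cone kan_coneD(7) by blast

lemma unit_component: "V \<in> functors X C \<Longrightarrow> x \<in> Obj X \<Longrightarrow>
    shriek_unit T V at x \<in> Hom C (FObj V x) (FObj (Lo V) (FObj f x))"
  using functor_cat_HomD(4)[OF Lad(3)] by (metis rs_Obj)

lemma counit_component: "V \<in> functors X C \<Longrightarrow> x \<in> Obj X \<Longrightarrow>
    star_counit T V at x \<in> Hom C (FObj (Ro V) (FObj f x)) (FObj V x)"
  using functor_cat_HomD(4)[OF Rad(4)] by (metis rs_Obj)

text \<open>On legs and projections the functors, units and counits of the chosen adjunctions become explicit.\<close>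

lemma La_lg:
  assumes t: "t \<in> Hom CX V W" and y: "y \<in> Obj Y" and p: "p \<in> Obj (hf y)"
  shows "La t at y \<bullet> lg V p = lg W p \<bullet> t at (fst p)"
proof -
  have x: "fst p \<in> Obj X" and h: "snd p \<in> Hom Y (FObj f (fst p)) y" using p by (simp_all add: hf_Obj)
  note V = functor_cat_HomD(1)[OF t] and W = functor_cat_HomD(2)[OF t]
  note tx = functor_cat_HomD(4)[OF t x] and Lt = functor_cat_HomD(4)[OF Lfun(4)[OF t]]
  note LV = is_functorD(4)[OF functorsD[OF Lfun(3)[OF V]] h] and LW = is_functorD(4)[OF functorsD[OF Lfun(3)[OF W]] h]
  note eV = unit_component[OF V x] and eW = unit_component[OF W x]
  have nat: "La t at (FObj f (fst p)) \<bullet> shriek_unit T V at (fst p)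
      = shriek_unit T W at (fst p) \<bullet> t at (fst p)"
    using arg_cong[OF Lad(5)[OF t], of "\<lambda>a. a at (fst p)"] x by (simp add: component_simps)
  show ?thesis
    using Cmp_assoc[OF eV LV Lt[OF y]] functor_cat_HomD(5)[OF Lfun(4)[OF t] h] Cmp_assoc[OF eV Lt[OF fd(3)[OF x]] LW]
      nat Cmp_assoc[OF tx eW LW] by (simp add: lg_eq)
qed

lemma pr_Ra:
  assumes t: "t \<in> Hom CX V W" and y: "y \<in> Obj Y" and p: "p \<in> Obj (hf y)"
  shows "pr W p \<bullet> Ra t at y = t at (fst p) \<bullet> pr V p"
proof -
  have x: "fst p \<in> Obj X" and h: "snd p \<in> Hom Y (FObj f (fst p)) y" using p by (simp_all add: hf_Obj)
  note ih = groupoid_inv(1)[OF Y.groupoid h]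
  note V = functor_cat_HomD(1)[OF t] and W = functor_cat_HomD(2)[OF t]
  note tx = functor_cat_HomD(4)[OF t x] and Rt = functor_cat_HomD(4)[OF Rfun(4)[OF t]]
  note RV = is_functorD(4)[OF functorsD[OF Rfun(3)[OF V]] ih] and RW = is_functorD(4)[OF functorsD[OF Rfun(3)[OF W]] ih]
  note eV = counit_component[OF V x] and eW = counit_component[OF W x]
  have nat: "star_counit T W at (fst p) \<bullet> Ra t at (FObj f (fst p))
      = t at (fst p) \<bullet> star_counit T V at (fst p)"
    using arg_cong[OF Rad(6)[OF t], of "\<lambda>a. a at (fst p)"] x by (simp add: component_simps)
  show ?thesis
    using Cmp_assoc[OF Rt[OF y] RW eW] functor_cat_HomD(5)[OF Rfun(4)[OF t] ih] Cmp_assoc[OF RV Rt[OF fd(3)[OF x]] eW]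
      nat Cmp_assoc[OF RV eV tx] by (simp add: pr_def)
qed

lemma counit_lg:
  assumes W: "W \<in> functors Y C" and y: "y \<in> Obj Y" and p: "p \<in> Obj (hf y)"
  shows "shriek_counit T W at y \<bullet> lg (re W) p = FArr W (snd p)"
proof -
  have x: "fst p \<in> Obj X" and h: "snd p \<in> Hom Y (FObj f (fst p)) y" using p by (simp_all add: hf_Obj)
  note rW = rs_closed[OF W] and Wd = is_functorD[OF functorsD[OF W]]
  note LV = is_functorD(4)[OF functorsD[OF Lfun(3)[OF rW]] h] and eV = unit_component[OF rW x]
  note c = functor_cat_HomD(4)[OF Lad(4)[OF W]]
  have tri: "shriek_counit T W at (FObj f (fst p)) \<bullet> shriek_unit T (re W) at (fst p)
      = Idn C (FObj W (FObj f (fst p)))"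
    using arg_cong[OF Lad(8)[OF W], of "\<lambda>a. a at (fst p)"] x by (simp add: component_simps rs_Obj)
  show ?thesis
    using Cmp_assoc[OF eV LV c[OF y]] functor_cat_HomD(5)[OF Lad(4)[OF W] h] Cmp_assoc[OF eV c[OF fd(3)[OF x]] Wd(4)[OF h]]
      tri Idn_right[OF Wd(4)[OF h]] by (simp add: lg_eq)
qed

lemma pr_unit:
  assumes W: "W \<in> functors Y C" and y: "y \<in> Obj Y" and p: "p \<in> Obj (hf y)"
  shows "pr (re W) p \<bullet> star_unit T W at y = FArr W (inv_arr Y (snd p))"
proof -
  have x: "fst p \<in> Obj X" and h: "snd p \<in> Hom Y (FObj f (fst p)) y" using p by (simp_all add: hf_Obj)
  note ih = groupoid_inv(1)[OF Y.groupoid h]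
  note rW = rs_closed[OF W] and Wd = is_functorD[OF functorsD[OF W]]
  note RV = is_functorD(4)[OF functorsD[OF Rfun(3)[OF rW]] ih] and eV = counit_component[OF rW x, unfolded rs_Obj[OF x]]
  note c = functor_cat_HomD(4)[OF Rad(3)[OF W]]
  have tri: "star_counit T (re W) at (fst p) \<bullet> star_unit T W at (FObj f (fst p))
      = Idn C (FObj W (FObj f (fst p)))"
    using arg_cong[OF Rad(7)[OF W], of "\<lambda>a. a at (fst p)"] x by (simp add: component_simps rs_Obj)
  show ?thesis
    using Cmp_assoc[OF c[OF y] RV eV] functor_cat_HomD(5)[OF Rad(3)[OF W] ih] Cmp_assoc[OF Wd(4)[OF ih] c[OF fd(3)[OF x]] eV]
      tri Idn_left[OF Wd(4)[OF ih]] by (simp add: pr_def)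
qed

subsection \<open>The projection maps\<close>

lemma rs_tensor: "re (V \<boxtimes>\<^bsub>CY\<^esub> W) = re V \<boxtimes>\<^bsub>CX\<^esub> re W"
proof -
  have "FArr f k \<in> Arr Y" if "k \<in> Arr X" for k
    using fd(4)[of k "Dom X k" "Cod X k"] that by (simp add: Hom_def)
  then show ?thesis
    using fd(3) by (simp add: functor_cat_def tensor_functor_def pull_functor_def ext_functor_def fun_eq_iff)
qed

text \<open>The projection maps take their expected values on legs and projections, which characterises them.\<close>

lemma proj_shriek_leg:
  assumes V: "V \<in> functors X C" and W: "W \<in> functors Y C"
  shows "proj_shriek CY CX T V W \<in> Hom CY (Lo (V \<boxtimes>\<^bsub>CX\<^esub> re W)) (Lo V \<boxtimes>\<^bsub>CY\<^esub> W)"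
    "y \<in> Obj Y \<Longrightarrow> p \<in> Obj (hf y) \<Longrightarrow>
      proj_shriek CY CX T V W at y \<bullet> lg (V \<boxtimes>\<^bsub>CX\<^esub> re W) p = lg V p \<star> FArr W (snd p)"
proof -
  let ?A = "V \<boxtimes>\<^bsub>CX\<^esub> re W" and ?U = "Lo V \<boxtimes>\<^bsub>CY\<^esub> W"
  note LV = Lfun(3)[OF V] and rW = rs_closed[OF W]
  have U: "?U \<in> functors Y C" by (rule tensor_closed[OF LV W])
  have A: "?A \<in> functors X C" by (rule tensor_closed[OF V rW])
  note rU = rs_closed[OF U]
  let ?i = "shriek_unit T V \<star>\<^bsub>CX\<^esub> Idn CX (re W)" and ?j = "Idn CX (re ?U)"
  have iW: "Idn CX (re W) \<in> Hom CX (re W) (re W)"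
    using CX.Idn_closed rW by (simp add: Obj_functor_cat)
  have i: "?i \<in> Hom CX ?A (re ?U)"
    using TensA_functor_closed[OF Lad(3)[OF V] iW] by (simp add: rs_tensor)
  have j: "?j \<in> Hom CX (re ?U) (re ?U)"
    using CX.Idn_closed rU by (simp add: Obj_functor_cat)
  have e: "proj_shriek CY CX T V W = shriek_counit T ?U \<bullet>\<^bsub>CY\<^esub> La ?j \<bullet>\<^bsub>CY\<^esub> La ?i"
    by (simp add: proj_shriek_def kan_sel FObj_restriction)
  note Li = Lfun(4)[OF i] and Lj = Lfun(4)[OF j] and c = Lad(4)[OF U]
  show "proj_shriek CY CX T V W \<in> Hom CY (Lo ?A) ?U"
    unfolding e by (rule CY.Cmp_closed[OF CY.Cmp_closed[OF Li Lj] c])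
  assume y: "y \<in> Obj Y" and p: "p \<in> Obj (hf y)"
  have x: "fst p \<in> Obj X" and h: "snd p \<in> Hom Y (FObj f (fst p)) y" using p by (simp_all add: hf_Obj)
  note Liy = functor_cat_HomD(4)[OF Li y] and Ljy = functor_cat_HomD(4)[OF Lj y] and cy = functor_cat_HomD(4)[OF c y]
  note ix = functor_cat_HomD(4)[OF i x] and lA = lg_closed[OF A y p] and lU = lg_closed[OF rU y p]
  note \<eta> = unit_component[OF V x] and LVh = is_functorD(4)[OF functorsD[OF LV] h] and Wd = is_functorD[OF functorsD[OF W]]
  have "proj_shriek CY CX T V W at y \<bullet> lg ?A p
      = shriek_counit T ?U at y \<bullet> (La ?j at y \<bullet> (La ?i at y \<bullet> lg ?A p))"
    unfolding e using y Cmp_assoc[OF lA Cmp_closed[OF Liy Ljy] cy] Cmp_assoc[OF lA Liy Ljy] by (simp add: component_simps)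
  also have "\<dots> = shriek_counit T ?U at y \<bullet> (lg (re ?U) p \<bullet> ?i at (fst p))"
    using La_lg[OF i y p] La_lg[OF j y p] Cmp_assoc[OF ix lU Ljy] Idn_right[OF lU] x by (simp add: component_simps rs_Obj)
  also have "\<dots> = FArr ?U (snd p) \<bullet> ?i at (fst p)"
    using Cmp_assoc[OF ix lU cy] counit_lg[OF U y p] by simp
  also have "\<dots> = lg V p \<star> FArr W (snd p)"
    using TensA_Cmp[OF \<eta> LVh Idn_closed[OF Wd(3)[OF fd(3)[OF x]]] Wd(4)[OF h]] Idn_right[OF Wd(4)[OF h]] x HomD(1)[OF h]
    by (simp add: component_simps functor_simps lg_eq)
  finally show "proj_shriek CY CX T V W at y \<bullet> lg ?A p = lg V p \<star> FArr W (snd p)" .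
qed

lemma proj_star_projection:
  assumes V: "V \<in> functors X C" and W: "W \<in> functors Y C"
  shows "proj_star CY CX T W V \<in> Hom CY (W \<boxtimes>\<^bsub>CY\<^esub> Ro V) (Ro (re W \<boxtimes>\<^bsub>CX\<^esub> V))"
    "y \<in> Obj Y \<Longrightarrow> p \<in> Obj (hf y) \<Longrightarrow>
      pr (re W \<boxtimes>\<^bsub>CX\<^esub> V) p \<bullet> proj_star CY CX T W V at y = FArr W (inv_arr Y (snd p)) \<star> pr V p"
proof -
  let ?A = "re W \<boxtimes>\<^bsub>CX\<^esub> V" and ?U = "W \<boxtimes>\<^bsub>CY\<^esub> Ro V"
  note RV = Rfun(3)[OF V] and rW = rs_closed[OF W]
  have U: "?U \<in> functors Y C" by (rule tensor_closed[OF W RV])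
  have A: "?A \<in> functors X C" by (rule tensor_closed[OF rW V])
  note rU = rs_closed[OF U]
  let ?i = "Idn CX (re W) \<star>\<^bsub>CX\<^esub> star_counit T V" and ?j = "Idn CX (re ?U)"
  have iW: "Idn CX (re W) \<in> Hom CX (re W) (re W)"
    using CX.Idn_closed rW by (simp add: Obj_functor_cat)
  have i: "?i \<in> Hom CX (re ?U) ?A"
    using TensA_functor_closed[OF iW Rad(4)[OF V]] by (simp add: rs_tensor)
  have j: "?j \<in> Hom CX (re ?U) (re ?U)"
    using CX.Idn_closed rU by (simp add: Obj_functor_cat)
  have e: "proj_star CY CX T W V = Ra ?i \<bullet>\<^bsub>CY\<^esub> Ra ?j \<bullet>\<^bsub>CY\<^esub> star_unit T ?U"
    using CX.inv_arr_Idn[of "re ?U"] rU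
    by (simp add: proj_star_def kan_sel FObj_restriction Obj_functor_cat)
  note Ri = Rfun(4)[OF i] and Rj = Rfun(4)[OF j] and c = Rad(3)[OF U]
  show "proj_star CY CX T W V \<in> Hom CY ?U (Ro ?A)"
    unfolding e by (rule CY.Cmp_closed[OF CY.Cmp_closed[OF c Rj] Ri])
  assume y: "y \<in> Obj Y" and p: "p \<in> Obj (hf y)"
  have x: "fst p \<in> Obj X" and h: "snd p \<in> Hom Y (FObj f (fst p)) y" using p by (simp_all add: hf_Obj)
  note ih = groupoid_inv(1)[OF Y.groupoid h]
  note Riy = functor_cat_HomD(4)[OF Ri y] and Rjy = functor_cat_HomD(4)[OF Rj y] and cy = functor_cat_HomD(4)[OF c y]
  note ix = functor_cat_HomD(4)[OF i x] and pA = pr_closed[OF A y p] and pU = pr_closed[OF rU y p]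
  note \<epsilon> = counit_component[OF V x] and RVh = is_functorD(4)[OF functorsD[OF RV] ih] and Wd = is_functorD[OF functorsD[OF W]]
  have "pr ?A p \<bullet> proj_star CY CX T W V at y
      = (pr ?A p \<bullet> Ra ?i at y) \<bullet> (Ra ?j at y \<bullet> star_unit T ?U at y)"
    unfolding e using y Cmp_assoc[OF Cmp_closed[OF cy Rjy] Riy pA] by (simp add: component_simps)
  also have "\<dots> = ?i at (fst p) \<bullet> ((pr (re ?U) p \<bullet> Ra ?j at y) \<bullet> star_unit T ?U at y)"
    using pr_Ra[OF i y p] Cmp_assoc[OF Cmp_closed[OF cy Rjy] pU ix] Cmp_assoc[OF cy Rjy pU] by simp
  also have "\<dots> = ?i at (fst p) \<bullet> FArr ?U (inv_arr Y (snd p))"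
    using pr_Ra[OF j y p] Idn_left[OF pU] pr_unit[OF U y p] x by (simp add: component_simps rs_Obj)
  also have "\<dots> = FArr W (inv_arr Y (snd p)) \<star> pr V p"
    using TensA_Cmp[OF Wd(4)[OF ih] Idn_closed[OF Wd(3)[OF fd(3)[OF x]]] RVh \<epsilon>] Idn_left[OF Wd(4)[OF ih]] x HomD(1)[OF ih]
    by (simp add: component_simps functor_simps pr_def)
  finally show "pr ?A p \<bullet> proj_star CY CX T W V at y = FArr W (inv_arr Y (snd p)) \<star> pr V p" .
qed

lemma hf_arrow_W:
  assumes W: "W \<in> functors Y C" and \<kappa>: "\<kappa> \<in> Hom (hf y) p q"
  shows "FArr W (inv_arr Y (snd q)) \<bullet> FArr W (snd p) = FArr W (FArr f (snd (snd \<kappa>)))"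
proof -
  have u: "snd (snd \<kappa>) \<in> Hom X (fst p) (fst q)" and q: "snd q \<in> Hom Y (FObj f (fst q)) y"
    and p: "snd p \<in> Hom Y (FObj f (fst p)) y" and e: "snd q \<bullet>\<^bsub>Y\<^esub> FArr f (snd (snd \<kappa>)) = snd p"
    using \<kappa> by (simp_all add: hf_Hom hf_Obj)
  have "inv_arr Y (snd q) \<bullet>\<^bsub>Y\<^esub> snd p = FArr f (snd (snd \<kappa>))"
    using groupoid_cancel_left[OF Y.groupoid q fd(4)[OF u]] e by simp
  then show ?thesis
    using is_functorD(6)[OF functorsD[OF W] p groupoid_inv(1)[OF Y.groupoid q]] by simp
qed

text \<open>Tensoring the bilimit over a fibre with \<open>W y\<close> gives a bilimit of the tensored diagram, since
  the tensor product is linear in each variable and \<open>W\<close> turns every arrow into an isomorphism.\<close>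

lemma tensor_bilimit_right:
  assumes K: "kan_cone V F l m" and W: "W \<in> functors Y C" and y: "y \<in> Obj Y"
  shows "bilimit (hf y) (fib (V \<boxtimes>\<^bsub>CX\<^esub> re W) y) (FObj F y \<boxtimes> FObj W y)
    (\<lambda>p. l p \<star> FArr W (snd p)) (\<lambda>p. m p \<star> FArr W (inv_arr Y (snd p)))"
proof -
  interpret P: ess_finite "hf y" by (rule hf_ess_finite)
  let ?A = "V \<boxtimes>\<^bsub>CX\<^esub> re W" and ?rW = "re W" and ?E = "FObj F y" and ?W = "FObj W y"
  let ?EW = "?E \<boxtimes> ?W"
  note k = kan_coneD[OF K] and rW = rs_closed[OF W]
  have A: "?A \<in> functors X C" by (rule tensor_closed[OF k(1) rW])
  note Vd = is_functorD[OF functorsD[OF k(1)]] and rd = is_functorD[OF functorsD[OF rW]] and Wd = is_functorD[OF functorsD[OF W]]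
  note c = restriction_cocone(1,2)[OF W y] and c' = restriction_cone(1,2)[OF W y] and E = bilimitD(1)[OF k(3)[OF y]] and Wy = Wd(3)[OF y]
  have x: "fst p \<in> Obj X" and h: "snd p \<in> Hom Y (FObj f (fst p)) y" if "p \<in> Obj (hf y)" for p using that by (simp_all add: hf_Obj)
  have Ao: "FObj (fib ?A y) p = FObj V (fst p) \<boxtimes> FObj ?rW (fst p)" if "p \<in> Obj (hf y)" for p
    using x[OF that] that by (simp add: fib_Obj FObj_tensor)
  have u: "snd (snd \<kappa>) \<in> Hom X (fst p) (fst q)" "p \<in> Obj (hf y)" "q \<in> Obj (hf y)"
    if "\<kappa> \<in> Hom (hf y) p q" for \<kappa> p q using that by (simp_all add: hf_Hom)
  have Au: "FArr (fib ?A y) \<kappa> = FArr V (snd (snd \<kappa>)) \<star> FArr ?rW (snd (snd \<kappa>))" if "\<kappa> \<in> Hom (hf y) p q" for \<kappa> p q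
    using HomD(1)[OF u(1)[OF that]] by (simp add: fib_Arr[OF that] FArr_tensor)
  have l: "l p \<star> FArr W (snd p) \<in> Hom C (FObj (fib ?A y) p) ?EW" and m: "m p \<star> FArr W (inv_arr Y (snd p)) \<in> Hom C ?EW (FObj (fib ?A y) p)" if p: "p \<in> Obj (hf y)" for p
    unfolding Ao[OF p] using TensA_closed[OF k(6)[OF y p] c(1)[OF p]] TensA_closed[OF k(7)[OF y p] c'(1)[OF p]] by simp_all
  show ?thesis
    unfolding bilimit_def
  proof (intro conjI ballI allI l m)
    show "?EW \<in> Obj C" by (rule TensO_closed[OF E Wy])
  next
    fix p q \<kappa> assume \<kappa>: "\<kappa> \<in> Hom (hf y) p q"
    note pq = u[OF \<kappa>]
    show "(l q \<star> FArr W (snd q)) \<bullet> FArr (fib ?A y) \<kappa> = l p \<star> FArr W (snd p)"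
      using TensA_Cmp[OF Vd(4)[OF pq(1)] k(6)[OF y pq(3)] rd(4)[OF pq(1)] c(1)[OF pq(3)]] k(9)[OF y \<kappa>] c(2)[OF \<kappa>] by (simp add: Au[OF \<kappa>])
    show "FArr (fib ?A y) \<kappa> \<bullet> (m p \<star> FArr W (inv_arr Y (snd p))) = m q \<star> FArr W (inv_arr Y (snd q))"
      using TensA_Cmp[OF k(7)[OF y pq(2)] Vd(4)[OF pq(1)] c'(1)[OF pq(2)] rd(4)[OF pq(1)]] k(10)[OF y \<kappa>] c'(2)[OF \<kappa>] by (simp add: Au[OF \<kappa>])
  next
    fix p q assume p: "p \<in> Obj (hf y)" and q: "q \<in> Obj (hf y)"
    let ?w = "FArr W (inv_arr Y (snd q)) \<bullet> FArr W (snd p)" and ?Ap = "FObj (fib ?A y) p" and ?Aq = "FObj (fib ?A y) q"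
    have w: "?w \<in> Hom C (FObj ?rW (fst p)) (FObj ?rW (fst q))" by (rule Cmp_closed[OF c(1)[OF p] c'(1)[OF q]])
    note Vp = Vd(3)[OF x[OF p]] and Vq = Vd(3)[OF x[OF q]] and o = Hom_obj(1)[OF l[OF p]] Hom_obj(1)[OF l[OF q]]
    have "(m q \<star> FArr W (inv_arr Y (snd q))) \<bullet> (l p \<star> FArr W (snd p)) = (m q \<bullet> l p) \<star> ?w"
      using TensA_Cmp[OF k(6)[OF y p] k(7)[OF y q] c(1)[OF p] c'(1)[OF q]] by simp
    also have "\<dots> = wsum ?Ap ?Aq (Hom (hf y) p q) (\<lambda>_. 1) (\<lambda>\<kappa>. FArr V (snd (snd \<kappa>)) \<star> ?w)"
      unfolding k(8)[OF y p q] Ao[OF p] Ao[OF q]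
      using Vd(4)[OF u(1)] by (intro wsum_tensor_right[OF Vp Vq P.finite_Hom _ w]) auto
    also have "\<dots> = wsum ?Ap ?Aq (Hom (hf y) p q) (\<lambda>_. 1) (FArr (fib ?A y))"
    proof (rule wsum_cong[OF o])
      show "(\<lambda>\<kappa>. FArr V (snd (snd \<kappa>)) \<star> ?w) \<in> Hom (hf y) p q \<rightarrow> Hom C ?Ap ?Aq"
        unfolding Ao[OF p] Ao[OF q] using TensA_closed[OF Vd(4)[OF u(1)] w] by blast
      show "FArr (fib ?A y) \<in> Hom (hf y) p q \<rightarrow> Hom C ?Ap ?Aq" using is_functorD(4)[OF fib_functor[OF A]] by blast
      show "FArr V (snd (snd \<kappa>)) \<star> ?w = FArr (fib ?A y) \<kappa>" if "\<kappa> \<in> Hom (hf y) p q" for \<kappa>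
        using hf_arrow_W[OF W that] rs_Arr[OF u(1)[OF that], of W] by (simp add: Au[OF that])
    qed simp
    finally show "(m q \<star> FArr W (inv_arr Y (snd q))) \<bullet> (l p \<star> FArr W (snd p)) = wsum ?Ap ?Aq (Hom (hf y) p q) (\<lambda>_. 1) (FArr (fib ?A y))" .
  next
    note EW = TensO_closed[OF E Wy]
    have "integ ?EW ?EW (hf y) (\<lambda>p. (l p \<star> FArr W (snd p)) \<bullet> (m p \<star> FArr W (inv_arr Y (snd p)))) = integ ?EW ?EW (hf y) (\<lambda>p. (l p \<bullet> m p) \<star> Idn C ?W)"
    proof (rule integ_eqI[OF P.ess_finite_axioms EW EW])
      fix p assume p: "p \<in> Obj (hf y)"
      show "(l p \<star> FArr W (snd p)) \<bullet> (m p \<star> FArr W (inv_arr Y (snd p))) \<in> Hom C ?EW ?EW" by (rule Cmp_closed[OF m[OF p] l[OF p]])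
      have "FArr W (snd p) \<bullet> FArr W (inv_arr Y (snd p)) = Idn C ?W"
        using Wd(6)[OF groupoid_inv(1)[OF Y.groupoid h[OF p]] h[OF p]] groupoid_inv(3)[OF Y.groupoid h[OF p]] Wd(5)[OF y] by simp
      then show "(l p \<star> FArr W (snd p)) \<bullet> (m p \<star> FArr W (inv_arr Y (snd p))) = (l p \<bullet> m p) \<star> Idn C ?W"
        using TensA_Cmp[OF k(7)[OF y p] k(6)[OF y p] c'(1)[OF p] c(1)[OF p]] by simp
    qed
    also have "\<dots> = integ ?E ?E (hf y) (\<lambda>p. l p \<bullet> m p) \<star> Idn C ?W"
      unfolding integ_def using Cmp_closed[OF k(7)[OF y] k(6)[OF y]] P.reps_obj
      by (intro wsum_tensor_right[OF E E P.reps_finite _ Idn_closed[OF Wy], symmetric]) auto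
    also have "\<dots> = Idn C ?EW"
      using bilimitD(7)[OF k(3)[OF y]] TensA_Idn[OF E Wy] by simp
    finally show "integ ?EW ?EW (hf y) (\<lambda>p. (l p \<star> FArr W (snd p)) \<bullet> (m p \<star> FArr W (inv_arr Y (snd p)))) = Idn C ?EW" .
  qed
qed

lemma tensor_bilimit_left:
  assumes K: "kan_cone V F l m" and W: "W \<in> functors Y C" and y: "y \<in> Obj Y"
  shows "bilimit (hf y) (fib (re W \<boxtimes>\<^bsub>CX\<^esub> V) y) (FObj W y \<boxtimes> FObj F y)
    (\<lambda>p. FArr W (snd p) \<star> l p) (\<lambda>p. FArr W (inv_arr Y (snd p)) \<star> m p)"
proof -
  interpret P: ess_finite "hf y" by (rule hf_ess_finite)
  let ?A = "re W \<boxtimes>\<^bsub>CX\<^esub> V" and ?rW = "re W" and ?E = "FObj F y" and ?W = "FObj W y"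
  let ?EW = "?W \<boxtimes> ?E"
  note k = kan_coneD[OF K] and rW = rs_closed[OF W]
  have A: "?A \<in> functors X C" by (rule tensor_closed[OF rW k(1)])
  note Vd = is_functorD[OF functorsD[OF k(1)]] and rd = is_functorD[OF functorsD[OF rW]] and Wd = is_functorD[OF functorsD[OF W]]
  note c = restriction_cocone(1,2)[OF W y] and c' = restriction_cone(1,2)[OF W y] and E = bilimitD(1)[OF k(3)[OF y]] and Wy = Wd(3)[OF y]
  have x: "fst p \<in> Obj X" and h: "snd p \<in> Hom Y (FObj f (fst p)) y" if "p \<in> Obj (hf y)" for p using that by (simp_all add: hf_Obj)
  have Ao: "FObj (fib ?A y) p = FObj ?rW (fst p) \<boxtimes> FObj V (fst p)" if "p \<in> Obj (hf y)" for p
    using x[OF that] that by (simp add: fib_Obj FObj_tensor)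
  have u: "snd (snd \<kappa>) \<in> Hom X (fst p) (fst q)" "p \<in> Obj (hf y)" "q \<in> Obj (hf y)"
    if "\<kappa> \<in> Hom (hf y) p q" for \<kappa> p q using that by (simp_all add: hf_Hom)
  have Au: "FArr (fib ?A y) \<kappa> = FArr ?rW (snd (snd \<kappa>)) \<star> FArr V (snd (snd \<kappa>))" if "\<kappa> \<in> Hom (hf y) p q" for \<kappa> p q
    using HomD(1)[OF u(1)[OF that]] by (simp add: fib_Arr[OF that] FArr_tensor)
  have l: "FArr W (snd p) \<star> l p \<in> Hom C (FObj (fib ?A y) p) ?EW" and m: "FArr W (inv_arr Y (snd p)) \<star> m p \<in> Hom C ?EW (FObj (fib ?A y) p)" if p: "p \<in> Obj (hf y)" for p
    unfolding Ao[OF p] using TensA_closed[OF c(1)[OF p] k(6)[OF y p]] TensA_closed[OF c'(1)[OF p] k(7)[OF y p]] by simp_all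
  show ?thesis
    unfolding bilimit_def
  proof (intro conjI ballI allI l m)
    show "?EW \<in> Obj C" by (rule TensO_closed[OF Wy E])
  next
    fix p q \<kappa> assume \<kappa>: "\<kappa> \<in> Hom (hf y) p q"
    note pq = u[OF \<kappa>]
    show "(FArr W (snd q) \<star> l q) \<bullet> FArr (fib ?A y) \<kappa> = FArr W (snd p) \<star> l p"
      using TensA_Cmp[OF rd(4)[OF pq(1)] c(1)[OF pq(3)] Vd(4)[OF pq(1)] k(6)[OF y pq(3)]] k(9)[OF y \<kappa>] c(2)[OF \<kappa>] by (simp add: Au[OF \<kappa>])
    show "FArr (fib ?A y) \<kappa> \<bullet> (FArr W (inv_arr Y (snd p)) \<star> m p) = FArr W (inv_arr Y (snd q)) \<star> m q"
      using TensA_Cmp[OF c'(1)[OF pq(2)] rd(4)[OF pq(1)] k(7)[OF y pq(2)] Vd(4)[OF pq(1)]] k(10)[OF y \<kappa>] c'(2)[OF \<kappa>] by (simp add: Au[OF \<kappa>])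
  next
    fix p q assume p: "p \<in> Obj (hf y)" and q: "q \<in> Obj (hf y)"
    let ?w = "FArr W (inv_arr Y (snd q)) \<bullet> FArr W (snd p)" and ?Ap = "FObj (fib ?A y) p" and ?Aq = "FObj (fib ?A y) q"
    have w: "?w \<in> Hom C (FObj ?rW (fst p)) (FObj ?rW (fst q))" by (rule Cmp_closed[OF c(1)[OF p] c'(1)[OF q]])
    note Vp = Vd(3)[OF x[OF p]] and Vq = Vd(3)[OF x[OF q]] and o = Hom_obj(1)[OF l[OF p]] Hom_obj(1)[OF l[OF q]]
    have "(FArr W (inv_arr Y (snd q)) \<star> m q) \<bullet> (FArr W (snd p) \<star> l p) = ?w \<star> (m q \<bullet> l p)"
      using TensA_Cmp[OF c(1)[OF p] c'(1)[OF q] k(6)[OF y p] k(7)[OF y q]] by simp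
    also have "\<dots> = wsum ?Ap ?Aq (Hom (hf y) p q) (\<lambda>_. 1) (\<lambda>\<kappa>. ?w \<star> FArr V (snd (snd \<kappa>)))"
      unfolding k(8)[OF y p q] Ao[OF p] Ao[OF q]
      using Vd(4)[OF u(1)] by (intro wsum_tensor_left[OF Vp Vq P.finite_Hom _ w]) auto
    also have "\<dots> = wsum ?Ap ?Aq (Hom (hf y) p q) (\<lambda>_. 1) (FArr (fib ?A y))"
    proof (rule wsum_cong[OF o])
      show "(\<lambda>\<kappa>. ?w \<star> FArr V (snd (snd \<kappa>))) \<in> Hom (hf y) p q \<rightarrow> Hom C ?Ap ?Aq"
        unfolding Ao[OF p] Ao[OF q] using TensA_closed[OF w Vd(4)[OF u(1)]] by blast
      show "FArr (fib ?A y) \<in> Hom (hf y) p q \<rightarrow> Hom C ?Ap ?Aq" using is_functorD(4)[OF fib_functor[OF A]] by blast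
      show "?w \<star> FArr V (snd (snd \<kappa>)) = FArr (fib ?A y) \<kappa>" if "\<kappa> \<in> Hom (hf y) p q" for \<kappa>
        using hf_arrow_W[OF W that] rs_Arr[OF u(1)[OF that], of W] by (simp add: Au[OF that])
    qed simp
    finally show "(FArr W (inv_arr Y (snd q)) \<star> m q) \<bullet> (FArr W (snd p) \<star> l p) = wsum ?Ap ?Aq (Hom (hf y) p q) (\<lambda>_. 1) (FArr (fib ?A y))" .
  next
    note EW = TensO_closed[OF Wy E]
    have "integ ?EW ?EW (hf y) (\<lambda>p. (FArr W (snd p) \<star> l p) \<bullet> (FArr W (inv_arr Y (snd p)) \<star> m p)) = integ ?EW ?EW (hf y) (\<lambda>p. Idn C ?W \<star> (l p \<bullet> m p))"
    proof (rule integ_eqI[OF P.ess_finite_axioms EW EW])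
      fix p assume p: "p \<in> Obj (hf y)"
      show "(FArr W (snd p) \<star> l p) \<bullet> (FArr W (inv_arr Y (snd p)) \<star> m p) \<in> Hom C ?EW ?EW" by (rule Cmp_closed[OF m[OF p] l[OF p]])
      have "FArr W (snd p) \<bullet> FArr W (inv_arr Y (snd p)) = Idn C ?W"
        using Wd(6)[OF groupoid_inv(1)[OF Y.groupoid h[OF p]] h[OF p]] groupoid_inv(3)[OF Y.groupoid h[OF p]] Wd(5)[OF y] by simp
      then show "(FArr W (snd p) \<star> l p) \<bullet> (FArr W (inv_arr Y (snd p)) \<star> m p) = Idn C ?W \<star> (l p \<bullet> m p)"
        using TensA_Cmp[OF c'(1)[OF p] c(1)[OF p] k(7)[OF y p] k(6)[OF y p]] by simp
    qed
    also have "\<dots> = Idn C ?W \<star> integ ?E ?E (hf y) (\<lambda>p. l p \<bullet> m p)"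
      unfolding integ_def using Cmp_closed[OF k(7)[OF y] k(6)[OF y]] P.reps_obj
      by (intro wsum_tensor_left[OF E E P.reps_finite _ Idn_closed[OF Wy], symmetric]) auto
    also have "\<dots> = Idn C ?EW"
      using bilimitD(7)[OF k(3)[OF y]] TensA_Idn[OF Wy E] by simp
    finally show "integ ?EW ?EW (hf y) (\<lambda>p. (FArr W (snd p) \<star> l p) \<bullet> (FArr W (inv_arr Y (snd p)) \<star> m p)) = Idn C ?EW" .
  qed
qed

text \<open>The projection formulas: both projection maps compare two bilimits of one diagram, which gives
  their inverses.\<close>

lemma proj_shriek_inverse:
  assumes V: "V \<in> functors X C" and W: "W \<in> functors Y C" and K: "kan_cone V (Lo V) (lg V) m"
  shows "inv_arr CY (proj_shriek CY CX T V W) \<in> Hom CY (Lo V \<boxtimes>\<^bsub>CY\<^esub> W) (Lo (V \<boxtimes>\<^bsub>CX\<^esub> re W))"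
    "y \<in> Obj Y \<Longrightarrow> inv_arr CY (proj_shriek CY CX T V W) at y
      = integ (FObj (Lo V) y \<boxtimes> FObj W y) (FObj (Lo (V \<boxtimes>\<^bsub>CX\<^esub> re W)) y) (hf y)
          (\<lambda>p. lg (V \<boxtimes>\<^bsub>CX\<^esub> re W) p \<bullet> (m p \<star> FArr W (inv_arr Y (snd p))))"
proof -
  let ?A = "V \<boxtimes>\<^bsub>CX\<^esub> re W"
  define \<mu> where "\<mu> y = integ (FObj (Lo V) y \<boxtimes> FObj W y) (FObj (Lo ?A) y) (hf y)
      (\<lambda>p. lg ?A p \<bullet> (m p \<star> FArr W (inv_arr Y (snd p))))" for y
  have A: "?A \<in> functors X C" by (rule tensor_closed[OF V rs_closed[OF W]])
  obtain mA where KA: "kan_cone ?A (Lo ?A) (lg ?A) mA" using left_cone[OF A] by blast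
  note \<Lambda> = proj_shriek_leg[OF V W]
  have inv: "inverse_arrows C (proj_shriek CY CX T V W at y) (\<mu> y)" if y: "y \<in> Obj Y" for y
    unfolding \<mu>_def
    by (rule bilimit_comparison(1)[OF hf_ess_finite fib_functor[OF A] tensor_bilimit_right[OF K W y] kan_coneD(3)[OF KA y]])
      (use functor_cat_HomD(4)[OF \<Lambda>(1) y] y \<Lambda>(2)[OF y] in \<open>simp_all add: functor_simps\<close>)
  from functor_cat_inverse(2,3)[OF Y.category_axioms category_axioms \<Lambda>(1) inv]
  show "inv_arr CY (proj_shriek CY CX T V W) \<in> Hom CY (Lo V \<boxtimes>\<^bsub>CY\<^esub> W) (Lo ?A)"
    "y \<in> Obj Y \<Longrightarrow> inv_arr CY (proj_shriek CY CX T V W) at y = integ (FObj (Lo V) y \<boxtimes> FObj W y) (FObj (Lo ?A) y) (hf y)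
          (\<lambda>p. lg ?A p \<bullet> (m p \<star> FArr W (inv_arr Y (snd p))))"
    by (simp_all add: \<mu>_def)
qed

lemma proj_star_inverse:
  assumes V: "V \<in> functors X C" and W: "W \<in> functors Y C" and K: "kan_cone V (Ro V) n (pr V)"
  shows "inv_arr CY (proj_star CY CX T W V) \<in> Hom CY (Ro (re W \<boxtimes>\<^bsub>CX\<^esub> V)) (W \<boxtimes>\<^bsub>CY\<^esub> Ro V)"
    "y \<in> Obj Y \<Longrightarrow> inv_arr CY (proj_star CY CX T W V) at y
      = integ (FObj (Ro (re W \<boxtimes>\<^bsub>CX\<^esub> V)) y) (FObj W y \<boxtimes> FObj (Ro V) y) (hf y)
          (\<lambda>p. (FArr W (snd p) \<star> n p) \<bullet> pr (re W \<boxtimes>\<^bsub>CX\<^esub> V) p)"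
proof -
  let ?A = "re W \<boxtimes>\<^bsub>CX\<^esub> V"
  define \<mu> where "\<mu> y = integ (FObj (Ro ?A) y) (FObj W y \<boxtimes> FObj (Ro V) y) (hf y)
      (\<lambda>p. (FArr W (snd p) \<star> n p) \<bullet> pr ?A p)" for y
  have A: "?A \<in> functors X C" by (rule tensor_closed[OF rs_closed[OF W] V])
  obtain nA where KA: "kan_cone ?A (Ro ?A) nA (pr ?A)" using right_cone[OF A] by blast
  note \<Lambda> = proj_star_projection[OF V W]
  have inv: "inverse_arrows C (proj_star CY CX T W V at y) (\<mu> y)" if y: "y \<in> Obj Y" for y
    unfolding \<mu>_def
    by (rule bilimit_comparison(2)[OF hf_ess_finite fib_functor[OF A] tensor_bilimit_left[OF K W y] kan_coneD(3)[OF KA y]])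
      (use functor_cat_HomD(4)[OF \<Lambda>(1) y] y \<Lambda>(2)[OF y] in \<open>simp_all add: functor_simps\<close>)
  from functor_cat_inverse(2,3)[OF Y.category_axioms category_axioms \<Lambda>(1) inv]
  show "inv_arr CY (proj_star CY CX T W V) \<in> Hom CY (Ro ?A) (W \<boxtimes>\<^bsub>CY\<^esub> Ro V)"
    "y \<in> Obj Y \<Longrightarrow> inv_arr CY (proj_star CY CX T W V) at y = integ (FObj (Ro ?A) y) (FObj W y \<boxtimes> FObj (Ro V) y) (hf y)
          (\<lambda>p. (FArr W (snd p) \<star> n p) \<bullet> pr ?A p)"
    by (simp_all add: \<mu>_def)
qed

subsection \<open>The pre-Nakayama map on a homotopy fibre\<close>

text \<open>Unfolding the definition, the component at \<open>y\<close> is a double integral over \<open>c\<close> and \<open>d\<close> whose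
  integrand is \<open>card (Hom c d)\<close> copies of \<open>lg d \<circ> m d \<circ> lg c \<circ> pr c\<close>, that is
  \<open>(card (Hom c d))\<^sup>2\<close> copies of \<open>lg c \<circ> pr c\<close>. Only \<open>d = c\<close> contributes, and the two factors
  \<open>card (Aut c)\<close> cancel the two weights.\<close>

lemma pre_nakayama_component:
  assumes V: "V \<in> functors X C"
  shows "pre_nakayama CY CX T V \<in> Hom CY (Ro V) (Lo V)"
    "y \<in> Obj Y \<Longrightarrow> pre_nakayama CY CX T V at y
      = wsum (FObj (Ro V) y) (FObj (Lo V) y) (iso_reps (hf y)) (\<lambda>_. 1) (\<lambda>c. lg V c \<bullet> pr V c)"
proof -
  let ?O = "Unit CX"
  have O: "?O \<in> functors X C" by (rule Unit_functor_closed[OF X.category_axioms])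
  note LV = Lfun(3)[OF V] and RO = Rfun(3)[OF O]
  obtain m where K: "kan_cone V (Lo V) (lg V) m" using left_cone[OF V] by blast
  obtain n where KO: "kan_cone ?O (Ro ?O) n (pr ?O)" using right_cone[OF O] by blast
  obtain n' where KR: "kan_cone V (Ro V) n' (pr V)" using right_cone[OF V] by blast
  note k = kan_coneD[OF K] and kO = kan_coneD[OF KO] and kR = kan_coneD[OF KR]
  note Vd = is_functorD[OF functorsD[OF V]]
  let ?A = "V \<boxtimes>\<^bsub>CX\<^esub> re (Ro ?O)" and ?B = "re (Lo V) \<boxtimes>\<^bsub>CX\<^esub> ?O" and ?VO = "V \<boxtimes>\<^bsub>CX\<^esub> ?O"
  have A: "?A \<in> functors X C" by (rule tensor_closed[OF V rs_closed[OF RO]])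
  have B: "?B \<in> functors X C" by (rule tensor_closed[OF rs_closed[OF LV] O])
  have VO: "?VO \<in> functors X C" by (rule tensor_closed[OF V O])
  have iV: "Idn CX V \<in> Hom CX V V" and iO: "Idn CX ?O \<in> Hom CX ?O ?O"
    using CX.Idn_closed V O by (simp_all add: Obj_functor_cat)
  let ?a1 = "RUn CX V" and ?a2 = "Idn CX V \<star>\<^bsub>CX\<^esub> star_counit T ?O"
  let ?b1 = "shriek_unit T V \<star>\<^bsub>CX\<^esub> Idn CX ?O" and ?b2 = "inv_arr CX (RUn CX V)"
  note a1 = RUn_functor(1)[OF V] and b2 = RUn_functor(2)[OF V] and b2c = RUn_functor(3)[OF V]
  have a2: "?a2 \<in> Hom CX ?A ?VO" by (rule TensA_functor_closed[OF iV Rad(4)[OF O]])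
  have b1: "?b1 \<in> Hom CX ?VO ?B" by (rule TensA_functor_closed[OF Lad(3)[OF V] iO])
  let ?M = "inv_arr CY (proj_shriek CY CX T V (Ro ?O))" and ?S = "inv_arr CY (proj_star CY CX T (Lo V) ?O)"
  note M = proj_shriek_inverse[OF V RO K] and S = proj_star_inverse[OF O LV KO]
  have e: "pre_nakayama CY CX T V = La ?a1 \<bullet>\<^bsub>CY\<^esub> La ?a2 \<bullet>\<^bsub>CY\<^esub> ?M \<bullet>\<^bsub>CY\<^esub> ?S \<bullet>\<^bsub>CY\<^esub> Ra ?b1 \<bullet>\<^bsub>CY\<^esub> Ra ?b2"
    by (simp add: pre_nakayama_def)
  note Ra1 = Lfun(4)[OF a1] and Ra2 = Lfun(4)[OF a2] and Rb1 = Rfun(4)[OF b1] and Rb2 = Rfun(4)[OF b2]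
  show "pre_nakayama CY CX T V \<in> Hom CY (Ro V) (Lo V)"
    unfolding e
    by (rule CY.Cmp_closed[OF CY.Cmp_closed[OF CY.Cmp_closed[OF CY.Cmp_closed[OF CY.Cmp_closed[OF Rb2 Rb1] S(1)] M(1)] Ra2] Ra1])
  assume y: "y \<in> Obj Y"
  interpret P: ess_finite "hf y" by (rule hf_ess_finite)
  have h: "snd p \<in> Hom Y (FObj f (fst p)) y" and x: "fst p \<in> Obj X" if "p \<in> Obj (hf y)" for p
    using that by (simp_all add: hf_Obj)
  note ih = groupoid_inv(1)[OF Y.groupoid h]
  let ?E = "FObj (Lo V) y" and ?F = "FObj (Ro V) y" and ?Q = "FObj (Ro ?O) y" and ?I = "Unit C"
  have E: "?E \<in> Obj C" and F: "?F \<in> Obj C" and Q: "?Q \<in> Obj C"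
    using bilimitD(1)[OF k(3)[OF y]] bilimitD(1)[OF kR(3)[OF y]] bilimitD(1)[OF kO(3)[OF y]] by simp_all
  have EQ: "?E \<boxtimes> ?Q \<in> Obj C" using TensO_closed[OF E Q] .
  have LA: "FObj (Lo ?A) y \<in> Obj C" and RB: "FObj (Ro ?B) y \<in> Obj C"
    using is_functorD(3)[OF functorsD[OF Lfun(3)[OF A]] y] is_functorD(3)[OF functorsD[OF Rfun(3)[OF B]] y] by simp_all
  let ?a1y = "La ?a1 at y" and ?a2y = "La ?a2 at y"
  let ?b1y = "Ra ?b1 at y" and ?b2y = "Ra ?b2 at y"
  let ?My = "?M at y" and ?Sy = "?S at y"
  note a1y = functor_cat_HomD(4)[OF Ra1 y] and a2y = functor_cat_HomD(4)[OF Ra2 y]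
  note b1y = functor_cat_HomD(4)[OF Rb1 y] and b2y = functor_cat_HomD(4)[OF Rb2 y]
  have My: "?My \<in> Hom C (?E \<boxtimes> ?Q) (FObj (Lo ?A) y)" and Sy: "?Sy \<in> Hom C (FObj (Ro ?B) y) (?E \<boxtimes> ?Q)"
    using functor_cat_HomD(4)[OF M(1) y] functor_cat_HomD(4)[OF S(1) y] y by (simp_all add: functor_simps)
  note a12 = Cmp_closed[OF a2y a1y] and b12 = Cmp_closed[OF b2y b1y]
  define A1 where "A1 = (?a1y \<bullet> ?a2y) \<bullet> ?My"
  have A1: "A1 \<in> Hom C (?E \<boxtimes> ?Q) ?E" unfolding A1_def by (rule Cmp_closed[OF My a12])
  have "pre_nakayama CY CX T V at y = ?a1y \<bullet> ?a2y \<bullet> ?My \<bullet> ?Sy \<bullet> ?b1y \<bullet> ?b2y"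
    unfolding e using y by (simp add: component_simps)
  also have "\<dots> = A1 \<bullet> (?Sy \<bullet> ?b1y \<bullet> ?b2y)"
    unfolding A1_def
    using Cmp_assoc[OF Cmp_closed[OF Cmp_closed[OF b12 Sy] My] a2y a1y] Cmp_assoc[OF Cmp_closed[OF b12 Sy] My a12] by simp
  finally have \<gamma>: "pre_nakayama CY CX T V at y = A1 \<bullet> (?Sy \<bullet> ?b1y \<bullet> ?b2y)" .
  define r where "r p = RUn C (FObj V (fst p))" for p :: "'x \<times> 'w"
  define r' where "r' p = inv_arr C (r p)" for p
  have r: "r p \<in> Hom C (FObj V (fst p) \<boxtimes> ?I) (FObj V (fst p))" and r': "r' p \<in> Hom C (FObj V (fst p)) (FObj V (fst p) \<boxtimes> ?I)"
    and rr': "r p \<bullet> r' p = Idn C (FObj V (fst p))" if "p \<in> Obj (hf y)" for p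
    unfolding r_def r'_def
    using is_iso_inv_arr[OF conjunct2[OF RUn_closed[OF Vd(3)[OF x[OF that]]]] conjunct1[OF RUn_closed[OF Vd(3)[OF x[OF that]]]]]
      RUn_closed[OF Vd(3)[OF x[OF that]]] by simp_all
  have kOl: "n p \<in> Hom C ?I ?Q" and kOm: "pr ?O p \<in> Hom C ?Q ?I" if "p \<in> Obj (hf y)" for p
    using kO(6,7)[OF y that] x[OF that] by (simp_all add: functor_simps)
  note I = Unit_closed and iI = Idn_closed[OF Unit_closed]
  \<comment> \<open>the right half of the composite\<close>
  have mS: "(FArr (Lo V) (snd p) \<star> n p) \<in> Hom C (FObj ?B (fst p)) (?E \<boxtimes> ?Q)" if p: "p \<in> Obj (hf y)" for p
    using TensA_closed[OF is_functorD(4)[OF functorsD[OF LV] h[OF p]] kOl[OF p]] x[OF p] by (simp add: functor_simps)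
  have ln: "lg V p \<star> n p \<in> Hom C (FObj V (fst p) \<boxtimes> ?I) (?E \<boxtimes> ?Q)" if p: "p \<in> Obj (hf y)" for p
    by (rule TensA_closed[OF k(6)[OF y p] kOl[OF p]])
  note r'p = Cmp_closed[OF kR(7)[OF y] r']
  have "?Sy \<bullet> ?b1y \<bullet> ?b2y = integ ?F (?E \<boxtimes> ?Q) (hf y) (\<lambda>p. ((FArr (Lo V) (snd p) \<star> n p) \<bullet> pr ?B p) \<bullet> (?b1y \<bullet> ?b2y))"
    unfolding S(2)[OF y]
    by (rule integ_pre[OF P.ess_finite_axioms RB EQ Cmp_closed[OF pr_closed[OF B y] mS] b12])
  also have "\<dots> = integ ?F (?E \<boxtimes> ?Q) (hf y) (\<lambda>p. (lg V p \<star> n p) \<bullet> (r' p \<bullet> pr V p))"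
  proof (rule integ_eqI[OF P.ess_finite_axioms F EQ])
    fix p assume p: "p \<in> Obj (hf y)"
    note pB = pr_closed[OF B y p] and pVO = pr_closed[OF VO y p]
    note b1x = functor_cat_HomD(4)[OF b1 x[OF p]]
    show "((FArr (Lo V) (snd p) \<star> n p) \<bullet> pr ?B p) \<bullet> (?b1y \<bullet> ?b2y) \<in> Hom C ?F (?E \<boxtimes> ?Q)"
      by (rule Cmp_closed[OF b12 Cmp_closed[OF pB mS[OF p]]])
    have "pr ?B p \<bullet> (?b1y \<bullet> ?b2y) = ?b1 at (fst p) \<bullet> (?b2 at (fst p) \<bullet> pr V p)"
      using Cmp_assoc[OF b2y b1y pB] pr_Ra[OF b1 y p] Cmp_assoc[OF b2y pVO b1x] pr_Ra[OF b2 y p] by simp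
    also have "?b2 at (fst p) = r' p" using b2c[OF x[OF p]] by (simp add: r'_def r_def)
    finally have 1: "pr ?B p \<bullet> (?b1y \<bullet> ?b2y) = ?b1 at (fst p) \<bullet> (r' p \<bullet> pr V p)" .
    have b1x': "?b1 at (fst p) \<in> Hom C (FObj V (fst p) \<boxtimes> ?I) (FObj ?B (fst p))"
      using b1x x[OF p] by (simp add: functor_simps)
    have "(FArr (Lo V) (snd p) \<star> n p) \<bullet> ?b1 at (fst p) = lg V p \<star> n p"
      using TensA_Cmp[OF unit_component[OF V x[OF p]] is_functorD(4)[OF functorsD[OF LV] h[OF p]] iI kOl[OF p]]
        Idn_right[OF kOl[OF p]] x[OF p] by (simp add: component_simps functor_simps lg_eq)
    then show "((FArr (Lo V) (snd p) \<star> n p) \<bullet> pr ?B p) \<bullet> (?b1y \<bullet> ?b2y) = (lg V p \<star> n p) \<bullet> (r' p \<bullet> pr V p)"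
      using Cmp_assoc[OF b12 pB mS[OF p]] 1 Cmp_assoc[OF r'p[OF p p] b1x' mS[OF p]] by simp
  qed
  finally have right: "?Sy \<bullet> ?b1y \<bullet> ?b2y = integ ?F (?E \<boxtimes> ?Q) (hf y) (\<lambda>p. (lg V p \<star> n p) \<bullet> (r' p \<bullet> pr V p))" .
  \<comment> \<open>the left half\<close>
  have mO: "m p \<star> FArr (Ro ?O) (inv_arr Y (snd p)) \<in> Hom C (?E \<boxtimes> ?Q) (FObj ?A (fst p))" if p: "p \<in> Obj (hf y)" for p
    using TensA_closed[OF k(7)[OF y p] is_functorD(4)[OF functorsD[OF RO] ih[OF p]]] x[OF p] by (simp add: functor_simps)
  have mp: "m p \<star> pr ?O p \<in> Hom C (?E \<boxtimes> ?Q) (FObj V (fst p) \<boxtimes> ?I)" if p: "p \<in> Obj (hf y)" for p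
    by (rule TensA_closed[OF k(7)[OF y p] kOm[OF p]])
  have left_summand: "lg V p \<bullet> (r p \<bullet> (m p \<star> pr ?O p)) \<in> Hom C (?E \<boxtimes> ?Q) ?E" if p: "p \<in> Obj (hf y)" for p
    by (rule Cmp_closed[OF Cmp_closed[OF mp[OF p] r[OF p]] k(6)[OF y p]])
  have "A1 = integ (?E \<boxtimes> ?Q) ?E (hf y) (\<lambda>p. (?a1y \<bullet> ?a2y) \<bullet> (lg ?A p \<bullet> (m p \<star> FArr (Ro ?O) (inv_arr Y (snd p)))))"
    unfolding A1_def M(2)[OF y]
    by (rule integ_post[OF P.ess_finite_axioms EQ LA Cmp_closed[OF mO lg_closed[OF A y]] a12])
  also have "\<dots> = integ (?E \<boxtimes> ?Q) ?E (hf y) (\<lambda>p. lg V p \<bullet> (r p \<bullet> (m p \<star> pr ?O p)))"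
  proof (rule integ_eqI[OF P.ess_finite_axioms EQ E])
    fix p assume p: "p \<in> Obj (hf y)"
    note lA = lg_closed[OF A y p] and lVO = lg_closed[OF VO y p]
    have a2x: "?a2 at (fst p) \<in> Hom C (FObj ?A (fst p)) (FObj V (fst p) \<boxtimes> ?I)"
      using functor_cat_HomD(4)[OF a2 x[OF p]] x[OF p] by (simp add: functor_simps)
    have lVO': "lg ?VO p \<in> Hom C (FObj V (fst p) \<boxtimes> ?I) (FObj (Lo ?VO) y)" using lVO x[OF p] by (simp add: functor_simps)
    show "(?a1y \<bullet> ?a2y) \<bullet> (lg ?A p \<bullet> (m p \<star> FArr (Ro ?O) (inv_arr Y (snd p)))) \<in> Hom C (?E \<boxtimes> ?Q) ?E"
      by (rule Cmp_closed[OF Cmp_closed[OF mO[OF p] lA] a12])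
    have "(?a1y \<bullet> ?a2y) \<bullet> lg ?A p = ?a1y \<bullet> (lg ?VO p \<bullet> ?a2 at (fst p))"
      using Cmp_assoc[OF lA a2y a1y] La_lg[OF a2 y p] by simp
    also have "\<dots> = lg V p \<bullet> (r p \<bullet> ?a2 at (fst p))"
      using Cmp_assoc[OF a2x lVO' a1y] La_lg[OF a1 y p] Cmp_assoc[OF a2x r[OF p] k(6)[OF y p]] x[OF p]
      by (simp add: component_simps r_def)
    finally have 1: "(?a1y \<bullet> ?a2y) \<bullet> lg ?A p = lg V p \<bullet> (r p \<bullet> ?a2 at (fst p))" .
    have "?a2 at (fst p) \<bullet> (m p \<star> FArr (Ro ?O) (inv_arr Y (snd p))) = m p \<star> pr ?O p"
      using TensA_Cmp[OF k(7)[OF y p] Idn_closed[OF Vd(3)[OF x[OF p]]] is_functorD(4)[OF functorsD[OF RO] ih[OF p]] counit_component[OF O x[OF p]]]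
        Idn_left[OF k(7)[OF y p]] x[OF p] by (simp add: component_simps pr_def)
    then show "(?a1y \<bullet> ?a2y) \<bullet> (lg ?A p \<bullet> (m p \<star> FArr (Ro ?O) (inv_arr Y (snd p)))) = lg V p \<bullet> (r p \<bullet> (m p \<star> pr ?O p))"
      using Cmp_assoc[OF mO[OF p] lA a12] 1 Cmp_assoc[OF mO[OF p] Cmp_closed[OF a2x r[OF p]] k(6)[OF y p]]
        Cmp_assoc[OF mO[OF p] a2x r[OF p]] by simp
  qed
  finally have left: "A1 = integ (?E \<boxtimes> ?Q) ?E (hf y) (\<lambda>p. lg V p \<bullet> (r p \<bullet> (m p \<star> pr ?O p)))" .
  \<comment> \<open>the two halves meet in \<open>lg c \<star> n c\<close>\<close>
  define N where "N c d = rat_of_nat (card (Hom (hf y) c d))" for c d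
  have key: "A1 \<bullet> (lg V c \<star> n c) = scl (N c c) (lg V c \<bullet> r c)" if c: "c \<in> iso_reps (hf y)" for c
  proof -
    have co: "c \<in> Obj (hf y)" using P.reps_obj[OF c] .
    note rc = r[OF co] and lc = k(6)[OF y co]
    have Vc: "FObj V (fst c) \<in> Obj C" using Vd(3)[OF x[OF co]] .
    note VcI = TensO_closed[OF Vc I]
    let ?t = "lg V c \<bullet> r c"
    have t: "?t \<in> Hom C (FObj V (fst c) \<boxtimes> ?I) ?E" by (rule Cmp_closed[OF rc lc])
    have "A1 \<bullet> (lg V c \<star> n c) = integ (FObj V (fst c) \<boxtimes> ?I) ?E (hf y) (\<lambda>d. (lg V d \<bullet> (r d \<bullet> (m d \<star> pr ?O d))) \<bullet> (lg V c \<star> n c))"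
      unfolding left by (rule integ_pre[OF P.ess_finite_axioms EQ E left_summand ln[OF co]])
    also have "\<dots> = integ (FObj V (fst c) \<boxtimes> ?I) ?E (hf y) (\<lambda>d. scl (N c d * N c d) ?t)"
    proof (rule integ_eqI[OF P.ess_finite_axioms VcI E])
      fix d assume d: "d \<in> Obj (hf y)"
      show "(lg V d \<bullet> (r d \<bullet> (m d \<star> pr ?O d))) \<bullet> (lg V c \<star> n c) \<in> Hom C (FObj V (fst c) \<boxtimes> ?I) ?E"
        by (rule Cmp_closed[OF ln[OF co] left_summand[OF d]])
      have Vdd: "FObj V (fst d) \<in> Obj C" using Vd(3)[OF x[OF d]] .
      have u: "snd (snd \<kappa>) \<in> Hom X (fst c) (fst d)" if "\<kappa> \<in> Hom (hf y) c d" for \<kappa> using that by (simp add: hf_Hom)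
      have "pr ?O d \<bullet> n c = wsum ?I ?I (Hom (hf y) c d) (\<lambda>_. 1) (\<lambda>_. Idn C ?I)"
        unfolding kO(8)[OF y co d] FObj_Unit[OF x[OF co]] FObj_Unit[OF x[OF d]]
        using iI HomD(1)[OF u] by (intro wsum_cong[OF I I]) (auto simp: functor_simps)
      also have "\<dots> = scl (N c d) (Idn C ?I)"
        using wsum_const[OF I I P.finite_Hom iI, of c d "\<lambda>_. 1"] by (simp add: N_def)
      finally have 1: "pr ?O d \<bullet> n c = scl (N c d) (Idn C ?I)" .
      let ?s = "m d \<bullet> lg V c"
      have s: "?s \<in> Hom C (FObj V (fst c)) (FObj V (fst d))" by (rule Cmp_closed[OF lc k(7)[OF y d]])
      have "lg V d \<bullet> ?s = wsum (FObj V (fst c)) ?E (Hom (hf y) c d) (\<lambda>_. 1) (\<lambda>\<kappa>. lg V d \<bullet> FArr V (snd (snd \<kappa>)))"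
        unfolding k(8)[OF y co d]
        using Vd(4)[OF u] by (intro wsum_post[OF Vc Vdd P.finite_Hom _ k(6)[OF y d]]) auto
      also have "\<dots> = wsum (FObj V (fst c)) ?E (Hom (hf y) c d) (\<lambda>_. 1) (\<lambda>_. lg V c)"
        using k(9)[OF y] lc by (intro wsum_cong[OF Vc E]) auto
      also have "\<dots> = scl (N c d) (lg V c)"
        using wsum_const[OF Vc E P.finite_Hom lc, of c d "\<lambda>_. 1"] by (simp add: N_def)
      finally have 2: "lg V d \<bullet> ?s = scl (N c d) (lg V c)" .
      have 3: "lg V d \<bullet> (?s \<bullet> r c) = scl (N c d) ?t"
        using Cmp_assoc[OF rc s k(6)[OF y d]] 2 Cmp_scl_left[OF rc lc] by simp
      have "(lg V d \<bullet> (r d \<bullet> (m d \<star> pr ?O d))) \<bullet> (lg V c \<star> n c) = lg V d \<bullet> (r d \<bullet> ((m d \<star> pr ?O d) \<bullet> (lg V c \<star> n c)))"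
        using Cmp_assoc[OF ln[OF co] Cmp_closed[OF mp[OF d] r[OF d]] k(6)[OF y d]] Cmp_assoc[OF ln[OF co] mp[OF d] r[OF d]] by simp
      also have "(m d \<star> pr ?O d) \<bullet> (lg V c \<star> n c) = scl (N c d) (?s \<star> Idn C ?I)"
        using TensA_Cmp[OF lc k(7)[OF y d] kOl[OF co] kOm[OF d]] 1 TensA_scl_right[OF s iI] by simp
      also have "r d \<bullet> scl (N c d) (?s \<star> Idn C ?I) = scl (N c d) (?s \<bullet> r c)"
        using Cmp_scl_right[OF TensA_closed[OF s iI] r[OF d]] RUn_natural[OF s] by (simp add: r_def)
      also have "lg V d \<bullet> scl (N c d) (?s \<bullet> r c) = scl (N c d * N c d) ?t"
        using Cmp_scl_right[OF Cmp_closed[OF rc s] k(6)[OF y d]] 3 scl_scl[OF t] by simp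
      finally show "(lg V d \<bullet> (r d \<bullet> (m d \<star> pr ?O d))) \<bullet> (lg V c \<star> n c) = scl (N c d * N c d) ?t" .
    qed
    also have "\<dots> = scl (\<Sum>d\<in>iso_reps (hf y). 1 / N d d * (N c d * N c d)) ?t"
      unfolding integ_def N_def
      using wsum_scl_in[OF VcI E, of "\<lambda>_. ?t" "iso_reps (hf y)"] t wsum_const[OF VcI E P.reps_finite t] by simp
    also have "(\<Sum>d\<in>iso_reps (hf y). 1 / N d d * (N c d * N c d)) = (\<Sum>d\<in>iso_reps (hf y). if d = c then N c c else 0)"
    proof (rule sum.cong)
      fix d assume d: "d \<in> iso_reps (hf y)"
      show "1 / N d d * (N c d * N c d) = (if d = c then N c c else 0)"
      proof (cases "d = c")
        case True
        have "N c c > 0" unfolding N_def using P.card_Aut_pos[OF co] by (simp only: of_nat_0_less_iff)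
        then show ?thesis using True by simp
      next
        case False
        have "Hom (hf y) c d = {}"
          using P.reps_unique[OF d c, of c] False P.Idn_closed[OF co] by blast
        then show ?thesis using False by (simp add: N_def)
      qed
    qed simp
    also have "\<dots> = N c c" using c P.reps_finite by simp
    finally show ?thesis .
  qed
  have lp: "lg V c \<bullet> pr V c \<in> Hom C ?F ?E" if "c \<in> Obj (hf y)" for c
    by (rule Cmp_closed[OF kR(7)[OF y that] k(6)[OF y that]])
  have rp: "(lg V c \<star> n c) \<bullet> (r' c \<bullet> pr V c) \<in> Hom C ?F (?E \<boxtimes> ?Q)" if "c \<in> Obj (hf y)" for c
    by (rule Cmp_closed[OF r'p[OF that that] ln[OF that]])
  have "A1 \<bullet> (?Sy \<bullet> ?b1y \<bullet> ?b2y) = integ ?F ?E (hf y) (\<lambda>c. A1 \<bullet> ((lg V c \<star> n c) \<bullet> (r' c \<bullet> pr V c)))"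
    unfolding right by (rule integ_post[OF P.ess_finite_axioms F EQ rp A1])
  also have "\<dots> = wsum ?F ?E (iso_reps (hf y)) (\<lambda>c. 1 / N c c) (\<lambda>c. scl (N c c) (lg V c \<bullet> pr V c))"
    unfolding integ_def N_def
  proof (rule wsum_cong[OF F E])
    fix c assume c: "c \<in> iso_reps (hf y)"
    then have co: "c \<in> Obj (hf y)" by (rule P.reps_obj)
    note lc = k(6)[OF y co] and pc = kR(7)[OF y co]
    have "A1 \<bullet> ((lg V c \<star> n c) \<bullet> (r' c \<bullet> pr V c)) = scl (N c c) (lg V c \<bullet> r c) \<bullet> (r' c \<bullet> pr V c)"
      using Cmp_assoc[OF r'p[OF co co] ln[OF co] A1] key[OF c] by simp
    also have "\<dots> = scl (N c c) (lg V c \<bullet> (r c \<bullet> (r' c \<bullet> pr V c)))"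
      using Cmp_scl_left[OF r'p[OF co co] Cmp_closed[OF r[OF co] lc]] Cmp_assoc[OF r'p[OF co co] r[OF co] lc] by simp
    also have "r c \<bullet> (r' c \<bullet> pr V c) = pr V c"
      using Cmp_assoc[OF pc r'[OF co] r[OF co]] rr'[OF co] Idn_left[OF pc] by simp
    finally show "A1 \<bullet> ((lg V c \<star> n c) \<bullet> (r' c \<bullet> pr V c)) = scl (of_nat (card (Hom (hf y) c c))) (lg V c \<bullet> pr V c)"
      by (simp add: N_def)
  qed (use Cmp_closed[OF rp A1] scl_closed[OF lp] P.reps_obj in auto)
  also have "\<dots> = wsum ?F ?E (iso_reps (hf y)) (\<lambda>_. 1) (\<lambda>c. lg V c \<bullet> pr V c)"
  proof -
    have lp': "(\<lambda>c. lg V c \<bullet> pr V c) \<in> iso_reps (hf y) \<rightarrow> Hom C ?F ?E" using lp P.reps_obj by auto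
    have "1 / N c c * N c c = 1" if "c \<in> iso_reps (hf y)" for c
    proof -
      have "N c c > 0" unfolding N_def using P.card_Aut_pos[OF P.reps_obj[OF that]] by (simp only: of_nat_0_less_iff)
      then show ?thesis by simp
    qed
    then show ?thesis by (subst wsum_scl_in[OF F E lp']) (intro wsum_cong[OF F E lp' lp'], auto)
  qed
  finally show "pre_nakayama CY CX T V at y
      = wsum (FObj (Ro V) y) (FObj (Lo V) y) (iso_reps (hf y)) (\<lambda>_. 1) (\<lambda>c. lg V c \<bullet> pr V c)"
    unfolding \<gamma> .
qed

end

section \<open>The endomorphism \<open>\<delta>\<close> and the Nakayama map\<close>

lemma conn_component_Hom:
  "k \<in> Hom (conn_component P p) a b \<longleftrightarrow> k \<in> Hom P a b \<and> Hom P p a \<noteq> {} \<and> Hom P p b \<noteq> {}"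
  by (auto simp: Hom_def conn_component_def)

lemma conn_component_sel:
  "q \<in> Obj (conn_component P p) \<longleftrightarrow> q \<in> Obj P \<and> Hom P p q \<noteq> {}"
  "Idn (conn_component P p) = Idn P" "Cmp (conn_component P p) = Cmp P"
  "Dom (conn_component P p) = Dom P" "Cod (conn_component P p) = Cod P"
  by (simp_all add: conn_component_def)

lemma conn_component_ess_finite:
  assumes P: "ess_finite P" and p: "p \<in> Obj P"
  shows "ess_finite (conn_component P p)"
proof -
  interpret P: ess_finite P by fact
  let ?Q = "conn_component P p"
  have trans: "Hom P p b \<noteq> {}" if "Hom P p a \<noteq> {}" "k \<in> Hom P a b" for a b k
    using P.Cmp_closed that by blast
  have cat: "category ?Q"
  proof
    fix k assume "k \<in> Arr ?Q"
    then show "Dom ?Q k \<in> Obj ?Q" "Cod ?Q k \<in> Obj ?Q"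
      using P.Dom_closed P.Cod_closed by (auto simp: conn_component_def)
  qed (auto simp: conn_component_Hom conn_component_sel
      intro: P.Idn_closed P.Cmp_closed P.Idn_left P.Idn_right P.Cmp_assoc)
  interpret Q: category ?Q by (rule cat)
  have "groupoid ?Q"
    unfolding groupoid_def
  proof (intro conjI ballI cat)
    fix k assume "k \<in> Arr ?Q"
    then have k: "k \<in> Hom ?Q (Dom P k) (Cod P k)" by (simp add: Hom_def conn_component_def)
    then have k': "k \<in> Hom P (Dom P k) (Cod P k)" and ne: "Hom P p (Dom P k) \<noteq> {}" "Hom P p (Cod P k) \<noteq> {}"
      by (simp_all add: conn_component_Hom)
    note i = groupoid_inv[OF P.groupoid k']
    have "inv_arr P k \<in> Hom ?Q (Cod P k) (Dom P k)" using i ne by (simp add: conn_component_Hom)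
    from Q.inverse_arrowsI[OF k this] i show "is_iso_arr ?Q k"
      unfolding is_iso_arr_def conn_component_sel by blast
  qed
  then show ?thesis
  proof (rule ess_finiteI)
    show "finite {p}" by simp
    show "\<exists>s\<in>{p}. Hom ?Q q s \<noteq> {}" if q: "q \<in> Obj ?Q" for q
    proof -
      obtain k where k: "k \<in> Hom P p q" using q by (auto simp: conn_component_sel)
      have "inv_arr P k \<in> Hom ?Q q p"
        using groupoid_inv(1)[OF P.groupoid k] q P.Idn_closed[OF p] by (auto simp: conn_component_Hom conn_component_sel)
      then show ?thesis by blast
    qed
    show "finite (Hom ?Q a b)" for a b
      by (rule finite_subset[OF _ P.finite_Hom[of a b]]) (auto simp: conn_component_Hom)
  qed
qed

lemma point_cat_ess_finite: "ess_finite point_cat"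
proof (rule ess_finiteI)
  have cat: "category point_cat" by unfold_locales (auto simp: point_cat_def Hom_def)
  have "inverse_arrows point_cat k ()" for k by (simp add: inverse_arrows_def point_cat_def Hom_def)
  then show "groupoid point_cat" unfolding groupoid_def is_iso_arr_def using cat by blast
  show "finite {()}" by simp
qed (auto simp: point_cat_def Hom_def)

context rational_monoidal_category
begin

text \<open>The fibre of \<open>\<iota>\<close> over \<open>p\<close> is the discrete set \<open>Hom b p\<close>, and each of its points contributes an
  identity, so \<open>\<delta>\<close> multiplies by the order of the automorphism group.\<close>

lemma component_endo_at:
  fixes P :: "('p, 'q) category"
  assumes P: "ess_finite P" and p: "p \<in> Obj P"
  shows "component_endo (conn_component P p) C at p = scl (of_nat (card (Hom P p p))) (Idn C (Unit C))"
proof -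
  interpret P: ess_finite P by fact
  let ?Q = "conn_component P p"
  interpret Q: ess_finite ?Q by (rule conn_component_ess_finite[OF P p])
  have pQ: "p \<in> Obj ?Q" using p P.Idn_closed[OF p] by (auto simp: conn_component_sel)
  define b where "b = (SOME b. b \<in> Obj ?Q)"
  have b: "b \<in> Obj ?Q" unfolding b_def using pQ by (rule someI)
  let ?i = "point_map ?Q b"
  have i: "is_functor point_cat ?Q ?i"
    using point_cat_ess_finite[THEN ess_finite.groupoid, THEN groupoid_category] Q.category_axioms b Q.Idn_closed[OF b]
      Q.Idn_left[OF Q.Idn_closed[OF b]]
    by (auto simp: is_functor_def point_map_def point_cat_def)
  interpret K: kan_setting C add zer scl point_cat ?Q ?i
    by (intro kan_setting.intro rational_monoidal_category_axioms groupoid_map.intro groupoid_map_axioms.intro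
        point_cat_ess_finite Q.ess_finite_axioms i)
  let ?O = "Unit K.CY"
  let ?V = "pull_functor point_cat ?i ?O"
  have O: "?O \<in> functors ?Q C" by (rule Unit_functor_closed[OF Q.category_axioms])
  have V: "?V \<in> functors point_cat C" by (rule K.rs_closed[OF O])
  note g = K.pre_nakayama_component[OF V]
  interpret H: ess_finite "K.hf p" by (rule K.hf_ess_finite)
  have "component_endo ?Q C at p = shriek_counit K.T ?O at p \<bullet>
      (pre_nakayama K.CY K.CX K.T ?V at p \<bullet> star_unit K.T ?O at p)"
    using pQ by (simp add: component_endo_def Let_def component_simps K.kan_sel FObj_restriction flip: b_def)
  also have "\<dots> = wsum (Unit C) (Unit C) (iso_reps (K.hf p)) (\<lambda>_. 1) (\<lambda>_. Idn C (Unit C))"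
  proof -
    let ?E = "FObj (K.Lo ?V) p" and ?F = "FObj (K.Ro ?V) p"
    have E: "?E \<in> Obj C" and F: "?F \<in> Obj C"
      using is_functorD(3)[OF functorsD[OF K.Lfun(3)[OF V]] pQ] is_functorD(3)[OF functorsD[OF K.Rfun(3)[OF V]] pQ] by simp_all
    have c: "shriek_counit K.T ?O at p \<in> Hom C ?E (Unit C)" and u: "star_unit K.T ?O at p \<in> Hom C (Unit C) ?F"
      using functor_cat_HomD(4)[OF K.Lad(4)[OF O] pQ] functor_cat_HomD(4)[OF K.Rad(3)[OF O] pQ] pQ by (simp_all add: functor_simps)
    note lg = K.lg_closed[OF V pQ] and pr = K.pr_closed[OF V pQ]
    note lp = Cmp_closed[OF pr lg]
    have x: "fst q \<in> Obj point_cat" and h: "snd q \<in> Hom ?Q (FObj ?i (fst q)) p" if "q \<in> Obj (K.hf p)" for q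
      using that by (simp_all add: K.hf_Obj)
    have "pre_nakayama K.CY K.CX K.T ?V at p \<bullet> star_unit K.T ?O at p
        = wsum (Unit C) ?E (iso_reps (K.hf p)) (\<lambda>_. 1) (\<lambda>q. (K.lg ?V q \<bullet> K.pr ?V q) \<bullet> star_unit K.T ?O at p)"
      unfolding g(2)[OF pQ] using lp H.reps_obj by (intro wsum_pre[OF F E H.reps_finite _ u]) auto
    then have "shriek_counit K.T ?O at p \<bullet>
        (pre_nakayama K.CY K.CX K.T ?V at p \<bullet> star_unit K.T ?O at p)
        = wsum (Unit C) (Unit C) (iso_reps (K.hf p)) (\<lambda>_. 1)
            (\<lambda>q. shriek_counit K.T ?O at p \<bullet> ((K.lg ?V q \<bullet> K.pr ?V q) \<bullet> star_unit K.T ?O at p))"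
      using wsum_post[OF Unit_closed E H.reps_finite _ c] Cmp_closed[OF u lp] H.reps_obj by (auto simp: Pi_iff)
    also have "\<dots> = wsum (Unit C) (Unit C) (iso_reps (K.hf p)) (\<lambda>_. 1) (\<lambda>_. Idn C (Unit C))"
    proof (rule wsum_cong[OF Unit_closed Unit_closed])
      fix q assume "q \<in> iso_reps (K.hf p)"
      then have q: "q \<in> Obj (K.hf p)" by (rule H.reps_obj)
      note ih = groupoid_inv(1)[OF Q.groupoid h[OF q]]
      have "shriek_counit K.T ?O at p \<bullet> ((K.lg ?V q \<bullet> K.pr ?V q) \<bullet> star_unit K.T ?O at p)
          = (shriek_counit K.T ?O at p \<bullet> K.lg ?V q) \<bullet> (K.pr ?V q \<bullet> star_unit K.T ?O at p)"
        using Cmp_assoc[OF u pr[OF q] lg[OF q]] Cmp_assoc[OF Cmp_closed[OF u pr[OF q]] lg[OF q] c] by simp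
      then show "shriek_counit K.T ?O at p \<bullet> ((K.lg ?V q \<bullet> K.pr ?V q) \<bullet> star_unit K.T ?O at p) = Idn C (Unit C)"
        using K.counit_lg[OF O pQ q] K.pr_unit[OF O pQ q] HomD(1)[OF h[OF q]] HomD(1)[OF ih] Idn_left[OF Idn_closed[OF Unit_closed]]
        by (simp add: functor_simps)
    qed (use Cmp_closed[OF Cmp_closed[OF u lp] c] Idn_closed[OF Unit_closed] H.reps_obj in auto)
    finally show ?thesis .
  qed
  also have "\<dots> = scl (of_nat (card (iso_reps (K.hf p)))) (Idn C (Unit C))"
    using wsum_const[OF Unit_closed Unit_closed H.reps_finite Idn_closed[OF Unit_closed], of "\<lambda>_. 1"] by simp
  also have "card (iso_reps (K.hf p)) = card (Hom P p p)"
  proof -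
    have Obj: "Obj (K.hf p) = {()} \<times> Hom ?Q b p" by (auto simp: hfibre_def point_map_def point_cat_def)
    have disc: "q = q'" if "\<kappa> \<in> Hom (K.hf p) q q'" for \<kappa> q q'
    proof -
      have "FArr ?i k = Idn ?Q b" "FObj ?i x = b" for k x by (simp_all add: point_map_def)
      then have "snd q' \<bullet>\<^bsub>?Q\<^esub> Idn ?Q b = snd q" and q': "snd q' \<in> Hom ?Q b p"
        using that by (simp_all only: K.hf_Hom K.hf_Obj)
      then have "snd q = snd q'" using Q.Idn_right[OF q'] by simp
      then show ?thesis by (simp add: prod_eq_iff)
    qed
    have "iso_reps (K.hf p) = Obj (K.hf p)"
    proof
      show "Obj (K.hf p) \<subseteq> iso_reps (K.hf p)"
      proof
        fix q assume "q \<in> Obj (K.hf p)"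
        then obtain c where c: "c \<in> iso_reps (K.hf p)" and "Hom (K.hf p) q c \<noteq> {}" by (rule H.reps_ex)
        then obtain \<kappa> where "\<kappa> \<in> Hom (K.hf p) q c" by blast
        from disc[OF this] c show "q \<in> iso_reps (K.hf p)" by simp
      qed
    qed (use H.reps_obj in auto)
    then have "card (iso_reps (K.hf p)) = card (Hom ?Q b p)" by (simp add: Obj card_cartesian_product)
    also have "Hom ?Q b p = Hom P b p"
      using b pQ by (auto simp: conn_component_Hom conn_component_sel)
    also have "card (Hom P b p) = card (Hom P p p)"
    proof (rule P.card_Hom_rep)
      obtain k where "k \<in> Hom P p b" using b by (auto simp: conn_component_sel)
      then show "Hom P b p \<noteq> {}" using groupoid_inv(1)[OF P.groupoid] by blast
    qed
    finally show ?thesis .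
  qed
  finally show ?thesis .
qed

end

context kan_setting
begin

lemma card_Aut_invariant:
  assumes "\<kappa> \<in> Hom (hf y) p q" shows "card (Hom (hf y) p p) = card (Hom (hf y) q q)"
  by (rule trans[OF bij_betw_same_card[OF groupoid_post_bij[OF hf_groupoid assms]]
        bij_betw_same_card[OF groupoid_pre_bij[OF hf_groupoid assms], symmetric]])

lemma delta_iso:
  "is_iso_arr (functor_cat (hf y) C) (delta X Y C f y)"
  "q \<in> Obj (hf y) \<Longrightarrow> inv_arr (functor_cat (hf y) C) (delta X Y C f y) at q
     = scl (1 / of_nat (card (Hom (hf y) q q))) (Idn C (Unit C))"
proof -
  let ?P = "hf y" and ?F = "functor_cat (hf y) C"
  interpret P: ess_finite ?P by (rule hf_ess_finite)
  let ?O = "Unit ?F"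
  note O = Unit_functor_closed[OF P.category_axioms]
  note iI = Idn_closed[OF Unit_closed]
  let ?d = "\<lambda>q. scl (of_nat (card (Hom ?P q q))) (Idn C (Unit C))"
  have d: "delta X Y C f y = (?O, ?O, restrict ?d (Obj ?P))"
  proof -
    have "?O = unit_functor ?P C" by (simp add: functor_cat_def)
    then show ?thesis
      using component_endo_at[OF P.ess_finite_axioms] by (simp add: delta_def Let_def cong: restrict_cong)
  qed
  have h: "delta X Y C f y \<in> Hom ?F ?O ?O"
    unfolding d
  proof (rule functor_cat_HomI[OF O O])
    fix \<kappa> p q assume \<kappa>: "\<kappa> \<in> Hom ?P p q"
    show "?d q \<bullet> FArr ?O \<kappa> = FArr ?O \<kappa> \<bullet> ?d p"
      using card_Aut_invariant[OF \<kappa>] Idn_left[OF scl_closed[OF iI]] Idn_right[OF scl_closed[OF iI]]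
      by (simp add: functor_simps HomD(1)[OF \<kappa>])
  qed (use scl_closed[OF iI] in \<open>simp add: functor_simps\<close>)
  have inv: "inverse_arrows C (delta X Y C f y at q) (scl (1 / of_nat (card (Hom ?P q q))) (Idn C (Unit C)))"
    if q: "q \<in> Obj ?P" for q
  proof -
    have "rat_of_nat (card (Hom ?P q q)) > 0" using P.card_Aut_pos[OF q] by (simp only: of_nat_0_less_iff)
    then have n: "rat_of_nat (card (Hom ?P q q)) \<noteq> 0" by simp
    have sc: "scl a (Idn C (Unit C)) \<bullet> scl b (Idn C (Unit C)) = scl (a * b) (Idn C (Unit C))" for a b
      using Cmp_scl_left[OF scl_closed[OF iI] iI] Idn_left[OF scl_closed[OF iI]] scl_scl[OF iI] by simp
    show ?thesis
      using q n scl_closed[OF iI] sc scl_one[OF iI] by (intro inverse_arrowsI) (auto simp: d)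
  qed
  from functor_cat_inverse(1,3)[OF P.category_axioms category_axioms h inv]
  show "is_iso_arr ?F (delta X Y C f y)" "q \<in> Obj ?P \<Longrightarrow> inv_arr ?F (delta X Y C f y) at q
     = scl (1 / of_nat (card (Hom ?P q q))) (Idn C (Unit C))"
    by auto
qed

lemma delta_action:
  assumes V: "V \<in> functors X C" and q: "q \<in> Obj (hf y)"
  shows "(unit_endo_action (functor_cat (hf y) C) (inv_arr (functor_cat (hf y) C) (delta X Y C f y)) (fib V y)) at q
     = scl (1 / of_nat (card (Hom (hf y) q q))) (Idn C (FObj V (fst q)))"
proof -
  let ?P = "hf y" and ?F = "functor_cat (hf y) C" and ?a = "FObj V (fst q)"
  have fV: "fib V y \<in> functors ?P C" by (rule pull_functor_closed[OF hf_proj V])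
  have a: "?a \<in> Obj C" using is_functorD(3)[OF functorsD[OF V]] q by (simp add: hf_Obj)
  note L = LUn_closed[OF a] and iI = Idn_closed[OF Unit_closed] and ia = Idn_closed[OF a]
  note Li = is_iso_inv_arr[OF conjunct2[OF L] conjunct1[OF L]]
  have "unit_endo_action ?F (inv_arr ?F (delta X Y C f y)) (fib V y) at q
      = LUn C ?a \<bullet> (scl (1 / of_nat (card (Hom ?P q q))) (Idn C (Unit C)) \<star> Idn C ?a) \<bullet> inv_arr C (LUn C ?a)"
    using q LUn_functor_inv[OF fV q] delta_iso(2)[OF q] by (simp add: unit_endo_action_def component_simps fib_Obj)
  also have "scl (1 / of_nat (card (Hom ?P q q))) (Idn C (Unit C)) \<star> Idn C ?a
      = scl (1 / of_nat (card (Hom ?P q q))) (Idn C (Unit C \<boxtimes> ?a))"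
    using TensA_scl_left[OF iI ia] TensA_Idn[OF Unit_closed a] by simp
  also have "LUn C ?a \<bullet> \<dots> \<bullet> inv_arr C (LUn C ?a) = scl (1 / of_nat (card (Hom ?P q q))) (Idn C ?a)"
    using Cmp_scl_left[OF Li(1) Idn_closed[OF TensO_closed[OF Unit_closed a]]] Idn_left[OF Li(1)]
      Cmp_scl_right[OF Li(1) conjunct1[OF L]] Li(3) by simp
  finally show ?thesis .
qed

text \<open>The order of the automorphism group is constant on components of the fibre, so dividing the legs
  by it gives another cocone.\<close>

lemma shriek_delta_inv:
  assumes V: "V \<in> functors X C"
  shows "shriek_delta_inv X Y C f V \<in> Hom CY (Lo V) (Lo V)"
    "y \<in> Obj Y \<Longrightarrow> q \<in> Obj (hf y) \<Longrightarrow> shriek_delta_inv X Y C f V at y \<bullet> lg V q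
       = scl (1 / of_nat (card (Hom (hf y) q q))) (lg V q)"
proof -
  obtain m where K: "kan_cone V (Lo V) (lg V) m" using left_cone[OF V] by blast
  note k = kan_coneD[OF K] and LV = Lfun(3)[OF V]
  note Ld = is_functorD[OF functorsD[OF LV]] and Vd = is_functorD[OF functorsD[OF V]]
  define N where "N q = rat_of_nat (card (Hom (hf (Cod Y (snd q))) q q))" for q
  have N: "N q = of_nat (card (Hom (hf y) q q))" if "q \<in> Obj (hf y)" for q y
    using that by (simp add: N_def hf_Obj Hom_def[of Y])
  have "\<exists>\<alpha>\<in>Hom CY (Lo V) (Lo V). \<forall>y\<in>Obj Y. \<forall>q\<in>Obj (hf y). \<alpha> at y \<bullet> lg V q = scl (1 / N q) (lg V q)"
  proof (rule kan_cone_out[OF K LV])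
    fix y p assume "y \<in> Obj Y" "p \<in> Obj (hf y)"
    then show "scl (1 / N p) (lg V p) \<in> Hom C (FObj V (fst p)) (FObj (Lo V) y)" by (rule scl_closed[OF k(6)])
  next
    fix y p q \<kappa> assume y: "y \<in> Obj Y" and \<kappa>: "\<kappa> \<in> Hom (hf y) p q"
    have p: "p \<in> Obj (hf y)" and q: "q \<in> Obj (hf y)" and u: "snd (snd \<kappa>) \<in> Hom X (fst p) (fst q)"
      using \<kappa> by (simp_all add: hf_Hom)
    show "scl (1 / N q) (lg V q) \<bullet> FArr V (snd (snd \<kappa>)) = scl (1 / N p) (lg V p)"
      using Cmp_scl_left[OF Vd(4)[OF u] k(6)[OF y q]] k(9)[OF y \<kappa>] card_Aut_invariant[OF \<kappa>] N[OF p] N[OF q] by simp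
  next
    fix y y' j p assume j: "j \<in> Hom Y y y'" and p: "p \<in> Obj (hf y)"
    note y = Y.Hom_obj[OF j]
    show "FArr (Lo V) j \<bullet> scl (1 / N p) (lg V p) = scl (1 / N (push j p)) (lg V (push j p))"
      using Cmp_scl_right[OF k(6)[OF y(1) p] Ld(4)[OF j]] k(4)[OF j p] N[OF p] N[OF push_closed[OF j p]]
        bij_betw_same_card[OF push_Hom_bij[OF j p p]] by simp
  qed
  then obtain \<alpha> where \<alpha>: "\<alpha> \<in> Hom CY (Lo V) (Lo V)"
    and \<alpha>l: "\<And>y q. y \<in> Obj Y \<Longrightarrow> q \<in> Obj (hf y) \<Longrightarrow> \<alpha> at y \<bullet> lg V q = scl (1 / N q) (lg V q)" by blast
  note \<alpha>c = functor_cat_HomD(4)[OF \<alpha>]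
  let ?e = "\<lambda>y. unit_endo_action (functor_cat (hf y) C) (inv_arr (functor_cat (hf y) C) (delta X Y C f y)) (fib V y)"
  have e: "lg V q \<bullet> ?e y at q = scl (1 / N q) (lg V q)" if y: "y \<in> Obj Y" and q: "q \<in> Obj (hf y)" for y q
    using delta_action[OF V q] Cmp_scl_right[OF Idn_closed[OF Hom_obj(1)[OF k(6)[OF y q]]] k(6)[OF y q]]
      Idn_right[OF k(6)[OF y q]] N[OF q] by simp
  have the: "(THE u. u \<in> Hom C (FObj (Lo V) y) (FObj (Lo V) y) \<and>
      (\<forall>q \<in> Obj (hf y). u \<bullet> lg V q = lg V q \<bullet> ?e y at q)) = \<alpha> at y" if y: "y \<in> Obj Y" for y
  proof (rule the_equality)
    show "\<alpha> at y \<in> Hom C (FObj (Lo V) y) (FObj (Lo V) y) \<and>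
      (\<forall>q \<in> Obj (hf y). \<alpha> at y \<bullet> lg V q = lg V q \<bullet> ?e y at q)"
      using \<alpha>c[OF y] \<alpha>l[OF y] e[OF y] by simp
    fix u assume u: "u \<in> Hom C (FObj (Lo V) y) (FObj (Lo V) y) \<and>
      (\<forall>q \<in> Obj (hf y). u \<bullet> lg V q = lg V q \<bullet> ?e y at q)"
    then show "u = \<alpha> at y"
      using \<alpha>l[OF y] e[OF y] by (intro bilimit_ext_left[OF hf_ess_finite k(3)[OF y] _ \<alpha>c[OF y]]) auto
  qed
  have "shriek_delta_inv X Y C f V = (Lo V, Lo V, \<lambda>y\<in>Obj Y. \<alpha> at y)"
    unfolding shriek_delta_inv_def Let_def using the by (auto cong: restrict_cong)
  moreover have "(Lo V, Lo V, \<lambda>y\<in>Obj Y. \<alpha> at y) \<in> Hom CY (Lo V) (Lo V)"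
    using functor_cat_HomD(4,5)[OF \<alpha>] by (intro functor_cat_HomI[OF LV LV]) auto
  ultimately show "shriek_delta_inv X Y C f V \<in> Hom CY (Lo V) (Lo V)"
    "y \<in> Obj Y \<Longrightarrow> q \<in> Obj (hf y) \<Longrightarrow> shriek_delta_inv X Y C f V at y \<bullet> lg V q
       = scl (1 / of_nat (card (Hom (hf y) q q))) (lg V q)"
    using \<alpha>l N by simp_all
qed

text \<open>The factor \<open>1 / card (Aut c)\<close> supplied by \<open>\<delta>\<inverse>\<close> turns the sum over components into the
  integral over the homotopy fibre.\<close>

lemma nakayama_component:
  assumes V: "V \<in> functors X C"
  shows "nakayama X Y C f V \<in> Hom CY (Ro V) (Lo V)"
    "y \<in> Obj Y \<Longrightarrow> nakayama X Y C f V at y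
       = integ (FObj (Ro V) y) (FObj (Lo V) y) (hf y) (\<lambda>c. lg V c \<bullet> pr V c)"
proof -
  note g = pre_nakayama_component[OF V] and s = shriek_delta_inv[OF V]
  show "nakayama X Y C f V \<in> Hom CY (Ro V) (Lo V)"
    unfolding nakayama_def by (rule CY.Cmp_closed[OF g(1) s(1)])
  assume y: "y \<in> Obj Y"
  interpret P: ess_finite "hf y" by (rule hf_ess_finite)
  let ?E = "FObj (Lo V) y" and ?F = "FObj (Ro V) y" and ?S = "shriek_delta_inv X Y C f V at y"
  have E: "?E \<in> Obj C" and F: "?F \<in> Obj C"
    using is_functorD(3)[OF functorsD[OF Lfun(3)[OF V]] y] is_functorD(3)[OF functorsD[OF Rfun(3)[OF V]] y] by simp_all
  note sy = functor_cat_HomD(4)[OF s(1) y] and lg = lg_closed[OF V y] and pr = pr_closed[OF V y]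
  have lp: "(\<lambda>c. lg V c \<bullet> pr V c) \<in> iso_reps (hf y) \<rightarrow> Hom C ?F ?E"
    using Cmp_closed[OF pr lg] P.reps_obj by auto
  have "nakayama X Y C f V at y = ?S \<bullet> wsum ?F ?E (iso_reps (hf y)) (\<lambda>_. 1) (\<lambda>c. lg V c \<bullet> pr V c)"
    unfolding nakayama_def using y g(2)[OF y] by (simp add: component_simps)
  also have "\<dots> = wsum ?F ?E (iso_reps (hf y)) (\<lambda>_. 1) (\<lambda>c. ?S \<bullet> (lg V c \<bullet> pr V c))"
    by (rule wsum_post[OF F E P.reps_finite lp sy])
  also have "\<dots> = wsum ?F ?E (iso_reps (hf y)) (\<lambda>_. 1) (\<lambda>c. scl (1 / of_nat (card (Hom (hf y) c c))) (lg V c \<bullet> pr V c))"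
  proof (rule wsum_cong[OF F E])
    fix c assume "c \<in> iso_reps (hf y)"
    then have c: "c \<in> Obj (hf y)" by (rule P.reps_obj)
    show "?S \<bullet> (lg V c \<bullet> pr V c) = scl (1 / of_nat (card (Hom (hf y) c c))) (lg V c \<bullet> pr V c)"
      using Cmp_assoc[OF pr[OF c] lg[OF c] sy] s(2)[OF y c] Cmp_scl_left[OF pr[OF c] lg[OF c]] by simp
  qed (use lp scl_closed Cmp_closed[OF _ sy] in \<open>auto simp: Pi_iff\<close>)
  also have "\<dots> = integ ?F ?E (hf y) (\<lambda>c. lg V c \<bullet> pr V c)"
    unfolding integ_def by (subst wsum_scl_in[OF F E lp]) simp
  finally show "nakayama X Y C f V at y = integ ?F ?E (hf y) (\<lambda>c. lg V c \<bullet> pr V c)" .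
qed

text \<open>The integrand \<open>lg \<circ> pr\<close> is natural, because \<open>f\<^sub>! t\<close> and \<open>f\<^sub>* t\<close> are given by \<open>t\<close> on legs and
  projections.\<close>

lemma nakayama_natural:
  assumes t: "t \<in> Hom CX V W"
  shows "La t \<bullet>\<^bsub>CY\<^esub> nakayama X Y C f V = nakayama X Y C f W \<bullet>\<^bsub>CY\<^esub> Ra t"
proof -
  note V = functor_cat_HomD(1)[OF t] and W = functor_cat_HomD(2)[OF t]
  note nV = nakayama_component[OF V] and nW = nakayama_component[OF W]
  note Lt = Lfun(4)[OF t] and Rt = Rfun(4)[OF t]
  show ?thesis
  proof (rule functor_cat_ext[OF CY.Cmp_closed[OF nV(1) Lt] CY.Cmp_closed[OF Rt nW(1)]])
    fix y assume y: "y \<in> Obj Y"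
    have o: "FObj (Lo U) y \<in> Obj C" "FObj (Ro U) y \<in> Obj C" if "U \<in> functors X C" for U
      using is_functorD(3)[OF functorsD[OF Lfun(3)[OF that]] y] is_functorD(3)[OF functorsD[OF Rfun(3)[OF that]] y] by simp_all
    note Lty = functor_cat_HomD(4)[OF Lt y] and Rty = functor_cat_HomD(4)[OF Rt y]
    note lV = lg_closed[OF V y] and pV = pr_closed[OF V y] and lW = lg_closed[OF W y] and pW = pr_closed[OF W y]
    have tp: "t at (fst p) \<in> Hom C (FObj V (fst p)) (FObj W (fst p))" if "p \<in> Obj (hf y)" for p
      using functor_cat_HomD(4)[OF t] that by (simp add: hf_Obj)
    have "La t at y \<bullet> integ (FObj (Ro V) y) (FObj (Lo V) y) (hf y) (\<lambda>c. lg V c \<bullet> pr V c)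
        = integ (FObj (Ro V) y) (FObj (Lo W) y) (hf y) (\<lambda>c. La t at y \<bullet> (lg V c \<bullet> pr V c))"
      by (rule integ_post[OF hf_ess_finite o(2)[OF V] o(1)[OF V] Cmp_closed[OF pV lV] Lty])
    also have "\<dots> = integ (FObj (Ro V) y) (FObj (Lo W) y) (hf y) (\<lambda>c. (lg W c \<bullet> pr W c) \<bullet> Ra t at y)"
    proof (rule integ_eqI[OF hf_ess_finite o(2)[OF V] o(1)[OF W]])
      fix c assume c: "c \<in> Obj (hf y)"
      show "La t at y \<bullet> (lg V c \<bullet> pr V c) \<in> Hom C (FObj (Ro V) y) (FObj (Lo W) y)"
        by (rule Cmp_closed[OF Cmp_closed[OF pV[OF c] lV[OF c]] Lty])
      show "La t at y \<bullet> (lg V c \<bullet> pr V c) = (lg W c \<bullet> pr W c) \<bullet> Ra t at y"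
        using Cmp_assoc[OF pV[OF c] lV[OF c] Lty] La_lg[OF t y c] Cmp_assoc[OF pV[OF c] tp[OF c] lW[OF c]]
          pr_Ra[OF t y c] Cmp_assoc[OF Rty pW[OF c] lW[OF c]] by simp
    qed
    also have "\<dots> = integ (FObj (Ro W) y) (FObj (Lo W) y) (hf y) (\<lambda>c. lg W c \<bullet> pr W c) \<bullet> Ra t at y"
      by (rule integ_pre[OF hf_ess_finite o(2)[OF W] o(1)[OF W] Cmp_closed[OF pW lW] Rty, symmetric])
    finally show "(La t \<bullet>\<^bsub>CY\<^esub> nakayama X Y C f V) at y = (nakayama X Y C f W \<bullet>\<^bsub>CY\<^esub> Ra t) at y"
      using y nV(2)[OF y] nW(2)[OF y] by (simp add: component_simps)
  qed
qed

end

section \<open>Functoriality of the Nakayama map\<close>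

lemma comp_functor_is_functor:
  assumes f: "is_functor X Y f" and g: "is_functor Y Z g"
  shows "is_functor X Z (comp_functor g f)"
proof -
  note fd = is_functorD[OF f] and gd = is_functorD[OF g]
  show ?thesis
    unfolding is_functor_def comp_functor_def cfunctor.simps comp_def
  proof (intro conjI ballI allI)
    fix k assume "k \<in> Arr X"
    then have "k \<in> Hom X (Dom X k) (Cod X k)" by (simp add: Hom_def)
    from gd(4)[OF fd(4)[OF this]]
    show "FArr g (FArr f k) \<in> Hom Z (FObj g (FObj f (Dom X k))) (FObj g (FObj f (Cod X k)))" .
  next
    fix x y z k l assume k: "k \<in> Hom X x y" and l: "l \<in> Hom X y z"
    show "FArr g (FArr f (l \<bullet>\<^bsub>X\<^esub> k)) = FArr g (FArr f l) \<bullet>\<^bsub>Z\<^esub> FArr g (FArr f k)"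
      using fd(6)[OF k l] gd(6)[OF fd(4)[OF k] fd(4)[OF l]] by simp
  qed (use fd(1,3,5) gd(2,3,5) in auto)
qed

context rational_monoidal_category
begin

text \<open>A point \<open>d\<close> of the fibre of \<open>g\<close> and a point \<open>c\<close> of the fibre of \<open>f\<close> below it compose to a point
  \<open>\<Phi> d c\<close> of the fibre of \<open>g f\<close>, whose leg and projection are, up to the comparison maps, the
  composites of those of \<open>c\<close> and \<open>d\<close>. An arrow into \<open>\<Phi> d c\<close> amounts to an arrow into \<open>d\<close> and then
  one into \<open>c\<close>, which is the count required by \<open>integ_fubini\<close>.\<close>

lemma nakayama_functorialI:
  fixes X :: "('x, 'y) category" and Y :: "('z, 'w) category" and Z :: "('i, 'j) category"
  assumes X: "ess_finite X" and Y: "ess_finite Y" and Z: "ess_finite Z"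
    and f: "is_functor X Y f" and g: "is_functor Y Z g"
  shows "nakayama_functorial X Y Z C f g"
proof -
  interpret F: kan_setting C add zer scl X Y f
    by (intro kan_setting.intro rational_monoidal_category_axioms groupoid_map.intro groupoid_map_axioms.intro X Y f)
  interpret G: kan_setting C add zer scl Y Z g
    by (intro kan_setting.intro rational_monoidal_category_axioms groupoid_map.intro groupoid_map_axioms.intro Y Z g)
  let ?h = "comp_functor g f"
  interpret H: kan_setting C add zer scl X Z ?h
    by (intro kan_setting.intro rational_monoidal_category_axioms groupoid_map.intro groupoid_map_axioms.intro
        X Z comp_functor_is_functor[OF f g])
  have hO: "FObj ?h x = FObj g (FObj f x)" and hA: "FArr ?h k = FArr g (FArr f k)" for x k
    by (simp_all add: comp_functor_def)
  have rs_comp: "pull_functor X ?h W = pull_functor X f (pull_functor Y g W)" for W :: "('i, 'j, 'o, 'm) cfunctor"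
  proof -
    have "FArr f k \<in> Arr Y" if "k \<in> Arr X" for k
      using F.fd(4)[of k "Dom X k" "Cod X k"] that by (simp add: Hom_def)
    then show ?thesis
      using F.fd(3) by (simp add: pull_functor_def ext_functor_def fun_eq_iff hO hA)
  qed
  show ?thesis
    unfolding nakayama_functorial_def Let_def
  proof (intro ballI conjI)
    fix V assume "V \<in> Obj F.CX"
    then have V: "V \<in> functors X C" by (simp add: Obj_functor_cat)
    let ?fL = "F.Lo V" and ?fR = "F.Ro V" and ?hL = "H.Lo V" and ?hR = "H.Ro V"
    note fL = F.Lfun(3)[OF V] and fR = F.Rfun(3)[OF V] and hL = H.Lfun(3)[OF V] and hR = H.Rfun(3)[OF V]
    let ?gL = "G.Lo ?fL" and ?gR = "G.Ro ?fR" and ?N = "nakayama X Y C f V" and ?M = "nakayama Y Z C g ?fR"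
    let ?r = "pull_functor Y g ?hR"
    let ?rr = "pull_functor X f ?r"
    note gL = G.Lfun(3)[OF fL] and gR = G.Rfun(3)[OF fR]
    note \<nu>f = F.nakayama_component[OF V] and \<nu>h = H.nakayama_component[OF V]
    note \<nu>g = G.nakayama_component[OF fR] and nat = G.nakayama_natural[OF \<nu>f(1)]
    show "G.La ?N \<bullet>\<^bsub>G.CY\<^esub> ?M = nakayama Y Z C g ?fL \<bullet>\<^bsub>G.CY\<^esub> G.Ra ?N"
      by (rule nat)
    \<comment> \<open>the comparison of left Kan extensions on legs\<close>
    let ?\<kappa> = "shriek_comparison X Y Z C f g V" and ?\<tau> = "star_comparison X Y Z C f g V"
    let ?u = "FArr F.rs (shriek_unit G.T ?fL)"
    have u: "?u \<in> Hom F.CX (pull_functor X f ?fL) (pull_functor X ?h ?gL)"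
      unfolding rs_comp by (rule F.rs_Hom[OF G.Lad(3)[OF fL]])
    have \<kappa>_eq: "?\<kappa> = shriek_counit H.T ?gL \<bullet>\<^bsub>G.CY\<^esub> H.La ?u \<bullet>\<^bsub>G.CY\<^esub> H.La (shriek_unit F.T V)"
      by (simp add: shriek_comparison_def Let_def F.kan_sel)
    note L1 = H.Lfun(4)[OF F.Lad(3)[OF V]] and L2 = H.Lfun(4)[OF u] and L3 = H.Lad(4)[OF gL]
    have \<kappa>: "?\<kappa> \<in> Hom G.CY ?hL ?gL"
      unfolding \<kappa>_eq by (rule G.CY.Cmp_closed[OF G.CY.Cmp_closed[OF L1 L2] L3])
    have \<kappa>_leg: "?\<kappa> at z \<bullet> H.lg V p
        = G.lg ?fL (FObj f (fst p), snd p) \<bullet> shriek_unit F.T V at (fst p)"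
      if z: "z \<in> Obj Z" and p: "p \<in> Obj (H.hf z)" for z p
    proof -
      have x: "fst p \<in> Obj X" and w: "snd p \<in> Hom Z (FObj g (FObj f (fst p))) z" using p by (simp_all add: H.hf_Obj hO)
      note fx = F.fd(3)[OF x]
      note L1z = functor_cat_HomD(4)[OF L1 z] and L2z = functor_cat_HomD(4)[OF L2 z] and L3z = functor_cat_HomD(4)[OF L3 z]
      note rfL = F.rs_closed[OF fL]
      note \<eta>f = F.unit_component[OF V x] and \<eta>g = G.unit_component[OF fL fx]
      have ux: "?u at (fst p) = shriek_unit G.T ?fL at (FObj f (fst p))"
        using x by (simp add: component_simps)
      note l0 = H.lg_closed[OF V z p] and l1 = H.lg_closed[OF rfL z p] and l2 = H.lg_closed[OF H.rs_closed[OF gL] z p]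
      have \<eta>f': "shriek_unit F.T V at (fst p) \<in> Hom C (FObj V (fst p)) (FObj (pull_functor X f ?fL) (fst p))"
        using \<eta>f x by (simp add: functor_simps)
      have \<eta>g': "shriek_unit G.T ?fL at (FObj f (fst p)) \<in> Hom C (FObj (pull_functor X f ?fL) (fst p)) (FObj (pull_functor X ?h ?gL) (fst p))"
        using \<eta>g x by (simp add: functor_simps hO)
      note gLw = is_functorD(4)[OF functorsD[OF gL] w]
      have "?\<kappa> at z \<bullet> H.lg V p = shriek_counit H.T ?gL at z \<bullet>
          (H.La ?u at z \<bullet> (H.La (shriek_unit F.T V) at z \<bullet> H.lg V p))"
        unfolding \<kappa>_eq using z Cmp_assoc[OF l0 Cmp_closed[OF L1z L2z] L3z] Cmp_assoc[OF l0 L1z L2z] by (simp add: component_simps)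
      also have "\<dots> = shriek_counit H.T ?gL at z \<bullet> (H.lg (pull_functor X ?h ?gL) p \<bullet>
          (shriek_unit G.T ?fL at (FObj f (fst p)) \<bullet> shriek_unit F.T V at (fst p)))"
        using H.La_lg[OF F.Lad(3)[OF V] z p] H.La_lg[OF u z p] ux Cmp_assoc[OF \<eta>f' l1 L2z] Cmp_assoc[OF \<eta>f' \<eta>g' l2] by simp
      also have "\<dots> = FArr ?gL (snd p) \<bullet>
          (shriek_unit G.T ?fL at (FObj f (fst p)) \<bullet> shriek_unit F.T V at (fst p))"
        using Cmp_assoc[OF Cmp_closed[OF \<eta>f' \<eta>g'] l2 L3z] H.counit_lg[OF gL z p] by simp
      also have "\<dots> = G.lg ?fL (FObj f (fst p), snd p) \<bullet> shriek_unit F.T V at (fst p)"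
        using Cmp_assoc[OF \<eta>f \<eta>g gLw] by (simp add: G.lg_eq)
      finally show ?thesis .
    qed
    \<comment> \<open>and of right Kan extensions on projections\<close>
    let ?v = "F.Ra (star_counit H.T V)" and ?v' = "star_unit F.T ?r"
    note rghR = G.rs_closed[OF hR]
    have ch: "star_counit H.T V \<in> Hom F.CX ?rr V"
      using H.Rad(4)[OF V] by (simp add: rs_comp)
    note v = F.Rfun(4)[OF ch] and v' = F.Rad(3)[OF rghR]
    have \<tau>_eq: "?\<tau> = G.Ra ?v \<bullet>\<^bsub>G.CY\<^esub> G.Ra ?v' \<bullet>\<^bsub>G.CY\<^esub> star_unit G.T ?hR"
      by (simp add: star_comparison_def Let_def G.kan_sel FObj_restriction)
    note R1 = G.Rad(3)[OF hR] and R2 = G.Rfun(4)[OF v'] and R3 = G.Rfun(4)[OF v]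
    have \<tau>: "?\<tau> \<in> Hom G.CY ?hR ?gR"
      unfolding \<tau>_eq by (rule G.CY.Cmp_closed[OF G.CY.Cmp_closed[OF R1 R2] R3])
    define \<Phi> where "\<Phi> d c = (fst c, snd d \<bullet>\<^bsub>Z\<^esub> FArr g (snd c))" for d :: "'z \<times> 'j" and c :: "'x \<times> 'w"
    have \<Phi>: "\<Phi> d c \<in> Obj (H.hf z)" if "d \<in> Obj (G.hf z)" "c \<in> Obj (F.hf (fst d))" for d c z
      using that G.Y.Cmp_closed[OF G.fd(4)[of "snd c" "FObj f (fst c)" "fst d"]] by (simp add: \<Phi>_def F.hf_Obj G.hf_Obj H.hf_Obj hO)
    have \<kappa>_leg2: "?\<kappa> at z \<bullet> H.lg V (\<Phi> d c) = G.lg ?fL d \<bullet> F.lg V c"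
      if z: "z \<in> Obj Z" and d: "d \<in> Obj (G.hf z)" and c: "c \<in> Obj (F.hf (fst d))" for z d c
    proof -
      have x: "fst c \<in> Obj X" and w: "snd c \<in> Hom Y (FObj f (fst c)) (fst d)" and y: "fst d \<in> Obj Y"
        and dz: "snd d \<in> Hom Z (FObj g (fst d)) z"
        using c d by (simp_all add: F.hf_Obj G.hf_Obj)
      let ?q = "(FObj f (fst c), snd (\<Phi> d c))"
      have q: "?q \<in> Obj (G.hf z)" using \<Phi>[OF d c] F.fd(3)[OF x] by (simp add: H.hf_Obj G.hf_Obj hO \<Phi>_def)
      have arrow: "(?q, d, snd c) \<in> Hom (G.hf z) ?q d"
        using q d w by (simp add: G.hf_Hom \<Phi>_def)
      obtain m where K: "G.kan_cone ?fL ?gL (G.lg ?fL) m" using G.left_cone[OF fL] by blast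
      have "G.lg ?fL d \<bullet> FArr ?fL (snd c) = G.lg ?fL ?q" using G.kan_coneD(9)[OF K z arrow] by simp
      then show ?thesis
        using \<kappa>_leg[OF z \<Phi>[OF d c]] Cmp_assoc[OF F.unit_component[OF V x] is_functorD(4)[OF functorsD[OF fL] w] G.lg_closed[OF fL z d]]
        by (simp add: F.lg_eq \<Phi>_def)
    qed
    have \<tau>_pr: "F.pr V c \<bullet> (G.pr ?fR d \<bullet> ?\<tau> at z) = H.pr V (\<Phi> d c)"
      if z: "z \<in> Obj Z" and d: "d \<in> Obj (G.hf z)" and c: "c \<in> Obj (F.hf (fst d))" for z d c
    proof -
      let ?e = "star_counit H.T V at (fst c)"
      have x: "fst c \<in> Obj X" and w: "snd c \<in> Hom Y (FObj f (fst c)) (fst d)" and y: "fst d \<in> Obj Y"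
        and dz: "snd d \<in> Hom Z (FObj g (fst d)) z"
        using c d by (simp_all add: F.hf_Obj G.hf_Obj)
      note R1z = functor_cat_HomD(4)[OF R1 z] and R2z = functor_cat_HomD(4)[OF R2 z] and R3z = functor_cat_HomD(4)[OF R3 z]
      note vy = functor_cat_HomD(4)[OF v y] and v'y = functor_cat_HomD(4)[OF v' y]
      note FR = F.Rfun(3)[OF F.rs_closed[OF rghR]]
      note p0 = G.pr_closed[OF rghR z d] and p1 = G.pr_closed[OF FR z d] and p2 = G.pr_closed[OF fR z d]
      note q0 = F.pr_closed[OF V y c] and q1 = F.pr_closed[OF F.rs_closed[OF rghR] y c]
      note iw = groupoid_inv(1)[OF F.Y.groupoid w] and idz = groupoid_inv(1)[OF G.Y.groupoid dz]
      note hd = is_functorD[OF functorsD[OF hR]]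
      have e: "?e \<in> Hom C (FObj ?hR (FObj g (FObj f (fst c)))) (FObj V (fst c))"
        using H.counit_component[OF V x] by (simp add: hO)
      have e': "?e \<in> Hom C (FObj ?rr (fst c)) (FObj V (fst c))"
        using functor_cat_HomD(4)[OF ch x] .
      have hw: "FArr ?r (inv_arr Y (snd c)) = FArr ?hR (FArr g (inv_arr Y (snd c)))"
        using iw by (simp add: functor_simps HomD(1))
      have hdz: "FArr ?hR (inv_arr Z (snd d)) \<in> Hom C (FObj ?hR z) (FObj ?r (fst d))"
        using hd(4)[OF idz] y by (simp add: functor_simps)
      have 1: "G.pr ?fR d \<bullet> ?\<tau> at z = ?v at (fst d) \<bullet> (?v' at (fst d) \<bullet> FArr ?hR (inv_arr Z (snd d)))"
      proof -
        have "G.pr ?fR d \<bullet> ?\<tau> at z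
            = (G.pr ?fR d \<bullet> G.Ra ?v at z) \<bullet> (G.Ra ?v' at z \<bullet> star_unit G.T ?hR at z)"
          unfolding \<tau>_eq using z Cmp_assoc[OF Cmp_closed[OF R1z R2z] R3z p2] by (simp add: component_simps)
        also have "\<dots> = ?v at (fst d) \<bullet> ((G.pr (F.Ro ?rr) d \<bullet> G.Ra ?v' at z)
            \<bullet> star_unit G.T ?hR at z)"
          using G.pr_Ra[OF v z d] Cmp_assoc[OF Cmp_closed[OF R1z R2z] p1 vy] Cmp_assoc[OF R1z R2z p1] by simp
        also have "\<dots> = ?v at (fst d) \<bullet> (?v' at (fst d) \<bullet> FArr ?hR (inv_arr Z (snd d)))"
          using G.pr_Ra[OF v' z d] Cmp_assoc[OF R1z p0 v'y] G.pr_unit[OF hR z d] by simp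
        finally show ?thesis .
      qed
      have "F.pr V c \<bullet> (G.pr ?fR d \<bullet> ?\<tau> at z)
          = ?e \<bullet> ((F.pr ?rr c \<bullet> ?v' at (fst d)) \<bullet> FArr ?hR (inv_arr Z (snd d)))"
        unfolding 1
        using Cmp_assoc[OF Cmp_closed[OF hdz v'y] vy q0] F.pr_Ra[OF ch y c] Cmp_assoc[OF Cmp_closed[OF hdz v'y] q1 e']
          Cmp_assoc[OF hdz v'y q1] by simp
      also have "\<dots> = ?e \<bullet> (FArr ?hR (FArr g (inv_arr Y (snd c))) \<bullet> FArr ?hR (inv_arr Z (snd d)))"
        using F.pr_unit[OF rghR y c] hw by simp
      also have "\<dots> = ?e \<bullet> FArr ?hR (FArr g (inv_arr Y (snd c)) \<bullet>\<^bsub>Z\<^esub> inv_arr Z (snd d))"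
        using hd(6)[OF idz G.fd(4)[OF iw]] by simp
      also have "FArr g (inv_arr Y (snd c)) = inv_arr Z (FArr g (snd c))"
        using functor_inv[OF g F.Y.groupoid w] G.Y.inv_arr_eqI by metis
      also have "inv_arr Z (FArr g (snd c)) \<bullet>\<^bsub>Z\<^esub> inv_arr Z (snd d) = inv_arr Z (snd d \<bullet>\<^bsub>Z\<^esub> FArr g (snd c))"
        using groupoid_inv_cmp[OF G.Y.groupoid G.fd(4)[OF w] dz] by simp
      finally show ?thesis by (simp add: H.pr_def \<Phi>_def)
    qed
    \<comment> \<open>both sides are integrals of the same function, over the fibre of \<open>g f\<close> and iterated\<close>
    have first: "G.La ?N \<bullet>\<^bsub>G.CY\<^esub> ?M \<in> Hom G.CY ?gR ?gL"
      by (rule G.CY.Cmp_closed[OF \<nu>g(1) G.Lfun(4)[OF \<nu>f(1)]])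
    show "?\<kappa> \<bullet>\<^bsub>G.CY\<^esub> nakayama X Z C ?h V
        = (G.La ?N \<bullet>\<^bsub>G.CY\<^esub> ?M) \<bullet>\<^bsub>G.CY\<^esub> ?\<tau>"
    proof (rule functor_cat_ext[OF G.CY.Cmp_closed[OF \<nu>h(1) \<kappa>] G.CY.Cmp_closed[OF \<tau> first]])
      fix z assume z: "z \<in> Obj Z"
      let ?A = "FObj ?hR z" and ?B = "FObj ?gL z"
      have o: "?A \<in> Obj C" "?B \<in> Obj C" "FObj ?hL z \<in> Obj C" "FObj ?gR z \<in> Obj C" "FObj (G.Lo ?fR) z \<in> Obj C"
        using is_functorD(3)[OF functorsD[OF hR] z] is_functorD(3)[OF functorsD[OF gL] z] is_functorD(3)[OF functorsD[OF hL] z]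
          is_functorD(3)[OF functorsD[OF gR] z] is_functorD(3)[OF functorsD[OF G.Lfun(3)[OF fR]] z] by simp_all
      note \<kappa>z = functor_cat_HomD(4)[OF \<kappa> z] and \<tau>z = functor_cat_HomD(4)[OF \<tau> z]
      note hl = H.lg_closed[OF V z] and hp = H.pr_closed[OF V z]
      define I where "I p = ?\<kappa> at z \<bullet> (H.lg V p \<bullet> H.pr V p)" for p
      have I: "I p \<in> Hom C ?A ?B" if "p \<in> Obj (H.hf z)" for p
        unfolding I_def by (rule Cmp_closed[OF Cmp_closed[OF hp[OF that] hl[OF that]] \<kappa>z])
      obtain m where KL: "H.kan_cone V ?hL (H.lg V) m" using H.left_cone[OF V] by blast
      obtain n where KR: "H.kan_cone V ?hR n (H.pr V)" using H.right_cone[OF V] by blast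
      have I_inv: "I p = I q" if \<kappa>: "\<mu> \<in> Hom (H.hf z) p q" for p q \<mu>
      proof -
        have p: "p \<in> Obj (H.hf z)" and q: "q \<in> Obj (H.hf z)" and k: "snd (snd \<mu>) \<in> Hom X (fst p) (fst q)"
          using \<kappa> by (simp_all add: H.hf_Hom)
        show ?thesis
          unfolding I_def
          using H.kan_coneD(9)[OF KL z \<kappa>] H.kan_coneD(10)[OF KR z \<kappa>]
            Cmp_assoc[OF hp[OF p] is_functorD(4)[OF functorsD[OF V] k] hl[OF q]] by simp
      qed
      have "(?\<kappa> \<bullet>\<^bsub>G.CY\<^esub> nakayama X Z C ?h V) at z = integ ?A ?B (H.hf z) I"
        unfolding I_def using z \<nu>h(2)[OF z] integ_post[OF H.hf_ess_finite o(1,3) Cmp_closed[OF hp hl] \<kappa>z]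
        by (simp add: component_simps)
      also have "\<dots> = integ ?A ?B (G.hf z) (\<lambda>d. integ ?A ?B (F.hf (fst d)) (\<lambda>c. I (\<Phi> d c)))"
      proof (rule integ_fubini[symmetric, where \<pi> = "\<lambda>p. (FObj f (fst p), snd p)" and \<sigma> = "\<lambda>p u. (fst p, snd (snd u))"])
        show "(FObj f (fst p), snd p) \<in> Obj (G.hf z)" if "p \<in> Obj (H.hf z)" for p
          using that F.fd(3) by (simp add: H.hf_Obj G.hf_Obj hO)
        show "(fst p, snd (snd u)) \<in> Obj (F.hf (fst d))"
          if "p \<in> Obj (H.hf z)" "u \<in> Hom (G.hf z) (FObj f (fst p), snd p) d" for p d u
          using that by (simp add: G.hf_Hom F.hf_Obj H.hf_Obj)
        fix p d c assume p: "p \<in> Obj (H.hf z)" and d: "d \<in> Obj (G.hf z)" and c: "c \<in> Obj (F.hf (fst d))"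
        let ?\<pi> = "(FObj f (fst p), snd p)"
        have p': "?\<pi> \<in> Obj (G.hf z)" using p F.fd(3) by (simp add: H.hf_Obj G.hf_Obj hO)
        have w: "snd c \<in> Hom Y (FObj f (fst c)) (fst d)" and dz: "snd d \<in> Hom Z (FObj g (fst d)) z"
          using c d by (simp_all add: F.hf_Obj G.hf_Obj)
        have eq: "(snd d \<bullet>\<^bsub>Z\<^esub> FArr g (snd c)) \<bullet>\<^bsub>Z\<^esub> FArr ?h k = snd d \<bullet>\<^bsub>Z\<^esub> FArr g (snd c \<bullet>\<^bsub>Y\<^esub> FArr f k)"
          if k: "k \<in> Hom X (fst p) (fst c)" for k
          using G.Y.Cmp_assoc[OF G.fd(4)[OF F.fd(4)[OF k]] G.fd(4)[OF w] dz] G.fd(6)[OF F.fd(4)[OF k] w] by (simp add: hA)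
        let ?S = "SIGMA u : Hom (G.hf z) ?\<pi> d. Hom (F.hf (fst d)) (fst p, snd (snd u)) c"
        have "bij_betw (\<lambda>(u, \<kappa>). (p, \<Phi> d c, snd (snd \<kappa>))) ?S (Hom (H.hf z) p (\<Phi> d c))"
        proof (rule bij_betw_byWitness[where f' = "\<lambda>\<mu>. ((?\<pi>, d, snd c \<bullet>\<^bsub>Y\<^esub> FArr f (snd (snd \<mu>))),
            ((fst p, snd c \<bullet>\<^bsub>Y\<^esub> FArr f (snd (snd \<mu>))), c, snd (snd \<mu>)))"])
          show "\<forall>s\<in>?S. (\<lambda>\<mu>. ((?\<pi>, d, snd c \<bullet>\<^bsub>Y\<^esub> FArr f (snd (snd \<mu>))),
            ((fst p, snd c \<bullet>\<^bsub>Y\<^esub> FArr f (snd (snd \<mu>))), c, snd (snd \<mu>)))) ((\<lambda>(u, \<kappa>). (p, \<Phi> d c, snd (snd \<kappa>))) s) = s"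
            by (auto simp: G.hf_Hom F.hf_Hom prod_eq_iff)
          show "\<forall>\<mu>\<in>Hom (H.hf z) p (\<Phi> d c). (\<lambda>(u, \<kappa>). (p, \<Phi> d c, snd (snd \<kappa>))) ((?\<pi>, d, snd c \<bullet>\<^bsub>Y\<^esub> FArr f (snd (snd \<mu>))),
            ((fst p, snd c \<bullet>\<^bsub>Y\<^esub> FArr f (snd (snd \<mu>))), c, snd (snd \<mu>))) = \<mu>"
            by (auto simp: H.hf_Hom prod_eq_iff)
          show "(\<lambda>(u, \<kappa>). (p, \<Phi> d c, snd (snd \<kappa>))) ` ?S \<subseteq> Hom (H.hf z) p (\<Phi> d c)"
          proof (rule image_subsetI)
            fix s assume "s \<in> ?S"
            then obtain u \<kappa> where s: "s = (u, \<kappa>)" and u: "u \<in> Hom (G.hf z) ?\<pi> d"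
              and \<kappa>: "\<kappa> \<in> Hom (F.hf (fst d)) (fst p, snd (snd u)) c" by (rule SigmaE)
            have k: "snd (snd \<kappa>) \<in> Hom X (fst p) (fst c)" and "snd c \<bullet>\<^bsub>Y\<^esub> FArr f (snd (snd \<kappa>)) = snd (snd u)"
              and "snd d \<bullet>\<^bsub>Z\<^esub> FArr g (snd (snd u)) = snd p"
              using u \<kappa> by (simp_all add: G.hf_Hom F.hf_Hom)
            then show "(\<lambda>(u, \<kappa>). (p, \<Phi> d c, snd (snd \<kappa>))) s \<in> Hom (H.hf z) p (\<Phi> d c)"
              using eq[OF k] p \<Phi>[OF d c] unfolding H.hf_Hom s by (simp add: \<Phi>_def)
          qed
          show "(\<lambda>\<mu>. ((?\<pi>, d, snd c \<bullet>\<^bsub>Y\<^esub> FArr f (snd (snd \<mu>))), ((fst p, snd c \<bullet>\<^bsub>Y\<^esub> FArr f (snd (snd \<mu>))), c, snd (snd \<mu>))))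
              ` Hom (H.hf z) p (\<Phi> d c) \<subseteq> ?S"
          proof (rule image_subsetI)
            fix \<mu> assume \<mu>: "\<mu> \<in> Hom (H.hf z) p (\<Phi> d c)"
            let ?k = "snd (snd \<mu>)"
            have k: "?k \<in> Hom X (fst p) (fst c)" and e: "(snd d \<bullet>\<^bsub>Z\<^esub> FArr g (snd c)) \<bullet>\<^bsub>Z\<^esub> FArr ?h ?k = snd p"
              using \<mu> by (simp_all add: H.hf_Hom \<Phi>_def)
            note wk = F.Y.Cmp_closed[OF F.fd(4)[OF k] w]
            have a: "(?\<pi>, d, snd c \<bullet>\<^bsub>Y\<^esub> FArr f ?k) \<in> Hom (G.hf z) ?\<pi> d"
              using p' d wk e eq[OF k] unfolding G.hf_Hom by simp
            have b: "((fst p, snd c \<bullet>\<^bsub>Y\<^esub> FArr f ?k), c, ?k) \<in> Hom (F.hf (fst d)) (fst p, snd c \<bullet>\<^bsub>Y\<^esub> FArr f ?k) c"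
              using c wk k p unfolding F.hf_Hom by (simp add: F.hf_Obj H.hf_Obj)
            show "((?\<pi>, d, snd c \<bullet>\<^bsub>Y\<^esub> FArr f ?k), ((fst p, snd c \<bullet>\<^bsub>Y\<^esub> FArr f ?k), c, ?k)) \<in> ?S"
              using a b by simp
          qed
        qed
        from bij_betw_same_card[OF this]
        show "card (Hom (H.hf z) p (\<Phi> d c)) = (\<Sum>u\<in>Hom (G.hf z) ?\<pi> d. card (Hom (F.hf (fst d)) (fst p, snd (snd u)) c))"
          using ess_finite.finite_Hom[OF G.hf_ess_finite] ess_finite.finite_Hom[OF F.hf_ess_finite]
          by (simp add: card_SigmaI)
      qed (use H.hf_ess_finite G.hf_ess_finite F.hf_ess_finite \<Phi> o I I_inv in blast)+
      also have "\<dots> = ((G.La ?N \<bullet>\<^bsub>G.CY\<^esub> ?M) \<bullet>\<^bsub>G.CY\<^esub> ?\<tau>) at z"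
      proof -
        note Lf = functor_cat_HomD(4)[OF G.Lfun(4)[OF \<nu>f(1)] z]
        note gl = G.lg_closed[OF fR z] and gp = G.pr_closed[OF fR z] and gl' = G.lg_closed[OF fL z]
        have "((G.La ?N \<bullet>\<^bsub>G.CY\<^esub> ?M) \<bullet>\<^bsub>G.CY\<^esub> ?\<tau>) at z
            = (G.La ?N at z \<bullet> integ (FObj ?gR z) (FObj (G.Lo ?fR) z) (G.hf z) (\<lambda>d. G.lg ?fR d \<bullet> G.pr ?fR d)) \<bullet> ?\<tau> at z"
          using z \<nu>g(2)[OF z] by (simp add: component_simps)
        also have "\<dots> = integ ?A ?B (G.hf z) (\<lambda>d. (G.La ?N at z \<bullet> (G.lg ?fR d \<bullet> G.pr ?fR d)) \<bullet> ?\<tau> at z)"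
          using integ_post[OF G.hf_ess_finite o(4,5) Cmp_closed[OF gp gl] Lf]
            integ_pre[OF G.hf_ess_finite o(4,2) Cmp_closed[OF Cmp_closed[OF gp gl] Lf] \<tau>z] by simp
        also have "\<dots> = integ ?A ?B (G.hf z) (\<lambda>d. integ ?A ?B (F.hf (fst d)) (\<lambda>c. I (\<Phi> d c)))"
        proof (rule integ_eqI[OF G.hf_ess_finite o(1,2)])
          fix d assume d: "d \<in> Obj (G.hf z)"
          then have y: "fst d \<in> Obj Y" by (simp add: G.hf_Obj)
          show "(G.La ?N at z \<bullet> (G.lg ?fR d \<bullet> G.pr ?fR d)) \<bullet> ?\<tau> at z \<in> Hom C ?A ?B"
            by (rule Cmp_closed[OF \<tau>z Cmp_closed[OF Cmp_closed[OF gp[OF d] gl[OF d]] Lf]])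
          let ?t = "G.pr ?fR d \<bullet> ?\<tau> at z"
          have t: "?t \<in> Hom C ?A (FObj ?fR (fst d))" by (rule Cmp_closed[OF \<tau>z gp[OF d]])
          have oy: "FObj ?fR (fst d) \<in> Obj C" "FObj ?fL (fst d) \<in> Obj C"
            using is_functorD(3)[OF functorsD[OF fR] y] is_functorD(3)[OF functorsD[OF fL] y] by simp_all
          note fl = F.lg_closed[OF V y] and fp = F.pr_closed[OF V y]
          have "(G.La ?N at z \<bullet> (G.lg ?fR d \<bullet> G.pr ?fR d)) \<bullet> ?\<tau> at z
              = (G.La ?N at z \<bullet> G.lg ?fR d) \<bullet> ?t"
            using Cmp_assoc[OF gp[OF d] gl[OF d] Lf] Cmp_assoc[OF \<tau>z gp[OF d] Cmp_closed[OF gl[OF d] Lf]] by simp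
          also have "\<dots> = (G.lg ?fL d \<bullet> integ (FObj ?fR (fst d)) (FObj ?fL (fst d)) (F.hf (fst d)) (\<lambda>c. F.lg V c \<bullet> F.pr V c)) \<bullet> ?t"
            using G.La_lg[OF \<nu>f(1) z d] \<nu>f(2)[OF y] by simp
          also have "\<dots> = integ ?A ?B (F.hf (fst d)) (\<lambda>c. (G.lg ?fL d \<bullet> (F.lg V c \<bullet> F.pr V c)) \<bullet> ?t)"
            using integ_post[OF F.hf_ess_finite oy Cmp_closed[OF fp fl] gl'[OF d]]
              integ_pre[OF F.hf_ess_finite oy(1) o(2) Cmp_closed[OF Cmp_closed[OF fp fl] gl'[OF d]] t] by simp
          also have "\<dots> = integ ?A ?B (F.hf (fst d)) (\<lambda>c. I (\<Phi> d c))"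
          proof (rule integ_eqI[OF F.hf_ess_finite o(1,2)])
            fix c assume c: "c \<in> Obj (F.hf (fst d))"
            note lp = Cmp_closed[OF fp[OF c] fl[OF c]]
            show "(G.lg ?fL d \<bullet> (F.lg V c \<bullet> F.pr V c)) \<bullet> ?t \<in> Hom C ?A ?B" by (rule Cmp_closed[OF t Cmp_closed[OF lp gl'[OF d]]])
            note p = \<Phi>[OF d c]
            have "(G.lg ?fL d \<bullet> (F.lg V c \<bullet> F.pr V c)) \<bullet> ?t = (G.lg ?fL d \<bullet> F.lg V c) \<bullet> (F.pr V c \<bullet> ?t)"
              using Cmp_assoc[OF fp[OF c] fl[OF c] gl'[OF d]] Cmp_assoc[OF t fp[OF c] Cmp_closed[OF fl[OF c] gl'[OF d]]] by simp
            then show "(G.lg ?fL d \<bullet> (F.lg V c \<bullet> F.pr V c)) \<bullet> ?t = I (\<Phi> d c)"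
              unfolding I_def using \<kappa>_leg2[OF z d c] \<tau>_pr[OF z d c] Cmp_assoc[OF hp[OF p] hl[OF p] \<kappa>z] by simp
          qed
          finally show "(G.La ?N at z \<bullet> (G.lg ?fR d \<bullet> G.pr ?fR d)) \<bullet> ?\<tau> at z
              = integ ?A ?B (F.hf (fst d)) (\<lambda>c. I (\<Phi> d c))" .
        qed
        finally show ?thesis by simp
      qed
      finally show "(?\<kappa> \<bullet>\<^bsub>G.CY\<^esub> nakayama X Z C ?h V) at z
          = ((G.La ?N \<bullet>\<^bsub>G.CY\<^esub> ?M) \<bullet>\<^bsub>G.CY\<^esub> ?\<tau>) at z" .
    qed
  qed
qed

text \<open>The colimit of \<open>D\<close> over \<open>P\<close> is its bilimit.\<close>

theorem nakayama_categoryI: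
  assumes "has_duals C"
  shows "nakayama_category TYPE('u) C"
  unfolding nakayama_category_def
proof (intro conjI allI impI ballI)
  show "has_ess_finite_colimits TYPE('u) C"
    unfolding has_ess_finite_colimits_def
  proof (intro allI impI, elim conjE)
    fix P :: "('u, 'u) category" and D assume "ess_finite_groupoid P" and D: "is_functor P C D"
    then have P: "ess_finite P" by unfold_locales
    obtain E l m where B: "bilimit P D E l m" using bilimit_exists[OF P D] by blast
    note b = bilimitD[OF B]
    interpret P: ess_finite P by (rule P)
    have "is_cocone P C D E l"
      unfolding is_cocone_def
    proof (intro conjI ballI b(1,2))
      show "l (Cod P k) \<bullet> FArr D k = l (Dom P k)" if "k \<in> Arr P" for k
        using b(4)[of k "Dom P k" "Cod P k"] that by (simp add: Hom_def)
    qed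
    moreover have "\<exists>!u. u \<in> Hom C E c' \<and> (\<forall>p\<in>Obj P. u \<bullet> l p = t' p)" if "is_cocone P C D c' t'" for c' t'
    proof -
      have c': "c' \<in> Obj C" and t': "\<And>p. p \<in> Obj P \<Longrightarrow> t' p \<in> Hom C (FObj D p) c'"
        and nat: "\<And>p q k. k \<in> Hom P p q \<Longrightarrow> t' q \<bullet> FArr D k = t' p"
        using that by (auto simp: is_cocone_def Hom_def)
      note u = bilimit_cocone[OF P B D c' t' nat]
      show ?thesis
        by (rule ex1I[of _ "integ E c' P (\<lambda>p. t' p \<bullet> m p)"]) (use u bilimit_ext_left[OF P B] in auto)
    qed
    ultimately show "\<exists>c t. is_colimit P C D c t" unfolding is_colimit_def by blast
  qed
  show "symmetric_monoidal_category C" by (rule symmetric_monoidal_category_axioms)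
  show "has_duals C" by fact
next
  fix X Y :: "('u, 'u) category" and f y
  assume "ess_finite_groupoid X \<and> ess_finite_groupoid Y \<and> is_functor X Y f"
  then interpret kan_setting C add zer scl X Y f by unfold_locales auto
  show "is_iso_arr (functor_cat (hfibre X Y f y) C) (delta X Y C f y)" by (rule delta_iso(1))
next
  fix X Y Z :: "('u, 'u) category" and f g
  assume "ess_finite_groupoid X \<and> ess_finite_groupoid Y \<and> ess_finite_groupoid Z \<and> is_functor X Y f \<and> is_functor Y Z g"
  then show "nakayama_functorial X Y Z C f g"
    by (intro nakayama_functorialI) (auto simp: ess_finite_def)
qed

end

section \<open>Finite-dimensional spaces inside a given type\<close>

lemmas (in vectorspace) module_facts =
  M.add.m_closed M.zero_closed smult_closed M.a_assoc M.a_comm M.r_zero M.l_zero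
  smult_assoc1 smult_one smult_l_distr smult_r_distr smult_l_null smult_r_null

text \<open>The embedding of \<open>K\<close> into \<open>'v\<close> guarantees that \<open>'v\<close> contains a copy of every finite-dimensional
  \<open>K\<close>-vector space, of whatever type.\<close>

locale fd_universe = field K for K :: "('k, 'r) ring_scheme" (structure) +
  fixes emb :: "'k \<Rightarrow> 'v"
  assumes char_zero: "\<And>n::nat. n > 0 \<Longrightarrow> [n] \<cdot> \<one> \<noteq> \<zero>"
    and emb: "inj_on emb (carrier K)"
begin

lemmas vsD = vectorspace.module_facts

lemma homI:
  assumes "\<And>x. x \<in> carrier V \<Longrightarrow> f x \<in> carrier W"
    "\<And>x y. x \<in> carrier V \<Longrightarrow> y \<in> carrier V \<Longrightarrow> f (x \<oplus>\<^bsub>V\<^esub> y) = f x \<oplus>\<^bsub>W\<^esub> f y"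
    "\<And>a x. a \<in> carrier K \<Longrightarrow> x \<in> carrier V \<Longrightarrow> f (a \<odot>\<^bsub>V\<^esub> x) = a \<odot>\<^bsub>W\<^esub> f x"
  shows "f \<in> module_hom K V W"
  using assms by (auto simp: module_hom_def)

lemma homD:
  assumes "f \<in> module_hom K V W"
  shows "x \<in> carrier V \<Longrightarrow> f x \<in> carrier W"
    "x \<in> carrier V \<Longrightarrow> y \<in> carrier V \<Longrightarrow> f (x \<oplus>\<^bsub>V\<^esub> y) = f x \<oplus>\<^bsub>W\<^esub> f y"
    "a \<in> carrier K \<Longrightarrow> x \<in> carrier V \<Longrightarrow> f (a \<odot>\<^bsub>V\<^esub> x) = a \<odot>\<^bsub>W\<^esub> f x"
  using assms by (auto simp: module_hom_def)

lemma hom_zero: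
  assumes V: "vectorspace K V" and W: "vectorspace K W" and f: "f \<in> module_hom K V W"
  shows "f \<zero>\<^bsub>V\<^esub> = \<zero>\<^bsub>W\<^esub>"
  using homD(3)[OF f zero_closed vsD(2)[OF V]] vsD(12)[OF V vsD(2)[OF V]] vsD(12)[OF W homD(1)[OF f vsD(2)[OF V]]] by simp

lemma hom_sum:
  assumes V: "vectorspace K V" and W: "vectorspace K W" and f: "f \<in> module_hom K V W"
    and I: "finite I" and g: "\<And>i. i \<in> I \<Longrightarrow> g i \<in> carrier V"
  shows "f (finsum V g I) = finsum W (\<lambda>i. f (g i)) I"
proof -
  interpret V: vectorspace K V by fact
  interpret W: vectorspace K W by fact
  show ?thesis
    using I g
  proof (induction I)
    case empty
    then show ?case using hom_zero[OF V W f] by simp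
  next
    case (insert i I)
    have g: "g \<in> I \<rightarrow> carrier V" "g i \<in> carrier V" using insert.prems by auto
    then have "(\<lambda>i. f (g i)) \<in> I \<rightarrow> carrier W" "f (g i) \<in> carrier W" using homD(1)[OF f] by auto
    then show ?case
      using insert g homD(2)[OF f g(2) V.M.finsum_closed[OF g(1)]] by (simp add: V.M.finsum_insert W.M.finsum_insert)
  qed
qed

lemma submodule_finsum:
  assumes V: "vectorspace K V" and N: "submodule K N V" and I: "finite I" and g: "\<And>i. i \<in> I \<Longrightarrow> g i \<in> N"
  shows "finsum V g I \<in> N"
proof -
  interpret V: vectorspace K V by fact
  interpret N: submodule K N V by fact
  show ?thesis
    using I g
  proof (induction I)
    case empty
    then show ?case by simp
  next
    case (insert i I)
    have "g \<in> I \<rightarrow> carrier V" "g i \<in> carrier V" using insert.prems N.subset by auto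
    then show ?case using insert by (simp add: V.M.finsum_insert)
  qed
qed

text \<open>Being generated by a finite set, phrased without linear combinations.\<close>

lemma fin_dim_iff:
  assumes V: "vectorspace K V"
  shows "vectorspace.fin_dim K V \<longleftrightarrow>
    (\<exists>S. finite S \<and> S \<subseteq> carrier V \<and> (\<forall>N. submodule K N V \<longrightarrow> S \<subseteq> N \<longrightarrow> carrier V \<subseteq> N))"
proof -
  interpret V: vectorspace K V by fact
  show ?thesis
  proof
    assume "V.fin_dim"
    then obtain S where S: "finite S" "S \<subseteq> carrier V" "V.gen_set S" by (auto simp: V.fin_dim_def)
    show "\<exists>S. finite S \<and> S \<subseteq> carrier V \<and> (\<forall>N. submodule K N V \<longrightarrow> S \<subseteq> N \<longrightarrow> carrier V \<subseteq> N)"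
    proof (intro exI[of _ S] conjI S(1,2) allI impI)
      show "carrier V \<subseteq> N" if "submodule K N V" "S \<subseteq> N" for N
        using V.span_is_subset[OF that(2,1)] S(3) by simp
    qed
  next
    assume "\<exists>S. finite S \<and> S \<subseteq> carrier V \<and> (\<forall>N. submodule K N V \<longrightarrow> S \<subseteq> N \<longrightarrow> carrier V \<subseteq> N)"
    then obtain S where S: "finite S" "S \<subseteq> carrier V"
      and "\<forall>N. submodule K N V \<longrightarrow> S \<subseteq> N \<longrightarrow> carrier V \<subseteq> N" by (elim exE conjE) (rule that)
    then have S3: "\<And>N. submodule K N V \<Longrightarrow> S \<subseteq> N \<Longrightarrow> carrier V \<subseteq> N" by simp
    have "carrier V \<subseteq> V.span S"
      by (rule S3[OF V.span_is_submodule[OF S(2)] V.in_own_span[OF S(2)]])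
    then have "V.span S = carrier V" using V.span_is_subset2[OF S(2)] by blast
    then show "V.fin_dim" using S(1,2) unfolding V.fin_dim_def by blast
  qed
qed

lemma preimage_submodule:
  assumes V: "vectorspace K V" and W: "vectorspace K W" and f: "f \<in> module_hom K V W" and N: "submodule K N W"
  shows "submodule K {x \<in> carrier V. f x \<in> N} V"
proof -
  interpret N: submodule K N W by fact
  show ?thesis
    using vsD(1-3)[OF V] homD[OF f] hom_zero[OF V W f] V by (intro submodule.intro) (auto simp: vectorspace_def)
qed

lemma fin_dim_image:
  assumes V: "vectorspace K V" and W: "vectorspace K W" and f: "f \<in> module_hom K V W"
    and surj: "\<And>y. y \<in> carrier W \<Longrightarrow> \<exists>x\<in>carrier V. f x = y" and fd: "vectorspace.fin_dim K V"
  shows "vectorspace.fin_dim K W"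
proof -
  obtain S where S: "finite S" "S \<subseteq> carrier V" "\<And>N. submodule K N V \<Longrightarrow> S \<subseteq> N \<Longrightarrow> carrier V \<subseteq> N"
    using fd unfolding fin_dim_iff[OF V] by blast
  have "carrier W \<subseteq> N" if N: "submodule K N W" "f ` S \<subseteq> N" for N
  proof
    fix y assume "y \<in> carrier W"
    then obtain x where x: "x \<in> carrier V" "f x = y" using surj by blast
    have "carrier V \<subseteq> {x \<in> carrier V. f x \<in> N}"
      by (rule S(3)[OF preimage_submodule[OF V W f N(1)]]) (use S(2) N(2) in auto)
    then show "y \<in> N" using x by blast
  qed
  then show ?thesis
    unfolding fin_dim_iff[OF W] using S homD(1)[OF f] by (intro exI[of _ "f ` S"]) auto
qed

lemma dual_basis:
  assumes V: "vectorspace K V" and fd: "vectorspace.fin_dim K V"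
  obtains B c where "finite B" "B \<subseteq> carrier V" "\<And>b v. b \<in> B \<Longrightarrow> v \<in> carrier V \<Longrightarrow> c b v \<in> carrier K"
    "\<And>b v w. b \<in> B \<Longrightarrow> v \<in> carrier V \<Longrightarrow> w \<in> carrier V \<Longrightarrow> c b (v \<oplus>\<^bsub>V\<^esub> w) = c b v \<oplus> c b w"
    "\<And>b a v. b \<in> B \<Longrightarrow> a \<in> carrier K \<Longrightarrow> v \<in> carrier V \<Longrightarrow> c b (a \<odot>\<^bsub>V\<^esub> v) = a \<otimes> c b v"
    "\<And>v. v \<in> carrier V \<Longrightarrow> v = finsum V (\<lambda>b. c b v \<odot>\<^bsub>V\<^esub> b) B"
    "\<And>b b'. b \<in> B \<Longrightarrow> b' \<in> B \<Longrightarrow> c b b' = (if b = b' then \<one> else \<zero>)"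
proof -
  interpret V: vectorspace K V by fact
  obtain B where B: "finite B" "V.basis B" using V.finite_basis_exists[OF fd] by blast
  then have BV: "B \<subseteq> carrier V" by (simp add: V.basis_def)
  define P where "P v a \<longleftrightarrow> a \<in> B \<rightarrow>\<^sub>E carrier K \<and> V.lincomb a B = v" for v a
  have ex1: "\<exists>!a. P v a" if "v \<in> carrier V" for v
    unfolding P_def using V.basis_criterion[OF B(1) BV] B(2) that by blast
  define c where "c b v = (THE a. P v a) b" for b v
  have P: "P v (THE a. P v a)" if "v \<in> carrier V" for v using theI'[OF ex1[OF that]] .
  have unique: "c b v = a b" if "P v a" "b \<in> B" for a b v
  proof -
    have "v \<in> carrier V" using that BV by (auto simp: P_def)
    then have "(THE a. P v a) = a" using ex1 that(1) P by blast
    then show ?thesis by (simp add: c_def)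
  qed
  have cK: "c b v \<in> carrier K" if "b \<in> B" "v \<in> carrier V" for b v
    using P[OF that(2)] that(1) by (auto simp: P_def c_def)
  have cP: "(\<lambda>b. c b v) \<in> B \<rightarrow> carrier K" if "v \<in> carrier V" for v using cK that by auto
  have lin: "V.lincomb (\<lambda>b. c b v) B = v" if "v \<in> carrier V" for v
    using P[OF that] by (simp add: P_def c_def)
  have restr: "V.lincomb (restrict a B) B = V.lincomb a B" if "a \<in> B \<rightarrow> carrier K" for a
    using that BV by (intro V.lincomb_cong) auto
  show thesis
  proof (rule that[OF B(1) BV])
    show "c b v \<in> carrier K" if "b \<in> B" "v \<in> carrier V" for b v by (rule cK[OF that])
    show "c b (v \<oplus>\<^bsub>V\<^esub> w) = c b v \<oplus> c b w" if "b \<in> B" "v \<in> carrier V" "w \<in> carrier V" for b v w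
    proof -
      have "P (v \<oplus>\<^bsub>V\<^esub> w) (\<lambda>b\<in>B. c b v \<oplus> c b w)"
        unfolding P_def using cP[OF that(2)] cP[OF that(3)] cK that restr[of "\<lambda>b. c b v \<oplus> c b w"]
          V.lincomb_sum[OF B(1) BV cP[OF that(2)] cP[OF that(3)]] lin by auto
      from unique[OF this that(1)] that(1) show ?thesis by simp
    qed
    show "c b (a \<odot>\<^bsub>V\<^esub> v) = a \<otimes> c b v" if "b \<in> B" "a \<in> carrier K" "v \<in> carrier V" for b a v
    proof -
      have "P (a \<odot>\<^bsub>V\<^esub> v) (\<lambda>b\<in>B. a \<otimes> c b v)"
        unfolding P_def using cP[OF that(3)] cK that restr[of "\<lambda>b. a \<otimes> c b v"]
          V.lincomb_smult[OF BV cP[OF that(3)] that(2)] lin by auto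
      from unique[OF this that(1)] that(1) show ?thesis by simp
    qed
    show "v = finsum V (\<lambda>b. c b v \<odot>\<^bsub>V\<^esub> b) B" if "v \<in> carrier V" for v
      using lin[OF that] by (simp add: V.lincomb_def)
    show "c b b' = (if b = b' then \<one> else \<zero>)" if "b \<in> B" "b' \<in> B" for b b'
    proof -
      have "V.lincomb (\<lambda>b\<in>B. if b = b' then \<one> else \<zero>) B = finsum V (\<lambda>b. if b' = b then b else \<zero>\<^bsub>V\<^esub>) B"
        unfolding V.lincomb_def using BV by (intro V.M.finsum_cong') (auto simp: subset_iff)
      also have "\<dots> = b'" using V.M.finsum_singleton[OF that(2) B(1), of "\<lambda>b. b"] BV by auto
      finally have "P b' (\<lambda>b\<in>B. if b = b' then \<one> else \<zero>)" unfolding P_def by auto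
      from unique[OF this that(1)] that(1) show ?thesis by simp
    qed
  qed
qed

lemma infinite_carrier: "infinite (carrier K)"
proof -
  have "inj (\<lambda>n::nat. [n] \<cdot> \<one>)"
  proof (rule linorder_injI)
    fix m n :: nat assume "m < n"
    then obtain d where d: "n = m + d" "d > 0" using less_imp_add_positive by blast
    have "[n] \<cdot> \<one> = [m] \<cdot> \<one> \<oplus> [d] \<cdot> \<one>" using d by (simp add: add.nat_pow_mult)
    moreover have "[m] \<cdot> \<one> \<in> carrier K" "[d] \<cdot> \<one> \<in> carrier K" by simp_all
    ultimately have "[d] \<cdot> \<one> = \<ominus> ([m] \<cdot> \<one>) \<oplus> [n] \<cdot> \<one>" by (simp add: r_neg1)
    then show "[m] \<cdot> \<one> \<noteq> [n] \<cdot> \<one>" using char_zero[OF d(2)] l_neg[of "[m] \<cdot> \<one>"] by auto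
  qed
  moreover have "range (\<lambda>n::nat. [n] \<cdot> \<one>) \<subseteq> carrier K" by auto
  ultimately show ?thesis using finite_subset range_inj_infinite by blast
qed

text \<open>As \<open>K\<close> is infinite, a finite-dimensional space is no larger than \<open>K\<close>, so it has a copy in \<open>'v\<close>.\<close>

lemma fin_dim_lepoll:
  fixes V :: "('k, 'w, 'z) module_scheme"
  assumes V: "vectorspace K V" and fd: "vectorspace.fin_dim K V"
  shows "carrier V \<lesssim> carrier K"
proof -
  interpret V: vectorspace K V by fact
  obtain B where B: "finite B" "V.basis B" using V.finite_basis_exists[OF fd] by blast
  have "carrier V = V.span B" "B \<subseteq> carrier V" using B by (auto simp: V.basis_def)
  then have sub: "carrier V \<subseteq> (\<lambda>a. V.lincomb a B) ` (B \<rightarrow>\<^sub>E carrier K)"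
  proof -
    have "v \<in> (\<lambda>a. V.lincomb a B) ` (B \<rightarrow>\<^sub>E carrier K)" if "v \<in> carrier V" for v
      using V.basis_criterion[OF B(1)] B(2) that \<open>B \<subseteq> carrier V\<close> by blast
    then show ?thesis by blast
  qed
  have sq: "carrier K \<times> carrier K \<lesssim> carrier K"
    using card_of_Times_same_infinite[OF infinite_carrier] eqpoll_imp_lepoll eqpoll_iff_card_of_ordIso by blast
  have "(A \<rightarrow>\<^sub>E carrier K) \<lesssim> carrier K" if "finite A" for A :: "'w set"
    using that
  proof (induction A)
    case empty
    have "(\<lambda>_. \<zero>) ` {\<lambda>_. undefined} \<subseteq> carrier K" by simp
    then show ?case by (auto simp: lepoll_def intro!: exI[of _ "\<lambda>_. \<zero>"])
  next
    case (insert x A)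
    have "(insert x A \<rightarrow>\<^sub>E carrier K) \<lesssim> carrier K \<times> (A \<rightarrow>\<^sub>E carrier K)"
      unfolding PiE_insert_eq by (rule image_lepoll)
    also have "\<dots> \<lesssim> carrier K \<times> carrier K" using insert.IH by (intro times_lepoll_mono) auto
    also note sq
    finally show ?case .
  qed
  from this[OF B(1)] subset_image_lepoll[OF sub] show ?thesis by (rule lepoll_trans[rotated])
qed

lemma fd_copy:
  fixes M :: "('k, 'w) module"
  assumes M: "vectorspace K M" and fd: "vectorspace.fin_dim K M"
  shows "\<exists>(N :: ('k, 'v) module) f g. N \<in> fd_spaces K \<and> f \<in> module_hom K M N \<and> g \<in> module_hom K N M \<and>
    (\<forall>x\<in>carrier M. g (f x) = x) \<and> (\<forall>y\<in>carrier N. f (g y) = y)"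
proof -
  obtain f0 where f0: "inj_on f0 (carrier M)" "f0 ` carrier M \<subseteq> carrier K"
    using fin_dim_lepoll[OF M fd] by (auto simp: lepoll_def)
  define f where "f = emb \<circ> f0"
  have f: "inj_on f (carrier M)"
    unfolding f_def using f0 emb by (intro comp_inj_on) (auto intro: inj_on_subset)
  define g where "g = inv_into (carrier M) f"
  have gf: "g (f x) = x" if "x \<in> carrier M" for x using f that by (simp add: g_def)
  define N :: "('k, 'v) module" where "N = \<lparr>carrier = f ` carrier M, mult = \<lambda>_ _. undefined, one = undefined, zero = f \<zero>\<^bsub>M\<^esub>,
    add = \<lambda>x y. f (g x \<oplus>\<^bsub>M\<^esub> g y), smult = \<lambda>a x. f (a \<odot>\<^bsub>M\<^esub> g x)\<rparr>"
  note m = vsD[OF M]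
  interpret M: vectorspace K M by fact
  have N: "vectorspace K N"
  proof (rule vs_criteria[OF field_axioms])
    show "\<forall>v\<in>carrier N. \<exists>w\<in>carrier N. v \<oplus>\<^bsub>N\<^esub> w = \<zero>\<^bsub>N\<^esub>"
    proof
      fix v assume "v \<in> carrier N"
      then obtain x where "x \<in> carrier M" "v = f x" by (auto simp: N_def)
      then show "\<exists>w\<in>carrier N. v \<oplus>\<^bsub>N\<^esub> w = \<zero>\<^bsub>N\<^esub>"
        by (intro bexI[of _ "f (\<ominus>\<^bsub>M\<^esub> x)"]) (auto simp: N_def gf M.M.r_neg)
    qed
  qed (use m in \<open>auto simp: N_def gf\<close>)
  have fh: "f \<in> module_hom K M N" by (rule homI) (auto simp: N_def gf)
  have gh: "g \<in> module_hom K N M" by (rule homI) (auto simp: N_def gf m)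
  have "vectorspace.fin_dim K N" by (rule fin_dim_image[OF M N fh _ fd]) (auto simp: N_def)
  then show ?thesis using N fh gh gf by (intro exI[of _ N] exI[of _ f] exI[of _ g]) (auto simp: fd_spaces_def N_def)
qed

definition prod_space :: "'i set \<Rightarrow> ('i \<Rightarrow> ('k, 'w) module) \<Rightarrow> ('k, 'i \<Rightarrow> 'w) module" where
  "prod_space I A = \<lparr>carrier = (\<Pi>\<^sub>E i\<in>I. carrier (A i)), mult = \<lambda>_ _. undefined, one = undefined,
     zero = \<lambda>i\<in>I. \<zero>\<^bsub>A i\<^esub>, add = \<lambda>x y. \<lambda>i\<in>I. x i \<oplus>\<^bsub>A i\<^esub> y i, smult = \<lambda>a x. \<lambda>i\<in>I. a \<odot>\<^bsub>A i\<^esub> x i\<rparr>"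

lemma prod_space:
  assumes I: "finite I" and A: "\<And>i. i \<in> I \<Longrightarrow> vectorspace K (A i)" "\<And>i. i \<in> I \<Longrightarrow> vectorspace.fin_dim K (A i)"
  shows "vectorspace K (prod_space I A)" "vectorspace.fin_dim K (prod_space I A)"
    "i \<in> I \<Longrightarrow> (\<lambda>x. x i) \<in> module_hom K (prod_space I A) (A i)"
    "i \<in> I \<Longrightarrow> (\<lambda>a. \<lambda>j\<in>I. if j = i then a else \<zero>\<^bsub>A j\<^esub>) \<in> module_hom K (A i) (prod_space I A)"
    "x \<in> carrier (prod_space I A) \<Longrightarrow> finsum (prod_space I A) (\<lambda>i. \<lambda>j\<in>I. if j = i then x i else \<zero>\<^bsub>A j\<^esub>) I = x"
proof -
  let ?P = "prod_space I A" and ?\<iota> = "\<lambda>i a. \<lambda>j\<in>I. if j = i then a else \<zero>\<^bsub>A j\<^esub>"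
  note v = vsD[OF A(1)]
  show P: "vectorspace K ?P"
  proof (rule vs_criteria[OF field_axioms])
    show "\<forall>x\<in>carrier ?P. \<exists>w\<in>carrier ?P. x \<oplus>\<^bsub>?P\<^esub> w = \<zero>\<^bsub>?P\<^esub>"
    proof
      fix x assume x: "x \<in> carrier ?P"
      have "\<ominus>\<^bsub>A i\<^esub> x i \<in> carrier (A i) \<and> x i \<oplus>\<^bsub>A i\<^esub> (\<ominus>\<^bsub>A i\<^esub> x i) = \<zero>\<^bsub>A i\<^esub>" if i: "i \<in> I" for i
      proof -
        interpret Ai: vectorspace K "A i" by (rule A(1)[OF i])
        have "x i \<in> carrier (A i)" using x i by (auto simp: prod_space_def)
        then show ?thesis by (simp add: Ai.M.r_neg)
      qed
      then show "\<exists>w\<in>carrier ?P. x \<oplus>\<^bsub>?P\<^esub> w = \<zero>\<^bsub>?P\<^esub>"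
        by (intro bexI[of _ "\<lambda>i\<in>I. \<ominus>\<^bsub>A i\<^esub> x i"]) (auto simp: prod_space_def intro!: restrict_ext)
    qed
  qed (use v(1-11) in \<open>auto simp: prod_space_def PiE_iff fun_eq_iff extensional_def\<close>)
  interpret P: vectorspace K ?P by (rule P)
  show \<pi>: "(\<lambda>x. x i) \<in> module_hom K ?P (A i)" if "i \<in> I" for i
    by (rule homI) (use that in \<open>auto simp: prod_space_def\<close>)
  show \<iota>: "?\<iota> i \<in> module_hom K (A i) ?P" if i: "i \<in> I" for i
    by (rule homI) (use v i in \<open>auto simp: prod_space_def fun_eq_iff\<close>)
  show sum: "finsum ?P (\<lambda>i. ?\<iota> i (x i)) I = x" if x: "x \<in> carrier ?P" for x
  proof -
    have xi: "x i \<in> carrier (A i)" if "i \<in> I" for i using x that by (auto simp: prod_space_def)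
    have g: "?\<iota> i (x i) \<in> carrier ?P" if "i \<in> I" for i using homD(1)[OF \<iota>[OF that] xi[OF that]] .
    show ?thesis
    proof (rule PiE_ext[of _ I "\<lambda>i. carrier (A i)"])
      have "finsum ?P (\<lambda>i. ?\<iota> i (x i)) I \<in> carrier ?P" using g by (intro P.M.finsum_closed) auto
      then show "finsum ?P (\<lambda>i. ?\<iota> i (x i)) I \<in> (\<Pi>\<^sub>E i\<in>I. carrier (A i))" by (simp add: prod_space_def)
      show "x \<in> (\<Pi>\<^sub>E i\<in>I. carrier (A i))" using x by (simp add: prod_space_def)
      fix j assume j: "j \<in> I"
      interpret Aj: vectorspace K "A j" by (rule A(1)[OF j])
      have "finsum ?P (\<lambda>i. ?\<iota> i (x i)) I j = finsum (A j) (\<lambda>i. ?\<iota> i (x i) j) I"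
        using hom_sum[OF P A(1)[OF j] \<pi>[OF j] I g] by simp
      also have "\<dots> = finsum (A j) (\<lambda>i. if j = i then x i else \<zero>\<^bsub>A j\<^esub>) I"
        using xi j by (intro Aj.M.finsum_cong') auto
      also have "\<dots> = finsum (A j) (\<lambda>i. if j = i then x j else \<zero>\<^bsub>A j\<^esub>) I"
        using xi[OF j] by (intro Aj.M.finsum_cong') auto
      also have "\<dots> = x j" using Aj.M.finsum_singleton[OF j I, of "\<lambda>_. x j"] xi[OF j] by simp
      finally show "finsum ?P (\<lambda>i. ?\<iota> i (x i)) I j = x j" .
    qed
  qed
  have "\<forall>i\<in>I. \<exists>S. finite S \<and> S \<subseteq> carrier (A i) \<and> (\<forall>N. submodule K N (A i) \<longrightarrow> S \<subseteq> N \<longrightarrow> carrier (A i) \<subseteq> N)"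
    using iffD1[OF fin_dim_iff[OF A(1)] A(2)] by (rule ballI)
  from bchoice[OF this] obtain S where "\<forall>i\<in>I. finite (S i) \<and> S i \<subseteq> carrier (A i) \<and>
      (\<forall>N. submodule K N (A i) \<longrightarrow> S i \<subseteq> N \<longrightarrow> carrier (A i) \<subseteq> N)" by (rule exE)
  then have S: "finite (S i)" "S i \<subseteq> carrier (A i)" "submodule K N (A i) \<Longrightarrow> S i \<subseteq> N \<Longrightarrow> carrier (A i) \<subseteq> N"
    if "i \<in> I" for i N using that by simp_all
  let ?S = "\<Union>i\<in>I. ?\<iota> i ` S i"
  have "carrier ?P \<subseteq> N" if N: "submodule K N ?P" "?S \<subseteq> N" for N
  proof
    fix x assume x: "x \<in> carrier ?P"
    have "?\<iota> i (x i) \<in> N" if i: "i \<in> I" for i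
    proof -
      have "S i \<subseteq> {a \<in> carrier (A i). ?\<iota> i a \<in> N}" using N(2) S(2)[OF i] i by auto
      from S(3)[OF i preimage_submodule[OF A(1)[OF i] P \<iota>[OF i] N(1)] this]
      have "carrier (A i) \<subseteq> {a \<in> carrier (A i). ?\<iota> i a \<in> N}" .
      moreover have "x i \<in> carrier (A i)" using x i by (auto simp: prod_space_def)
      ultimately show ?thesis by blast
    qed
    with submodule_finsum[OF P N(1) I, of "\<lambda>i. ?\<iota> i (x i)"] sum[OF x] show "x \<in> N" by simp
  qed
  moreover have "finite ?S" using I S(1) by simp
  moreover have "?S \<subseteq> carrier ?P"
  proof (intro UN_least image_subsetI)
    show "?\<iota> i a \<in> carrier ?P" if "i \<in> I" "a \<in> S i" for i a
      using homD(1)[OF \<iota>[OF that(1)]] S(2)[OF that(1)] that(2) by blast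
  qed
  ultimately show "vectorspace.fin_dim K ?P" unfolding fin_dim_iff[OF P] by (intro exI[of _ ?S]) simp
qed

subsection \<open>Linear maps and tensor products\<close>

lemma fdD: "V \<in> fd_spaces K \<Longrightarrow> vectorspace K V" "V \<in> fd_spaces K \<Longrightarrow> vectorspace.fin_dim K V"
  by (simp_all add: fd_spaces_def)

lemma bilinearI:
  assumes "\<And>v w. v \<in> carrier V \<Longrightarrow> w \<in> carrier W \<Longrightarrow> b v w \<in> carrier U"
    "\<And>v v' w. v \<in> carrier V \<Longrightarrow> v' \<in> carrier V \<Longrightarrow> w \<in> carrier W \<Longrightarrow> b (v \<oplus>\<^bsub>V\<^esub> v') w = b v w \<oplus>\<^bsub>U\<^esub> b v' w"
    "\<And>v w w'. v \<in> carrier V \<Longrightarrow> w \<in> carrier W \<Longrightarrow> w' \<in> carrier W \<Longrightarrow> b v (w \<oplus>\<^bsub>W\<^esub> w') = b v w \<oplus>\<^bsub>U\<^esub> b v w'"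
    "\<And>a v w. a \<in> carrier K \<Longrightarrow> v \<in> carrier V \<Longrightarrow> w \<in> carrier W \<Longrightarrow> b (a \<odot>\<^bsub>V\<^esub> v) w = a \<odot>\<^bsub>U\<^esub> b v w"
    "\<And>a v w. a \<in> carrier K \<Longrightarrow> v \<in> carrier V \<Longrightarrow> w \<in> carrier W \<Longrightarrow> b v (a \<odot>\<^bsub>W\<^esub> w) = a \<odot>\<^bsub>U\<^esub> b v w"
  shows "bilinear_map K V W U b"
  unfolding bilinear_map_def using assms by (auto intro!: homI)

lemma bilinearD:
  assumes "bilinear_map K V W U b"
  shows "v \<in> carrier V \<Longrightarrow> w \<in> carrier W \<Longrightarrow> b v w \<in> carrier U"
    "v \<in> carrier V \<Longrightarrow> v' \<in> carrier V \<Longrightarrow> w \<in> carrier W \<Longrightarrow> b (v \<oplus>\<^bsub>V\<^esub> v') w = b v w \<oplus>\<^bsub>U\<^esub> b v' w"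
    "v \<in> carrier V \<Longrightarrow> w \<in> carrier W \<Longrightarrow> w' \<in> carrier W \<Longrightarrow> b v (w \<oplus>\<^bsub>W\<^esub> w') = b v w \<oplus>\<^bsub>U\<^esub> b v w'"
    "a \<in> carrier K \<Longrightarrow> v \<in> carrier V \<Longrightarrow> w \<in> carrier W \<Longrightarrow> b (a \<odot>\<^bsub>V\<^esub> v) w = a \<odot>\<^bsub>U\<^esub> b v w"
    "a \<in> carrier K \<Longrightarrow> v \<in> carrier V \<Longrightarrow> w \<in> carrier W \<Longrightarrow> b v (a \<odot>\<^bsub>W\<^esub> w) = a \<odot>\<^bsub>U\<^esub> b v w"
    "v \<in> carrier V \<Longrightarrow> (\<lambda>w. b v w) \<in> module_hom K W U" "w \<in> carrier W \<Longrightarrow> (\<lambda>v. b v w) \<in> module_hom K V U"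
  using assms by (auto simp: bilinear_map_def module_hom_def)

lemma restrict_hom: "vectorspace K V \<Longrightarrow> f \<in> module_hom K V W \<Longrightarrow> restrict f (carrier V) \<in> lin_maps K V W"
  using homD[of f V W] vsD(1,3)[of K V] by (auto simp: lin_maps_def intro!: homI)

text \<open>With a basis \<open>B\<close> of \<open>V\<close>, the space \<open>W\<^sup>B\<close> with \<open>v \<otimes> w = (\<lambda>b. c\<^sub>b(v) w)\<close> is a tensor product:
  every \<open>x\<close> is the sum of the \<open>b \<otimes> x b\<close>.\<close>

lemma tensor_product_exists:
  assumes V: "V \<in> fd_spaces K" and W: "W \<in> fd_spaces K"
  shows "\<exists>(T :: ('k, 'v) module) t. is_tensor_product K V W T t"
proof -
  note Vv = fdD(1)[OF V] and Wv = fdD(1)[OF W]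
  obtain B c where B: "finite B" "B \<subseteq> carrier V" and cK: "\<And>b v. b \<in> B \<Longrightarrow> v \<in> carrier V \<Longrightarrow> c b v \<in> carrier K"
    and c_add: "\<And>b v w. b \<in> B \<Longrightarrow> v \<in> carrier V \<Longrightarrow> w \<in> carrier V \<Longrightarrow> c b (v \<oplus>\<^bsub>V\<^esub> w) = c b v \<oplus> c b w"
    and c_smult: "\<And>b a v. b \<in> B \<Longrightarrow> a \<in> carrier K \<Longrightarrow> v \<in> carrier V \<Longrightarrow> c b (a \<odot>\<^bsub>V\<^esub> v) = a \<otimes> c b v"
    and expand: "\<And>v. v \<in> carrier V \<Longrightarrow> v = finsum V (\<lambda>b. c b v \<odot>\<^bsub>V\<^esub> b) B"
    and dual: "\<And>b b'. b \<in> B \<Longrightarrow> b' \<in> B \<Longrightarrow> c b b' = (if b = b' then \<one> else \<zero>)"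
    by (rule dual_basis[OF Vv fdD(2)[OF V]]) (rule that, assumption+)
  let ?M = "prod_space B (\<lambda>_. W)"
  note M = prod_space[OF B(1), of "\<lambda>_. W", OF Wv fdD(2)[OF W]]
  obtain T :: "('k, 'v) module" and f g where T: "T \<in> fd_spaces K" and f: "f \<in> module_hom K ?M T" and g: "g \<in> module_hom K T ?M"
    and "\<forall>x\<in>carrier ?M. g (f x) = x" "\<forall>y\<in>carrier T. f (g y) = y"
    using fd_copy[OF M(1,2)] by (elim exE conjE) (erule (4) that)
  then have gf: "\<And>x. x \<in> carrier ?M \<Longrightarrow> g (f x) = x" and fg: "\<And>y. y \<in> carrier T \<Longrightarrow> f (g y) = y" by simp_all
  note Tv = fdD(1)[OF T]
  interpret V: vectorspace K V by (rule Vv)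
  define s where "s v w = (\<lambda>b\<in>B. c b v \<odot>\<^bsub>W\<^esub> w)" for v w
  have s: "v \<in> carrier V \<Longrightarrow> w \<in> carrier W \<Longrightarrow> s v w \<in> carrier ?M"
    "v \<in> carrier V \<Longrightarrow> v' \<in> carrier V \<Longrightarrow> w \<in> carrier W \<Longrightarrow> s (v \<oplus>\<^bsub>V\<^esub> v') w = s v w \<oplus>\<^bsub>?M\<^esub> s v' w"
    "v \<in> carrier V \<Longrightarrow> w \<in> carrier W \<Longrightarrow> w' \<in> carrier W \<Longrightarrow> s v (w \<oplus>\<^bsub>W\<^esub> w') = s v w \<oplus>\<^bsub>?M\<^esub> s v w'"
    "a \<in> carrier K \<Longrightarrow> v \<in> carrier V \<Longrightarrow> w \<in> carrier W \<Longrightarrow> s (a \<odot>\<^bsub>V\<^esub> v) w = a \<odot>\<^bsub>?M\<^esub> s v w"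
    "a \<in> carrier K \<Longrightarrow> v \<in> carrier V \<Longrightarrow> w \<in> carrier W \<Longrightarrow> s v (a \<odot>\<^bsub>W\<^esub> w) = a \<odot>\<^bsub>?M\<^esub> s v w" for v v' w w' a
    using vsD[OF Wv] cK
    by (auto simp: s_def prod_space_def c_add c_smult m_comm fun_eq_iff simp flip: vsD(8)[OF Wv])
  have t: "bilinear_map K V W T (\<lambda>v w. f (s v w))"
    using s homD[OF f] by (intro bilinearI) auto
  have sb: "s b w = (\<lambda>j\<in>B. if j = b then w else \<zero>\<^bsub>W\<^esub>)" if "b \<in> B" "w \<in> carrier W" for b w
    using that dual vsD(9,12)[OF Wv that(2)] by (auto simp: s_def fun_eq_iff)
  have "is_tensor_product K V W T (\<lambda>v w. f (s v w))"
    unfolding is_tensor_product_def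
  proof (intro conjI T t ballI allI impI)
    fix U :: "('k, 'v) module" and \<beta> assume U: "U \<in> fd_spaces K" and \<beta>: "bilinear_map K V W U \<beta>"
    note Uv = fdD(1)[OF U]
    interpret U: vectorspace K U by (rule Uv)
    note b = bilinearD[OF \<beta>]
    define h where "h x = finsum U (\<lambda>b. \<beta> b (x b)) B" for x
    have xW: "x b \<in> carrier W" if "x \<in> carrier ?M" "b \<in> B" for x b using homD(1)[OF M(3)[OF that(2)] that(1)] .
    have bx: "\<beta> b (x b) \<in> carrier U" if "x \<in> carrier ?M" "b \<in> B" for x b using b(1) xW[OF that] B(2) that(2) by blast
    have h: "h \<in> module_hom K ?M U"
    proof (rule homI)
      fix x y assume x: "x \<in> carrier ?M" and y: "y \<in> carrier ?M"
      show "h x \<in> carrier U" unfolding h_def using bx[OF x] by (intro U.M.finsum_closed) auto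
      have "h (x \<oplus>\<^bsub>?M\<^esub> y) = finsum U (\<lambda>b. \<beta> b (x b) \<oplus>\<^bsub>U\<^esub> \<beta> b (y b)) B"
        unfolding h_def using homD(2)[OF M(3) x y] b(3) xW[OF x] xW[OF y] bx[OF x] bx[OF y] B(2)
        by (intro U.M.finsum_cong') (auto simp: subset_iff)
      also have "\<dots> = h x \<oplus>\<^bsub>U\<^esub> h y" unfolding h_def using bx[OF x] bx[OF y] by (intro U.M.finsum_addf) auto
      finally show "h (x \<oplus>\<^bsub>?M\<^esub> y) = h x \<oplus>\<^bsub>U\<^esub> h y" .
    next
      fix a x assume a: "a \<in> carrier K" and x: "x \<in> carrier ?M"
      have "h (a \<odot>\<^bsub>?M\<^esub> x) = finsum U (\<lambda>b. a \<odot>\<^bsub>U\<^esub> \<beta> b (x b)) B"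
        unfolding h_def using homD(3)[OF M(3) a x] b(5)[OF a] xW[OF x] bx[OF x] B(2) a
        by (intro U.M.finsum_cong') (auto simp: subset_iff)
      also have "\<dots> = a \<odot>\<^bsub>U\<^esub> h x"
        unfolding h_def using bx[OF x] a vsD(3,11)[OF Uv]
        by (intro hom_sum[OF Uv Uv _ B(1), where f = "\<lambda>u. a \<odot>\<^bsub>U\<^esub> u", symmetric] homI)
          (auto simp: m_comm simp flip: vsD(8)[OF Uv])
      finally show "h (a \<odot>\<^bsub>?M\<^esub> x) = a \<odot>\<^bsub>U\<^esub> h x" .
    qed
    have hs: "h (s v w) = \<beta> v w" if v: "v \<in> carrier V" and w: "w \<in> carrier W" for v w
    proof -
      have "\<beta> v w = \<beta> (finsum V (\<lambda>b. c b v \<odot>\<^bsub>V\<^esub> b) B) w" using expand[OF v] by simp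
      also have "\<dots> = finsum U (\<lambda>b'. \<beta> (c b' v \<odot>\<^bsub>V\<^esub> b') w) B"
        using cK v B(2) by (intro hom_sum[OF Vv Uv b(7)[OF w] B(1)]) auto
      also have "\<dots> = h (s v w)"
        unfolding h_def using cK v w B(2) b(1,4,5) vsD(3)[OF Wv]
        by (intro U.M.finsum_cong') (auto simp: s_def subset_iff)
      finally show ?thesis by simp
    qed
    let ?\<phi> = "restrict (\<lambda>y. h (g y)) (carrier T)"
    have hg: "(\<lambda>y. h (g y)) \<in> module_hom K T U" by (rule homI) (simp_all add: homD[OF g] homD[OF h])
    have \<phi>: "?\<phi> \<in> lin_maps K T U" by (rule restrict_hom[OF Tv hg])
    have \<phi>s: "?\<phi> (f (s v w)) = \<beta> v w" if "v \<in> carrier V" "w \<in> carrier W" for v w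
      using hs[OF that] gf s(1)[OF that] homD(1)[OF f] by simp
    show "\<exists>!\<phi>. \<phi> \<in> lin_maps K T U \<and> (\<forall>v\<in>carrier V. \<forall>w\<in>carrier W. \<phi> (f (s v w)) = \<beta> v w)"
    proof (rule ex1I[of _ ?\<phi>])
      fix \<psi> assume \<psi>: "\<psi> \<in> lin_maps K T U \<and> (\<forall>v\<in>carrier V. \<forall>w\<in>carrier W. \<psi> (f (s v w)) = \<beta> v w)"
      then have \<psi>h: "\<psi> \<in> module_hom K T U" and \<psi>e: "\<psi> \<in> extensional (carrier T)" by (simp_all add: lin_maps_def)
      show "\<psi> = ?\<phi>"
      proof (rule extensionalityI[OF \<psi>e])
        fix y assume y: "y \<in> carrier T"
        let ?x = "g y"
        have x: "?x \<in> carrier ?M" by (rule homD(1)[OF g y])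
        have sx: "s b (?x b) \<in> carrier ?M" if "b \<in> B" for b using s(1) xW[OF x that] B(2) that by blast
        have "?x = finsum ?M (\<lambda>b. s b (?x b)) B"
        proof -
          interpret M: vectorspace K ?M by (rule M(1))
          have "finsum ?M (\<lambda>b. s b (?x b)) B = finsum ?M (\<lambda>i. \<lambda>j\<in>B. if j = i then ?x i else \<zero>\<^bsub>W\<^esub>) B"
            using sb xW[OF x] sx by (intro M.M.finsum_cong') auto
          then show ?thesis using M(5)[OF x] by simp
        qed
        then have "y = f (finsum ?M (\<lambda>b. s b (?x b)) B)" using fg[OF y] by simp
        also have "\<dots> = finsum T (\<lambda>b. f (s b (?x b))) B" by (rule hom_sum[OF M(1) Tv f B(1) sx])
        finally have y': "y = finsum T (\<lambda>b. f (s b (?x b))) B" .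
        have "\<psi> y = finsum U (\<lambda>b. \<psi> (f (s b (?x b)))) B"
          by (subst y', rule hom_sum[OF Tv Uv \<psi>h B(1)], use homD(1)[OF f sx] in blast)
        also have "\<dots> = h ?x"
          unfolding h_def using \<psi> xW[OF x] bx[OF x] B(2) by (intro U.M.finsum_cong') (auto simp: subset_iff)
        finally show "\<psi> y = ?\<phi> y" using y by simp
      qed simp
    qed (use \<phi> \<phi>s in auto)
  qed
  then show ?thesis by blast
qed

subsection \<open>The chosen tensor products and unit\<close>

abbreviation tensor :: "('k, 'v) module \<Rightarrow> ('k, 'v) module \<Rightarrow> ('k, 'v) module"
  where "tensor \<equiv> vs_tensor K"

abbreviation pt :: "('k, 'v) module \<Rightarrow> ('k, 'v) module \<Rightarrow> 'v \<Rightarrow> 'v \<Rightarrow> 'v"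
  where "pt \<equiv> pure_tensor K"

lemma chosen_tensor_product:
  assumes "V \<in> fd_spaces K" "W \<in> fd_spaces K"
  shows "is_tensor_product K V W (tensor V W) (pt V W)"
proof -
  obtain T :: "('k, 'v) module" and t where "is_tensor_product K V W T t"
    using tensor_product_exists[OF assms] by blast
  then have "case (T, t) of (T, t) \<Rightarrow> is_tensor_product K V W T t" by simp
  then have "case tensor_choice K V W of (T :: ('k, 'v) module, t) \<Rightarrow> is_tensor_product K V W T t"
    unfolding tensor_choice_def by (rule someI)
  then show ?thesis by (simp add: vs_tensor_def pure_tensor_def case_prod_beta)
qed

lemma tensor_closed: "V \<in> fd_spaces K \<Longrightarrow> W \<in> fd_spaces K \<Longrightarrow> tensor V W \<in> fd_spaces K"
  using chosen_tensor_product by (simp add: is_tensor_product_def)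

lemma pt_bilinear:
  assumes "V \<in> fd_spaces K" "W \<in> fd_spaces K"
  shows "bilinear_map K V W (tensor V W) (pt V W)"
  using chosen_tensor_product[OF assms] by (simp add: is_tensor_product_def)

lemmas pt = bilinearD(1-5)[OF pt_bilinear]

lemma bilinear_comp:
  assumes "bilinear_map K V W U b" "f \<in> module_hom K U X"
  shows "bilinear_map K V W X (\<lambda>v w. f (b v w))"
  using bilinearD(1-5)[OF assms(1)] homD[OF assms(2)] by (intro bilinearI) auto

lemma tensor_lift:
  fixes U :: "('k, 'v) module"
  assumes "V \<in> fd_spaces K" "W \<in> fd_spaces K" "U \<in> fd_spaces K" "bilinear_map K V W U b"
  shows "\<exists>\<phi>. \<phi> \<in> lin_maps K (tensor V W) U \<and> (\<forall>v\<in>carrier V. \<forall>w\<in>carrier W. \<phi> (pt V W v w) = b v w)"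
proof -
  have "\<exists>!\<phi>. \<phi> \<in> lin_maps K (tensor V W) U \<and> (\<forall>v\<in>carrier V. \<forall>w\<in>carrier W. \<phi> (pt V W v w) = b v w)"
    using chosen_tensor_product[OF assms(1,2)] assms(3,4) unfolding is_tensor_product_def by simp
  then show ?thesis by (rule ex1_implies_ex)
qed

lemma tensor_ext:
  fixes U :: "('k, 'v) module"
  assumes V: "V \<in> fd_spaces K" and W: "W \<in> fd_spaces K" and U: "U \<in> fd_spaces K"
    and f: "f \<in> module_hom K (tensor V W) U" and g: "g \<in> module_hom K (tensor V W) U"
    and eq: "\<And>v w. v \<in> carrier V \<Longrightarrow> w \<in> carrier W \<Longrightarrow> f (pt V W v w) = g (pt V W v w)"
    and x: "x \<in> carrier (tensor V W)"
  shows "f x = g x"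
proof -
  let ?r = "\<lambda>f. restrict f (carrier (tensor V W))"
  define P where "P \<phi> \<longleftrightarrow> \<phi> \<in> lin_maps K (tensor V W) U \<and> (\<forall>v\<in>carrier V. \<forall>w\<in>carrier W. \<phi> (pt V W v w) = f (pt V W v w))" for \<phi>
  have ex1: "\<exists>!\<phi>. P \<phi>"
    unfolding P_def using chosen_tensor_product[OF V W] U bilinear_comp[OF pt_bilinear[OF V W] f] unfolding is_tensor_product_def by simp
  have T: "vectorspace K (tensor V W)" using fdD(1)[OF tensor_closed[OF V W]] .
  have f': "P (?r f)" unfolding P_def using restrict_hom[OF T f] pt(1)[OF V W] by simp
  have g': "P (?r g)" unfolding P_def using restrict_hom[OF T g] pt(1)[OF V W] eq by simp
  have "?r f = ?r g" using ex1 f' g' by blast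
  from fun_cong[OF this, of x] x show ?thesis by simp
qed

lemma hom_comp: "f \<in> module_hom K V W \<Longrightarrow> g \<in> module_hom K W U \<Longrightarrow> (\<lambda>x. g (f x)) \<in> module_hom K V U"
  by (rule homI) (simp_all add: homD[of f V W] homD[of g W U])

lemma tensor_ext_left:
  fixes X :: "('k, 'v) module"
  assumes fd: "U \<in> fd_spaces K" "V \<in> fd_spaces K" "W \<in> fd_spaces K" "X \<in> fd_spaces K"
    and f: "f \<in> module_hom K (tensor (tensor U V) W) X" and g: "g \<in> module_hom K (tensor (tensor U V) W) X"
    and eq: "\<And>u v w. u \<in> carrier U \<Longrightarrow> v \<in> carrier V \<Longrightarrow> w \<in> carrier W \<Longrightarrow>
      f (pt (tensor U V) W (pt U V u v) w) = g (pt (tensor U V) W (pt U V u v) w)"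
    and x: "x \<in> carrier (tensor (tensor U V) W)"
  shows "f x = g x"
proof (rule tensor_ext[OF tensor_closed[OF fd(1,2)] fd(3,4) f g _ x])
  note b = pt_bilinear[OF tensor_closed[OF fd(1,2)] fd(3)]
  fix s w assume s: "s \<in> carrier (tensor U V)" and w: "w \<in> carrier W"
  note h = bilinearD(7)[OF b w]
  show "f (pt (tensor U V) W s w) = g (pt (tensor U V) W s w)"
    by (rule tensor_ext[OF fd(1,2,4) hom_comp[OF h f] hom_comp[OF h g] eq[OF _ _ w] s])
qed

lemma tensor_ext_right:
  fixes X :: "('k, 'v) module"
  assumes fd: "U \<in> fd_spaces K" "V \<in> fd_spaces K" "W \<in> fd_spaces K" "X \<in> fd_spaces K"
    and f: "f \<in> module_hom K (tensor U (tensor V W)) X" and g: "g \<in> module_hom K (tensor U (tensor V W)) X"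
    and eq: "\<And>u v w. u \<in> carrier U \<Longrightarrow> v \<in> carrier V \<Longrightarrow> w \<in> carrier W \<Longrightarrow>
      f (pt U (tensor V W) u (pt V W v w)) = g (pt U (tensor V W) u (pt V W v w))"
    and x: "x \<in> carrier (tensor U (tensor V W))"
  shows "f x = g x"
proof (rule tensor_ext[OF fd(1) tensor_closed[OF fd(2,3)] fd(4) f g _ x])
  note b = pt_bilinear[OF fd(1) tensor_closed[OF fd(2,3)]]
  fix u s assume u: "u \<in> carrier U" and s: "s \<in> carrier (tensor V W)"
  note h = bilinearD(6)[OF b u]
  show "f (pt U (tensor V W) u s) = g (pt U (tensor V W) u s)"
    by (rule tensor_ext[OF fd(2,3,4) hom_comp[OF h f] hom_comp[OF h g] eq[OF u] s])
qed

lemma tensor_ext_left4: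
  fixes X :: "('k, 'v) module"
  assumes fd: "U \<in> fd_spaces K" "V \<in> fd_spaces K" "W \<in> fd_spaces K" "Z \<in> fd_spaces K" "X \<in> fd_spaces K"
    and f: "f \<in> module_hom K (tensor (tensor (tensor U V) W) Z) X"
    and g: "g \<in> module_hom K (tensor (tensor (tensor U V) W) Z) X"
    and eq: "\<And>u v w z. u \<in> carrier U \<Longrightarrow> v \<in> carrier V \<Longrightarrow> w \<in> carrier W \<Longrightarrow> z \<in> carrier Z \<Longrightarrow>
      f (pt (tensor (tensor U V) W) Z (pt (tensor U V) W (pt U V u v) w) z)
        = g (pt (tensor (tensor U V) W) Z (pt (tensor U V) W (pt U V u v) w) z)"
    and x: "x \<in> carrier (tensor (tensor (tensor U V) W) Z)"
  shows "f x = g x"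
proof (rule tensor_ext[OF tensor_closed[OF tensor_closed[OF fd(1,2)] fd(3)] fd(4,5) f g _ x])
  note b = pt_bilinear[OF tensor_closed[OF tensor_closed[OF fd(1,2)] fd(3)] fd(4)]
  fix s z assume s: "s \<in> carrier (tensor (tensor U V) W)" and z: "z \<in> carrier Z"
  note h = bilinearD(7)[OF b z]
  show "f (pt (tensor (tensor U V) W) Z s z) = g (pt (tensor (tensor U V) W) Z s z)"
    by (rule tensor_ext_left[OF fd(1,2,3,5) hom_comp[OF h f] hom_comp[OF h g] eq[OF _ _ _ z] s])
qed

text \<open>Lift \<open>\<tau>\<close> with \<open>w\<close> fixed to a linear map on \<open>U \<otimes> V\<close>. By uniqueness of lifts it depends linearly on
  \<open>w\<close>, so it can be lifted again.\<close>

lemma trilinear_lift: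
  fixes X :: "('k, 'v) module"
  assumes fd: "U \<in> fd_spaces K" "V \<in> fd_spaces K" "W \<in> fd_spaces K" "X \<in> fd_spaces K"
    and b: "\<And>w. w \<in> carrier W \<Longrightarrow> bilinear_map K U V X (\<lambda>u v. \<tau> u v w)"
    and l: "\<And>u v. u \<in> carrier U \<Longrightarrow> v \<in> carrier V \<Longrightarrow> (\<lambda>w. \<tau> u v w) \<in> module_hom K W X"
  shows "\<exists>\<phi>. \<phi> \<in> lin_maps K (tensor (tensor U V) W) X \<and> (\<forall>u\<in>carrier U. \<forall>v\<in>carrier V. \<forall>w\<in>carrier W.
    \<phi> (pt (tensor U V) W (pt U V u v) w) = \<tau> u v w)"
proof -
  note UV = tensor_closed[OF fd(1,2)]
  note x = vsD[OF fdD(1)[OF fd(4)]] and Wv = vsD[OF fdD(1)[OF fd(3)]]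
  interpret X: vectorspace K X by (rule fdD(1)[OF fd(4)])
  have "\<forall>w\<in>carrier W. \<exists>\<psi>. \<psi> \<in> lin_maps K (tensor U V) X \<and> (\<forall>u\<in>carrier U. \<forall>v\<in>carrier V. \<psi> (pt U V u v) = \<tau> u v w)"
    using tensor_lift[OF fd(1,2,4) b] by (rule ballI)
  from bchoice[OF this] obtain \<psi> where
    "\<forall>w\<in>carrier W. \<psi> w \<in> lin_maps K (tensor U V) X \<and> (\<forall>u\<in>carrier U. \<forall>v\<in>carrier V. \<psi> w (pt U V u v) = \<tau> u v w)"
    by (rule exE)
  then have \<psi>: "\<psi> w \<in> module_hom K (tensor U V) X" and e: "u \<in> carrier U \<Longrightarrow> v \<in> carrier V \<Longrightarrow> \<psi> w (pt U V u v) = \<tau> u v w"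
    if "w \<in> carrier W" for w u v using that by (simp_all add: lin_maps_def)
  have "bilinear_map K (tensor U V) W X (\<lambda>s w. \<psi> w s)"
  proof (rule bilinearI)
    fix s w w' assume s: "s \<in> carrier (tensor U V)" and w: "w \<in> carrier W" and w': "w' \<in> carrier W"
    note h = homD[OF \<psi>[OF w]] and h' = homD[OF \<psi>[OF w']]
    have "(\<lambda>s. \<psi> w s \<oplus>\<^bsub>X\<^esub> \<psi> w' s) \<in> module_hom K (tensor U V) X"
      by (rule homI) (simp_all add: h h' x X.M.a_ac)
    then show "\<psi> (w \<oplus>\<^bsub>W\<^esub> w') s = \<psi> w s \<oplus>\<^bsub>X\<^esub> \<psi> w' s"
      by (rule tensor_ext[OF fd(1,2,4) \<psi>[OF Wv(1)[OF w w']] _ _ s])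
        (simp add: e w w' Wv(1) homD(2)[OF l])
  next
    fix a s w assume a: "a \<in> carrier K" and s: "s \<in> carrier (tensor U V)" and w: "w \<in> carrier W"
    note h = homD[OF \<psi>[OF w]]
    have "(\<lambda>s. a \<odot>\<^bsub>X\<^esub> \<psi> w s) \<in> module_hom K (tensor U V) X"
      by (rule homI) (simp_all add: h x a m_comm flip: x(8))
    then show "\<psi> (a \<odot>\<^bsub>W\<^esub> w) s = a \<odot>\<^bsub>X\<^esub> \<psi> w s"
      by (rule tensor_ext[OF fd(1,2,4) \<psi>[OF Wv(3)[OF a w]] _ _ s])
        (simp add: e w a Wv(3) homD(3)[OF l])
  qed (simp_all add: homD[OF \<psi>])
  from tensor_lift[OF UV fd(3,4) this] obtain \<phi> where "\<phi> \<in> lin_maps K (tensor (tensor U V) W) X"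
    "\<forall>s\<in>carrier (tensor U V). \<forall>w\<in>carrier W. \<phi> (pt (tensor U V) W s w) = \<psi> w s" by (elim exE conjE)
  then show ?thesis by (intro exI[of _ \<phi>]) (simp add: e pt(1)[OF fd(1,2)])
qed

abbreviation one_space :: "('k, 'v) module" where "one_space \<equiv> vs_unit K"
abbreviation unit_vec :: 'v where "unit_vec \<equiv> vs_unit_vec K"

text \<open>The scalar \<open>c\<close> of a vector \<open>c \<cdot> 1\<close> of the unit space.\<close>

definition coord :: "'v \<Rightarrow> 'k" where
  "coord = inv_into (carrier K) (snd (unit_choice K :: ('k, 'v) module \<times> ('k \<Rightarrow> 'v)))"

lemma unit_choice:
  shows "one_space \<in> fd_spaces K" "unit_vec \<in> carrier one_space"
    "x \<in> carrier one_space \<Longrightarrow> coord x \<in> carrier K"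
    "x \<in> carrier one_space \<Longrightarrow> coord x \<odot>\<^bsub>one_space\<^esub> unit_vec = x"
    "x \<in> carrier one_space \<Longrightarrow> y \<in> carrier one_space \<Longrightarrow> coord (x \<oplus>\<^bsub>one_space\<^esub> y) = coord x \<oplus> coord y"
    "a \<in> carrier K \<Longrightarrow> x \<in> carrier one_space \<Longrightarrow> coord (a \<odot>\<^bsub>one_space\<^esub> x) = a \<otimes> coord x"
    "coord unit_vec = \<one>"
proof -
  let ?P = "\<lambda>(U :: ('k, 'v) module, i). U \<in> fd_spaces K \<and> bij_betw i (carrier K) (carrier U) \<and>
     (\<forall>c \<in> carrier K. \<forall>d \<in> carrier K. i (c \<oplus> d) = i c \<oplus>\<^bsub>U\<^esub> i d \<and> i (c \<otimes> d) = c \<odot>\<^bsub>U\<^esub> i d)"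
  define M :: "('k, 'k) module" where "M = \<lparr>carrier = carrier K, mult = \<lambda>_ _. undefined, one = undefined, zero = \<zero>, add = (\<oplus>), smult = (\<otimes>)\<rparr>"
  have M: "vectorspace K M"
  proof (rule vs_criteria[OF field_axioms])
    show "\<forall>v\<in>carrier M. \<exists>w\<in>carrier M. v \<oplus>\<^bsub>M\<^esub> w = \<zero>\<^bsub>M\<^esub>"
      by (auto simp: M_def intro!: bexI[of _ "\<ominus> _"] r_neg)
  qed (auto simp: M_def a_ac m_ac l_distr r_distr)
  have "vectorspace.fin_dim K M"
    unfolding fin_dim_iff[OF M]
  proof (intro exI[of _ "{\<one>}"] conjI allI impI subsetI)
    fix N x assume N: "submodule K N M" "{\<one>} \<subseteq> N" and x: "x \<in> carrier M"
    then have "x \<odot>\<^bsub>M\<^esub> \<one> \<in> N" by (intro submodule.smult_closed[OF N(1)]) (auto simp: M_def)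
    then show "x \<in> N" using x by (simp add: M_def)
  qed (auto simp: M_def)
  from fd_copy[OF M this] obtain N :: "('k, 'v) module" and f g where N: "N \<in> fd_spaces K" "f \<in> module_hom K M N" "g \<in> module_hom K N M"
    "\<forall>x\<in>carrier M. g (f x) = x" "\<forall>y\<in>carrier N. f (g y) = y" by (elim exE conjE) (erule (4) that)
  have "bij_betw f (carrier K) (carrier N)"
    by (rule bij_betw_byWitness[of _ g]) (use N(4,5) homD(1)[OF N(2)] homD(1)[OF N(3)] in \<open>auto simp: M_def\<close>)
  then have "?P (N, f)" using N(1) homD(2,3)[OF N(2)] by (simp add: M_def)
  then have "?P (unit_choice K)" unfolding unit_choice_def by (rule someI)
  moreover define i where "i = snd (unit_choice K :: ('k, 'v) module \<times> ('k \<Rightarrow> 'v))"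
  ultimately have U: "one_space \<in> fd_spaces K" and i: "bij_betw i (carrier K) (carrier one_space)"
    "\<And>c d. c \<in> carrier K \<Longrightarrow> d \<in> carrier K \<Longrightarrow> i (c \<oplus> d) = i c \<oplus>\<^bsub>one_space\<^esub> i d"
    "\<And>c d. c \<in> carrier K \<Longrightarrow> d \<in> carrier K \<Longrightarrow> i (c \<otimes> d) = c \<odot>\<^bsub>one_space\<^esub> i d"
    by (simp_all add: vs_unit_def case_prod_beta)
  have k: "coord = inv_into (carrier K) i" "unit_vec = i \<one>" by (simp_all add: coord_def i_def vs_unit_vec_def)
  have inv: "coord x \<in> carrier K \<and> i (coord x) = x" if "x \<in> carrier one_space" for x
    unfolding k(1) using that bij_betw_imp_surj_on[OF i(1)] by (auto simp: inv_into_into f_inv_into_f)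
  have inv': "coord (i c) = c" if "c \<in> carrier K" for c
    unfolding k(1) using bij_betw_imp_inj_on[OF i(1)] that by simp
  show "one_space \<in> fd_spaces K" by (rule U)
  show "unit_vec \<in> carrier one_space" unfolding k(2) using i(1) by (rule bij_betw_apply) simp
  show "x \<in> carrier one_space \<Longrightarrow> coord x \<in> carrier K" using inv by blast
  show "coord x \<odot>\<^bsub>one_space\<^esub> unit_vec = x" if "x \<in> carrier one_space"
    unfolding k(2) using inv[OF that] i(3)[of "coord x" \<one>] by simp
  show "coord (x \<oplus>\<^bsub>one_space\<^esub> y) = coord x \<oplus> coord y" if "x \<in> carrier one_space" "y \<in> carrier one_space"
    using inv[OF that(1)] inv[OF that(2)] inv'[of "coord x \<oplus> coord y"] i(2)[of "coord x" "coord y"] by simp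
  show "coord (a \<odot>\<^bsub>one_space\<^esub> x) = a \<otimes> coord x" if "a \<in> carrier K" "x \<in> carrier one_space"
    using that inv[OF that(2)] inv'[of "a \<otimes> coord x"] i(3)[of a "coord x"] by simp
  show "coord unit_vec = \<one>" unfolding k(2) by (rule inv') simp
qed

subsection \<open>The symmetric monoidal structure\<close>

abbreviation FD :: "(('k, 'v) module, ('k, 'v) lin_arr) smcat" where "FD \<equiv> FdVect K"
abbreviation cmp (infixr "oo" 70) where "cmp \<equiv> Cmp FD"
abbreviation tns (infixr "xx" 75) where "tns \<equiv> TensA FD"
abbreviation src :: "('k, 'v) lin_arr \<Rightarrow> ('k, 'v) module" where "src \<alpha> \<equiv> fst \<alpha>"
abbreviation tgt :: "('k, 'v) lin_arr \<Rightarrow> ('k, 'v) module" where "tgt \<alpha> \<equiv> fst (snd \<alpha>)"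
abbreviation app :: "('k, 'v) lin_arr \<Rightarrow> 'v \<Rightarrow> 'v" where "app \<alpha> \<equiv> snd (snd \<alpha>)"

lemma FD_proj [simp]: "Obj FD = fd_spaces K" "Dom FD \<alpha> = src \<alpha>" "Cod FD \<alpha> = tgt \<alpha>" "TensO FD = tensor" "Unit FD = one_space"
  by (simp_all add: FdVect_def case_prod_beta)

lemma arr_iff: "\<alpha> \<in> Arr FD \<longleftrightarrow> src \<alpha> \<in> fd_spaces K \<and> tgt \<alpha> \<in> fd_spaces K \<and> app \<alpha> \<in> lin_maps K (src \<alpha>) (tgt \<alpha>)"
  by (simp add: FdVect_def case_prod_beta)

lemma arrD:
  assumes "\<alpha> \<in> Arr FD"
  shows "src \<alpha> \<in> fd_spaces K" "tgt \<alpha> \<in> fd_spaces K" "app \<alpha> \<in> module_hom K (src \<alpha>) (tgt \<alpha>)"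
    "app \<alpha> \<in> extensional (carrier (src \<alpha>))"
  using assms by (simp_all add: arr_iff lin_maps_def)

lemma Hom_FD: "\<alpha> \<in> Hom FD V W \<longleftrightarrow> \<alpha> \<in> Arr FD \<and> src \<alpha> = V \<and> tgt \<alpha> = W"
  by (simp add: Hom_def)

lemma arr_ext:
  assumes "\<alpha> \<in> Arr FD" "\<beta> \<in> Arr FD" "src \<alpha> = V" "src \<beta> = V" "tgt \<alpha> = tgt \<beta>"
    "\<And>v. v \<in> carrier V \<Longrightarrow> app \<alpha> v = app \<beta> v"
  shows "\<alpha> = \<beta>"
proof -
  have "app \<alpha> = app \<beta>"
    using arrD(4)[OF assms(1)] arrD(4)[OF assms(2)] assms(3-6) by (intro extensionalityI[of _ "carrier V"]) simp_all
  then show ?thesis using assms(3-5) by (intro prod_eqI) simp_all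
qed

lemma arr_app:
  assumes "\<alpha> \<in> Arr FD"
  shows "tgt \<alpha> = W \<Longrightarrow> v \<in> carrier (src \<alpha>) \<Longrightarrow> app \<alpha> v \<in> carrier W"
    "src \<alpha> = V \<Longrightarrow> v \<in> carrier V \<Longrightarrow> w \<in> carrier V \<Longrightarrow> app \<alpha> (v \<oplus>\<^bsub>V\<^esub> w) = app \<alpha> v \<oplus>\<^bsub>tgt \<alpha>\<^esub> app \<alpha> w"
    "src \<alpha> = V \<Longrightarrow> a \<in> carrier K \<Longrightarrow> v \<in> carrier V \<Longrightarrow> app \<alpha> (a \<odot>\<^bsub>V\<^esub> v) = a \<odot>\<^bsub>tgt \<alpha>\<^esub> app \<alpha> v"
  using homD[OF arrD(3)[OF assms]] by auto

text \<open>Arrows out of an iterated tensor product agree if they agree on pure tensors. With the values of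
  the structure maps on pure tensors (\<open>FD_eval\<close>) this turns the axioms into computations.\<close>

lemma arr_ext2:
  assumes "\<alpha> \<in> Arr FD" "\<beta> \<in> Arr FD" "src \<alpha> = tensor V W" "src \<beta> = tensor V W" "tgt \<alpha> = tgt \<beta>"
    "V \<in> fd_spaces K" "W \<in> fd_spaces K"
    "\<And>v w. v \<in> carrier V \<Longrightarrow> w \<in> carrier W \<Longrightarrow> app \<alpha> (pt V W v w) = app \<beta> (pt V W v w)"
  shows "\<alpha> = \<beta>"
  by (rule arr_ext[OF assms(1-5)], rule tensor_ext[OF assms(6,7), where U = "tgt \<beta>" and f = "app \<alpha>" and g = "app \<beta>"])
    (use arrD[OF assms(1)] arrD[OF assms(2)] in \<open>simp_all add: assms(3-5,8)\<close>)

lemma arr_ext_left: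
  assumes "\<alpha> \<in> Arr FD" "\<beta> \<in> Arr FD" "src \<alpha> = tensor (tensor U V) W" "src \<beta> = tensor (tensor U V) W" "tgt \<alpha> = tgt \<beta>"
    "U \<in> fd_spaces K" "V \<in> fd_spaces K" "W \<in> fd_spaces K"
    "\<And>u v w. u \<in> carrier U \<Longrightarrow> v \<in> carrier V \<Longrightarrow> w \<in> carrier W \<Longrightarrow>
      app \<alpha> (pt (tensor U V) W (pt U V u v) w) = app \<beta> (pt (tensor U V) W (pt U V u v) w)"
  shows "\<alpha> = \<beta>"
  by (rule arr_ext[OF assms(1-5)], rule tensor_ext_left[OF assms(6-8), where X = "tgt \<beta>" and f = "app \<alpha>" and g = "app \<beta>"])
    (use arrD[OF assms(1)] arrD[OF assms(2)] in \<open>simp_all add: assms(3-5,9)\<close>)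

lemma arr_ext_right:
  assumes "\<alpha> \<in> Arr FD" "\<beta> \<in> Arr FD" "src \<alpha> = tensor U (tensor V W)" "src \<beta> = tensor U (tensor V W)" "tgt \<alpha> = tgt \<beta>"
    "U \<in> fd_spaces K" "V \<in> fd_spaces K" "W \<in> fd_spaces K"
    "\<And>u v w. u \<in> carrier U \<Longrightarrow> v \<in> carrier V \<Longrightarrow> w \<in> carrier W \<Longrightarrow>
      app \<alpha> (pt U (tensor V W) u (pt V W v w)) = app \<beta> (pt U (tensor V W) u (pt V W v w))"
  shows "\<alpha> = \<beta>"
  by (rule arr_ext[OF assms(1-5)], rule tensor_ext_right[OF assms(6-8), where X = "tgt \<beta>" and f = "app \<alpha>" and g = "app \<beta>"])
    (use arrD[OF assms(1)] arrD[OF assms(2)] in \<open>simp_all add: assms(3-5,9)\<close>)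

lemma arr_ext_left4:
  assumes "\<alpha> \<in> Arr FD" "\<beta> \<in> Arr FD" "src \<alpha> = tensor (tensor (tensor U V) W) Z" "src \<beta> = tensor (tensor (tensor U V) W) Z"
    "tgt \<alpha> = tgt \<beta>" "U \<in> fd_spaces K" "V \<in> fd_spaces K" "W \<in> fd_spaces K" "Z \<in> fd_spaces K"
    "\<And>u v w z. u \<in> carrier U \<Longrightarrow> v \<in> carrier V \<Longrightarrow> w \<in> carrier W \<Longrightarrow> z \<in> carrier Z \<Longrightarrow>
      app \<alpha> (pt (tensor (tensor U V) W) Z (pt (tensor U V) W (pt U V u v) w) z)
        = app \<beta> (pt (tensor (tensor U V) W) Z (pt (tensor U V) W (pt U V u v) w) z)"
  shows "\<alpha> = \<beta>"
  by (rule arr_ext[OF assms(1-5)], rule tensor_ext_left4[OF assms(6-9), where X = "tgt \<beta>" and f = "app \<alpha>" and g = "app \<beta>"])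
    (use arrD[OF assms(1)] arrD[OF assms(2)] in \<open>simp_all add: assms(3-5,10)\<close>)

lemma the_lin:
  assumes V: "V \<in> fd_spaces K" and W: "W \<in> fd_spaces K" and ex: "\<exists>\<phi>. \<phi> \<in> lin_maps K V W \<and> \<Phi> \<phi>"
    and uniq: "\<And>\<phi> \<psi> x. \<phi> \<in> module_hom K V W \<Longrightarrow> \<psi> \<in> module_hom K V W \<Longrightarrow> \<Phi> \<phi> \<Longrightarrow> \<Phi> \<psi> \<Longrightarrow> x \<in> carrier V \<Longrightarrow> \<phi> x = \<psi> x"
  shows "the_lin K V W \<Phi> \<in> Arr FD \<and> src (the_lin K V W \<Phi>) = V \<and> tgt (the_lin K V W \<Phi>) = W \<and> \<Phi> (app (the_lin K V W \<Phi>))"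
proof -
  have "\<exists>!\<phi>. \<phi> \<in> lin_maps K V W \<and> \<Phi> \<phi>"
  proof (rule ex_ex1I[OF ex])
    fix \<phi> \<psi> assume "\<phi> \<in> lin_maps K V W \<and> \<Phi> \<phi>" "\<psi> \<in> lin_maps K V W \<and> \<Phi> \<psi>"
    then show "\<phi> = \<psi>"
      by (intro extensionalityI[of _ "carrier V"]) (simp_all add: lin_maps_def uniq)
  qed
  from theI'[OF this] show ?thesis using V W by (simp add: arr_iff the_lin_def)
qed

lemma Idn_FD:
  assumes "V \<in> fd_spaces K"
  shows "Idn FD V \<in> Arr FD" "src (Idn FD V) = V" "tgt (Idn FD V) = V" "v \<in> carrier V \<Longrightarrow> app (Idn FD V) v = v"
  using assms vsD(1,3)[OF fdD(1)[OF assms]] by (auto simp: FdVect_def lin_maps_def intro!: homI)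

lemma Cmp_FD:
  shows "src (\<beta> oo \<alpha>) = src \<alpha>" "tgt (\<beta> oo \<alpha>) = tgt \<beta>"
    "v \<in> carrier (src \<alpha>) \<Longrightarrow> app (\<beta> oo \<alpha>) v = app \<beta> (app \<alpha> v)"
  by (simp_all add: FdVect_def case_prod_beta compose_def)

lemma Cmp_arr:
  assumes "\<alpha> \<in> Arr FD" "\<beta> \<in> Arr FD" "tgt \<alpha> = src \<beta>"
  shows "\<beta> oo \<alpha> \<in> Arr FD"
proof -
  note a = arrD[OF assms(1)] and b = arrD[OF assms(2)]
  have "(\<lambda>x. app \<beta> (app \<alpha> x)) \<in> module_hom K (src \<alpha>) (tgt \<beta>)"
    using hom_comp[OF a(3)] b(3) assms(3) by simp
  from restrict_hom[OF fdD(1)[OF a(1)] this] show ?thesis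
    using a b by (simp add: FdVect_def case_prod_beta compose_def)
qed

lemma TensA_FD:
  assumes \<alpha>: "\<alpha> \<in> Arr FD" and \<beta>: "\<beta> \<in> Arr FD"
  shows "\<alpha> xx \<beta> \<in> Arr FD" "src (\<alpha> xx \<beta>) = tensor (src \<alpha>) (src \<beta>)" "tgt (\<alpha> xx \<beta>) = tensor (tgt \<alpha>) (tgt \<beta>)"
    "src \<alpha> = V \<Longrightarrow> src \<beta> = W \<Longrightarrow> v \<in> carrier V \<Longrightarrow> w \<in> carrier W \<Longrightarrow>
      app (\<alpha> xx \<beta>) (pt V W v w) = pt (tgt \<alpha>) (tgt \<beta>) (app \<alpha> v) (app \<beta> w)"
proof -
  note a = arrD[OF \<alpha>] and b = arrD[OF \<beta>]
  let ?\<Phi> = "\<lambda>\<phi>. \<forall>v \<in> carrier (src \<alpha>). \<forall>w \<in> carrier (src \<beta>).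
    \<phi> (pt (src \<alpha>) (src \<beta>) v w) = pt (tgt \<alpha>) (tgt \<beta>) (app \<alpha> v) (app \<beta> w)"
  let ?T = "the_lin K (tensor (src \<alpha>) (src \<beta>)) (tensor (tgt \<alpha>) (tgt \<beta>)) ?\<Phi>"
  have eq: "\<alpha> xx \<beta> = ?T" by (simp add: FdVect_def case_prod_beta)
  have bil: "bilinear_map K (src \<alpha>) (src \<beta>) (tensor (tgt \<alpha>) (tgt \<beta>)) (\<lambda>v w. pt (tgt \<alpha>) (tgt \<beta>) (app \<alpha> v) (app \<beta> w))"
    by (rule bilinearI) (simp_all add: homD[OF a(3)] homD[OF b(3)] pt[OF a(2) b(2)])
  have "?T \<in> Arr FD \<and> src ?T = tensor (src \<alpha>) (src \<beta>) \<and> tgt ?T = tensor (tgt \<alpha>) (tgt \<beta>) \<and> ?\<Phi> (app ?T)"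
    by (rule the_lin[OF tensor_closed[OF a(1) b(1)] tensor_closed[OF a(2) b(2)]
        tensor_lift[OF a(1) b(1) tensor_closed[OF a(2) b(2)] bil]],
      rule tensor_ext[OF a(1) b(1) tensor_closed[OF a(2) b(2)]]) simp_all
  then show "\<alpha> xx \<beta> \<in> Arr FD" "src (\<alpha> xx \<beta>) = tensor (src \<alpha>) (src \<beta>)" "tgt (\<alpha> xx \<beta>) = tensor (tgt \<alpha>) (tgt \<beta>)"
    "src \<alpha> = V \<Longrightarrow> src \<beta> = W \<Longrightarrow> v \<in> carrier V \<Longrightarrow> w \<in> carrier W \<Longrightarrow>
      app (\<alpha> xx \<beta>) (pt V W v w) = pt (tgt \<alpha>) (tgt \<beta>) (app \<alpha> v) (app \<beta> w)"
    unfolding eq by blast+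
qed

lemma Braid_FD:
  assumes V: "V \<in> fd_spaces K" and W: "W \<in> fd_spaces K"
  shows "Braid FD V W \<in> Arr FD" "src (Braid FD V W) = tensor V W" "tgt (Braid FD V W) = tensor W V"
    "v \<in> carrier V \<Longrightarrow> w \<in> carrier W \<Longrightarrow> app (Braid FD V W) (pt V W v w) = pt W V w v"
proof -
  let ?\<Phi> = "\<lambda>\<phi>. \<forall>v \<in> carrier V. \<forall>w \<in> carrier W. \<phi> (pt V W v w) = pt W V w v"
  let ?T = "the_lin K (tensor V W) (tensor W V) ?\<Phi>"
  have eq: "Braid FD V W = ?T" by (simp add: FdVect_def)
  have bil: "bilinear_map K V W (tensor W V) (\<lambda>v w. pt W V w v)"
    by (rule bilinearI) (simp_all add: pt[OF W V])
  have "?T \<in> Arr FD \<and> src ?T = tensor V W \<and> tgt ?T = tensor W V \<and> ?\<Phi> (app ?T)"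
    by (rule the_lin[OF tensor_closed[OF V W] tensor_closed[OF W V] tensor_lift[OF V W tensor_closed[OF W V] bil]],
      rule tensor_ext[OF V W tensor_closed[OF W V]]) simp_all
  then show "Braid FD V W \<in> Arr FD" "src (Braid FD V W) = tensor V W" "tgt (Braid FD V W) = tensor W V"
    "v \<in> carrier V \<Longrightarrow> w \<in> carrier W \<Longrightarrow> app (Braid FD V W) (pt V W v w) = pt W V w v"
    unfolding eq by blast+
qed

lemma Assoc_FD:
  assumes U: "U \<in> fd_spaces K" and V: "V \<in> fd_spaces K" and W: "W \<in> fd_spaces K"
  shows "Assoc FD U V W \<in> Arr FD" "src (Assoc FD U V W) = tensor (tensor U V) W" "tgt (Assoc FD U V W) = tensor U (tensor V W)"
    "u \<in> carrier U \<Longrightarrow> v \<in> carrier V \<Longrightarrow> w \<in> carrier W \<Longrightarrow>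
      app (Assoc FD U V W) (pt (tensor U V) W (pt U V u v) w) = pt U (tensor V W) u (pt V W v w)"
proof -
  let ?\<Phi> = "\<lambda>\<phi>. \<forall>u \<in> carrier U. \<forall>v \<in> carrier V. \<forall>w \<in> carrier W.
    \<phi> (pt (tensor U V) W (pt U V u v) w) = pt U (tensor V W) u (pt V W v w)"
  let ?T = "the_lin K (tensor (tensor U V) W) (tensor U (tensor V W)) ?\<Phi>"
  note VW = tensor_closed[OF V W] and UV = tensor_closed[OF U V]
  have eq: "Assoc FD U V W = ?T" by (simp add: FdVect_def)
  have ex: "\<exists>\<phi>. \<phi> \<in> lin_maps K (tensor (tensor U V) W) (tensor U (tensor V W)) \<and> ?\<Phi> \<phi>"
    by (rule trilinear_lift[OF U V W tensor_closed[OF U VW]]; (rule bilinearI | rule homI))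
      (simp_all add: pt[OF U VW] pt[OF V W])
  have "?T \<in> Arr FD \<and> src ?T = tensor (tensor U V) W \<and> tgt ?T = tensor U (tensor V W) \<and> ?\<Phi> (app ?T)"
    by (rule the_lin[OF tensor_closed[OF UV W] tensor_closed[OF U VW] ex],
      rule tensor_ext_left[OF U V W tensor_closed[OF U VW]]) simp_all
  then show "Assoc FD U V W \<in> Arr FD" "src (Assoc FD U V W) = tensor (tensor U V) W" "tgt (Assoc FD U V W) = tensor U (tensor V W)"
    "u \<in> carrier U \<Longrightarrow> v \<in> carrier V \<Longrightarrow> w \<in> carrier W \<Longrightarrow>
      app (Assoc FD U V W) (pt (tensor U V) W (pt U V u v) w) = pt U (tensor V W) u (pt V W v w)"
    unfolding eq by blast+
qed

text \<open>Every vector of the unit space is a multiple of \<open>1\<close>, so it is enough to test on \<open>1 \<otimes> v\<close>. This is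
  why the unitors are well defined by their values there.\<close>

lemma unit_tensor_ext:
  fixes X :: "('k, 'v) module"
  assumes V: "V \<in> fd_spaces K" and X: "X \<in> fd_spaces K"
    and f: "f \<in> module_hom K (tensor one_space V) X" and g: "g \<in> module_hom K (tensor one_space V) X"
    and eq: "\<And>v. v \<in> carrier V \<Longrightarrow> f (pt one_space V unit_vec v) = g (pt one_space V unit_vec v)"
    and x: "x \<in> carrier (tensor one_space V)"
  shows "f x = g x"
proof (rule tensor_ext[OF unit_choice(1) V X f g _ x])
  fix a v assume a: "a \<in> carrier one_space" and v: "v \<in> carrier V"
  note p = pt[OF unit_choice(1) V] and k = unit_choice(3)[OF a] 
  have "f (coord a \<odot>\<^bsub>tensor one_space V\<^esub> pt one_space V unit_vec v) = g (coord a \<odot>\<^bsub>tensor one_space V\<^esub> pt one_space V unit_vec v)"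
    using eq[OF v] homD(3)[OF f k p(1)[OF unit_choice(2) v]] homD(3)[OF g k p(1)[OF unit_choice(2) v]] by simp
  then show "f (pt one_space V a v) = g (pt one_space V a v)"
    using p(4)[OF k unit_choice(2) v] unit_choice(4)[OF a] by simp
qed

lemma unit_tensor_ext':
  fixes X :: "('k, 'v) module"
  assumes V: "V \<in> fd_spaces K" and X: "X \<in> fd_spaces K"
    and f: "f \<in> module_hom K (tensor V one_space) X" and g: "g \<in> module_hom K (tensor V one_space) X"
    and eq: "\<And>v. v \<in> carrier V \<Longrightarrow> f (pt V one_space v unit_vec) = g (pt V one_space v unit_vec)"
    and x: "x \<in> carrier (tensor V one_space)"
  shows "f x = g x"
proof (rule tensor_ext[OF V unit_choice(1) X f g _ x])
  fix a v assume a: "a \<in> carrier one_space" and v: "v \<in> carrier V"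
  note p = pt[OF V unit_choice(1)] and k = unit_choice(3)[OF a]
  have "f (coord a \<odot>\<^bsub>tensor V one_space\<^esub> pt V one_space v unit_vec) = g (coord a \<odot>\<^bsub>tensor V one_space\<^esub> pt V one_space v unit_vec)"
    using eq[OF v] homD(3)[OF f k p(1)[OF v unit_choice(2)]] homD(3)[OF g k p(1)[OF v unit_choice(2)]] by simp
  then show "f (pt V one_space v a) = g (pt V one_space v a)"
    using p(5)[OF k v unit_choice(2)] unit_choice(4)[OF a] by simp
qed

lemma coord_bilinear:
  assumes V: "V \<in> fd_spaces K"
  shows "bilinear_map K one_space V V (\<lambda>a v. coord a \<odot>\<^bsub>V\<^esub> v)" "bilinear_map K V one_space V (\<lambda>v a. coord a \<odot>\<^bsub>V\<^esub> v)"
  using vsD[OF fdD(1)[OF V]] unit_choice(3,5,6)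
  by (auto intro!: bilinearI simp: m_comm simp flip: vsD(8)[OF fdD(1)[OF V]])

lemma LUn_FD:
  assumes V: "V \<in> fd_spaces K"
  shows "LUn FD V \<in> Arr FD" "src (LUn FD V) = tensor one_space V" "tgt (LUn FD V) = V"
    "a \<in> carrier one_space \<Longrightarrow> v \<in> carrier V \<Longrightarrow> app (LUn FD V) (pt one_space V a v) = coord a \<odot>\<^bsub>V\<^esub> v"
proof -
  let ?\<Phi> = "\<lambda>\<phi>. \<forall>v \<in> carrier V. \<phi> (pt one_space V unit_vec v) = v"
  let ?T = "the_lin K (tensor one_space V) V ?\<Phi>"
  have eq: "LUn FD V = ?T" by (simp add: FdVect_def)
  from tensor_lift[OF unit_choice(1) V V coord_bilinear(1)[OF V]] obtain \<phi> where \<phi>: "\<phi> \<in> lin_maps K (tensor one_space V) V"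
    "\<forall>a\<in>carrier one_space. \<forall>v\<in>carrier V. \<phi> (pt one_space V a v) = coord a \<odot>\<^bsub>V\<^esub> v" by (elim exE conjE)
  then have \<Phi>: "?\<Phi> \<phi>" using unit_choice(2,7) vsD(9)[OF fdD(1)[OF V]] by simp
  have T: "?T \<in> Arr FD \<and> src ?T = tensor one_space V \<and> tgt ?T = V \<and> ?\<Phi> (app ?T)"
    by (rule the_lin[OF tensor_closed[OF unit_choice(1) V] V exI[of _ \<phi>]], use \<phi>(1) \<Phi> in simp,
      rule unit_tensor_ext[OF V V]) simp_all
  then show "LUn FD V \<in> Arr FD" "src (LUn FD V) = tensor one_space V" "tgt (LUn FD V) = V"
    unfolding eq by blast+
  have "app ?T x = \<phi> x" if "x \<in> carrier (tensor one_space V)" for x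
    by (rule unit_tensor_ext[OF V V, where f = "app ?T" and g = \<phi>])
      (use T \<phi>(1) \<Phi> that arrD(3)[of ?T] in \<open>simp_all add: lin_maps_def\<close>)
  then show "a \<in> carrier one_space \<Longrightarrow> v \<in> carrier V \<Longrightarrow> app (LUn FD V) (pt one_space V a v) = coord a \<odot>\<^bsub>V\<^esub> v"
    unfolding eq using \<phi>(2) pt(1)[OF unit_choice(1) V] by simp
qed

lemma RUn_FD:
  assumes V: "V \<in> fd_spaces K"
  shows "RUn FD V \<in> Arr FD" "src (RUn FD V) = tensor V one_space" "tgt (RUn FD V) = V"
    "a \<in> carrier one_space \<Longrightarrow> v \<in> carrier V \<Longrightarrow> app (RUn FD V) (pt V one_space v a) = coord a \<odot>\<^bsub>V\<^esub> v"
proof -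
  let ?\<Phi> = "\<lambda>\<phi>. \<forall>v \<in> carrier V. \<phi> (pt V one_space v unit_vec) = v"
  let ?T = "the_lin K (tensor V one_space) V ?\<Phi>"
  have eq: "RUn FD V = ?T" by (simp add: FdVect_def)
  from tensor_lift[OF V unit_choice(1) V coord_bilinear(2)[OF V]] obtain \<phi> where \<phi>: "\<phi> \<in> lin_maps K (tensor V one_space) V"
    "\<forall>v\<in>carrier V. \<forall>a\<in>carrier one_space. \<phi> (pt V one_space v a) = coord a \<odot>\<^bsub>V\<^esub> v" by (elim exE conjE)
  then have \<Phi>: "?\<Phi> \<phi>" using unit_choice(2,7) vsD(9)[OF fdD(1)[OF V]] by simp
  have T: "?T \<in> Arr FD \<and> src ?T = tensor V one_space \<and> tgt ?T = V \<and> ?\<Phi> (app ?T)"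
    by (rule the_lin[OF tensor_closed[OF V unit_choice(1)] V exI[of _ \<phi>]], use \<phi>(1) \<Phi> in simp,
      rule unit_tensor_ext'[OF V V]) simp_all
  then show "RUn FD V \<in> Arr FD" "src (RUn FD V) = tensor V one_space" "tgt (RUn FD V) = V"
    unfolding eq by blast+
  have "app ?T x = \<phi> x" if "x \<in> carrier (tensor V one_space)" for x
    by (rule unit_tensor_ext'[OF V V, where f = "app ?T" and g = \<phi>])
      (use T \<phi>(1) \<Phi> that arrD(3)[of ?T] in \<open>simp_all add: lin_maps_def\<close>)
  then show "a \<in> carrier one_space \<Longrightarrow> v \<in> carrier V \<Longrightarrow> app (RUn FD V) (pt V one_space v a) = coord a \<odot>\<^bsub>V\<^esub> v"
    unfolding eq using \<phi>(2) pt(1)[OF V unit_choice(1)] by simp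
qed

lemmas FD_eval = Idn_FD Cmp_FD Cmp_arr TensA_FD Braid_FD Assoc_FD LUn_FD RUn_FD tensor_closed pt(1) unit_choice(1-3,7) arr_app(1)

lemma category_FD: "category FD"
proof (rule category.intro)
  fix a b c d f g h assume f: "f \<in> Hom FD a b" and g: "g \<in> Hom FD b c" and h: "h \<in> Hom FD c d"
  then show "(h oo g) oo f = h oo (g oo f)"
    by (intro arr_ext[where V = a]) (simp_all add: Hom_FD FD_eval)
next
  fix a b f assume "f \<in> Hom FD a b"
  then show "Idn FD b oo f = f" "f oo Idn FD a = f"
    using arrD(1,2)[of f] by (auto intro!: arr_ext[where V = a] simp: Hom_FD FD_eval)
qed (auto simp: Hom_FD FD_eval arrD)

text \<open>The inverse of the associator rotates the three factors by braidings and associators: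
  \<open>u \<otimes> (v \<otimes> w) \<mapsto> v \<otimes> (w \<otimes> u) \<mapsto> w \<otimes> (u \<otimes> v) \<mapsto> (u \<otimes> v) \<otimes> w\<close>.\<close>

lemma Assoc_inverse:
  assumes U: "U \<in> fd_spaces K" and V: "V \<in> fd_spaces K" and W: "W \<in> fd_spaces K"
  obtains \<beta> where "inverse_arrows FD (Assoc FD U V W) \<beta>" "\<beta> \<in> Arr FD" "src \<beta> = tensor U (tensor V W)"
    "tgt \<beta> = tensor (tensor U V) W" "\<And>u v w. u \<in> carrier U \<Longrightarrow> v \<in> carrier V \<Longrightarrow> w \<in> carrier W \<Longrightarrow>
      app \<beta> (pt U (tensor V W) u (pt V W v w)) = pt (tensor U V) W (pt U V u v) w"
proof -
  define \<beta> where "\<beta> = Braid FD W (tensor U V) oo Assoc FD W U V oo Braid FD V (tensor W U) \<bullet>\<^bsub>FD\<^esub>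
    Assoc FD V W U oo Braid FD U (tensor V W)"
  have \<beta>: "\<beta> \<in> Arr FD" "src \<beta> = tensor U (tensor V W)" "tgt \<beta> = tensor (tensor U V) W"
    using U V W by (simp_all add: \<beta>_def FD_eval)
  have app: "app \<beta> (pt U (tensor V W) u (pt V W v w)) = pt (tensor U V) W (pt U V u v) w"
    if "u \<in> carrier U" "v \<in> carrier V" "w \<in> carrier W" for u v w
    using U V W that by (simp add: \<beta>_def FD_eval)
  have "\<beta> oo Assoc FD U V W = Idn FD (tensor (tensor U V) W)"
    by (rule arr_ext_left[of _ _ U V W]) (use U V W \<beta> app in \<open>simp_all add: FD_eval\<close>)
  moreover have "Assoc FD U V W oo \<beta> = Idn FD (tensor U (tensor V W))"
    by (rule arr_ext_right[of _ _ U V W]) (use U V W \<beta> app in \<open>simp_all add: FD_eval\<close>)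
  ultimately have "inverse_arrows FD (Assoc FD U V W) \<beta>"
    using U V W \<beta> by (simp add: inverse_arrows_def Hom_FD FD_eval)
  from that[OF this \<beta> app] show thesis .
qed

lemma unit_inverses:
  assumes V: "V \<in> fd_spaces K"
  defines "l \<equiv> (V, tensor one_space V, \<lambda>v\<in>carrier V. pt one_space V unit_vec v)"
    and "r \<equiv> (V, tensor V one_space, \<lambda>v\<in>carrier V. pt V one_space v unit_vec)"
  shows "inverse_arrows FD (LUn FD V) l" "inverse_arrows FD (RUn FD V) r" "l \<in> Arr FD" "r \<in> Arr FD"
proof -
  note v = vsD[OF fdD(1)[OF V]]
  show l: "l \<in> Arr FD" and r: "r \<in> Arr FD"
    using restrict_hom[OF fdD(1)[OF V] bilinearD(6)[OF pt_bilinear[OF unit_choice(1) V] unit_choice(2)]]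
      restrict_hom[OF fdD(1)[OF V] bilinearD(7)[OF pt_bilinear[OF V unit_choice(1)] unit_choice(2)]]
    by (simp_all add: arr_iff l_def r_def tensor_closed V unit_choice(1))
  have lp: "src l = V" "tgt l = tensor one_space V" "\<And>v. v \<in> carrier V \<Longrightarrow> app l v = pt one_space V unit_vec v"
    "src r = V" "tgt r = tensor V one_space" "\<And>v. v \<in> carrier V \<Longrightarrow> app r v = pt V one_space v unit_vec"
    by (simp_all add: l_def r_def)
  have slide: "pt one_space V unit_vec (coord a \<odot>\<^bsub>V\<^esub> v) = pt one_space V a v" "pt V one_space (coord a \<odot>\<^bsub>V\<^esub> v) unit_vec = pt V one_space v a"
    if "a \<in> carrier one_space" "v \<in> carrier V" for a v
    using pt(4,5)[OF unit_choice(1) V unit_choice(3)[OF that(1)] unit_choice(2) that(2)]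
      pt(4,5)[OF V unit_choice(1) unit_choice(3)[OF that(1)] that(2) unit_choice(2)] unit_choice(4)[OF that(1)] by simp_all
  have "LUn FD V oo l = Idn FD V" "RUn FD V oo r = Idn FD V"
    by (rule arr_ext[of _ _ V]; use V l r lp v(9) in \<open>simp add: FD_eval\<close>)+
  moreover have "l oo LUn FD V = Idn FD (tensor one_space V)"
    by (rule arr_ext2[of _ _ one_space V]) (use V l lp v(3) slide in \<open>simp_all add: FD_eval\<close>)
  moreover have "r oo RUn FD V = Idn FD (tensor V one_space)"
    by (rule arr_ext2[of _ _ V one_space]) (use V r lp v(3) slide in \<open>simp_all add: FD_eval\<close>)
  ultimately show "inverse_arrows FD (LUn FD V) l" "inverse_arrows FD (RUn FD V) r"
    using V l r lp by (simp_all add: inverse_arrows_def Hom_FD FD_eval)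
qed

theorem symmetric_monoidal_FD: "symmetric_monoidal_category FD"
proof (rule symmetric_monoidal_category.intro[OF category_FD], rule symmetric_monoidal_category_axioms.intro, unfold FD_proj)
  show "one_space \<in> fd_spaces K" by (rule unit_choice(1))
  show "tensor a b \<in> fd_spaces K" if "a \<in> fd_spaces K" "b \<in> fd_spaces K" for a b using that by (rule tensor_closed)
  show "f xx g \<in> Hom FD (tensor a c) (tensor b d)" if "f \<in> Hom FD a b" "g \<in> Hom FD c d" for f g a b c d
    using that by (simp add: Hom_FD FD_eval)
  show "Idn FD a xx Idn FD b = Idn FD (tensor a b)" if "a \<in> fd_spaces K" "b \<in> fd_spaces K" for a b
    by (rule arr_ext2[of _ _ a b]) (use that in \<open>simp_all add: FD_eval\<close>)
  show "(f' oo f) xx (g' oo g) = (f' xx g') oo (f xx g)"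
    if "f \<in> Hom FD a b" "f' \<in> Hom FD b c" "g \<in> Hom FD a' b'" "g' \<in> Hom FD b' c'" for f f' g g' a b c a' b' c'
    by (rule arr_ext2[of _ _ a a']) (use that arrD(1)[of f] arrD(1)[of g] in \<open>simp_all add: Hom_FD FD_eval\<close>)
  show "Assoc FD a b c \<in> Hom FD (tensor (tensor a b) c) (tensor a (tensor b c)) \<and> is_iso_arr FD (Assoc FD a b c)"
    if fd: "a \<in> fd_spaces K" "b \<in> fd_spaces K" "c \<in> fd_spaces K" for a b c
    unfolding is_iso_arr_def
    by (rule Assoc_inverse[OF fd], rule conjI[OF _ exI]) (simp_all add: fd Hom_FD FD_eval)
  show "LUn FD a \<in> Hom FD (tensor one_space a) a \<and> is_iso_arr FD (LUn FD a)" if "a \<in> fd_spaces K" for a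
    unfolding is_iso_arr_def
    by (rule conjI, simp add: that Hom_FD FD_eval) (rule exI, rule unit_inverses(1)[OF that])
  show "RUn FD a \<in> Hom FD (tensor a one_space) a \<and> is_iso_arr FD (RUn FD a)" if "a \<in> fd_spaces K" for a
    unfolding is_iso_arr_def
    by (rule conjI, simp add: that Hom_FD FD_eval) (rule exI, rule unit_inverses(2)[OF that])
  show "Braid FD a b \<in> Hom FD (tensor a b) (tensor b a)" if "a \<in> fd_spaces K" "b \<in> fd_spaces K" for a b
    using that by (simp add: Hom_FD FD_eval)
  show "Assoc FD a' b' c' oo ((f xx g) xx h) = (f xx (g xx h)) oo Assoc FD a b c"
    if "f \<in> Hom FD a a'" "g \<in> Hom FD b b'" "h \<in> Hom FD c c'" for f g h a a' b b' c c'
    by (rule arr_ext_left[of _ _ a b c])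
      (use that arrD(1,2)[of f] arrD(1,2)[of g] arrD(1,2)[of h] in \<open>simp_all add: Hom_FD FD_eval\<close>)
  show "LUn FD b oo (Idn FD one_space xx f) = f oo LUn FD a" if "f \<in> Hom FD a b" for f a b
    by (rule arr_ext2[of _ _ one_space a]) (use that arrD(1,2)[of f] in \<open>simp_all add: Hom_FD FD_eval arr_app(3)\<close>)
  show "RUn FD b oo (f xx Idn FD one_space) = f oo RUn FD a" if "f \<in> Hom FD a b" for f a b
    by (rule arr_ext2[of _ _ a one_space]) (use that arrD(1,2)[of f] in \<open>simp_all add: Hom_FD FD_eval arr_app(3)\<close>)
  show "Braid FD a' b' oo (f xx g) = (g xx f) oo Braid FD a b"
    if "f \<in> Hom FD a a'" "g \<in> Hom FD b b'" for f g a a' b b'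
    by (rule arr_ext2[of _ _ a b]) (use that arrD(1,2)[of f] arrD(1,2)[of g] in \<open>simp_all add: Hom_FD FD_eval\<close>)
  show "(Idn FD a xx Assoc FD b c d) oo Assoc FD a (tensor b c) d oo (Assoc FD a b c xx Idn FD d)
      = Assoc FD a b (tensor c d) oo Assoc FD (tensor a b) c d"
    if "a \<in> fd_spaces K" "b \<in> fd_spaces K" "c \<in> fd_spaces K" "d \<in> fd_spaces K" for a b c d
    by (rule arr_ext_left4[of _ _ a b c d]) (use that in \<open>simp_all add: FD_eval\<close>)
  show "(Idn FD a xx LUn FD b) oo Assoc FD a one_space b = RUn FD a xx Idn FD b"
    if "a \<in> fd_spaces K" "b \<in> fd_spaces K" for a b
    by (rule arr_ext_left[of _ _ a one_space b]) (use that in \<open>simp_all add: FD_eval pt(4,5)\<close>)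
  show "Assoc FD b c a oo Braid FD a (tensor b c) oo Assoc FD a b c
      = (Idn FD b xx Braid FD a c) oo Assoc FD b a c oo (Braid FD a b xx Idn FD c)"
    if "a \<in> fd_spaces K" "b \<in> fd_spaces K" "c \<in> fd_spaces K" for a b c
    by (rule arr_ext_left[of _ _ a b c]) (use that in \<open>simp_all add: FD_eval\<close>)
  show "Braid FD b a oo Braid FD a b = Idn FD (tensor a b)" if "a \<in> fd_spaces K" "b \<in> fd_spaces K" for a b
    by (rule arr_ext2[of _ _ a b]) (use that in \<open>simp_all add: FD_eval\<close>)
qed

subsection \<open>Rational multiples\<close>

lemma int_in:
  fixes i j :: int
  shows "[i] \<cdot> \<one> \<in> carrier K" "[(i + j)] \<cdot> \<one> = [i] \<cdot> \<one> \<oplus> [j] \<cdot> \<one>" "[(i * j)] \<cdot> \<one> = [i] \<cdot> \<one> \<otimes> [j] \<cdot> \<one>"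
    "[(1 :: int)] \<cdot> \<one> = \<one>" "[(0 :: int)] \<cdot> \<one> = \<zero>" "i \<noteq> 0 \<Longrightarrow> [i] \<cdot> \<one> \<noteq> \<zero>"
proof -
  show "[i] \<cdot> \<one> \<in> carrier K" by simp
  show "[(i + j)] \<cdot> \<one> = [i] \<cdot> \<one> \<oplus> [j] \<cdot> \<one>" by (rule add.int_pow_mult) simp
  have "[i] \<cdot> \<one> \<otimes> [j] \<cdot> \<one> = [i] \<cdot> (\<one> \<otimes> [j] \<cdot> \<one>)" by (rule add_pow_ldistr_int) simp_all
  also have "\<dots> = [(j * i)] \<cdot> \<one>" by (simp add: add.int_pow_pow)
  finally show "[(i * j)] \<cdot> \<one> = [i] \<cdot> \<one> \<otimes> [j] \<cdot> \<one>" by (simp add: mult.commute)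
  show "[(1 :: int)] \<cdot> \<one> = \<one>" by (rule add.int_pow_1) simp
  show "[(0 :: int)] \<cdot> \<one> = \<zero>" by (simp add: add_pow_int_ge)
  show "[i] \<cdot> \<one> \<noteq> \<zero>" if "i \<noteq> 0"
  proof (cases "i \<ge> 0")
    case True
    then show ?thesis using that char_zero[of "nat i"] by (simp add: add_pow_int_ge)
  next
    case False
    then show ?thesis using char_zero[of "nat (- i)"] by (simp add: add_pow_int_lt)
  qed
qed

text \<open>The homomorphism \<open>\<rat> \<rightarrow> K\<close>, through which rational numbers act on linear maps.\<close>

definition rat_in :: "rat \<Rightarrow> 'k" where
  "rat_in q = [fst (quotient_of q)] \<cdot> \<one> \<otimes> inv ([snd (quotient_of q)] \<cdot> \<one>)"

lemma inv_int: "n \<noteq> 0 \<Longrightarrow> inv ([(n :: int)] \<cdot> \<one>) \<in> carrier K" "n \<noteq> 0 \<Longrightarrow> [(n :: int)] \<cdot> \<one> \<otimes> inv ([n] \<cdot> \<one>) = \<one>"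
  using int_in(1)[of n] int_in(6)[of n] by (simp_all add: field_Units)

lemma rat_in_closed [simp]: "rat_in q \<in> carrier K"
  using int_in(1) inv_int(1)[of "snd (quotient_of q)"] quotient_of_denom_pos'[of q] by (simp add: rat_in_def)

text \<open>Any fraction representing \<open>q\<close> computes \<open>rat_in q\<close>, as nonzero integers are invertible in \<open>K\<close>.\<close>

lemma rat_in_fraction:
  assumes "q * of_int b = of_int a"
  shows "rat_in q \<otimes> [b] \<cdot> \<one> = [a] \<cdot> \<one>"
proof -
  obtain m n where mn: "quotient_of q = (m, n)" by (cases "quotient_of q")
  then have n: "n \<noteq> 0" using quotient_of_denom_pos[OF mn] by simp
  have qn: "q * of_int n = of_int m" using quotient_of_div[OF mn] n by simp
  have "of_int (m * b) = (of_int (a * n) :: rat)" by (simp add: mult_ac flip: assms qn)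
  then have e: "m * b = a * n" by (simp only: of_int_eq_iff)
  note c = int_in(1) inv_int(1)[OF n]
  have "rat_in q \<otimes> [b] \<cdot> \<one> = ([m] \<cdot> \<one> \<otimes> [b] \<cdot> \<one>) \<otimes> inv ([n] \<cdot> \<one>)"
    unfolding rat_in_def mn using c(1)[of m] c(1)[of b] c(2) by (simp add: m_ac)
  also have "\<dots> = ([a] \<cdot> \<one> \<otimes> [n] \<cdot> \<one>) \<otimes> inv ([n] \<cdot> \<one>)"
    using int_in(3)[of m b] int_in(3)[of a n] e by simp
  also have "\<dots> = [a] \<cdot> \<one> \<otimes> ([n] \<cdot> \<one> \<otimes> inv ([n] \<cdot> \<one>))"
    using c(1)[of a] c(1)[of n] c(2) by (simp add: m_assoc)
  finally show ?thesis using inv_int(2)[OF n] by simp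
qed

lemma rat_in_eqI:
  assumes "q * of_int b = of_int a" "b \<noteq> 0" "x \<in> carrier K" "x \<otimes> [b] \<cdot> \<one> = [a] \<cdot> \<one>"
  shows "rat_in q = x"
proof -
  have "y = (y \<otimes> [b] \<cdot> \<one>) \<otimes> inv ([b] \<cdot> \<one>)" if "y \<in> carrier K" for y
    using inv_int[OF assms(2)] int_in(1)[of b] that by (simp add: m_assoc)
  from this[OF rat_in_closed[of q]] this[OF assms(3)] show ?thesis using rat_in_fraction[OF assms(1)] assms(4) by simp
qed

lemma rat_in_hom: "rat_in 0 = \<zero>" "rat_in 1 = \<one>" "rat_in (p + q) = rat_in p \<oplus> rat_in q" "rat_in (p * q) = rat_in p \<otimes> rat_in q"
proof -
  show "rat_in 0 = \<zero>" by (rule rat_in_eqI[of _ 1 0]) (simp_all add: int_in(4,5))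
  show "rat_in 1 = \<one>" by (rule rat_in_eqI[of _ 1 1]) (simp_all add: int_in(4))
  obtain a b a' b' where q: "quotient_of p = (a, b)" "quotient_of q = (a', b')" by (cases "quotient_of p", cases "quotient_of q")
  then have b: "b \<noteq> 0" "b' \<noteq> 0" using quotient_of_denom_pos[OF q(1)] quotient_of_denom_pos[OF q(2)] by auto
  then have pq: "p * of_int b = of_int a" "q * of_int b' = of_int a'"
    using quotient_of_div[OF q(1)] quotient_of_div[OF q(2)] by simp_all
  note f = rat_in_fraction[OF pq(1)] rat_in_fraction[OF pq(2)]
  note c = int_in(1)
  show "rat_in (p + q) = rat_in p \<oplus> rat_in q"
  proof (rule rat_in_eqI[of _ "b * b'" "a * b' + a' * b"])
    show "(p + q) * of_int (b * b') = of_int (a * b' + a' * b)" by (simp add: algebra_simps flip: pq)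
    have "(rat_in p \<oplus> rat_in q) \<otimes> ([b] \<cdot> \<one> \<otimes> [b'] \<cdot> \<one>) = (rat_in p \<otimes> [b] \<cdot> \<one>) \<otimes> [b'] \<cdot> \<one> \<oplus> (rat_in q \<otimes> [b'] \<cdot> \<one>) \<otimes> [b] \<cdot> \<one>"
      using c[of b] c[of b'] rat_in_closed[of p] rat_in_closed[of q] by algebra
    then show "(rat_in p \<oplus> rat_in q) \<otimes> [(b * b')] \<cdot> \<one> = [(a * b' + a' * b)] \<cdot> \<one>" by (simp add: int_in(2,3) f)
  qed (use b in simp_all)
  show "rat_in (p * q) = rat_in p \<otimes> rat_in q"
  proof (rule rat_in_eqI[of _ "b * b'" "a * a'"])
    show "(p * q) * of_int (b * b') = of_int (a * a')" by (simp add: algebra_simps flip: pq)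
    have "(rat_in p \<otimes> rat_in q) \<otimes> ([b] \<cdot> \<one> \<otimes> [b'] \<cdot> \<one>) = (rat_in p \<otimes> [b] \<cdot> \<one>) \<otimes> (rat_in q \<otimes> [b'] \<cdot> \<one>)"
      using c[of b] c[of b'] rat_in_closed[of p] rat_in_closed[of q] by algebra
    then show "(rat_in p \<otimes> rat_in q) \<otimes> [(b * b')] \<cdot> \<one> = [(a * a')] \<cdot> \<one>" by (simp add: int_in(3) f)
  qed (use b in simp_all)
qed

definition add_arr :: "('k, 'v) lin_arr \<Rightarrow> ('k, 'v) lin_arr \<Rightarrow> ('k, 'v) lin_arr" where
  "add_arr \<alpha> \<beta> = (src \<alpha>, tgt \<alpha>, \<lambda>v\<in>carrier (src \<alpha>). app \<alpha> v \<oplus>\<^bsub>tgt \<alpha>\<^esub> app \<beta> v)"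

definition zero_arr :: "('k, 'v) module \<Rightarrow> ('k, 'v) module \<Rightarrow> ('k, 'v) lin_arr" where
  "zero_arr V W = (V, W, \<lambda>v\<in>carrier V. \<zero>\<^bsub>W\<^esub>)"

definition scale_arr :: "rat \<Rightarrow> ('k, 'v) lin_arr \<Rightarrow> ('k, 'v) lin_arr" where
  "scale_arr q \<alpha> = (src \<alpha>, tgt \<alpha>, \<lambda>v\<in>carrier (src \<alpha>). rat_in q \<odot>\<^bsub>tgt \<alpha>\<^esub> app \<alpha> v)"

lemma arr_ops:
  "src (add_arr \<alpha> \<beta>) = src \<alpha>" "tgt (add_arr \<alpha> \<beta>) = tgt \<alpha>"
  "v \<in> carrier (src \<alpha>) \<Longrightarrow> app (add_arr \<alpha> \<beta>) v = app \<alpha> v \<oplus>\<^bsub>tgt \<alpha>\<^esub> app \<beta> v"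
  "src (zero_arr V W) = V" "tgt (zero_arr V W) = W" "v \<in> carrier V \<Longrightarrow> app (zero_arr V W) v = \<zero>\<^bsub>W\<^esub>"
  "src (scale_arr q \<alpha>) = src \<alpha>" "tgt (scale_arr q \<alpha>) = tgt \<alpha>"
  "v \<in> carrier (src \<alpha>) \<Longrightarrow> app (scale_arr q \<alpha>) v = rat_in q \<odot>\<^bsub>tgt \<alpha>\<^esub> app \<alpha> v"
  by (simp_all add: add_arr_def zero_arr_def scale_arr_def)

lemma add_arr: "\<alpha> \<in> Arr FD \<Longrightarrow> \<beta> \<in> Arr FD \<Longrightarrow> src \<beta> = src \<alpha> \<Longrightarrow> tgt \<beta> = tgt \<alpha> \<Longrightarrow> add_arr \<alpha> \<beta> \<in> Arr FD"
proof -
  assume \<alpha>: "\<alpha> \<in> Arr FD" and \<beta>: "\<beta> \<in> Arr FD" and eq: "src \<beta> = src \<alpha>" "tgt \<beta> = tgt \<alpha>"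
  note w = vsD[OF fdD(1)[OF arrD(2)[OF \<alpha>]]]
  interpret W: vectorspace K "tgt \<alpha>" by (rule fdD(1)[OF arrD(2)[OF \<alpha>]])
  have h: "app \<beta> \<in> module_hom K (src \<alpha>) (tgt \<alpha>)" using arrD(3)[OF \<beta>] by (simp add: eq)
  have "(\<lambda>v. app \<alpha> v \<oplus>\<^bsub>tgt \<alpha>\<^esub> app \<beta> v) \<in> module_hom K (src \<alpha>) (tgt \<alpha>)"
    by (rule homI) (simp_all add: homD[OF arrD(3)[OF \<alpha>]] homD[OF h] w(1,3,11) W.M.a_ac)
  from restrict_hom[OF fdD(1)[OF arrD(1)[OF \<alpha>]] this] show "add_arr \<alpha> \<beta> \<in> Arr FD"
    using arrD(1,2)[OF \<alpha>] by (simp add: arr_iff add_arr_def)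
qed

lemma zero_arr: "V \<in> fd_spaces K \<Longrightarrow> W \<in> fd_spaces K \<Longrightarrow> zero_arr V W \<in> Arr FD"
proof -
  assume V: "V \<in> fd_spaces K" and W: "W \<in> fd_spaces K"
  note w = vsD[OF fdD(1)[OF W]]
  have "(\<lambda>v. \<zero>\<^bsub>W\<^esub>) \<in> module_hom K V W" by (rule homI) (simp_all add: w)
  from restrict_hom[OF fdD(1)[OF V] this] show "zero_arr V W \<in> Arr FD"
    using V W by (simp add: arr_iff zero_arr_def)
qed

lemma scale_arr: "\<alpha> \<in> Arr FD \<Longrightarrow> scale_arr q \<alpha> \<in> Arr FD"
proof -
  assume \<alpha>: "\<alpha> \<in> Arr FD"
  note w = vsD[OF fdD(1)[OF arrD(2)[OF \<alpha>]]]
  have "(\<lambda>v. rat_in q \<odot>\<^bsub>tgt \<alpha>\<^esub> app \<alpha> v) \<in> module_hom K (src \<alpha>) (tgt \<alpha>)"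
    by (rule homI) (simp_all add: homD[OF arrD(3)[OF \<alpha>]] w(1,3,11) m_comm flip: w(8))
  from restrict_hom[OF fdD(1)[OF arrD(1)[OF \<alpha>]] this] show "scale_arr q \<alpha> \<in> Arr FD"
    using arrD(1,2)[OF \<alpha>] by (simp add: arr_iff scale_arr_def)
qed

lemmas op_eval = FD_eval arr_ops add_arr zero_arr scale_arr Hom_FD

subsection \<open>Splitting families of idempotents\<close>

text \<open>The image of an idempotent is the space of its fixed vectors.\<close>

lemma fixed_space:
  assumes A: "A \<in> fd_spaces K" and e: "e \<in> module_hom K A A" and ee: "\<And>x. x \<in> carrier A \<Longrightarrow> e (e x) = e x"
  defines "F \<equiv> A\<lparr>carrier := {x \<in> carrier A. e x = x}\<rparr>"
  shows "F \<in> fd_spaces K" "e \<in> module_hom K A F"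
proof -
  note a = vsD[OF fdD(1)[OF A]] and h = homD[OF e] and z = hom_zero[OF fdD(1)[OF A] fdD(1)[OF A] e]
  have F: "vectorspace K F"
  proof (rule vs_criteria[OF field_axioms])
    show "\<forall>v\<in>carrier F. \<exists>w\<in>carrier F. v \<oplus>\<^bsub>F\<^esub> w = \<zero>\<^bsub>F\<^esub>"
    proof
      fix v assume "v \<in> carrier F"
      then have v: "v \<in> carrier A" "e v = v" by (simp_all add: F_def)
      have "v \<oplus>\<^bsub>A\<^esub> (\<ominus> \<one>) \<odot>\<^bsub>A\<^esub> v = (\<one> \<oplus> \<ominus> \<one>) \<odot>\<^bsub>A\<^esub> v" using a(10)[of \<one> "\<ominus> \<one>" v] a(9) v by simp
      also have "\<dots> = \<zero>\<^bsub>A\<^esub>" using a(12) v by (simp add: r_neg)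
      finally show "\<exists>w\<in>carrier F. v \<oplus>\<^bsub>F\<^esub> w = \<zero>\<^bsub>F\<^esub>"
        using v a(3)[of "\<ominus> \<one>" v] h(3)[of "\<ominus> \<one>" v] by (intro bexI[of _ "(\<ominus> \<one>) \<odot>\<^bsub>A\<^esub> v"]) (simp_all add: F_def)
    qed
  qed (use a h z in \<open>auto simp: F_def\<close>)
  show eF: "e \<in> module_hom K A F" by (rule homI) (simp_all add: F_def h ee)
  have "vectorspace.fin_dim K F" by (rule fin_dim_image[OF fdD(1)[OF A] F eF _ fdD(2)[OF A]]) (auto simp: F_def)
  with F show "F \<in> fd_spaces K" by (simp add: fd_spaces_def)
qed

text \<open>\<open>E\<close> is a copy in \<open>'v\<close> of the product of the fixed spaces.\<close>

lemma idempotent_sum: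
  fixes I :: "nat set"
  assumes I: "finite I" and A: "\<And>i. i \<in> I \<Longrightarrow> A i \<in> fd_spaces K" and e: "\<And>i. i \<in> I \<Longrightarrow> e i \<in> Hom FD (A i) (A i)"
    and ee: "\<And>i. i \<in> I \<Longrightarrow> e i oo e i = e i"
  shows "\<exists>E l m. E \<in> fd_spaces K \<and> (\<forall>i\<in>I. l i \<in> Hom FD (A i) E \<and> m i \<in> Hom FD E (A i) \<and>
      m i oo l i = e i \<and> e i oo m i = m i \<and> (\<forall>j\<in>I. j \<noteq> i \<longrightarrow> m j oo l i = zero_arr (A i) (A j))) \<and>
      (\<forall>c u v. u \<in> Hom FD c E \<longrightarrow> v \<in> Hom FD c E \<longrightarrow> (\<forall>i\<in>I. m i oo u = m i oo v) \<longrightarrow> u = v)"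
proof -
  have ea: "e i \<in> Arr FD" "src (e i) = A i" "tgt (e i) = A i" if "i \<in> I" for i using e[OF that] by (simp_all add: Hom_FD)
  have eh: "app (e i) \<in> module_hom K (A i) (A i)" if "i \<in> I" for i using arrD(3)[OF ea(1)[OF that]] ea(2,3)[OF that] by simp
  have idem: "app (e i) (app (e i) x) = app (e i) x" if "i \<in> I" "x \<in> carrier (A i)" for i x
    using Cmp_FD(3)[of x "e i" "e i"] ee[OF that(1)] ea(2)[OF that(1)] that(2) by simp
  define F where "F i = A i\<lparr>carrier := {x \<in> carrier (A i). app (e i) x = x}\<rparr>" for i
  have F: "F i \<in> fd_spaces K" "app (e i) \<in> module_hom K (A i) (F i)" if "i \<in> I" for i
    using fixed_space[OF A[OF that] eh[OF that] idem[OF that]] by (simp_all add: F_def)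
  have incl: "(\<lambda>x. x) \<in> module_hom K (F i) (A i)" for i by (rule homI) (simp_all add: F_def)
  let ?P = "prod_space I F" and ?\<iota> = "\<lambda>i a. \<lambda>j\<in>I. if j = i then a else \<zero>\<^bsub>F j\<^esub>"
  have P: "vectorspace K ?P" "vectorspace.fin_dim K ?P" "\<And>i. i \<in> I \<Longrightarrow> (\<lambda>x. x i) \<in> module_hom K ?P (F i)"
    "\<And>i. i \<in> I \<Longrightarrow> ?\<iota> i \<in> module_hom K (F i) ?P"
    by (rule prod_space[OF I fdD(1)[OF F(1)] fdD(2)[OF F(1)]]; assumption)+
  from fd_copy[OF P(1,2)] obtain E :: "('k, 'v) module" and f g where E: "E \<in> fd_spaces K"
    and f: "f \<in> module_hom K ?P E" and g: "g \<in> module_hom K E ?P"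
    and "\<forall>x\<in>carrier ?P. g (f x) = x" "\<forall>y\<in>carrier E. f (g y) = y" by (elim exE conjE) (erule (4) that)
  then have gf: "\<And>x. x \<in> carrier ?P \<Longrightarrow> g (f x) = x" and fg: "\<And>y. y \<in> carrier E \<Longrightarrow> f (g y) = y" by simp_all
  define l where "l i = (A i, E, \<lambda>x\<in>carrier (A i). f (?\<iota> i (app (e i) x)))" for i
  define m where "m i = (E, A i, \<lambda>y\<in>carrier E. g y i)" for i
  have lm: "src (l i) = A i" "tgt (l i) = E" "src (m i) = E" "tgt (m i) = A i"
    "x \<in> carrier (A i) \<Longrightarrow> app (l i) x = f (?\<iota> i (app (e i) x))" "y \<in> carrier E \<Longrightarrow> app (m i) y = g y i" for i x y
    by (simp_all add: l_def m_def)
  have \<iota>: "?\<iota> i (app (e i) x) \<in> carrier ?P" if "i \<in> I" "x \<in> carrier (A i)" for i x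
    using homD(1)[OF P(4)[OF that(1)] homD(1)[OF F(2)[OF that(1)] that(2)]] .
  have gF: "g y i \<in> carrier (F i)" if "i \<in> I" "y \<in> carrier E" for i y
    using homD(1)[OF P(3)[OF that(1)] homD(1)[OF g that(2)]] .
  have l: "l i \<in> Arr FD" if i: "i \<in> I" for i
    using restrict_hom[OF fdD(1)[OF A[OF i]] hom_comp[OF hom_comp[OF F(2)[OF i] P(4)[OF i]] f]] A[OF i] E
    by (simp add: arr_iff l_def)
  have m: "m i \<in> Arr FD" if i: "i \<in> I" for i
    using restrict_hom[OF fdD(1)[OF E] hom_comp[OF hom_comp[OF g P(3)[OF i]] incl[of i]]] A[OF i] E
    by (simp add: arr_iff m_def)
  have ml: "app (m j) (app (l i) x) = (if j = i then app (e i) x else \<zero>\<^bsub>A j\<^esub>)"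
    if "i \<in> I" "j \<in> I" "x \<in> carrier (A i)" for i j x
    using that homD(1)[OF f \<iota>[OF that(1,3)]] gf[OF \<iota>[OF that(1,3)]] by (simp add: lm F_def)
  show ?thesis
  proof (rule exI[of _ E], rule exI[of _ l], rule exI[of _ m], intro conjI ballI allI impI E)
    fix i assume i: "i \<in> I"
    show "l i \<in> Hom FD (A i) E" "m i \<in> Hom FD E (A i)" using l[OF i] m[OF i] by (simp_all add: Hom_FD lm)
    show "m i oo l i = e i"
      by (rule arr_ext[of _ _ "A i"]) (use l m ea i ml in \<open>simp_all add: FD_eval lm(1-4)\<close>)
    show "e i oo m i = m i"
      by (rule arr_ext[of _ _ E]) (use m ea i gF[OF i] in \<open>simp_all add: FD_eval lm F_def\<close>)
    show "m j oo l i = zero_arr (A i) (A j)" if "j \<in> I" "j \<noteq> i" for j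
      by (rule arr_ext[of _ _ "A i"]) (use l m i that ml A in \<open>simp_all add: op_eval lm(1-4)\<close>)
  next
    fix c u v assume u: "u \<in> Hom FD c E" and v: "v \<in> Hom FD c E" and eq: "\<forall>i\<in>I. m i oo u = m i oo v"
    show "u = v"
    proof (rule arr_ext[of _ _ c])
      fix x assume x: "x \<in> carrier c"
      have ux: "app u x \<in> carrier E" and vx: "app v x \<in> carrier E"
        using u v x arr_app(1)[of u E x] arr_app(1)[of v E x] by (simp_all add: Hom_FD)
      have "g (app u x) = g (app v x)"
      proof (rule PiE_ext[of _ I "\<lambda>i. carrier (F i)"])
        show "g (app u x) \<in> (\<Pi>\<^sub>E i\<in>I. carrier (F i))" "g (app v x) \<in> (\<Pi>\<^sub>E i\<in>I. carrier (F i))"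
          using homD(1)[OF g ux] homD(1)[OF g vx] by (simp_all add: prod_space_def)
        fix i assume i: "i \<in> I"
        have "app (m i oo u) x = app (m i oo v) x" using eq i by simp
        then show "g (app u x) i = g (app v x) i" using u v x ux vx by (simp add: Hom_FD Cmp_FD(3) lm)
      qed
      then show "app u x = app v x" using fg[OF ux] fg[OF vx] by metis
    qed (use u v in \<open>simp_all add: Hom_FD\<close>)
  qed
qed

subsection \<open>Duals\<close>

lemma arr_sum:
  assumes "\<alpha> \<in> Arr FD" "finite I" "\<And>i. i \<in> I \<Longrightarrow> g i \<in> carrier V" "src \<alpha> = V" "tgt \<alpha> = W"
  shows "app \<alpha> (finsum V g I) = finsum W (\<lambda>i. app \<alpha> (g i)) I"
  using hom_sum[OF fdD(1)[OF arrD(1)[OF assms(1)]] fdD(1)[OF arrD(2)[OF assms(1)]] arrD(3)[OF assms(1)] assms(2), of g] assms(3-5) by simp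

text \<open>A basis makes \<open>V\<close> its own dual: the coevaluation sends \<open>1\<close> to the sum of the \<open>b \<otimes> b\<close>, and the
  evaluation is the symmetric form for which the basis is orthonormal.\<close>

lemma has_duals_FD: "has_duals FD"
  unfolding has_duals_def FD_proj
proof
  interpret category FD by (rule category_FD)
  fix V :: "('k, 'v) module" assume V: "V \<in> fd_spaces K"
  note Vv = fdD(1)[OF V]
  note VV = tensor_closed[OF V V] and O = unit_choice(1) unit_choice(2)
  obtain B c where B: "finite B" "B \<subseteq> carrier V" and cK: "\<And>b v. b \<in> B \<Longrightarrow> v \<in> carrier V \<Longrightarrow> c b v \<in> carrier K"
    and c_add: "\<And>b v w. b \<in> B \<Longrightarrow> v \<in> carrier V \<Longrightarrow> w \<in> carrier V \<Longrightarrow> c b (v \<oplus>\<^bsub>V\<^esub> w) = c b v \<oplus> c b w"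
    and c_smult: "\<And>b a v. b \<in> B \<Longrightarrow> a \<in> carrier K \<Longrightarrow> v \<in> carrier V \<Longrightarrow> c b (a \<odot>\<^bsub>V\<^esub> v) = a \<otimes> c b v"
    and expand: "\<And>v. v \<in> carrier V \<Longrightarrow> v = finsum V (\<lambda>b. c b v \<odot>\<^bsub>V\<^esub> b) B"
    and dual: "\<And>b b'. b \<in> B \<Longrightarrow> b' \<in> B \<Longrightarrow> c b b' = (if b = b' then \<one> else \<zero>)"
    by (rule dual_basis[OF Vv fdD(2)[OF V]]) (rule that, assumption+)
  interpret V: vectorspace K V by (rule Vv)
  interpret VV: vectorspace K "tensor V V" by (rule fdD(1)[OF VV])
  have bV: "b \<in> carrier V" if "b \<in> B" for b using that B(2) by blast
  define s where "s v w = finsum K (\<lambda>b. c b v \<otimes> c b w) B" for v w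
  have sK: "s v w \<in> carrier K" if "v \<in> carrier V" "w \<in> carrier V" for v w
    unfolding s_def using cK that by (intro finsum_closed) auto
  have s_comm: "s v w = s w v" if "v \<in> carrier V" "w \<in> carrier V" for v w
    unfolding s_def using cK that by (intro finsum_cong') (auto intro: m_comm)
  have s_add: "s (v \<oplus>\<^bsub>V\<^esub> v') w = s v w \<oplus> s v' w" if "v \<in> carrier V" "v' \<in> carrier V" "w \<in> carrier V" for v v' w
  proof -
    have "s (v \<oplus>\<^bsub>V\<^esub> v') w = finsum K (\<lambda>b. c b v \<otimes> c b w \<oplus> c b v' \<otimes> c b w) B"
      unfolding s_def using cK that by (intro finsum_cong') (auto simp: c_add l_distr)
    also have "\<dots> = s v w \<oplus> s v' w" unfolding s_def using cK that by (intro finsum_addf) auto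
    finally show ?thesis .
  qed
  have s_smult: "s (a \<odot>\<^bsub>V\<^esub> v) w = a \<otimes> s v w" if "a \<in> carrier K" "v \<in> carrier V" "w \<in> carrier V" for a v w
  proof -
    have "s (a \<odot>\<^bsub>V\<^esub> v) w = finsum K (\<lambda>b. a \<otimes> (c b v \<otimes> c b w)) B"
      unfolding s_def using cK that by (intro finsum_cong') (auto simp: c_smult m_assoc)
    also have "\<dots> = a \<otimes> s v w" unfolding s_def using cK that B(1) by (intro finsum_rdistr[symmetric]) auto
    finally show ?thesis .
  qed
  have s_basis: "s v b = c b v" if "v \<in> carrier V" "b \<in> B" for v b
  proof -
    have "s v b = finsum K (\<lambda>b'. if b = b' then c b' v else \<zero>) B"
      unfolding s_def using cK that by (intro finsum_cong') (auto simp: dual)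
    also have "\<dots> = c b v" using add.finprod_singleton[OF that(2) B(1), of "\<lambda>b'. c b' v"] cK that by auto
    finally show ?thesis .
  qed
  have "bilinear_map K V V one_space (\<lambda>v w. s v w \<odot>\<^bsub>one_space\<^esub> unit_vec)"
  proof (rule bilinearI)
    note o = vsD[OF fdD(1)[OF O(1)]]
    fix v v' w w' a assume v: "v \<in> carrier V" and w: "w \<in> carrier V"
    show "s v w \<odot>\<^bsub>one_space\<^esub> unit_vec \<in> carrier one_space" using o(3) sK[OF v w] O(2) by simp
    show "s (v \<oplus>\<^bsub>V\<^esub> v') w \<odot>\<^bsub>one_space\<^esub> unit_vec = s v w \<odot>\<^bsub>one_space\<^esub> unit_vec \<oplus>\<^bsub>one_space\<^esub> s v' w \<odot>\<^bsub>one_space\<^esub> unit_vec"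
      if "v' \<in> carrier V" using o(10) sK s_add v w that O(2) by simp
    show "s v (w \<oplus>\<^bsub>V\<^esub> w') \<odot>\<^bsub>one_space\<^esub> unit_vec = s v w \<odot>\<^bsub>one_space\<^esub> unit_vec \<oplus>\<^bsub>one_space\<^esub> s v w' \<odot>\<^bsub>one_space\<^esub> unit_vec"
      if "w' \<in> carrier V" using o(10) sK s_add[of w w' v] s_comm[of v] vsD(1)[OF Vv] v w that O(2) by simp
    assume a: "a \<in> carrier K"
    show "s (a \<odot>\<^bsub>V\<^esub> v) w \<odot>\<^bsub>one_space\<^esub> unit_vec = a \<odot>\<^bsub>one_space\<^esub> (s v w \<odot>\<^bsub>one_space\<^esub> unit_vec)"
      using o(8) sK s_smult v w a O(2) by simp
    show "s v (a \<odot>\<^bsub>V\<^esub> w) \<odot>\<^bsub>one_space\<^esub> unit_vec = a \<odot>\<^bsub>one_space\<^esub> (s v w \<odot>\<^bsub>one_space\<^esub> unit_vec)"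
      using o(8) sK s_smult[of a w v] s_comm[of v] vsD(3)[OF Vv] v w a O(2) by simp
  qed
  from tensor_lift[OF V V O(1) this] obtain \<epsilon> where \<epsilon>: "\<epsilon> \<in> lin_maps K (tensor V V) one_space"
    "\<forall>v\<in>carrier V. \<forall>w\<in>carrier V. \<epsilon> (pt V V v w) = s v w \<odot>\<^bsub>one_space\<^esub> unit_vec" by (elim exE conjE)
  define ev where "ev = (tensor V V, one_space, \<epsilon>)"
  have ev: "ev \<in> Arr FD" "src ev = tensor V V" "tgt ev = one_space"
    and ev_app: "v \<in> carrier V \<Longrightarrow> w \<in> carrier V \<Longrightarrow> app ev (pt V V v w) = s v w \<odot>\<^bsub>one_space\<^esub> unit_vec" for v w
    using \<epsilon> VV O(1) by (simp_all add: ev_def arr_iff)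
  have coord_s: "coord (s v w \<odot>\<^bsub>one_space\<^esub> unit_vec) = s v w" "s v w \<odot>\<^bsub>one_space\<^esub> unit_vec \<in> carrier one_space"
    if "v \<in> carrier V" "w \<in> carrier V" for v w
    using unit_choice(6)[OF sK[OF that] O(2)] unit_choice(7) sK[OF that] vsD(3)[OF fdD(1)[OF O(1)] sK[OF that] O(2)] by simp_all
  have coord_c: "coord (c b v \<odot>\<^bsub>one_space\<^esub> unit_vec) = c b v" "c b v \<odot>\<^bsub>one_space\<^esub> unit_vec \<in> carrier one_space"
    if "v \<in> carrier V" "b \<in> B" for v b
    using coord_s[OF that(1) bV[OF that(2)]] s_basis[OF that] by simp_all
  define t where "t = finsum (tensor V V) (\<lambda>b. pt V V b b) B"
  have bb: "pt V V b b \<in> carrier (tensor V V)" if "b \<in> B" for b by (rule pt(1)[OF V V bV[OF that] bV[OF that]])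
  have t: "t \<in> carrier (tensor V V)" unfolding t_def using bb by (intro VV.M.finsum_closed) auto
  define coev where "coev = (one_space, tensor V V, \<lambda>x\<in>carrier one_space. coord x \<odot>\<^bsub>tensor V V\<^esub> t)"
  have coev: "coev \<in> Arr FD" "src coev = one_space" "tgt coev = tensor V V" and coev_app: "app coev unit_vec = t"
    using restrict_hom[OF fdD(1)[OF O(1)] bilinearD(7)[OF coord_bilinear(1)[OF VV] t]] VV O vsD(9)[OF fdD(1)[OF VV] t] unit_choice(7)
    by (simp_all add: coev_def arr_iff)
  obtain \<alpha> where \<alpha>: "inverse_arrows FD (Assoc FD V V V) \<alpha>" "\<alpha> \<in> Arr FD" "src \<alpha> = tensor V (tensor V V)"
    "tgt \<alpha> = tensor (tensor V V) V" and \<alpha>_app: "\<And>u v w. u \<in> carrier V \<Longrightarrow> v \<in> carrier V \<Longrightarrow> w \<in> carrier V \<Longrightarrow>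
      app \<alpha> (pt V (tensor V V) u (pt V V v w)) = pt (tensor V V) V (pt V V u v) w"
    by (rule Assoc_inverse[OF V V V]) (rule that, assumption+)
  define l where "l = (V, tensor one_space V, \<lambda>v\<in>carrier V. pt one_space V unit_vec v)"
  define r where "r = (V, tensor V one_space, \<lambda>v\<in>carrier V. pt V one_space v unit_vec)"
  note ui = unit_inverses[OF V, folded l_def r_def]
  have lp: "src l = V" "tgt l = tensor one_space V" "\<And>v. v \<in> carrier V \<Longrightarrow> app l v = pt one_space V unit_vec v"
    "src r = V" "tgt r = tensor V one_space" "\<And>v. v \<in> carrier V \<Longrightarrow> app r v = pt V one_space v unit_vec"
    by (simp_all add: l_def r_def)
  have inv: "inv_arr FD (Assoc FD V V V) = \<alpha>" "inv_arr FD (LUn FD V) = l" "inv_arr FD (RUn FD V) = r"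
    using inv_arr_eqI \<alpha>(1) ui(1,2) by simp_all
  define \<theta> where "\<theta> = LUn FD V oo (ev xx Idn FD V) oo \<alpha>"
  define \<kappa> where "\<kappa> = RUn FD V oo (Idn FD V xx ev) oo Assoc FD V V V"
  have \<theta>: "\<theta> \<in> Arr FD" "src \<theta> = tensor V (tensor V V)" "tgt \<theta> = V"
    "v \<in> carrier V \<Longrightarrow> b \<in> B \<Longrightarrow> app \<theta> (pt V (tensor V V) v (pt V V b b)) = c b v \<odot>\<^bsub>V\<^esub> b" for v b
    using V ev \<alpha>(2-4) bV[of b] by (simp_all add: \<theta>_def FD_eval ev_app \<alpha>_app coord_c s_basis)
  have \<kappa>: "\<kappa> \<in> Arr FD" "src \<kappa> = tensor (tensor V V) V" "tgt \<kappa> = V"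
    "v \<in> carrier V \<Longrightarrow> b \<in> B \<Longrightarrow> app \<kappa> (pt (tensor V V) V (pt V V b b) v) = c b v \<odot>\<^bsub>V\<^esub> b" for v b
    using V ev bV[of b] s_comm[of b v] by (simp_all add: \<kappa>_def FD_eval ev_app coord_c s_basis)
  have left: "app \<theta> (pt V (tensor V V) v t) = v" if v: "v \<in> carrier V" for v
  proof -
    have "pt V (tensor V V) v t = finsum (tensor V (tensor V V)) (\<lambda>b. pt V (tensor V V) v (pt V V b b)) B"
      unfolding t_def by (rule hom_sum[OF fdD(1)[OF VV] fdD(1)[OF tensor_closed[OF V VV]] bilinearD(6)[OF pt_bilinear[OF V VV] v] B(1) bb])
    then have "app \<theta> (pt V (tensor V V) v t) = finsum V (\<lambda>b. app \<theta> (pt V (tensor V V) v (pt V V b b))) B"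
      using arr_sum[OF \<theta>(1) B(1) _ \<theta>(2,3), of "\<lambda>b. pt V (tensor V V) v (pt V V b b)"] pt(1)[OF V VV v bb] by simp
    also have "\<dots> = finsum V (\<lambda>b. c b v \<odot>\<^bsub>V\<^esub> b) B" using \<theta>(4)[OF v] cK v bV by (intro V.M.finsum_cong') auto
    finally show ?thesis using expand[OF v] by simp
  qed
  have right: "app \<kappa> (pt (tensor V V) V t v) = v" if v: "v \<in> carrier V" for v
  proof -
    have "pt (tensor V V) V t v = finsum (tensor (tensor V V) V) (\<lambda>b. pt (tensor V V) V (pt V V b b) v) B"
      unfolding t_def by (rule hom_sum[OF fdD(1)[OF VV] fdD(1)[OF tensor_closed[OF VV V]] bilinearD(7)[OF pt_bilinear[OF VV V] v] B(1) bb])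
    then have "app \<kappa> (pt (tensor V V) V t v) = finsum V (\<lambda>b. app \<kappa> (pt (tensor V V) V (pt V V b b) v)) B"
      using arr_sum[OF \<kappa>(1) B(1) _ \<kappa>(2,3), of "\<lambda>b. pt (tensor V V) V (pt V V b b) v"] pt(1)[OF VV V bb v] by simp
    also have "\<dots> = finsum V (\<lambda>b. c b v \<odot>\<^bsub>V\<^esub> b) B" using \<kappa>(4)[OF v] cK v bV by (intro V.M.finsum_cong') auto
    finally show ?thesis using expand[OF v] by simp
  qed
  let ?L = "LUn FD V oo (ev xx Idn FD V) oo \<alpha> oo (Idn FD V xx coev) oo r" and ?R = "RUn FD V oo (Idn FD V xx ev) oo Assoc FD V V V oo (coev xx Idn FD V) oo l"
  have "?L = Idn FD V"
  proof (rule arr_ext[of _ _ V])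
    fix v assume v: "v \<in> carrier V"
    have "app \<alpha> (pt V (tensor V V) v t) \<in> carrier (tensor (tensor V V) V)"
      using arr_app(1)[OF \<alpha>(2,4)] \<alpha>(3) pt(1)[OF V VV v t] by simp
    then show "app ?L v = app (Idn FD V) v"
      using left[OF v] v V t ev \<alpha>(2-4) coev lp ui(4) by (simp add: \<theta>_def FD_eval coev_app)
  qed (use V ev \<alpha>(2-4) coev lp ui(4) in \<open>simp_all add: FD_eval\<close>)
  moreover have "?R = Idn FD V"
  proof (rule arr_ext[of _ _ V])
    fix v assume v: "v \<in> carrier V"
    show "app ?R v = app (Idn FD V) v"
      using right[OF v] v V t ev coev lp ui(3) by (simp add: \<kappa>_def FD_eval coev_app)
  qed (use V ev coev lp ui(3) in \<open>simp_all add: FD_eval\<close>)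
  ultimately have "is_dual FD V V coev ev"
    using V ev coev unfolding is_dual_def inv by (simp add: Hom_FD)
  then show "\<exists>d coev ev. is_dual FD V d coev ev" by (intro exI)
qed

subsection \<open>The rational monoidal category of finite-dimensional vector spaces\<close>

lemma rational_monoidal_FD: "rational_monoidal_category FD add_arr zero_arr scale_arr"
proof (rule rational_monoidal_category.intro[OF symmetric_monoidal_FD], rule rational_monoidal_category_axioms.intro, unfold FD_proj)
  fix f g h a b assume f: "f \<in> Hom FD a b" and g: "g \<in> Hom FD a b"
  have ab: "a \<in> fd_spaces K" "b \<in> fd_spaces K" using f arrD(1,2)[of f] by (auto simp: Hom_FD)
  note v = vsD[OF fdD(1)[OF ab(2)]]
  note fg = f[unfolded Hom_FD] g[unfolded Hom_FD]
  show "add_arr f g \<in> Hom FD a b" using fg by (simp add: op_eval)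
  show "add_arr f g = add_arr g f" by (rule arr_ext[of _ _ a]) (use fg v(5) in \<open>simp_all add: op_eval\<close>)
  show "scale_arr q (add_arr f g) = add_arr (scale_arr q f) (scale_arr q g)" for q
    by (rule arr_ext[of _ _ a]) (use fg v(11) in \<open>simp_all add: op_eval\<close>)
  show "add_arr (add_arr f g) h = add_arr f (add_arr g h)" if "h \<in> Hom FD a b"
    by (rule arr_ext[of _ _ a]) (use fg that v(4) in \<open>simp_all add: op_eval\<close>)
next
  fix f a b assume f: "f \<in> Hom FD a b"
  have ab: "a \<in> fd_spaces K" "b \<in> fd_spaces K" using f arrD(1,2)[of f] by (auto simp: Hom_FD)
  note v = vsD[OF fdD(1)[OF ab(2)]]
  note f = f[unfolded Hom_FD]
  show "scale_arr q f \<in> Hom FD a b" for q using f by (simp add: op_eval)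
  show "add_arr (zero_arr a b) f = f" by (rule arr_ext[of _ _ a]) (use f ab v(7) in \<open>simp_all add: op_eval\<close>)
  show "scale_arr (q + q') f = add_arr (scale_arr q f) (scale_arr q' f)" for q q'
    by (rule arr_ext[of _ _ a]) (use f v(10) in \<open>simp_all add: op_eval rat_in_hom\<close>)
  show "scale_arr q (scale_arr q' f) = scale_arr (q * q') f" for q q'
    by (rule arr_ext[of _ _ a]) (use f v(8) in \<open>simp_all add: op_eval rat_in_hom\<close>)
  show "scale_arr 1 f = f" by (rule arr_ext[of _ _ a]) (use f v(9) in \<open>simp_all add: op_eval rat_in_hom\<close>)
  show "scale_arr 0 f = zero_arr a b" by (rule arr_ext[of _ _ a]) (use f ab v(12) in \<open>simp_all add: op_eval rat_in_hom\<close>)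
next
  show "zero_arr a b \<in> Hom FD a b" if "a \<in> fd_spaces K" "b \<in> fd_spaces K" for a b using that by (simp add: op_eval)
  show "add_arr g g' oo f = add_arr (g oo f) (g' oo f)"
    if "f \<in> Hom FD a b" "g \<in> Hom FD b c" "g' \<in> Hom FD b c" for f g g' a b c
    by (rule arr_ext[of _ _ a]) (use that in \<open>simp_all add: op_eval\<close>)
  show "g oo add_arr f f' = add_arr (g oo f) (g oo f')"
    if "f \<in> Hom FD a b" "f' \<in> Hom FD a b" "g \<in> Hom FD b c" for f f' g a b c
    by (rule arr_ext[of _ _ a]) (use that in \<open>simp_all add: op_eval arr_app(2)\<close>)
  show "scale_arr q g oo f = scale_arr q (g oo f)" if "f \<in> Hom FD a b" "g \<in> Hom FD b c" for f g a b c q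
    by (rule arr_ext[of _ _ a]) (use that in \<open>simp_all add: op_eval\<close>)
  show "g oo scale_arr q f = scale_arr q (g oo f)" if "f \<in> Hom FD a b" "g \<in> Hom FD b c" for f g a b c q
    by (rule arr_ext[of _ _ a]) (use that in \<open>simp_all add: op_eval arr_app(3)\<close>)
  show "add_arr f f' xx g = add_arr (f xx g) (f' xx g)"
    if "f \<in> Hom FD a b" "f' \<in> Hom FD a b" "g \<in> Hom FD c d" for f f' g a b c d
    by (rule arr_ext2[of _ _ a c]) (use that arrD(1,2)[of f] arrD(1,2)[of g] in \<open>simp_all add: op_eval pt(2)\<close>)
  show "f xx add_arr g g' = add_arr (f xx g) (f xx g')"
    if "f \<in> Hom FD a b" "g \<in> Hom FD c d" "g' \<in> Hom FD c d" for f g g' a b c d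
    by (rule arr_ext2[of _ _ a c]) (use that arrD(1,2)[of f] arrD(1,2)[of g] in \<open>simp_all add: op_eval pt(3)\<close>)
  show "scale_arr q f xx g = scale_arr q (f xx g)" if "f \<in> Hom FD a b" "g \<in> Hom FD c d" for f g a b c d q
    by (rule arr_ext2[of _ _ a c]) (use that arrD(1,2)[of f] arrD(1,2)[of g] in \<open>simp_all add: op_eval pt(4)\<close>)
  show "f xx scale_arr q g = scale_arr q (f xx g)" if "f \<in> Hom FD a b" "g \<in> Hom FD c d" for f g a b c d q
    by (rule arr_ext2[of _ _ a c]) (use that arrD(1,2)[of f] arrD(1,2)[of g] in \<open>simp_all add: op_eval pt(5)\<close>)
qed (rule idempotent_sum)

end

theorem theorem6p4:
  fixes K :: "('k, 'r) ring_scheme"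
  assumes "field K"
    and char_zero: "\<And>n::nat. n > 0 \<Longrightarrow> [n] \<cdot>\<^bsub>K\<^esub> \<one>\<^bsub>K\<^esub> \<noteq> \<zero>\<^bsub>K\<^esub>"
    and universe: "\<exists>j :: 'k \<Rightarrow> 'v. inj_on j (carrier K)"
  shows "nakayama_category TYPE('u) (FdVect K :: (('k, 'v) module, ('k, 'v) lin_arr) smcat)"
proof -
  obtain j :: "'k \<Rightarrow> 'v" where j: "inj_on j (carrier K)" using universe by blast
  interpret fd_universe K j
    by (rule fd_universe.intro[OF assms(1)], rule fd_universe_axioms.intro) (simp_all add: char_zero j)
  show ?thesis by (rule rational_monoidal_category.nakayama_categoryI[OF rational_monoidal_FD has_duals_FD])
qed

end
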